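(* Let $n=2\bar n$ and let $H:\mathbb{R}^n\times\mathbb{R}\to\mathbb{R}$ be analytic; consider the Hamiltonian system $\dot x=f(x;\mu)$ with $f(x;\mu)=J_n(\mathrm{D}_xH(x;\mu))^*$, $\mu\in\mathbb{R}$. Assume that: (M1) $x=0$ is a hyperbolic saddle at $\mu=0$ (so that $\mathrm{D}_xf(0;0)$ has $\bar n$ eigenvalues with negative and $\bar n$ with positive real part); (M2) $x=0$ has a homoclinic orbit $x^{\mathrm h}(t)$ at $\mu=0$; (M3) with $n_0=2$: the variational equation $\dot\xi=\mathrm{D}_xf(x^{\mathrm h}(t);0)\xi$ has exactly two independent bounded solutions $\varphi_1(t)=\dot x^{\mathrm h}(t)$ and $\varphi_2(t)$; (M4) there is an $n\times n$ matrix $S$ with $S^2=\mathrm{id}_n$ and $Sf(x;\mu)=f(Sx;\mu)$; (M5) for every $t$, $x^{\mathrm h}(t),\psi_{\bar n+1}(t)\in X^+$ and $\varphi_2(t),\psi_{\bar n+2}(t)\in X^-$, where $X^\pm=\{x\in\mathbb{R}^n:Sx=\pm x\}$ and $\psi_{\bar n+j}(t)=-J_n\varphi_j(t)$, $j=1,2$. Let $\bar a_2,\bar b_2\in\mathbb{R}$ be the constants defined in the context and suppose $\bar a_2\ne0$ and $\bar b_2\neq0$. Then a pitchfork bifurcation of homoclinic orbits occurs at $\mu=0$. Moreover, it is supercritical or subcritical, depending on whether $\bar a_2\bar b_2<0$ or $\bar a_2\bar b_2>0$.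
   Context: $J_n=\begin{pmatrix}0&\mathrm{id}_{\bar n}\\-\mathrm{id}_{\bar n}&0\end{pmatrix}$; $*$ denotes transpose; $\langle\cdot,\cdot\rangle$ is the Euclidean inner product. Throughout, $f(0;\mu)=0$ for all $\mu$ near $0$. Let $\Phi(t)=(\varphi_1,\dots,\varphi_n)$ be a fundamental matrix of the variational equation, with $\varphi_1,\varphi_2$ as in (M3), such that $\varphi_j\to0$ as $t\to+\infty$, $|\varphi_j|\to\infty$ as $t\to-\infty$ for $3\le j\le\bar n$; $|\varphi_j|\to\infty$ as $t\to\pm\infty$ for $j=\bar n+1,\bar n+2$; $|\varphi_j|\to\infty$ as $t\to+\infty$, $\varphi_j\to0$ as $t\to-\infty$ for $j\ge\bar n+3$ (with exponential rates governed, up to polynomial factors, by the eigenvalues of $\mathrm{D}_xf(0;0)$), normalized so that $\Psi=(\psi_1,\dots,\psi_n)=(\Phi^* )^{-1}$ satisfies $\psi_{\bar n+j}=-J_n\varphi_j$, $j=1,2$. Let $G_\mu(t)=\mathrm{D}_\mu f(x^{\mathrm h}(t);0)$ and $G_\alpha(t)=\frac12\mathrm{D}_x^2f(x^{\mathrm h}(t);0)(\varphi_2(t),\varphi_2(t))$. Let $\xi^\mu(t)$ and $\xi^\alpha(t)$ be the unique solutions of $\dot\xi=\mathrm{D}_xf(x^{\mathrm h}(t);0)\xi+G_{\mu}(t)$ and $\dot\xi=\mathrm{D}_xf(x^{\mathrm h}(t);0)\xi+G_{\alpha}(t)$, respectively, that decay exponentially to zero (together with their derivatives) as $t\to\pm\infty$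 and satisfy $\langle\psi_j(0),\xi(0)\rangle=0$ for $j=1,2$. Define $\bar a_2=-\int_{-\infty}^\infty\langle J_n\varphi_2(t),\mathrm{D}_\mu\mathrm{D}_xf(x^{\mathrm h}(t);0)\varphi_2(t)+\mathrm{D}_x^2f(x^{\mathrm h}(t);0)(\xi^\mu(t),\varphi_2(t))\rangle\,\mathrm dt$, $\bar b_2=-\int_{-\infty}^\infty\langle J_n\varphi_2(t),\frac16\mathrm{D}_x^3f(x^{\mathrm h}(t);0)(\varphi_2(t),\varphi_2(t),\varphi_2(t))+\mathrm{D}_x^2f(x^{\mathrm h}(t);0)(\xi^\alpha(t),\varphi_2(t))\rangle\,\mathrm dt$. A pitchfork bifurcation of homoclinic orbits occurs at $\mu=0$ if for some open interval $I\ni0$: for each $\mu\in I$ there is a homoclinic orbit to $x=0$ on $X^+$ near $x^{\mathrm h}$ (equal to $x^{\mathrm h}$ at $\mu=0$); and there is a differentiable $\phi:I\to\mathbb{R}$ with $\phi(0)=0$, $\phi(-\alpha)=\phi(\alpha)$, $\phi''(0)\ne0$ such that for $\alpha\in I\setminus\{0\}$ the system with $\mu=\phi(\alpha)$ has a pair of distinct homoclinic orbits $\bar x(t)$, $S\bar x(t)$ with $\bar x(t)=x^{\mathrm h}(t)+\alpha\varphi_2(t)+O(\sqrt{\alpha^4+|\mu|^2})$ (sup norm over $t$). It is supercritical if $\phi''(0)>0$ (the pair exists for $\mu>0$) and subcritical if $\phi''(0)<0$. *)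

theory Defs
  imports "HOL-Analysis.Analysis"
begin

text \<open>
  The phase space of dimension \<open>n = 2 * nbar\<close> is \<open>real ^ ('m + 'm)\<close> with \<open>nbar = CARD('m)\<close>:
  the indices \<open>Inl i\<close> play the role of \<open>1, ..., nbar\<close> and \<open>Inr i\<close> that of the partner index
  \<open>nbar + i\<close>. The same labels are used for the columns of an \<open>n \<times> n\<close> matrix, so that the solutions
  numbered \<open>j\<close> and \<open>nbar + j\<close> carry the labels \<open>Inl i\<close> and \<open>Inr i\<close> with the same \<open>i\<close>.
\<close>

definition real_analytic :: "('a::euclidean_space \<Rightarrow> real) \<Rightarrow> bool" where
  "real_analytic g \<longleftrightarrow>
     (\<forall>z. \<exists>r>0. \<exists>c :: ('a \<Rightarrow> nat) \<Rightarrow> real. \<forall>x\<in>ball z r.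
        ((\<lambda>k. c k * (\<Prod>b\<in>Basis. ((x - z) \<bullet> b) ^ k b)) has_sum g x)
          (Basis \<rightarrow>\<^sub>E (UNIV :: nat set)))"

definition J_mat :: "real ^ ('m::finite + 'm) ^ ('m + 'm)" where
  "J_mat = (\<chi> r c. case (r, c) of
       (Inl i, Inr j) \<Rightarrow> (if i = j then 1 else 0)
     | (Inr i, Inl j) \<Rightarrow> (if i = j then - 1 else 0)
     | _ \<Rightarrow> 0)"

definition grad_x :: "((real ^ 'n) \<times> real \<Rightarrow> real) \<Rightarrow> real ^ 'n \<Rightarrow> real \<Rightarrow> real ^ ('n::finite)" where
  "grad_x H x \<mu> = (\<chi> i. frechet_derivative (\<lambda>y. H (y, \<mu>)) (at x) (axis i 1))"

definition ham_vf ::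
  "((real ^ ('m + 'm)) \<times> real \<Rightarrow> real) \<Rightarrow> real ^ ('m + 'm) \<Rightarrow> real \<Rightarrow> real ^ ('m::finite + 'm)" where
  "ham_vf H x \<mu> = J_mat *v grad_x H x \<mu>"

text \<open>
  Derivatives of a parametrized vector field \<open>f\<close> as multilinear maps. The higher ones are iterated
  directional derivatives, which for smooth \<open>f\<close> are the symmetric multilinear derivatives.
\<close>

definition Dx :: "('a::real_normed_vector \<Rightarrow> real \<Rightarrow> 'a) \<Rightarrow> 'a \<Rightarrow> real \<Rightarrow> 'a \<Rightarrow> 'a" where
  "Dx f x \<mu> u = frechet_derivative (\<lambda>y. f y \<mu>) (at x) u"

definition Dx2 :: "('a::real_normed_vector \<Rightarrow> real \<Rightarrow> 'a) \<Rightarrow> 'a \<Rightarrow> real \<Rightarrow> 'a \<Rightarrow> 'a \<Rightarrow> 'a" where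
  "Dx2 f x \<mu> u v = frechet_derivative (\<lambda>y. Dx f y \<mu> u) (at x) v"

definition Dx3 :: "('a::real_normed_vector \<Rightarrow> real \<Rightarrow> 'a) \<Rightarrow> 'a \<Rightarrow> real \<Rightarrow> 'a \<Rightarrow> 'a \<Rightarrow> 'a \<Rightarrow> 'a" where
  "Dx3 f x \<mu> u v w = frechet_derivative (\<lambda>y. Dx2 f y \<mu> u v) (at x) w"

definition Dmu :: "('a::real_normed_vector \<Rightarrow> real \<Rightarrow> 'a) \<Rightarrow> 'a \<Rightarrow> real \<Rightarrow> 'a" where
  "Dmu f x \<mu> = vector_derivative (\<lambda>\<nu>. f x \<nu>) (at \<mu>)"

definition Dmux :: "('a::real_normed_vector \<Rightarrow> real \<Rightarrow> 'a) \<Rightarrow> 'a \<Rightarrow> real \<Rightarrow> 'a \<Rightarrow> 'a" where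
  "Dmux f x \<mu> u = vector_derivative (\<lambda>\<nu>. Dx f x \<nu> u) (at \<mu>)"

definition complex_eigenvalue :: "real ^ 'n ^ 'n \<Rightarrow> complex \<Rightarrow> bool" where
  "complex_eigenvalue A l \<longleftrightarrow>
     (\<exists>v :: complex ^ ('n::finite). v \<noteq> 0 \<and> map_matrix complex_of_real A *v v = l *s v)"

text \<open>
  For a Hamiltonian vector field the spectrum of the linearization at an equilibrium is symmetric
  under negation, so hyperbolicity already forces \<open>nbar\<close> eigenvalues on each side of the imaginary
  axis.
\<close>

definition hyperbolic_saddle :: "(real ^ 'n \<Rightarrow> real ^ 'n) \<Rightarrow> real ^ ('n::finite) \<Rightarrow> bool" where
  "hyperbolic_saddle g p \<longleftrightarrow> g p = 0 \<and>
     (\<forall>l. complex_eigenvalue (jacobian g (at p)) l \<longrightarrow> Re l \<noteq> 0) \<and>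
     (\<exists>l. complex_eigenvalue (jacobian g (at p)) l \<and> Re l < 0) \<and>
     (\<exists>l. complex_eigenvalue (jacobian g (at p)) l \<and> Re l > 0)"

definition homoclinic_orbit_to_0 ::
  "('a::real_normed_vector \<Rightarrow> real \<Rightarrow> 'a) \<Rightarrow> real \<Rightarrow> (real \<Rightarrow> 'a) \<Rightarrow> bool" where
  "homoclinic_orbit_to_0 f \<mu> x \<longleftrightarrow>
     (\<forall>t. (x has_vector_derivative f (x t) \<mu>) (at t)) \<and>
     (x \<longlongrightarrow> 0) at_top \<and> (x \<longlongrightarrow> 0) at_bot \<and> (\<exists>t. x t \<noteq> 0)"

definition variational_solution ::
  "('a::real_normed_vector \<Rightarrow> real \<Rightarrow> 'a) \<Rightarrow> (real \<Rightarrow> 'a) \<Rightarrow> (real \<Rightarrow> 'a) \<Rightarrow> (real \<Rightarrow> 'a) \<Rightarrow> bool" where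
  "variational_solution f xh G \<xi> \<longleftrightarrow>
     (\<forall>t. (\<xi> has_vector_derivative Dx f (xh t) 0 (\<xi> t) + G t) (at t))"

text \<open>\<open>\<phi>1, \<phi>2\<close> form a basis of the space of bounded solutions of the variational equation.\<close>

definition bounded_solution_basis ::
  "('a::real_normed_vector \<Rightarrow> real \<Rightarrow> 'a) \<Rightarrow> (real \<Rightarrow> 'a) \<Rightarrow> (real \<Rightarrow> 'a) \<Rightarrow> (real \<Rightarrow> 'a) \<Rightarrow> bool" where
  "bounded_solution_basis f xh \<phi>1 \<phi>2 \<longleftrightarrow>
     variational_solution f xh (\<lambda>_. 0) \<phi>1 \<and> bounded (range \<phi>1) \<and>
     variational_solution f xh (\<lambda>_. 0) \<phi>2 \<and> bounded (range \<phi>2) \<and>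
     (\<forall>c1 c2 :: real. (\<forall>t. c1 *\<^sub>R \<phi>1 t + c2 *\<^sub>R \<phi>2 t = 0) \<longrightarrow> c1 = 0 \<and> c2 = 0) \<and>
     (\<forall>\<xi>. variational_solution f xh (\<lambda>_. 0) \<xi> \<and> bounded (range \<xi>) \<longrightarrow>
        (\<exists>c1 c2 :: real. \<forall>t. \<xi> t = c1 *\<^sub>R \<phi>1 t + c2 *\<^sub>R \<phi>2 t))"

definition fundamental_matrix ::
  "(real ^ 'n \<Rightarrow> real \<Rightarrow> real ^ 'n) \<Rightarrow> (real \<Rightarrow> real ^ 'n) \<Rightarrow> (real \<Rightarrow> real ^ 'n ^ ('n::finite)) \<Rightarrow> bool" where
  "fundamental_matrix f xh \<Phi> \<longleftrightarrow>
     (\<forall>t. (\<Phi> has_vector_derivative (jacobian (\<lambda>y. f y 0) (at (xh t)) ** \<Phi> t)) (at t) \<and>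
          invertible (\<Phi> t))"

text \<open>
  \<open>y\<close> behaves along \<open>F\<close> (that is, as \<open>t \<rightarrow> \<plusminus>\<infinity>\<close>) like \<open>exp (Re l * t)\<close> for an eigenvalue \<open>l\<close> of \<open>A\<close>,
  up to polynomial factors in \<open>t\<close>.
\<close>

definition eigenvalue_rate ::
  "real ^ 'n ^ 'n \<Rightarrow> real filter \<Rightarrow> (real \<Rightarrow> real ^ ('n::finite)) \<Rightarrow> bool" where
  "eigenvalue_rate A F y \<longleftrightarrow>
     (\<exists>l. complex_eigenvalue A l \<and> (\<exists>(k::nat) C. C > 0 \<and>
        (\<forall>\<^sub>F t in F. exp (Re l * t) / (C * \<bar>t\<bar> ^ k) \<le> norm (y t) \<and>
                   norm (y t) \<le> C * \<bar>t\<bar> ^ k * exp (Re l * t))))"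

text \<open>
  The labels \<open>i1 \<noteq> i2\<close> stand for the numbers 1 and 2. The columns \<open>Inl i1\<close>, \<open>Inl i2\<close> are the bounded
  solutions; the other columns have the prescribed behaviour at \<open>\<plusminus>\<infinity>\<close>.
\<close>

definition column_asymptotics ::
  "real ^ ('m + 'm) ^ ('m + 'm) \<Rightarrow> 'm \<Rightarrow> 'm \<Rightarrow> ('m + 'm \<Rightarrow> real \<Rightarrow> real ^ ('m::finite + 'm)) \<Rightarrow> bool" where
  "column_asymptotics A i1 i2 \<phi> \<longleftrightarrow>
     (\<forall>i. i \<noteq> i1 \<and> i \<noteq> i2 \<longrightarrow>
        (\<phi> (Inl i) \<longlongrightarrow> 0) at_top \<and> filterlim (\<lambda>t. norm (\<phi> (Inl i) t)) at_top at_bot) \<and>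
     (\<forall>i\<in>{i1, i2}.
        filterlim (\<lambda>t. norm (\<phi> (Inr i) t)) at_top at_top \<and>
        filterlim (\<lambda>t. norm (\<phi> (Inr i) t)) at_top at_bot) \<and>
     (\<forall>i. i \<noteq> i1 \<and> i \<noteq> i2 \<longrightarrow>
        filterlim (\<lambda>t. norm (\<phi> (Inr i) t)) at_top at_top \<and> (\<phi> (Inr i) \<longlongrightarrow> 0) at_bot) \<and>
     (\<forall>j. j \<noteq> Inl i1 \<and> j \<noteq> Inl i2 \<longrightarrow>
        eigenvalue_rate A at_top (\<phi> j) \<and> eigenvalue_rate A at_bot (\<phi> j))"

definition exp_decaying :: "(real \<Rightarrow> 'a::real_normed_vector) \<Rightarrow> bool" where
  "exp_decaying y \<longleftrightarrow> (\<exists>C \<kappa>. \<kappa> > 0 \<and> (\<forall>t. norm (y t) \<le> C * exp (- \<kappa> * \<bar>t\<bar>)))"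

definition decaying_solution ::
  "('a::real_inner \<Rightarrow> real \<Rightarrow> 'a) \<Rightarrow> (real \<Rightarrow> 'a) \<Rightarrow> (real \<Rightarrow> 'a) \<Rightarrow> 'a \<Rightarrow> 'a \<Rightarrow> (real \<Rightarrow> 'a) \<Rightarrow> bool" where
  "decaying_solution f xh G p1 p2 \<xi> \<longleftrightarrow>
     variational_solution f xh G \<xi> \<and>
     exp_decaying \<xi> \<and> exp_decaying (\<lambda>t. vector_derivative \<xi> (at t)) \<and>
     p1 \<bullet> \<xi> 0 = 0 \<and> p2 \<bullet> \<xi> 0 = 0"

definition G_mu :: "('a::real_normed_vector \<Rightarrow> real \<Rightarrow> 'a) \<Rightarrow> (real \<Rightarrow> 'a) \<Rightarrow> real \<Rightarrow> 'a" where
  "G_mu f xh t = Dmu f (xh t) 0"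

definition G_alpha ::
  "('a::real_normed_vector \<Rightarrow> real \<Rightarrow> 'a) \<Rightarrow> (real \<Rightarrow> 'a) \<Rightarrow> (real \<Rightarrow> 'a) \<Rightarrow> real \<Rightarrow> 'a" where
  "G_alpha f xh \<phi>2 t = (1/2) *\<^sub>R Dx2 f (xh t) 0 (\<phi>2 t) (\<phi>2 t)"

definition a2_bar ::
  "(real ^ ('m + 'm) \<Rightarrow> real \<Rightarrow> real ^ ('m + 'm)) \<Rightarrow> (real \<Rightarrow> real ^ ('m + 'm)) \<Rightarrow>
   (real \<Rightarrow> real ^ ('m + 'm)) \<Rightarrow> (real \<Rightarrow> real ^ ('m::finite + 'm)) \<Rightarrow> real" where
  "a2_bar f xh \<phi>2 \<xi>\<mu> =
     - (LBINT t. (J_mat *v \<phi>2 t) \<bullet>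
          (Dmux f (xh t) 0 (\<phi>2 t) + Dx2 f (xh t) 0 (\<xi>\<mu> t) (\<phi>2 t)))"

definition b2_bar ::
  "(real ^ ('m + 'm) \<Rightarrow> real \<Rightarrow> real ^ ('m + 'm)) \<Rightarrow> (real \<Rightarrow> real ^ ('m + 'm)) \<Rightarrow>
   (real \<Rightarrow> real ^ ('m + 'm)) \<Rightarrow> (real \<Rightarrow> real ^ ('m::finite + 'm)) \<Rightarrow> real" where
  "b2_bar f xh \<phi>2 \<xi>\<alpha> =
     - (LBINT t. (J_mat *v \<phi>2 t) \<bullet>
          ((1/6) *\<^sub>R Dx3 f (xh t) 0 (\<phi>2 t) (\<phi>2 t) (\<phi>2 t) + Dx2 f (xh t) 0 (\<xi>\<alpha> t) (\<phi>2 t)))"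

definition X_plus :: "real ^ 'n ^ 'n \<Rightarrow> (real ^ ('n::finite)) set" where
  "X_plus S = {x. S *v x = x}"

definition X_minus :: "real ^ 'n ^ 'n \<Rightarrow> (real ^ ('n::finite)) set" where
  "X_minus S = {x. S *v x = - x}"

text \<open>
  The interval \<open>I\<close> and the function \<open>\<phi>\<close> giving the parameter value are arguments, so that the type
  of the bifurcation (the sign of \<open>\<phi>''(0)\<close>) refers to the same \<open>\<phi>\<close>. \<open>y \<mu>\<close> is the symmetric branch,
  where ``near \<open>xh\<close>'' means uniform convergence to \<open>xh\<close> as \<open>\<mu> \<rightarrow> 0\<close>. The two homoclinic orbits of a
  pair are distinct as subsets of the phase space, not merely different time translates; the
  constant of the \<open>O\<close>-term is uniform in \<open>t\<close> and \<open>\<alpha>\<close>.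
\<close>

definition pitchfork_bifurcation ::
  "(real ^ 'n \<Rightarrow> real \<Rightarrow> real ^ 'n) \<Rightarrow> real ^ 'n ^ 'n \<Rightarrow> (real \<Rightarrow> real ^ 'n) \<Rightarrow>
   (real \<Rightarrow> real ^ ('n::finite)) \<Rightarrow> real set \<Rightarrow> (real \<Rightarrow> real) \<Rightarrow> bool" where
  "pitchfork_bifurcation f S xh \<phi>2 I \<phi> \<longleftrightarrow>
     open I \<and> is_interval I \<and> 0 \<in> I \<and>
     (\<exists>y :: real \<Rightarrow> real \<Rightarrow> real ^ 'n.
        (\<forall>\<mu>\<in>I. homoclinic_orbit_to_0 f \<mu> (y \<mu>) \<and> (\<forall>t. y \<mu> t \<in> X_plus S)) \<and>
        y 0 = xh \<and> uniform_limit UNIV y xh (at 0)) \<and>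
     \<phi> differentiable_on I \<and> deriv \<phi> differentiable (at 0) \<and>
     \<phi> 0 = 0 \<and> (\<forall>\<alpha>\<in>I. - \<alpha> \<in> I \<and> \<phi> (- \<alpha>) = \<phi> \<alpha>) \<and> deriv (deriv \<phi>) 0 \<noteq> 0 \<and>
     (\<exists>(xb :: real \<Rightarrow> real \<Rightarrow> real ^ 'n) C. \<forall>\<alpha>\<in>I - {0}.
        homoclinic_orbit_to_0 f (\<phi> \<alpha>) (xb \<alpha>) \<and>
        homoclinic_orbit_to_0 f (\<phi> \<alpha>) (\<lambda>t. S *v xb \<alpha> t) \<and>
        range (xb \<alpha>) \<noteq> range (\<lambda>t. S *v xb \<alpha> t) \<and>
        (\<forall>t. norm (xb \<alpha> t - (xh t + \<alpha> *\<^sub>R \<phi>2 t)) \<le> C * sqrt (\<alpha> ^ 4 + \<bar>\<phi> \<alpha>\<bar>\<^sup>2)))"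

definition supercritical :: "(real \<Rightarrow> real) \<Rightarrow> bool" where
  "supercritical \<phi> \<longleftrightarrow> deriv (deriv \<phi>) 0 > 0"

definition subcritical :: "(real \<Rightarrow> real) \<Rightarrow> bool" where
  "subcritical \<phi> \<longleftrightarrow> deriv (deriv \<phi>) 0 < 0"

end

theory Submission
  imports Defs "HOL-Real_Asymp.Real_Asymp" "HOL-Computational_Algebra.Fundamental_Theorem_Algebra"
begin

text \<open>
  Along the curve \<open>\<mu> = c a\<^sup>2\<close> with \<open>c = - b2 / a2\<close> one looks for homoclinic orbits of the form
  \<open>x = xh + a \<sigma> \<phi>2 + a\<^sup>2 (c \<xi>\<mu> + \<sigma>\<^sup>2 \<xi>\<alpha> + a Z)\<close> with \<open>\<sigma>\<close> close to 1. The equation for \<open>Z\<close> is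
  \<open>Z' = A Z + N\<close> with \<open>N\<close> bounded and Lipschitz in \<open>Z\<close> with constant \<open>O(a)\<close>. The operator \<open>d/dt - A\<close> has
  a bounded right inverse on the space of bounded functions once \<open>N\<close> is corrected by compactly
  supported functions times two multipliers, the integrals of \<open>N\<close> against \<open>\<psi> (Inr i1)\<close> and
  \<open>\<psi> (Inr i2)\<close>, so \<open>Z\<close> exists by contraction for every \<open>\<sigma>\<close>. At \<open>a = 0\<close> the second multiplier equals
  \<open>c \<sigma> a2 + \<sigma>\<^sup>3 b2 = (\<sigma>\<^sup>3 - \<sigma>) b2\<close>, which changes sign at \<open>\<sigma> = 1\<close>; by the intermediate value theorem
  it vanishes for some \<open>\<sigma>\<close> near 1 when \<open>a\<close> is small. The first multiplier then vanishes because \<open>H\<close> is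
  conserved and the remaining correction is transverse to the energy levels. Choosing the curve in
  advance and solving for \<open>\<sigma>\<close> makes \<open>\<theta> \<alpha> = c \<alpha>\<^sup>2\<close> exact. The orbit on \<open>X_plus S\<close> comes from \<open>\<sigma> = 0\<close> and
  the projection onto \<open>X_plus S\<close>, which commutes with \<open>A\<close> and annihilates \<open>\<psi> (Inr i2)\<close>. The two members
  of a pair are distinct as orbits: if \<open>S x\<close> were a time shift of \<open>x\<close>, then \<open>S\<^sup>2 = 1\<close> would make \<open>x\<close>
  periodic or fixed by \<open>S\<close>.
\<close>

section \<open>Smoothness of analytic functions\<close>

text \<open>Bounded solvability of the linearization along \<open>xh\<close> is obstructed by the
  two functions \<open>\<psi> (Inr i1)\<close> and \<open>\<psi> (Inr i2)\<close>, while only one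
  scalar, \<sigma>, can be tuned once the parameter curve is fixed. The other condition is paid for
  by the energy, because \<open>\<psi> (Inr i1)\<close> is the gradient of \<open>H\<close> along
  \<open>xh\<close>. The terms \<open>\<xi>\<mu>\<close> and \<open>\<xi>\<alpha>\<close> solve the
  equation exactly at order a^2, so the first obstruction sits at order a^3, and taking out a^3
  leaves an equation that still makes sense at a = 0. With this c, \<sigma> = 1 is a simple root of
  the limiting second multiplier; hence \<sigma> - 1 = O(a), and a \<sigma> \<phi>2 differs from a
  \<phi>2 by O(a^2), which is the accuracy demanded of a pair. Since existence of orbits is what is
  claimed, continuity in \<sigma> takes the place of the implicit function theorem. The linear
  theory starts from the constant limit system, where solvability and uniqueness for bounded
  functions follow by factoring a polynomial that annihilates the matrix.\<close>

definition monomial_expansion ::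
  "('a::euclidean_space \<Rightarrow> real) \<Rightarrow> 'a \<Rightarrow> real \<Rightarrow> (nat \<Rightarrow> real) \<Rightarrow> (nat \<Rightarrow> 'a \<Rightarrow> nat) \<Rightarrow> bool" where
  "monomial_expansion g z r c e \<longleftrightarrow> (\<forall>x\<in>ball z r.
        summable (\<lambda>i. \<bar>c i * (\<Prod>b\<in>Basis. ((x - z) \<bullet> b) ^ e i b)\<bar>) \<and>
        (\<lambda>i. c i * (\<Prod>b\<in>Basis. ((x - z) \<bullet> b) ^ e i b)) sums g x)"

definition monomial_series :: "('a::euclidean_space \<Rightarrow> real) \<Rightarrow> bool" where
  "monomial_series g \<longleftrightarrow> (\<forall>z. \<exists>r>0. \<exists>c e. monomial_expansion g z r c e)"

text \<open>Enumerating the multi-indices turns the unordered sum into a series over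
  \<open>nat\<close>, the form in which termwise differentiation is carried out. Absolute
  convergence is recorded as well: it is automatic for unordered sums of reals and later supplies
  the majorant.\<close>

lemma real_analytic_imp_monomial_series:
  fixes g :: "'a::euclidean_space \<Rightarrow> real"
  assumes "real_analytic g"
  shows "monomial_series g"
  unfolding monomial_series_def
proof
  fix z
  define K where "K = ((Basis :: 'a set) \<rightarrow>\<^sub>E (UNIV :: nat set))"
  from assms have "\<exists>r>0. \<exists>c. \<forall>x\<in>ball z r.
        ((\<lambda>k. c k * (\<Prod>b\<in>Basis. ((x - z) \<bullet> b) ^ k b)) has_sum g x) K"
    unfolding real_analytic_def K_def by (rule spec)
  then obtain r c where r: "r > 0" and hs0: "\<forall>x\<in>ball z r.
        ((\<lambda>k. c k * (\<Prod>b\<in>Basis. ((x - z) \<bullet> b) ^ k b)) has_sum g x) K"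
    by (elim exE conjE)
  note hs = bspec[OF hs0]
  have "countable K"
    unfolding K_def by (rule countable_PiE) auto
  moreover have "infinite K"
  proof -
    obtain b :: 'a where b: "b \<in> Basis" using nonempty_Basis by (rule ex_in_conv[THEN iffD2, THEN exE])
    have "inj (\<lambda>n::nat. restrict (\<lambda>_. n) (Basis :: 'a set))"
    proof (rule injI)
      fix m n :: nat assume "restrict (\<lambda>_. m) (Basis :: 'a set) = restrict (\<lambda>_. n) Basis"
      from fun_cong[OF this, of b] show "m = n" using b by simp
    qed
    moreover have "range (\<lambda>n::nat. restrict (\<lambda>_. n) (Basis :: 'a set)) \<subseteq> K"
      unfolding K_def by (intro image_subsetI restrict_PiE_iff[THEN iffD2]) simp
    ultimately show ?thesis by (meson finite_subset infinite_UNIV_nat finite_imageD)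
  qed
  ultimately have bij: "bij_betw (from_nat_into K) UNIV K"
    by (rule bij_betw_from_nat_into)
  show "\<exists>r>0. \<exists>c e. monomial_expansion g z r c e"
  proof (rule exI[of _ r], intro conjI r, rule exI[of _ "\<lambda>i. c (from_nat_into K i)"], rule exI[of _ "from_nat_into K"],
      unfold monomial_expansion_def, intro ballI conjI)
    fix x assume x: "x \<in> ball z r"
    let ?F = "\<lambda>i. c (from_nat_into K i) * (\<Prod>b\<in>Basis. ((x - z) \<bullet> b) ^ from_nat_into K i b)"
    have 1: "(?F has_sum g x) UNIV"
      using has_sum_reindex_bij_betw[OF bij, of "\<lambda>k. c k * (\<Prod>b\<in>Basis. ((x - z) \<bullet> b) ^ k b)"] hs[OF x]
      by simp
    then show "?F sums g x" by (rule has_sum_imp_sums)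
    have "?F summable_on UNIV" using 1 by (auto simp: summable_on_def)
    then have "(\<lambda>i. norm (?F i)) summable_on UNIV" by (rule summable_on_iff_abs_summable_on_real[THEN iffD1])
    then have "summable (\<lambda>i. norm (?F i))"
      by (rule summable_on_imp_summable)
    then show "summable (\<lambda>i. \<bar>?F i\<bar>)" by simp
  qed
qed

text \<open>Differentiating a monomial costs a factor \<open>n\<close>; by
  \<open>n \<le> 2 ^ n\<close>, halving the radius pays for it.\<close>

lemma nat_mult_half_power_le:
  fixes \<rho> :: real assumes "\<rho> > 0"
  shows "real n * (\<rho>/2) ^ (n - 1) \<le> (2/\<rho>) * \<rho> ^ n"
proof (cases n)
  case (Suc m)
  have "real (Suc m) \<le> 2 * 2 ^ m"
    using of_nat_mono[OF less_imp_le[OF less_exp[of "Suc m"]], where 'a=real] by simp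
  then have "real (Suc m) * (\<rho>/2) ^ m \<le> 2 * 2^m * (\<rho>/2) ^ m"
    using assms by (intro mult_right_mono) auto
  also have "\<dots> = (2/\<rho>) * \<rho> ^ Suc m"
    using assms by (simp add: power_divide)
  finally show ?thesis using Suc by simp
qed (use assms in auto)

text \<open>Absolute convergence at one point with all coordinates equal to \<open>\<rho>\<close>
  majorizes the differentiated series on the ball of radius \<open>\<rho>/2\<close>, so
  differentiation may be done termwise. The derived series is again a
  \<open>monomial_expansion\<close>, where exponents may repeat; this makes the step
  iterable.\<close>

lemma monomial_series_local_derivative:
  fixes g :: "'a::euclidean_space \<Rightarrow> real"
  assumes r: "r > 0" and gm: "monomial_expansion g z r c e"
  shows "\<exists>r'>0. (\<forall>x\<in>ball z r'. g differentiable (at x)) \<and>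
     (\<forall>b0\<in>Basis. monomial_expansion (\<lambda>x. frechet_derivative g (at x) b0) z r'
        (\<lambda>i. c i * real (e i b0)) (\<lambda>i. (e i)(b0 := e i b0 - 1)))"
proof -
  have s: "summable (\<lambda>i. \<bar>c i * (\<Prod>b\<in>Basis. ((x - z) \<bullet> b) ^ e i b)\<bar>)"
    and g: "(\<lambda>i. c i * (\<Prod>b\<in>Basis. ((x - z) \<bullet> b) ^ e i b)) sums g x" if "x \<in> ball z r" for x
    using bspec[OF gm[unfolded monomial_expansion_def] that] by simp_all
  \<comment> \<open>The factor \<open>DIM('a)\<close> keeps the corner \<open>p\<close> of the cube
    of half-width \<open>\<rho>\<close> within distance \<open>r/2\<close> of
    \<open>z\<close>.\<close>
  define \<rho> where "\<rho> = r / (2 * real DIM('a))"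
  have \<rho>: "\<rho> > 0" unfolding \<rho>_def using r by simp
  define p where "p = z + (\<Sum>b\<in>Basis. \<rho> *\<^sub>R b)"
  have pb: "(p - z) \<bullet> b = \<rho>" if "b \<in> Basis" for b
    using that unfolding p_def by (simp add: inner_sum_left_Basis)
  have "dist z p = norm (\<Sum>b\<in>(Basis::'a set). \<rho> *\<^sub>R b)"
    unfolding p_def by (simp add: dist_norm)
  also have "\<dots> \<le> (\<Sum>b\<in>(Basis::'a set). norm (\<rho> *\<^sub>R b))"
    by (rule norm_sum)
  also have "\<dots> = r / 2" using \<rho> r by (simp add: \<rho>_def)
  finally have pr: "p \<in> ball z r" using r by simp
  define M where "M i = (2/\<rho>) * \<bar>c i * (\<Prod>b\<in>(Basis::'a set). \<rho> ^ e i b)\<bar>" for i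
  have Msum: "summable M"
    unfolding M_def using s[OF pr] by (intro summable_mult) (simp add: pb)
  \<comment> \<open>If \<open>e i b0 = 0\<close>, the truncated exponent \<open>e i b0 - 1\<close>
    is harmless because the factor \<open>real (e i b0)\<close> is 0.\<close>
  define d where "d b0 i x = (c i * real (e i b0)) * (\<Prod>b\<in>Basis. ((x - z) \<bullet> b) ^ ((e i)(b0 := e i b0 - 1)) b)" for b0 i x
  have dM: "\<bar>d b0 i x\<bar> \<le> M i" if b0: "b0 \<in> Basis" and x: "x \<in> ball z (\<rho>/2)" for b0 i x
  proof -
    have xb: "\<bar>(x - z) \<bullet> b\<bar> \<le> \<rho>/2" if "b \<in> Basis" for b
      using Basis_le_norm[OF that, of "x - z"] x by (simp add: dist_norm norm_minus_commute)
    have "\<bar>d b0 i x\<bar> = \<bar>c i\<bar> * (real (e i b0) * \<bar>(x-z) \<bullet> b0\<bar> ^ (e i b0 - 1)) * (\<Prod>b\<in>Basis-{b0}. \<bar>(x - z) \<bullet> b\<bar> ^ e i b)"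
      unfolding d_def using b0 by (simp add: abs_mult abs_prod power_abs prod.remove[of Basis b0])
    also have "\<dots> \<le> \<bar>c i\<bar> * (real (e i b0) * (\<rho>/2) ^ (e i b0 - 1)) * (\<Prod>b\<in>Basis-{b0}. \<rho> ^ e i b)"
    proof (intro mult_mono)
      show "\<bar>(x-z) \<bullet> b0\<bar> ^ (e i b0 - 1) \<le> (\<rho>/2) ^ (e i b0 - 1)"
        by (intro power_mono xb b0) simp
      show "(\<Prod>b\<in>Basis-{b0}. \<bar>(x - z) \<bullet> b\<bar> ^ e i b) \<le> (\<Prod>b\<in>Basis-{b0}. \<rho> ^ e i b)"
      proof (intro prod_mono conjI power_mono)
        fix b :: 'a assume "b \<in> Basis - {b0}"
        then show "\<bar>(x - z) \<bullet> b\<bar> \<le> \<rho>" using xb[of b] \<rho> by simp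
      qed auto
    qed (use \<rho> in \<open>auto intro!: prod_nonneg mult_nonneg_nonneg\<close>)
    also have "\<dots> \<le> \<bar>c i\<bar> * ((2/\<rho>) * \<rho> ^ e i b0) * (\<Prod>b\<in>Basis-{b0}. \<rho> ^ e i b)"
      using \<rho> by (intro mult_right_mono mult_left_mono nat_mult_half_power_le prod_nonneg) auto
    also have "\<dots> = M i"
      unfolding M_def using b0 \<rho> by (simp add: abs_mult abs_prod prod.remove[of Basis b0])
    finally show ?thesis .
  qed
  have dsum: "summable (\<lambda>i. \<bar>d b0 i x\<bar>)" if "b0 \<in> Basis" "x \<in> ball z (\<rho>/2)" for b0 x
    by (rule summable_comparison_test'[OF Msum, of 0]) (use dM that in auto)
  define G where "G b0 x = (\<Sum>i. d b0 i x)" for b0 x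
  define g' where "g' x h = (\<Sum>b0\<in>Basis. (h \<bullet> b0) * G b0 x)" for x h
  define f where "f i x = c i * (\<Prod>b\<in>Basis. ((x - z) \<bullet> b) ^ e i b)" for i x
  define f' where "f' i x h = (\<Sum>b0\<in>Basis. (h \<bullet> b0) * d b0 i x)" for i x h
  have fder: "((f i) has_derivative f' i x) (at x within S)" for i x S
  proof -
    have "((\<lambda>x. \<Prod>b\<in>Basis. ((x - z) \<bullet> b) ^ e i b) has_derivative
        (\<lambda>h. \<Sum>b\<in>Basis. (real (e i b) * (h \<bullet> b) * ((x - z) \<bullet> b) ^ (e i b - 1)) * (\<Prod>j\<in>Basis - {b}. ((x - z) \<bullet> j) ^ e i j))) (at x within S)"
      by (rule has_derivative_prod) (auto intro!: derivative_eq_intros simp: fun_eq_iff)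
    then have "(f i has_derivative (\<lambda>h. c i * (\<Sum>b\<in>Basis. (real (e i b) * (h \<bullet> b) * ((x - z) \<bullet> b) ^ (e i b - 1)) * (\<Prod>j\<in>Basis - {b}. ((x - z) \<bullet> j) ^ e i j)))) (at x within S)"
      unfolding f_def by (rule has_derivative_mult_right)
    moreover have "f' i x = (\<lambda>h. c i * (\<Sum>b\<in>Basis. (real (e i b) * (h \<bullet> b) * ((x - z) \<bullet> b) ^ (e i b - 1)) * (\<Prod>j\<in>Basis - {b}. ((x - z) \<bullet> j) ^ e i j)))"
      unfolding f'_def d_def sum_distrib_left
      by (intro ext sum.cong refl) (simp add: prod.remove[of Basis] mult_ac)
    ultimately show ?thesis by simp
  qed
  have "\<exists>g1. \<forall>x\<in>ball z (\<rho>/2). (\<lambda>n. f n x) sums (g1 x) \<and> (g1 has_derivative g' x) (at x within ball z (\<rho>/2))"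
  proof (rule has_derivative_series[where f'=f' and x=z])
    show "(\<lambda>n. f n z) sums g z" unfolding f_def by (rule g) (use r in simp)
    fix \<epsilon> :: real assume "\<epsilon> > 0"
    define T where "T n = (\<Sum>i. M (i + n))" for n
    have T0: "T \<longlonglongrightarrow> 0"
      unfolding T_def using suminf_exist_split2[OF Msum] by simp
    have tail: "\<bar>(\<Sum>i<n. d b0 i x) - G b0 x\<bar> \<le> T n" if "b0 \<in> Basis" "x \<in> ball z (\<rho>/2)" for b0 x n
    proof -
      have sm: "summable (\<lambda>i. d b0 i x)" by (rule summable_rabs_cancel) (rule dsum[OF that])
      have "G b0 x = (\<Sum>i. d b0 (i + n) x) + (\<Sum>i<n. d b0 i x)"
        unfolding G_def by (rule suminf_split_initial_segment[OF sm])
      then have "\<bar>(\<Sum>i<n. d b0 i x) - G b0 x\<bar> = \<bar>\<Sum>i. d b0 (i + n) x\<bar>" by simp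
      also have "\<dots> \<le> (\<Sum>i. \<bar>d b0 (i + n) x\<bar>)"
        by (rule summable_rabs) (rule summable_ignore_initial_segment[OF dsum[OF that]])
      also have "\<dots> \<le> T n" unfolding T_def
        by (intro suminf_le dM that summable_ignore_initial_segment[OF dsum[OF that]] summable_ignore_initial_segment[OF Msum])
      finally show ?thesis .
    qed
    have "(\<lambda>n. real DIM('a) * T n) \<longlonglongrightarrow> real DIM('a) * 0" by (intro tendsto_intros T0)
    then have "\<forall>\<^sub>F n in sequentially. real DIM('a) * T n < \<epsilon>"
      using order_tendstoD(2)[of _ "real DIM('a) * 0" sequentially \<epsilon>] \<open>\<epsilon> > 0\<close> by simp
    then show "\<forall>\<^sub>F n in sequentially. \<forall>x\<in>ball z (\<rho>/2). \<forall>h. norm (sum (\<lambda>i. f' i x h) {..<n} - g' x h) \<le> \<epsilon> * norm h"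
    proof (rule eventually_mono, intro ballI allI)
      fix n x h assume n: "real DIM('a) * T n < \<epsilon>" and x: "x \<in> ball z (\<rho>/2)"
      have "(\<Sum>i<n. f' i x h) = (\<Sum>b0\<in>Basis. (h \<bullet> b0) * (\<Sum>i<n. d b0 i x))"
        unfolding f'_def by (subst sum.swap) (simp add: sum_distrib_left)
      then have "norm ((\<Sum>i<n. f' i x h) - g' x h) = \<bar>\<Sum>b0\<in>Basis. (h \<bullet> b0) * ((\<Sum>i<n. d b0 i x) - G b0 x)\<bar>"
        unfolding g'_def by (simp add: sum_subtractf[symmetric] algebra_simps)
      also have "\<dots> \<le> (\<Sum>b0\<in>Basis. \<bar>(h \<bullet> b0) * ((\<Sum>i<n. d b0 i x) - G b0 x)\<bar>)"
        by (rule sum_abs)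
      also have "\<dots> \<le> (\<Sum>b0\<in>(Basis::'a set). norm h * T n)"
        unfolding abs_mult using tail x by (intro sum_mono mult_mono Basis_le_norm) auto
      also have "\<dots> = (real DIM('a) * T n) * norm h" by simp
      also have "\<dots> \<le> \<epsilon> * norm h" using n by (intro mult_right_mono) auto
      finally show "norm ((\<Sum>i<n. f' i x h) - g' x h) \<le> \<epsilon> * norm h" .
    qed
  qed (use fder \<rho> in auto)
  then obtain g1 where g1': "\<forall>x\<in>ball z (\<rho>/2). (\<lambda>n. f n x) sums (g1 x) \<and> (g1 has_derivative g' x) (at x within ball z (\<rho>/2))" ..
  have g1: "(\<lambda>n. f n x) sums (g1 x)" "(g1 has_derivative g' x) (at x within ball z (\<rho>/2))"
    if "x \<in> ball z (\<rho>/2)" for x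
    using bspec[OF g1' that] by simp_all
  have "\<rho>/2 \<le> r"
  proof -
    have "1 \<le> 4 * real DIM('a)" using DIM_positive[where 'a='a] by linarith
    then have "r * 1 \<le> r * (4 * real DIM('a))" using r by (intro mult_left_mono) linarith+
    then show ?thesis unfolding \<rho>_def using DIM_positive[where 'a='a] by (simp add: divide_simps mult.commute)
  qed
  then have sub: "ball z (\<rho>/2) \<subseteq> ball z r" by (rule subset_ball)
  have eq: "g1 x = g x" if "x \<in> ball z (\<rho>/2)" for x
    using sums_unique2[OF g1(1)[OF that, unfolded f_def] g[OF subsetD[OF sub that]]] .
  have der: "(g has_derivative g' x) (at x)" if x: "x \<in> ball z (\<rho>/2)" for x
  proof -
    have "(g has_derivative g' x) (at x within ball z (\<rho>/2))"
      by (rule has_derivative_transform[OF x _ g1(2)[OF x]]) (simp add: eq)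
    then show ?thesis by (metis at_within_open open_ball x)
  qed
  have fd: "frechet_derivative g (at x) b0 = G b0 x" if "x \<in> ball z (\<rho>/2)" "b0 \<in> Basis" for x b0
  proof -
    have "frechet_derivative g (at x) = g' x" using frechet_derivative_at[OF der[OF that(1)]] by simp
    then have "frechet_derivative g (at x) b0 = (\<Sum>b\<in>Basis. (b0 \<bullet> b) * G b x)" by (simp add: g'_def)
    also have "\<dots> = (\<Sum>b\<in>Basis. if b = b0 then G b x else 0)"
      using that(2) by (intro sum.cong) (auto simp: inner_Basis)
    also have "\<dots> = G b0 x" using that(2) by simp
    finally show ?thesis .
  qed
  show ?thesis
  proof (intro exI[of _ "\<rho>/2"] conjI ballI)
    show "\<rho>/2 > 0" using \<rho> by simp
    fix x assume x: "x \<in> ball z (\<rho>/2)"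
    show "g differentiable (at x)" using der[OF x] by (rule differentiableI)
  next
    fix b0 :: 'a assume b0: "b0 \<in> Basis"
    show "monomial_expansion (\<lambda>x. frechet_derivative g (at x) b0) z (\<rho>/2)
        (\<lambda>i. c i * real (e i b0)) (\<lambda>i. (e i)(b0 := e i b0 - 1))"
      unfolding monomial_expansion_def
    proof (intro ballI conjI)
      fix x assume x: "x \<in> ball z (\<rho>/2)"
      show "summable (\<lambda>i. \<bar>(c i * real (e i b0)) * (\<Prod>b\<in>Basis. ((x - z) \<bullet> b) ^ ((e i)(b0 := e i b0 - 1)) b)\<bar>)"
        using dsum[OF b0 x] unfolding d_def .
      have "summable (\<lambda>i. d b0 i x)" by (rule summable_rabs_cancel) (rule dsum[OF b0 x])
      then have "(\<lambda>i. d b0 i x) sums G b0 x" unfolding G_def by (rule summable_sums)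
      then show "(\<lambda>i. (c i * real (e i b0)) * (\<Prod>b\<in>Basis. ((x - z) \<bullet> b) ^ ((e i)(b0 := e i b0 - 1)) b))
          sums frechet_derivative g (at x) b0"
        unfolding fd[OF x b0] d_def .
    qed
  qed
qed

lemma monomial_series_derivative:
  fixes g :: "'a::euclidean_space \<Rightarrow> real"
  assumes "monomial_series g"
  shows "g differentiable (at x)"
    and "b \<in> Basis \<Longrightarrow> monomial_series (\<lambda>x. frechet_derivative g (at x) b)"
proof -
  have *: "\<exists>r>0. (\<forall>x\<in>ball z r. g differentiable (at x)) \<and>
     (\<forall>b0\<in>Basis. \<exists>c e. monomial_expansion (\<lambda>x. frechet_derivative g (at x) b0) z r c e)" for z
  proof -
    from assms obtain r c e where "r > 0" "monomial_expansion g z r c e"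
      unfolding monomial_series_def by meson
    from monomial_series_local_derivative[OF this] obtain r' where "r' > 0" "\<forall>x\<in>ball z r'. g differentiable (at x)"
     and "\<forall>b0\<in>Basis. monomial_expansion (\<lambda>x. frechet_derivative g (at x) b0) z r'
        (\<lambda>i. c i * real (e i b0)) (\<lambda>i. (e i)(b0 := e i b0 - 1))" by (elim exE conjE)
    then show ?thesis by (intro exI[of _ r'] conjI ballI exI) auto
  qed
  from *[of x] show "g differentiable (at x)" by (meson centre_in_ball)
  show "monomial_series (\<lambda>x. frechet_derivative g (at x) b)" if "b \<in> Basis"
    using * that unfolding monomial_series_def by meson
qed

text \<open>Total differentiability is demanded at every order, so the chain rule applies without
  being derived from continuous partial derivatives. Descending through basis directions keeps every
  derivative in the codomain of \<open>g\<close>, so that one predicate serves all orders.\<close>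

primrec Ck :: "nat \<Rightarrow> ('a::euclidean_space \<Rightarrow> 'b::real_normed_vector) \<Rightarrow> bool" where
  "Ck 0 g \<longleftrightarrow> continuous_on UNIV g"
| "Ck (Suc n) g \<longleftrightarrow> (\<forall>x. g differentiable (at x)) \<and> (\<forall>b\<in>Basis. Ck n (\<lambda>x. frechet_derivative g (at x) b))"

lemma monomial_series_imp_Ck: "monomial_series g \<Longrightarrow> Ck n g"
proof (induction n arbitrary: g)
  case 0
  then show ?case
    by (auto simp: continuous_on_eq_continuous_within intro!: differentiable_imp_continuous_within monomial_series_derivative)
next
  case (Suc n)
  then show ?case by (auto intro: monomial_series_derivative)
qed

section \<open>Directional derivatives and Taylor expansion\<close>

definition ddir :: "('a::real_normed_vector \<Rightarrow> 'b::real_normed_vector) \<Rightarrow> 'a \<Rightarrow> 'a \<Rightarrow> 'b" where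
  "ddir g v x = frechet_derivative g (at x) v"

lemma Ck_Suc_ddir: "Ck (Suc n) g \<longleftrightarrow> (\<forall>x. g differentiable (at x)) \<and> (\<forall>b\<in>Basis. Ck n (ddir g b))"
  by (simp add: ddir_def[abs_def])

lemma Ck_SucI:
  assumes "\<And>x. (g has_derivative g' x) (at x)" "\<And>b. b \<in> Basis \<Longrightarrow> Ck n (\<lambda>x. g' x b)"
  shows "Ck (Suc n) g"
proof -
  have "frechet_derivative g (at x) = g' x" for x
    using frechet_derivative_at[OF assms(1)] by simp
  then show ?thesis using assms by (auto intro: differentiableI)
qed

lemma Ck_Suc_has_derivative: "Ck (Suc n) g \<Longrightarrow> (g has_derivative (\<lambda>v. ddir g v x)) (at x)"
  unfolding ddir_def by (simp add: frechet_derivative_works)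

lemma ddir_eq: "(g has_derivative g') (at x) \<Longrightarrow> ddir g v x = g' v"
  unfolding ddir_def using frechet_derivative_at[of g g' x] by simp

lemma Ck_continuous: "Ck n g \<Longrightarrow> continuous_on UNIV g"
  by (cases n) (auto simp: continuous_on_eq_continuous_within intro!: differentiable_imp_continuous_within)

lemma Ck_SucD: "Ck (Suc n) g \<Longrightarrow> Ck n g"
proof (induction n arbitrary: g)
  case 0
  then show ?case using Ck_continuous[of 1 g] by simp
next
  case (Suc n)
  then show ?case by (simp only: Ck_Suc_ddir[of "Suc n"] Ck_Suc_ddir[of n]) auto
qed

lemma Ck_const: "Ck n (\<lambda>x. c)"
  by (induction n arbitrary: c) (auto simp: frechet_derivative_const)

lemma Ck_linear: "bounded_linear g \<Longrightarrow> Ck n g"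
proof (cases n)
  case 0
  assume "bounded_linear g" then show ?thesis using 0 by (auto intro: linear_continuous_on)
next
  case (Suc m)
  assume g: "bounded_linear g"
  show ?thesis unfolding Suc
    by (rule Ck_SucI[where g'="\<lambda>x. g"]) (auto intro: Ck_const bounded_linear_imp_has_derivative g)
qed

lemma Ck_add: "Ck n f \<Longrightarrow> Ck n g \<Longrightarrow> Ck n (\<lambda>x. f x + g x)"
proof (induction n arbitrary: f g)
  case 0 then show ?case by (auto intro: continuous_intros)
next
  case (Suc n)
  show ?case
  proof (rule Ck_SucI)
    show "((\<lambda>x. f x + g x) has_derivative (\<lambda>v. ddir f v x + ddir g v x)) (at x)" for x
      by (intro derivative_intros Ck_Suc_has_derivative[OF Suc.prems(1)] Ck_Suc_has_derivative[OF Suc.prems(2)])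
    show "Ck n (\<lambda>x. ddir f b x + ddir g b x)" if "b \<in> Basis" for b
      using Suc.prems that by (intro Suc.IH) (auto simp: Ck_Suc_ddir simp del: Ck.simps)
  qed
qed

lemma Ck_compose_linear: "bounded_linear L \<Longrightarrow> Ck n g \<Longrightarrow> Ck n (\<lambda>x. L (g x))"
proof (induction n arbitrary: g)
  case 0 then show ?case by (auto intro: bounded_linear.continuous_on)
next
  case (Suc n)
  show ?case
  proof (rule Ck_SucI)
    show "((\<lambda>x. L (g x)) has_derivative (\<lambda>v. L (ddir g v x))) (at x)" for x
      by (intro bounded_linear.has_derivative[OF Suc.prems(1)] Ck_Suc_has_derivative[OF Suc.prems(2)])
    show "Ck n (\<lambda>x. L (ddir g b x))" if "b \<in> Basis" for b
      using Suc.prems that by (intro Suc.IH) (auto simp: Ck_Suc_ddir simp del: Ck.simps)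
  qed
qed

lemma Ck_sum: "finite A \<Longrightarrow> (\<And>i. i \<in> A \<Longrightarrow> Ck n (f i)) \<Longrightarrow> Ck n (\<lambda>x. \<Sum>i\<in>A. f i x)"
  by (induction A rule: finite_induct) (auto intro: Ck_const Ck_add)

lemma Ck_scaleR:
  fixes f :: "'a::euclidean_space \<Rightarrow> real" and g :: "'a \<Rightarrow> 'b::real_normed_vector"
  shows "Ck n f \<Longrightarrow> Ck n g \<Longrightarrow> Ck n (\<lambda>x. f x *\<^sub>R g x)"
proof (induction n arbitrary: f g)
  case 0 then show ?case by (auto intro: continuous_intros)
next
  case (Suc n)
  show ?case
  proof (rule Ck_SucI)
    show "((\<lambda>x. f x *\<^sub>R g x) has_derivative (\<lambda>v. f x *\<^sub>R ddir g v x + ddir f v x *\<^sub>R g x)) (at x)" for x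
      by (intro derivative_intros Ck_Suc_has_derivative[OF Suc.prems(1)] Ck_Suc_has_derivative[OF Suc.prems(2)])
    show "Ck n (\<lambda>x. f x *\<^sub>R ddir g b x + ddir f b x *\<^sub>R g x)" if "b \<in> Basis" for b
      using Suc.prems that
      by (intro Ck_add Suc.IH) (auto simp: Ck_Suc_ddir simp del: Ck.simps intro: Ck_SucD)
  qed
qed

lemma ddir_Basis_sum:
  fixes g :: "'a::euclidean_space \<Rightarrow> 'b::real_normed_vector"
  assumes "g differentiable (at x)"
  shows "ddir g v x = (\<Sum>b\<in>Basis. (v \<bullet> b) *\<^sub>R ddir g b x)"
proof -
  interpret bounded_linear "\<lambda>v. ddir g v x"
    unfolding ddir_def using assms by (intro has_derivative_bounded_linear[of g]) (simp add: frechet_derivative_works)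
  have "ddir g v x = ddir g (\<Sum>b\<in>Basis. (v \<bullet> b) *\<^sub>R b) x" by (simp add: euclidean_representation)
  also have "\<dots> = (\<Sum>b\<in>Basis. (v \<bullet> b) *\<^sub>R ddir g b x)" by (simp add: sum scaleR)
  finally show ?thesis .
qed

lemma Ck_ddir:
  fixes g :: "'a::euclidean_space \<Rightarrow> 'b::real_normed_vector"
  assumes "Ck (Suc n) g"
  shows "Ck n (ddir g v)"
proof -
  have "ddir g v = (\<lambda>x. \<Sum>b\<in>Basis. (v \<bullet> b) *\<^sub>R ddir g b x)"
    using assms by (intro ext ddir_Basis_sum) (simp add: Ck_Suc_ddir)
  then show ?thesis
    using assms by (auto simp: Ck_Suc_ddir simp del: Ck.simps intro!: Ck_sum Ck_compose_linear[OF bounded_linear_scaleR_right])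
qed

lemma Ck_compose:
  fixes g :: "'b::euclidean_space \<Rightarrow> 'c::real_normed_vector" and h :: "'a::euclidean_space \<Rightarrow> 'b"
  shows "Ck n g \<Longrightarrow> Ck n h \<Longrightarrow> Ck n (\<lambda>x. g (h x))"
proof (induction n arbitrary: g h)
  case 0 then show ?case by (auto intro: continuous_on_compose2)
next
  case (Suc n)
  show ?case
  proof (rule Ck_SucI)
    show "((\<lambda>x. g (h x)) has_derivative (\<lambda>v. ddir g (ddir h v x) (h x))) (at x)" for x
      using has_derivative_compose[OF Ck_Suc_has_derivative[OF Suc.prems(2)] Ck_Suc_has_derivative[OF Suc.prems(1)]] .
    have "ddir g (ddir h b x) (h x) = (\<Sum>c\<in>Basis. (ddir h b x \<bullet> c) *\<^sub>R ddir g c (h x))" for b x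
      using Suc.prems(1) by (intro ddir_Basis_sum) (simp add: Ck_Suc_ddir)
    then show "Ck n (\<lambda>x. ddir g (ddir h b x) (h x))" if "b \<in> Basis" for b
      by (simp only:) (intro Ck_sum finite_Basis Ck_scaleR Ck_compose_linear[OF bounded_linear_inner_left]
        Suc.IH[OF Ck_ddir[OF Suc.prems(1)] Ck_SucD[OF Suc.prems(2)]] Ck_ddir[OF Suc.prems(2)])
  qed
qed

section \<open>Symmetry of mixed second derivatives\<close>

lemma ddir_mean_value:
  fixes G :: "'a::euclidean_space \<Rightarrow> real"
  assumes "Ck 2 G" "h > 0"
  shows "\<exists>s t. 0 < s \<and> s < h \<and> 0 < t \<and> t < h \<and>
    G (x + h *\<^sub>R u + h *\<^sub>R v) - G (x + h *\<^sub>R u) - G (x + h *\<^sub>R v) + G x = h * h * ddir (ddir G u) v (x + s *\<^sub>R u + t *\<^sub>R v)"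
proof -
  have G: "Ck (Suc 1) G" using assms by (simp add: numeral_2_eq_2)
  have Gu: "Ck (Suc 0) (ddir G u)" using Ck_ddir[OF G] by simp
  have d1: "((\<lambda>s. G (y + s *\<^sub>R w)) has_real_derivative ddir G w (y + s *\<^sub>R w)) (at s)" for y s w
  proof -
    have "((\<lambda>s. G (y + s *\<^sub>R w)) has_derivative (\<lambda>k. ddir G (k *\<^sub>R w) (y + s *\<^sub>R w))) (at s)"
      by (rule has_derivative_compose[OF _ Ck_Suc_has_derivative[OF G]]) (auto intro!: derivative_eq_intros)
    moreover have "ddir G (k *\<^sub>R w) (y + s *\<^sub>R w) = k * ddir G w (y + s *\<^sub>R w)" for k
      using linear_scale[OF has_derivative_linear[OF Ck_Suc_has_derivative[OF G]], of k w] by simp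
    ultimately show ?thesis by (simp add: has_field_derivative_def mult_commute_abs)
  qed
  have d2: "((\<lambda>s. ddir G u (y + s *\<^sub>R w)) has_real_derivative ddir (ddir G u) w (y + s *\<^sub>R w)) (at s)" for y s w
  proof -
    have "((\<lambda>s. ddir G u (y + s *\<^sub>R w)) has_derivative (\<lambda>k. ddir (ddir G u) (k *\<^sub>R w) (y + s *\<^sub>R w))) (at s)"
      by (rule has_derivative_compose[OF _ Ck_Suc_has_derivative[OF Gu]]) (auto intro!: derivative_eq_intros)
    moreover have "ddir (ddir G u) (k *\<^sub>R w) (y + s *\<^sub>R w) = k * ddir (ddir G u) w (y + s *\<^sub>R w)" for k
      using linear_scale[OF has_derivative_linear[OF Ck_Suc_has_derivative[OF Gu]], of k w] by simp
    ultimately show ?thesis by (simp add: has_field_derivative_def mult_commute_abs)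
  qed
  define p where "p s = G ((x + h *\<^sub>R v) + s *\<^sub>R u) - G (x + s *\<^sub>R u)" for s
  have "(p has_real_derivative (ddir G u ((x + h *\<^sub>R v) + s *\<^sub>R u) - ddir G u (x + s *\<^sub>R u))) (at s)" for s
    unfolding p_def by (intro derivative_intros d1)
  then obtain s where s: "0 < s" "s < h" "p h - p 0 = (h - 0) * (ddir G u ((x + h *\<^sub>R v) + s *\<^sub>R u) - ddir G u (x + s *\<^sub>R u))"
    using MVT2[OF assms(2), of p "\<lambda>s. ddir G u ((x + h *\<^sub>R v) + s *\<^sub>R u) - ddir G u (x + s *\<^sub>R u)"] by blast
  obtain t where t: "0 < t" "t < h"
    "ddir G u ((x + s *\<^sub>R u) + h *\<^sub>R v) - ddir G u ((x + s *\<^sub>R u) + 0 *\<^sub>R v) = (h - 0) * ddir (ddir G u) v ((x + s *\<^sub>R u) + t *\<^sub>R v)"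
    using MVT2[OF assms(2) d2, of "x + s *\<^sub>R u" v] by blast
  have "p h - p 0 = h * h * ddir (ddir G u) v (x + s *\<^sub>R u + t *\<^sub>R v)"
    using s(3) t(3) by (simp add: algebra_simps)
  then show ?thesis
    using s t unfolding p_def by (intro exI[of _ s] exI[of _ t]) (simp add: algebra_simps)
qed

text \<open>The second difference of \<open>G\<close> over a parallelogram is symmetric in
  \<open>u\<close> and \<open>v\<close>, and two mean value steps turn it into a mixed derivative,
  in either order, at a nearby point. If the mixed derivatives differed at \<open>x\<close>,
  continuity would keep them apart on a small parallelogram.\<close>

lemma ddir_commute_real:
  fixes G :: "'a::euclidean_space \<Rightarrow> real"
  assumes "Ck 2 G"
  shows "ddir (ddir G u) v x = ddir (ddir G v) u x"
proof (rule ccontr)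
  assume ne: "ddir (ddir G u) v x \<noteq> ddir (ddir G v) u x"
  define \<epsilon> where "\<epsilon> = \<bar>ddir (ddir G u) v x - ddir (ddir G v) u x\<bar> / 2"
  have \<epsilon>: "\<epsilon> > 0" using ne by (simp add: \<epsilon>_def)
  have c: "continuous (at x) (ddir (ddir G u) v)" for u v
    using Ck_ddir[of 0 "ddir G u" v] Ck_ddir[of 1 G u] assms
    by (simp add: numeral_2_eq_2 continuous_on_eq_continuous_at)
  have "\<exists>d>0. \<forall>y. dist y x < d \<longrightarrow> dist (ddir (ddir G u) v y) (ddir (ddir G u) v x) < \<epsilon>" for u v
    using c[of u v] \<epsilon> unfolding continuous_at_eps_delta dist_norm by simp
  then obtain d1 d2 where d: "d1 > 0" "d2 > 0"
    "\<And>y. dist y x < d1 \<Longrightarrow> dist (ddir (ddir G u) v y) (ddir (ddir G u) v x) < \<epsilon>"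
    "\<And>y. dist y x < d2 \<Longrightarrow> dist (ddir (ddir G v) u y) (ddir (ddir G v) u x) < \<epsilon>" by metis
  \<comment> \<open>The summand 1 keeps the scale positive and the inequality in \<open>near\<close>
    strict even for \<open>u = v = 0\<close>.\<close>
  define N where "N = norm u + norm v + 1"
  have N: "N > 0" unfolding N_def by (smt (verit) norm_ge_zero)
  define h where "h = min d1 d2 / N"
  have h: "h > 0" using d N by (simp add: h_def)
  have near: "dist (x + (s *\<^sub>R u' + t *\<^sub>R v')) x < min d1 d2"
    if "0 < s" "s < h" "0 < t" "t < h" "norm u' + norm v' < N" for s t u' v'
  proof -
    have "dist (x + (s *\<^sub>R u' + t *\<^sub>R v')) x \<le> s * norm u' + t * norm v'"
      using norm_triangle_ineq[of "s *\<^sub>R u'" "t *\<^sub>R v'"] that by (simp add: dist_norm)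
    also have "\<dots> \<le> h * norm u' + h * norm v'" using that by (intro add_mono mult_right_mono) auto
    also have "\<dots> < h * N" using h that(5) by (simp add: distrib_left[symmetric])
    also have "\<dots> = min d1 d2" using N by (simp add: h_def)
    finally show ?thesis .
  qed
  from ddir_mean_value[OF assms h, of x u v] obtain s t where st: "0 < s" "s < h" "0 < t" "t < h"
    "G (x + h *\<^sub>R u + h *\<^sub>R v) - G (x + h *\<^sub>R u) - G (x + h *\<^sub>R v) + G x = h * h * ddir (ddir G u) v (x + s *\<^sub>R u + t *\<^sub>R v)" by blast
  from ddir_mean_value[OF assms h, of x v u] obtain s' t' where st': "0 < s'" "s' < h" "0 < t'" "t' < h"
    "G (x + h *\<^sub>R v + h *\<^sub>R u) - G (x + h *\<^sub>R v) - G (x + h *\<^sub>R u) + G x = h * h * ddir (ddir G v) u (x + s' *\<^sub>R v + t' *\<^sub>R u)" by blast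
  have "h * h * ddir (ddir G u) v (x + s *\<^sub>R u + t *\<^sub>R v) = h * h * ddir (ddir G v) u (x + s' *\<^sub>R v + t' *\<^sub>R u)"
    using st(5) st'(5) by (simp add: algebra_simps)
  then have eq: "ddir (ddir G u) v (x + s *\<^sub>R u + t *\<^sub>R v) = ddir (ddir G v) u (x + s' *\<^sub>R v + t' *\<^sub>R u)"
    using h by simp
  have "dist (ddir (ddir G u) v (x + s *\<^sub>R u + t *\<^sub>R v)) (ddir (ddir G u) v x) < \<epsilon>"
    using near[OF st(1-4), of u v] by (intro d) (simp add: N_def add.assoc)
  moreover have "dist (ddir (ddir G v) u (x + s' *\<^sub>R v + t' *\<^sub>R u)) (ddir (ddir G v) u x) < \<epsilon>"
    using near[OF st'(1-4), of v u] by (intro d) (simp add: N_def add.assoc)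
  ultimately show False using eq unfolding \<epsilon>_def dist_real_def by (simp add: abs_if split: if_splits)
qed

lemma ddir_inner:
  fixes F :: "'a::euclidean_space \<Rightarrow> 'b::euclidean_space"
  assumes "Ck (Suc n) F"
  shows "ddir (\<lambda>x. F x \<bullet> b) u = (\<lambda>x. ddir F u x \<bullet> b)"
  by (rule ext, rule ddir_eq, rule bounded_linear.has_derivative[OF bounded_linear_inner_left],
      rule Ck_Suc_has_derivative[OF assms])

lemma ddir_commute:
  fixes F :: "'a::euclidean_space \<Rightarrow> 'b::euclidean_space"
  assumes "Ck 2 F"
  shows "ddir (ddir F u) v x = ddir (ddir F v) u x"
proof (rule euclidean_eqI)
  fix b :: 'b
  have F: "Ck (Suc 1) F" using assms by (simp add: numeral_2_eq_2)
  have F1: "Ck (Suc 0) (ddir F w)" for w using Ck_ddir[OF F] by simp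
  have "Ck 2 (\<lambda>x. F x \<bullet> b)" by (rule Ck_compose_linear[OF bounded_linear_inner_left assms])
  from ddir_commute_real[OF this, of u v x]
  show "ddir (ddir F u) v x \<bullet> b = ddir (ddir F v) u x \<bullet> b"
    unfolding ddir_inner[OF F] ddir_inner[OF F1] .
qed

section \<open>Lipschitz bounds and the Taylor remainder along a quadratic curve\<close>

lemma Ck_locally_Lipschitz:
  fixes F :: "'a::euclidean_space \<Rightarrow> 'b::real_normed_vector"
  assumes "Ck 1 F"
  shows "\<exists>L\<ge>0. \<forall>x y. norm x \<le> M \<longrightarrow> norm y \<le> M \<longrightarrow> norm (F x - F y) \<le> L * norm (x - y)"
proof -
  have F: "Ck (Suc 0) F" using assms by simp
  have "\<exists>B. \<forall>x\<in>cball 0 M. norm (ddir F b x) \<le> B" if "b \<in> Basis" for b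
  proof -
    have "continuous_on (cball 0 M) (ddir F b)"
      using F that by (auto simp: Ck_Suc_ddir simp del: Ck.simps(2) intro: continuous_on_subset)
    then have "bounded (ddir F b ` cball 0 M)"
      by (intro compact_imp_bounded compact_continuous_image) auto
    then show ?thesis by (auto simp: bounded_iff)
  qed
  then obtain B where B: "\<And>b x. b \<in> Basis \<Longrightarrow> x \<in> cball 0 M \<Longrightarrow> norm (ddir F b x) \<le> B b" by metis
  define L where "L = (\<Sum>b\<in>(Basis :: 'a set). \<bar>B b\<bar>)"
  have on: "onorm (\<lambda>v. ddir F v x) \<le> L" if "x \<in> cball 0 M" for x
  proof (rule onorm_bound)
    show "0 \<le> L" unfolding L_def by (simp add: sum_nonneg)
    fix v
    have "ddir F v x = (\<Sum>b\<in>Basis. (v \<bullet> b) *\<^sub>R ddir F b x)"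
      using F by (intro ddir_Basis_sum) (simp add: Ck_Suc_ddir)
    also have "norm \<dots> \<le> (\<Sum>b\<in>Basis. norm ((v \<bullet> b) *\<^sub>R ddir F b x))" by (rule norm_sum)
    also have "\<dots> \<le> (\<Sum>b\<in>Basis. norm v * \<bar>B b\<bar>)"
    proof (rule sum_mono)
      fix b :: 'a assume b: "b \<in> Basis"
      show "norm ((v \<bullet> b) *\<^sub>R ddir F b x) \<le> norm v * \<bar>B b\<bar>"
        unfolding norm_scaleR using B[OF b that] Basis_le_norm[OF b, of v] by (intro mult_mono) auto
    qed
    also have "\<dots> = L * norm v" by (simp add: L_def sum_distrib_left mult.commute)
    finally show "norm (ddir F v x) \<le> L * norm v" .
  qed
  have "norm (F x - F y) \<le> L * norm (x - y)" if "norm x \<le> M" "norm y \<le> M" for x y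
  proof (rule differentiable_bound[of "cball 0 M" F "\<lambda>x v. ddir F v x" L x y])
    show "(F has_derivative (\<lambda>v. ddir F v z)) (at z within cball 0 M)" for z
      by (rule has_derivative_at_withinI[OF Ck_Suc_has_derivative[OF F]])
  qed (use that on in auto)
  then show ?thesis by (intro exI[of _ L]) (auto simp: L_def sum_nonneg)
qed

lemma has_vector_derivative_quadratic_curve:
  fixes F :: "'a::euclidean_space \<Rightarrow> 'b::real_normed_vector"
  assumes "Ck (Suc n) F"
  shows "((\<lambda>a. F (y + a *\<^sub>R w + a\<^sup>2 *\<^sub>R q)) has_vector_derivative
     (ddir F w (y + a *\<^sub>R w + a\<^sup>2 *\<^sub>R q) + (2 * a) *\<^sub>R ddir F q (y + a *\<^sub>R w + a\<^sup>2 *\<^sub>R q))) (at a)"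
proof -
  let ?p = "y + a *\<^sub>R w + a\<^sup>2 *\<^sub>R q"
  have "((\<lambda>a. F (y + a *\<^sub>R w + a\<^sup>2 *\<^sub>R q)) has_derivative (\<lambda>k. ddir F (k *\<^sub>R w + (2 * a * k) *\<^sub>R q) ?p)) (at a)"
    by (rule has_derivative_compose[OF _ Ck_Suc_has_derivative[OF assms]]) (auto intro!: derivative_eq_intros simp: algebra_simps)
  moreover have "ddir F (k *\<^sub>R w + (2 * a * k) *\<^sub>R q) ?p = k *\<^sub>R (ddir F w ?p + (2 * a) *\<^sub>R ddir F q ?p)" for k
  proof -
    interpret linear "\<lambda>v. ddir F v ?p" by (rule has_derivative_linear[OF Ck_Suc_has_derivative[OF assms]])
    show ?thesis by (simp add: add scale scaleR_add_right mult.commute)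
  qed
  ultimately show ?thesis by (simp add: has_vector_derivative_def)
qed

text \<open>The ansatz moves along a curve that is quadratic in \<open>a\<close>, so the expansion
  is taken in the curve parameter. The remainder is the integral form of the third derivative with
  a^3 taken out. Unlike a quotient by a^3 it is defined at \<open>a = 0\<close>, and it is Lipschitz
  on bounded sets jointly in all arguments.\<close>

lemma cubic_Taylor_remainder:
  fixes F :: "'a::euclidean_space \<Rightarrow> 'b::euclidean_space"
  assumes F: "\<And>n. Ck n F"
  obtains Rem :: "'a \<times> 'a \<times> 'a \<times> real \<Rightarrow> 'b" where
    "\<And>y w q a. F (y + a *\<^sub>R w + a\<^sup>2 *\<^sub>R q) = F y + a *\<^sub>R ddir F w y
        + a\<^sup>2 *\<^sub>R (ddir F q y + (1/2) *\<^sub>R ddir (ddir F w) w y) + a^3 *\<^sub>R Rem (y, w, q, a)"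
    "\<And>y w q. Rem (y, w, q, 0) = ddir (ddir F q) w y + (1/6) *\<^sub>R ddir (ddir (ddir F w) w) w y"
    "\<And>M. \<exists>L\<ge>0. \<forall>x y. norm x \<le> M \<longrightarrow> norm y \<le> M \<longrightarrow> norm (Rem x - Rem y) \<le> L * norm (x - y)"
proof -
  \<comment> \<open>Treating base point, directions and parameter as one variable makes smoothness
    of \<open>K\<close> yield Lipschitz dependence on all of them at once; the derivative in
    \<open>a\<close> becomes the directional derivative along \<open>e\<close>.\<close>
  define K :: "'a \<times> 'a \<times> 'a \<times> real \<Rightarrow> 'b" where
    "K v = F (fst v + snd (snd (snd v)) *\<^sub>R fst (snd v) + (snd (snd (snd v)))\<^sup>2 *\<^sub>R fst (snd (snd v)))" for v
  define e :: "'a \<times> 'a \<times> 'a \<times> real" where "e = (0, 0, 0, 1)"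
  have K: "Ck n K" for n
    unfolding K_def power2_eq_square scaleR_scaleR[symmetric]
    by (intro Ck_compose[OF F] Ck_add Ck_scaleR Ck_linear bounded_linear_fst_comp bounded_linear_snd_comp bounded_linear_fst bounded_linear_snd)
  define K1 where "K1 = ddir K e"
  define K2 where "K2 = ddir K1 e"
  define K3 where "K3 = ddir K2 e"
  have K1: "Ck n K1" for n unfolding K1_def by (rule Ck_ddir[OF K])
  have K2: "Ck n K2" for n unfolding K2_def by (rule Ck_ddir[OF K1])
  have K3: "Ck n K3" for n unfolding K3_def by (rule Ck_ddir[OF K2])
  have dK: "((\<lambda>a. k (y, w, q, a)) has_vector_derivative ddir k e (y, w, q, a)) (at a within S)"
    if k: "\<And>n. Ck n k" for k :: "'a \<times> 'a \<times> 'a \<times> real \<Rightarrow> 'b" and y w q a S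
  proof -
    have "((\<lambda>a. k (y, w, q, a)) has_derivative (\<lambda>h. ddir k (0, 0, 0, h) (y, w, q, a))) (at a)"
      by (rule has_derivative_compose[OF _ Ck_Suc_has_derivative[OF k[of "Suc 0"]]]) (auto intro!: derivative_eq_intros)
    moreover have "ddir k (0, 0, 0, h) x = h *\<^sub>R ddir k e x" for h x
      using linear_scale[OF has_derivative_linear[OF Ck_Suc_has_derivative[OF k[of "Suc 0"]]], of h e] by (simp add: e_def)
    ultimately show ?thesis
      by (simp add: has_vector_derivative_def has_derivative_at_withinI)
  qed
  have F1: "Ck n (ddir F u)" for n u by (rule Ck_ddir[OF F])
  have F2: "Ck n (ddir (ddir F u) v)" for n u v by (rule Ck_ddir[OF F1])
  note qc = has_vector_derivative_quadratic_curve
  have uniq: "ddir k e (y, w, q, a) = d"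
    if "\<And>n. Ck n k" "((\<lambda>a. k (y, w, q, a)) has_vector_derivative d) (at a)"
    for k :: "'a \<times> 'a \<times> 'a \<times> real \<Rightarrow> 'b" and y w q a d
    using vector_derivative_unique_at[OF dK[OF that(1)] that(2)] .
  let ?p = "\<lambda>y w q a. y + a *\<^sub>R w + a\<^sup>2 *\<^sub>R q"
  have K_eq: "K (y, w, q, a) = F (?p y w q a)" for y w q a by (simp add: K_def)
  have K1_eq: "K1 (y, w, q, a) = ddir F w (?p y w q a) + (2 * a) *\<^sub>R ddir F q (?p y w q a)" for y w q a
    unfolding K1_def by (rule uniq[OF K]) (unfold K_eq, rule qc[OF F[of "Suc 0"]])
  have K2_eq: "K2 (y, w, q, a) = (ddir (ddir F w) w (?p y w q a) + (2 * a) *\<^sub>R ddir (ddir F w) q (?p y w q a))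
      + ((2 * a) *\<^sub>R (ddir (ddir F q) w (?p y w q a) + (2 * a) *\<^sub>R ddir (ddir F q) q (?p y w q a))
      + 2 *\<^sub>R ddir F q (?p y w q a))" for y w q a
    unfolding K2_def by (rule uniq[OF K1])
      (unfold K1_eq, auto intro!: has_vector_derivative_add has_vector_derivative_scaleR qc[OF F1[of "Suc 0"]] derivative_eq_intros)
  have K3_0: "K3 (y, w, q, 0) = ddir (ddir (ddir F w) w) w y + 6 *\<^sub>R ddir (ddir F q) w y" for y w q
  proof -
    have "((\<lambda>a. K2 (y, w, q, a)) has_vector_derivative
       (ddir (ddir (ddir F w) w) w (?p y w q 0) + (2 * 0) *\<^sub>R ddir (ddir (ddir F w) w) q (?p y w q 0)
        + ((2 * 0) *\<^sub>R (ddir (ddir (ddir F w) q) w (?p y w q 0) + (2 * 0) *\<^sub>R ddir (ddir (ddir F w) q) q (?p y w q 0))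
          + 2 *\<^sub>R ddir (ddir F w) q (?p y w q 0)))
      + (((2 * 0) *\<^sub>R ((ddir (ddir (ddir F q) w) w (?p y w q 0) + (2 * 0) *\<^sub>R ddir (ddir (ddir F q) w) q (?p y w q 0))
           + ((2 * 0) *\<^sub>R (ddir (ddir (ddir F q) q) w (?p y w q 0) + (2 * 0) *\<^sub>R ddir (ddir (ddir F q) q) q (?p y w q 0))
             + 2 *\<^sub>R ddir (ddir F q) q (?p y w q 0)))
         + 2 *\<^sub>R (ddir (ddir F q) w (?p y w q 0) + (2 * 0) *\<^sub>R ddir (ddir F q) q (?p y w q 0)))
        + 2 *\<^sub>R (ddir (ddir F q) w (?p y w q 0) + (2 * 0) *\<^sub>R ddir (ddir F q) q (?p y w q 0)))) (at 0)"
      unfolding K2_eq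
      by (intro has_vector_derivative_add has_vector_derivative_scaleR qc[OF F1[of "Suc 0"]] qc[OF F2[of "Suc 0"]]
          bounded_linear.has_vector_derivative[OF bounded_linear_scaleR_right])
        (auto intro!: derivative_eq_intros)
    \<comment> \<open>The mixed terms arrive twice with the directions in the order
      \<open>w\<close>, \<open>q\<close> and four times in the order \<open>q\<close>,
      \<open>w\<close>; symmetry merges them into the factor 6.\<close>
    from uniq[OF K2 this] show ?thesis
      unfolding K3_def using ddir_commute[OF F, of w q y] by (simp add: scaleR_left_distrib[symmetric])
  qed
  define Rem :: "'a \<times> 'a \<times> 'a \<times> real \<Rightarrow> 'b" where
    "Rem v = integral {0..1} (\<lambda>\<tau>. ((1 - \<tau>)\<^sup>2 / 2) *\<^sub>R K3 (fst v, fst (snd v), fst (snd (snd v)), \<tau> * snd (snd (snd v))))" for v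
  have int: "(\<lambda>\<tau>. ((1 - \<tau>)\<^sup>2 / 2) *\<^sub>R K3 (fst v, fst (snd v), fst (snd (snd v)), \<tau> * snd (snd (snd v)))) integrable_on {0..1}" for v
    by (intro integrable_continuous_real continuous_intros continuous_on_compose2[OF Ck_continuous[OF K3]]) auto
  show ?thesis
  proof (rule that[of Rem])
    fix y w q :: 'a and a :: real
    define Df where "Df i \<tau> = a ^ i *\<^sub>R (if i = 0 then K else if i = 1 then K1 else if i = 2 then K2 else K3) (y, w, q, \<tau> * a)" for i :: nat and \<tau>
    have chain: "((\<lambda>\<tau>. k (y, w, q, \<tau> * a)) has_vector_derivative a *\<^sub>R ddir k e (y, w, q, \<tau> * a)) (at \<tau> within S)"
      if k: "\<And>n. Ck n k" for k :: "'a \<times> 'a \<times> 'a \<times> real \<Rightarrow> 'b" and \<tau> S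
    proof -
      have "((\<lambda>\<tau>. \<tau> * a) has_vector_derivative a) (at \<tau>)"
        by (auto intro!: derivative_eq_intros)
      from vector_diff_chain_at[OF this dK[OF k]] show ?thesis
        by (simp add: o_def has_vector_derivative_at_within)
    qed
    have Df: "(Df m has_vector_derivative Df (Suc m) t) (at t within {0..1})" if m3: "m < 3" for m t
    proof -
      consider "m = 0" | "m = 1" | "m = 2" using m3 by force
      then show ?thesis
      proof cases
        case 1
        show ?thesis unfolding Df_def 1 using chain[OF K] by (simp add: K1_def)
      next
        case 2
        show ?thesis unfolding Df_def 2
          using bounded_linear.has_vector_derivative[OF bounded_linear_scaleR_right chain[OF K1], of a]
          by (simp add: K2_def power2_eq_square)
      next
        case 3
        show ?thesis unfolding Df_def 3
          using bounded_linear.has_vector_derivative[OF bounded_linear_scaleR_right chain[OF K2], of "a^2"]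
          by (simp add: K3_def power2_eq_square power3_eq_cube)
      qed
    qed
    have "K (y, w, q, 1 * a) = (\<Sum>i<3. ((1-0) ^ i / fact i) *\<^sub>R Df i 0) + integral {0..1} (\<lambda>x. ((1 - x) ^ (3 - 1) / fact (3 - 1)) *\<^sub>R Df 3 x)"
      by (rule Taylor_integral[where Df=Df]) (use Df in \<open>auto simp: Df_def\<close>)
    also have "integral {0..1} (\<lambda>x. ((1 - x) ^ (3 - 1) / fact (3 - 1)) *\<^sub>R Df 3 x) = a^3 *\<^sub>R Rem (y, w, q, a)"
      unfolding Rem_def integral_cmul[symmetric] by (simp add: Df_def mult.commute fact_numeral numeral_2_eq_2)
    also have "(\<Sum>i<3. ((1-0) ^ i / fact i) *\<^sub>R Df i 0) = K (y,w,q,0) + a *\<^sub>R K1 (y,w,q,0) + (a\<^sup>2 / 2) *\<^sub>R K2 (y,w,q,0)"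
      by (simp add: numeral_3_eq_3 Df_def numeral_2_eq_2 power2_eq_square)
    finally show "F (y + a *\<^sub>R w + a\<^sup>2 *\<^sub>R q) = F y + a *\<^sub>R ddir F w y
        + a\<^sup>2 *\<^sub>R (ddir F q y + (1/2) *\<^sub>R ddir (ddir F w) w y) + a^3 *\<^sub>R Rem (y, w, q, a)"
      by (simp add: K_eq K1_eq K2_eq scaleR_add_right)
  next
    fix y w q :: 'a
    have "((\<lambda>\<tau>. (1 - \<tau>)\<^sup>2 / 2 :: real) has_integral (- ((1 - 1) ^ 3 / 6) - - ((1 - 0) ^ 3 / 6))) {0..1}"
      by (rule fundamental_theorem_of_calculus)
        (auto intro!: derivative_eq_intros simp: has_real_derivative_iff_has_vector_derivative[symmetric] power2_eq_square field_simps)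
    then have i: "((\<lambda>\<tau>. (1 - \<tau>)\<^sup>2 / 2 :: real) has_integral (1/6)) {0..1}" by simp
    have "Rem (y, w, q, 0) = (1/6) *\<^sub>R K3 (y, w, q, 0)"
      unfolding Rem_def using has_integral_scaleR_left[OF i, of "K3 (y,w,q,0)"] by (simp add: integral_unique)
    then show "Rem (y, w, q, 0) = ddir (ddir F q) w y + (1/6) *\<^sub>R ddir (ddir (ddir F w) w) w y"
      by (simp add: K3_0 scaleR_add_right)
  next
    fix M
    obtain L where L: "L \<ge> 0" "\<And>x y. norm x \<le> M \<Longrightarrow> norm y \<le> M \<Longrightarrow> norm (K3 x - K3 y) \<le> L * norm (x - y)"
      using Ck_locally_Lipschitz[OF K3[of 1], of M] by blast
    show "\<exists>L\<ge>0. \<forall>x y. norm x \<le> M \<longrightarrow> norm y \<le> M \<longrightarrow> norm (Rem x - Rem y) \<le> L * norm (x - y)"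
    proof (intro exI[of _ L] conjI L allI impI)
      fix x x' :: "'a \<times> 'a \<times> 'a \<times> real" assume M: "norm x \<le> M" "norm x' \<le> M"
      let ?s = "\<lambda>v \<tau>. (fst v, fst (snd v), fst (snd (snd v)), \<tau> * snd (snd (snd v))) :: 'a \<times> 'a \<times> 'a \<times> real"
      have s: "norm (?s v \<tau>) \<le> norm v" if "\<tau> \<in> {0..1}" for v \<tau>
      proof -
        have "(\<tau> * snd (snd (snd v)))\<^sup>2 \<le> (snd (snd (snd v)))\<^sup>2"
          using that by (simp add: power_mult_distrib mult_left_le_one_le power_le_one)
        then show ?thesis by (cases v) (simp add: norm_prod_def)
      qed
      have "norm (Rem x - Rem x') = norm (integral {0..1} (\<lambda>\<tau>. ((1 - \<tau>)\<^sup>2 / 2) *\<^sub>R (K3 (?s x \<tau>) - K3 (?s x' \<tau>))))"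
        unfolding Rem_def using int[of x] int[of x'] by (simp add: integral_diff scaleR_diff_right)
      also have "\<dots> \<le> (L * norm (x - x')) * measure lborel (cbox 0 (1::real))"
        unfolding cbox_interval[symmetric]
      proof (rule integrable_bound)
        show "(\<lambda>\<tau>. ((1 - \<tau>)\<^sup>2 / 2) *\<^sub>R (K3 (?s x \<tau>) - K3 (?s x' \<tau>))) integrable_on cbox 0 1"
          unfolding scaleR_diff_right using integrable_diff[OF int[of x] int[of x']] by simp
        fix \<tau> :: real assume "\<tau> \<in> cbox 0 1"
        then have \<tau>: "\<tau> \<in> {0..1}" by simp
        have "norm (K3 (?s x \<tau>) - K3 (?s x' \<tau>)) \<le> L * norm (?s x \<tau> - ?s x' \<tau>)"
          using s[OF \<tau>, of x] s[OF \<tau>, of x'] M by (intro L) auto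
        also have "?s x \<tau> - ?s x' \<tau> = ?s (x - x') \<tau>" by (simp add: algebra_simps)
        also have "L * norm \<dots> \<le> L * norm (x - x')" by (intro mult_left_mono L(1) s[OF \<tau>])
        finally have 1: "norm (K3 (?s x \<tau>) - K3 (?s x' \<tau>)) \<le> L * norm (x - x')" .
        have "\<bar>(1 - \<tau>)\<^sup>2 / 2\<bar> \<le> 1" using \<tau> power_le_one[of "1 - \<tau>" 2] by simp
        then show "norm (((1 - \<tau>)\<^sup>2 / 2) *\<^sub>R (K3 (?s x \<tau>) - K3 (?s x' \<tau>))) \<le> L * norm (x - x')"
          unfolding norm_scaleR using mult_mono[OF _ 1, of "\<bar>(1 - \<tau>)\<^sup>2 / 2\<bar>" 1] by simp
      qed (use L in auto)
      finally show "norm (Rem x - Rem x') \<le> L * norm (x - x')" by simp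
    qed
  qed
qed

section \<open>Bounded solutions of linear systems\<close>

lemma norm_vector_smult: "norm (c *s v) = norm c * norm (v :: complex ^ 'n)"
  unfolding norm_vec_def by (simp add: norm_mult L2_set_right_distrib)

lemma bounded_bilinear_vector_smult: "bounded_bilinear ((*s) :: complex \<Rightarrow> complex ^ 'n \<Rightarrow> complex ^ 'n)"
proof
  show "\<exists>K. \<forall>a b. norm (a *s (b :: complex ^ 'n)) \<le> norm a * norm b * K"
    by (intro exI[of _ 1]) (simp add: norm_vector_smult)
qed (auto simp: vec_eq_iff algebra_simps)

lemma has_vector_derivative_exp_smult:
  fixes y :: "real \<Rightarrow> complex ^ 'n"
  assumes "(y has_vector_derivative y') (at s)"
  shows "((\<lambda>s. exp (l * of_real (t - s)) *s y s) has_vector_derivative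
           exp (l * of_real (t - s)) *s (y' - l *s y s)) (at s)"
proof -
  have "((\<lambda>s. exp (l * of_real (t - s))) has_vector_derivative exp (l * of_real (t - s)) * (l * (0 - 1))) (at s)"
    unfolding of_real_diff
    by (rule has_vector_derivative_real_field[OF DERIV_fun_exp, of "\<lambda>s. l * (of_real t - s)", unfolded])
      (auto intro!: derivative_eq_intros)
  from bounded_bilinear.has_vector_derivative[OF bounded_bilinear_vector_smult this assms]
  show ?thesis by (simp add: vec_eq_iff algebra_simps)
qed

text \<open>For \<open>Re l > 0\<close> solutions grow forwards, so a value is controlled by any
  later one. The integrating factor \<open>exp (l * of_real (t - s))\<close> removes the linear
  term, and \<open>p\<close> is an antiderivative of the resulting bound on the derivative.\<close>

lemma scalar_equation_estimate:
  fixes y :: "real \<Rightarrow> complex ^ 'n"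
  assumes a: "Re l > 0" and y: "\<And>s. (y has_vector_derivative l *s y s + h s) (at s)"
    and t: "t \<le> T" and h: "\<And>s. t \<le> s \<Longrightarrow> s \<le> T \<Longrightarrow> norm (h s) \<le> \<epsilon>"
  shows "norm (y t) \<le> exp (- Re l * (T - t)) * norm (y T) + \<epsilon> / Re l"
proof (cases "t < T")
  case False
  then have "t = T" using t by simp
  moreover have "\<epsilon> \<ge> 0" using h[of T] t order_trans[OF norm_ge_zero] by auto
  ultimately show ?thesis using a by simp
next
  case True
  define z where "z s = exp (l * of_real (t - s)) *s y s" for s
  define p where "p s = - (\<epsilon> / Re l) * exp (Re l * (t - s))" for s
  have \<epsilon>: "\<epsilon> \<ge> 0" using h[of T] t order_trans[OF norm_ge_zero] by auto
  have z': "(z has_vector_derivative exp (l * of_real (t - s)) *s h s) (at s)" for s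
    unfolding z_def using has_vector_derivative_exp_smult[OF y[of s], of l t] by simp
  have p': "(p has_vector_derivative \<epsilon> * exp (Re l * (t - s))) (at s)" for s
    unfolding p_def has_real_derivative_iff_has_vector_derivative[symmetric]
    using a by (auto intro!: derivative_eq_intros)
  have "norm (z T - z t) \<le> p T - p t"
  proof (rule differentiable_bound_general[OF True _ _ z' p'])
    show "continuous_on {t..T} z"
      by (rule continuous_at_imp_continuous_on) (auto intro: has_vector_derivative_continuous z')
    show "continuous_on {t..T} p"
      by (rule continuous_at_imp_continuous_on) (auto intro: has_vector_derivative_continuous p')
    fix s assume "t < s" "s < T"
    then show "norm (exp (l * of_real (t - s)) *s h s) \<le> \<epsilon> * exp (Re l * (t - s))"
      using h[of s] by (simp add: norm_vector_smult mult.commute)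
  qed
  moreover have "p T - p t \<le> \<epsilon> / Re l"
    using a \<epsilon> by (simp add: p_def)
  moreover have "norm (z t) = norm (y t)" by (simp add: z_def)
  moreover have "norm (z T) = exp (- Re l * (T - t)) * norm (y T)"
    by (simp add: z_def norm_vector_smult algebra_simps)
  ultimately show ?thesis using norm_triangle_ineq3[of "z T" "z t"] by linarith
qed

text \<open>The solution is minus the integral of \<open>exp (l * of_real (t - s)) *s h s\<close>
  over \<open>s \<ge> t\<close>. It is reached without an improper integral, as the limit of the
  solutions that vanish at time \<open>n\<close>; these obey one common bound to the left of their
  zero by \<open>scalar_equation_estimate\<close>.\<close>

lemma scalar_equation_bounded_solution:
  fixes h :: "real \<Rightarrow> complex ^ 'n"
  assumes a: "Re l > 0" and h: "continuous_on UNIV h" "\<And>s. norm (h s) \<le> M"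
  shows "\<exists>y. (\<forall>t. (y has_vector_derivative l *s y t + h t) (at t)) \<and> (\<forall>t. norm (y t) \<le> M / Re l)"
proof -
  define k where "k s = exp (- l * of_real s) *s h s" for s
  have kc: "continuous_on S k" for S
    unfolding k_def by (intro bounded_bilinear.continuous_on[OF bounded_bilinear_vector_smult] continuous_intros continuous_on_subset[OF h(1)]) auto
  have "\<exists>I. \<forall>t. (I has_vector_derivative k t) (at t)"
    using einterval_antiderivative[of "-\<infinity>" "\<infinity>" k] kc[of UNIV] by (simp add: continuous_on_eq_continuous_at)
  then obtain I where I: "\<And>t. (I has_vector_derivative k t) (at t)" by blast
  define Y where "Y C t = exp (l * of_real t) *s (I t - C)" for C t
  have Y': "(Y C has_vector_derivative l *s Y C t + h t) (at t)" for C t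
  proof -
    have 1: "((\<lambda>t. exp (l * of_real t)) has_vector_derivative l * exp (l * of_real t)) (at t)"
      by (auto intro!: derivative_eq_intros has_vector_derivative_real_field)
    have 2: "((\<lambda>t. I t - C) has_vector_derivative k t) (at t)"
      using has_vector_derivative_diff[OF I has_vector_derivative_const] by simp
    have "exp (l * of_real t) *s k t = h t"
      by (simp add: k_def vector_smult_assoc exp_minus)
    then have "exp (l * of_real t) *s k t + (l * exp (l * of_real t)) *s (I t - C) = l *s Y C t + h t"
      by (simp add: Y_def vector_smult_assoc)
    with bounded_bilinear.has_vector_derivative[OF bounded_bilinear_vector_smult 1 2]
    show ?thesis unfolding Y_def[abs_def] by (rule has_vector_derivative_eq_rhs)
  qed
  have M: "M \<ge> 0" using h(2)[of 0] order_trans[OF norm_ge_zero] by blast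
  have Yb: "norm (Y (I T) t) \<le> M / Re l" if "t \<le> T" for t T
    using scalar_equation_estimate[OF a Y'[of "I T"] that, of M] h(2) by (simp add: Y_def)
  have diff: "norm (I S - I T) \<le> exp (- Re l * S) * (M / Re l)" if "S \<le> T" for S T
  proof -
    have "I S - I T = exp (- l * of_real S) *s Y (I T) S"
      by (simp add: Y_def vector_smult_assoc exp_minus)
    then have "norm (I S - I T) = exp (- Re l * S) * norm (Y (I T) S)"
      by (simp add: norm_vector_smult)
    also have "\<dots> \<le> exp (- Re l * S) * (M / Re l)" by (intro mult_left_mono Yb that) auto
    finally show ?thesis .
  qed
  have "Cauchy (\<lambda>n. I (real n))"
  proof (rule metric_CauchyI)
    fix e :: real assume e: "e > 0"
    have "((\<lambda>S. exp (- Re l * S) * (M / Re l)) \<longlongrightarrow> 0) at_top"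
      using a by real_asymp
    then have "\<forall>\<^sub>F S in at_top. exp (- Re l * S) * (M / Re l) < e / 2" using e by (intro order_tendstoD) auto
    then obtain S where S: "\<And>s. s \<ge> S \<Longrightarrow> exp (- Re l * s) * (M / Re l) < e / 2" by (auto simp: eventually_at_top_linorder)
    define N where "N = nat \<lceil>S\<rceil>"
    have N: "real N \<ge> S" by (simp add: N_def) linarith
    have *: "dist (I (real N)) (I (real n)) < e / 2" if "n \<ge> N" for n
      unfolding dist_norm by (rule le_less_trans[OF diff S[OF N]]) (use that in simp)
    show "\<exists>M. \<forall>m\<ge>M. \<forall>n\<ge>M. dist (I (real m)) (I (real n)) < e"
    proof (intro exI[of _ N] allI impI)
      fix m n assume "m \<ge> N" "n \<ge> N"
      then show "dist (I (real m)) (I (real n)) < e" by (intro dist_triangle_half_r[OF * *])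
    qed
  qed
  then obtain C where C: "(\<lambda>n. I (real n)) \<longlonglongrightarrow> C" by (auto simp: Cauchy_convergent_iff convergent_def)
  have "norm (Y C t) \<le> M / Re l" for t
  proof (rule Lim_bounded)
    show "(\<lambda>n. norm (Y (I (real n)) t)) \<longlonglongrightarrow> norm (Y C t)"
      unfolding Y_def
      by (intro tendsto_norm bounded_bilinear.tendsto[OF bounded_bilinear_vector_smult] tendsto_intros C)
    show "\<forall>n\<ge>nat \<lceil>t\<rceil>. norm (Y (I (real n)) t) \<le> M / Re l"
      by (intro allI impI Yb) linarith
  qed
  then show ?thesis using Y' by blast
qed

text \<open>At plus infinity the later endpoint of the estimate is sent to infinity, where
  boundedness of \<open>y\<close> removes its contribution. At minus infinity a fixed endpoint
  suffices, because the exponential factor itself tends to 0.\<close>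

lemma scalar_equation_tendsto_0:
  fixes y :: "real \<Rightarrow> complex ^ 'n"
  assumes a: "Re l > 0" and y: "\<And>s. (y has_vector_derivative l *s y s + h s) (at s)" and M: "\<And>s. norm (y s) \<le> M"
  shows "(h \<longlongrightarrow> 0) at_top \<Longrightarrow> (y \<longlongrightarrow> 0) at_top"
    and "(h \<longlongrightarrow> 0) at_bot \<Longrightarrow> (y \<longlongrightarrow> 0) at_bot"
proof -
  have M0: "M \<ge> 0" using M[of 0] order_trans[OF norm_ge_zero] by blast
  have tail: "norm (y t) \<le> \<epsilon> / Re l" if "\<And>s. s \<ge> t \<Longrightarrow> norm (h s) \<le> \<epsilon>" for t \<epsilon>
  proof (rule tendsto_lowerbound)
    have "((\<lambda>T. exp (- Re l * (T - t)) * M + \<epsilon> / Re l) \<longlongrightarrow> 0 * M + \<epsilon> / Re l) at_top"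
    proof (intro tendsto_intros)
      show "((\<lambda>T. exp (- Re l * (T - t))) \<longlongrightarrow> 0) at_top" using a by real_asymp
    qed
    then show "((\<lambda>T. exp (- Re l * (T - t)) * M + \<epsilon> / Re l) \<longlongrightarrow> \<epsilon> / Re l) at_top" by simp
    show "\<forall>\<^sub>F T in at_top. norm (y t) \<le> exp (- Re l * (T - t)) * M + \<epsilon> / Re l"
      using eventually_ge_at_top[of t]
    proof eventually_elim
      case (elim T)
      have "norm (y t) \<le> exp (- Re l * (T - t)) * norm (y T) + \<epsilon> / Re l"
        by (rule scalar_equation_estimate[OF a y elim]) (use that in auto)
      also have "\<dots> \<le> exp (- Re l * (T - t)) * M + \<epsilon> / Re l" by (intro add_mono mult_left_mono M) auto
      finally show ?case .
    qed
  qed simp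
  show "(y \<longlongrightarrow> 0) at_top" if h: "(h \<longlongrightarrow> 0) at_top"
  proof (rule tendstoI)
    fix e :: real assume e: "e > 0"
    have "\<forall>\<^sub>F s in at_top. dist (h s) 0 < e * Re l / 2" using h e a by (intro tendstoD) auto
    then obtain t0 where "\<forall>s\<ge>t0. norm (h s) < e * Re l / 2" unfolding eventually_at_top_linorder by auto
    then have t0: "norm (h s) \<le> e * Re l / 2" if "s \<ge> t0" for s using that by (auto intro: less_imp_le)
    have "norm (y t) \<le> e * Re l / 2 / Re l" if "t \<ge> t0" for t using t0 that by (intro tail) auto
    then show "\<forall>\<^sub>F t in at_top. dist (y t) 0 < e"
      using a e unfolding eventually_at_top_linorder by (intro exI[of _ t0] allI impI) (fastforce intro: le_less_trans)
  qed
  show "(y \<longlongrightarrow> 0) at_bot" if h: "(h \<longlongrightarrow> 0) at_bot"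
  proof (rule tendstoI)
    fix e :: real assume e: "e > 0"
    have "\<forall>\<^sub>F s in at_bot. dist (h s) 0 < e * Re l / 2" using h e a by (intro tendstoD) auto
    then obtain t0 where "\<forall>s\<le>t0. norm (h s) < e * Re l / 2" unfolding eventually_at_bot_linorder by auto
    then have t0: "norm (h s) \<le> e * Re l / 2" if "s \<le> t0" for s using that by (auto intro: less_imp_le)
    have "((\<lambda>t. exp (- Re l * (t0 - t)) * M) \<longlongrightarrow> 0 * M) at_bot"
    proof (intro tendsto_intros)
      show "((\<lambda>t. exp (- Re l * (t0 - t))) \<longlongrightarrow> 0) at_bot" using a by real_asymp
    qed
    then have "\<forall>\<^sub>F t in at_bot. exp (- Re l * (t0 - t)) * M < e / 2" using e by (intro order_tendstoD) auto
    then show "\<forall>\<^sub>F t in at_bot. dist (y t) 0 < e"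
      using eventually_le_at_bot[of t0]
    proof eventually_elim
      case (elim t)
      have "norm (y t) \<le> exp (- Re l * (t0 - t)) * norm (y t0) + (e * Re l / 2) / Re l"
        by (rule scalar_equation_estimate[OF a y elim(2)]) (use t0 in auto)
      also have "\<dots> \<le> exp (- Re l * (t0 - t)) * M + (e * Re l / 2) / Re l" by (intro add_mono mult_left_mono M) auto
      also have "\<dots> < e" using elim a by simp
      finally show ?case by simp
    qed
  qed
qed

lemma scalar_equation:
  fixes h :: "real \<Rightarrow> complex ^ 'n"
  assumes a: "Re l \<noteq> 0" and h: "continuous_on UNIV h" "\<And>s. norm (h s) \<le> M"
  shows "\<exists>y. (\<forall>t. (y has_vector_derivative l *s y t + h t) (at t)) \<and> (\<forall>t. norm (y t) \<le> M / \<bar>Re l\<bar>) \<and>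
    ((h \<longlongrightarrow> 0) at_top \<longrightarrow> (y \<longlongrightarrow> 0) at_top) \<and> ((h \<longlongrightarrow> 0) at_bot \<longrightarrow> (y \<longlongrightarrow> 0) at_bot)"
proof (cases "Re l > 0")
  case True
  from scalar_equation_bounded_solution[OF True h] obtain y where
    y: "\<And>t. (y has_vector_derivative l *s y t + h t) (at t)" "\<And>t. norm (y t) \<le> M / Re l" by blast
  show ?thesis
    using y scalar_equation_tendsto_0[OF True y] True by (intro exI[of _ y]) auto
next
  case False
  then have neg: "Re (- l) > 0" using a by simp
  \<comment> \<open>Time reversal changes the sign of \<open>Re l\<close> and exchanges the two ends
    of the line.\<close>
  define g where "g s = - h (- s)" for s
  have g: "continuous_on UNIV g" "\<And>s. norm (g s) \<le> M"
    unfolding g_def using h by (auto intro!: continuous_intros continuous_on_compose2[OF h(1)])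
  from scalar_equation_bounded_solution[OF neg g] obtain z where
    z: "\<And>t. (z has_vector_derivative (- l) *s z t + g t) (at t)" "\<And>t. norm (z t) \<le> M / Re (- l)" by blast
  have "((\<lambda>t. z (- t)) has_vector_derivative l *s z (- t) + h t) (at t)" for t
  proof -
    have "((\<lambda>t::real. - t) has_vector_derivative - 1) (at t)" by (auto intro!: derivative_eq_intros)
    from vector_diff_chain_at[OF this z(1)]
    show ?thesis by (simp add: o_def g_def vec_eq_iff add.commute)
  qed
  moreover have "((\<lambda>t. z (- t)) \<longlongrightarrow> 0) at_top" if "(h \<longlongrightarrow> 0) at_top"
  proof -
    have "(g \<longlongrightarrow> 0) at_bot" unfolding g_def
      using tendsto_minus[OF filterlim_compose[OF that filterlim_uminus_at_top_at_bot]] by simp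
    then have "(z \<longlongrightarrow> 0) at_bot" using scalar_equation_tendsto_0(2)[OF neg z] by simp
    then show ?thesis by (rule filterlim_compose[OF _ filterlim_uminus_at_bot_at_top])
  qed
  moreover have "((\<lambda>t. z (- t)) \<longlongrightarrow> 0) at_bot" if "(h \<longlongrightarrow> 0) at_bot"
  proof -
    have "(g \<longlongrightarrow> 0) at_top" unfolding g_def
      using tendsto_minus[OF filterlim_compose[OF that filterlim_uminus_at_bot_at_top]] by simp
    then have "(z \<longlongrightarrow> 0) at_top" using scalar_equation_tendsto_0(1)[OF neg z] by simp
    then show ?thesis by (rule filterlim_compose[OF _ filterlim_uminus_at_top_at_bot])
  qed
  ultimately show ?thesis using z(2) False by (intro exI[of _ "\<lambda>t. z (- t)"]) auto
qed

lemma scalar_equation_unique_0: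
  fixes y :: "real \<Rightarrow> complex ^ 'n"
  assumes a: "Re l \<noteq> 0" and y: "\<And>t. (y has_vector_derivative l *s y t) (at t)" and M: "\<And>t. norm (y t) \<le> M"
  shows "y t = 0"
proof -
  have pos: "z t = 0" if a: "Re k > 0" and z: "\<And>t. (z has_vector_derivative k *s z t) (at t)" and M: "\<And>t. norm (z t) \<le> M"
    for k t and z :: "real \<Rightarrow> complex ^ 'n"
  proof -
    have "norm (z t) \<le> 0"
    proof (rule tendsto_lowerbound)
      have "((\<lambda>T. exp (- Re k * (T - t)) * M) \<longlongrightarrow> 0 * M) at_top"
      proof (intro tendsto_intros)
        show "((\<lambda>T. exp (- Re k * (T - t))) \<longlongrightarrow> 0) at_top" using a by real_asymp
      qed
      then show "((\<lambda>T. exp (- Re k * (T - t)) * M) \<longlongrightarrow> 0) at_top" by simp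
      show "\<forall>\<^sub>F T in at_top. norm (z t) \<le> exp (- Re k * (T - t)) * M"
        using eventually_ge_at_top[of t]
      proof eventually_elim
        case (elim T)
        have "norm (z t) \<le> exp (- Re k * (T - t)) * norm (z T) + 0 / Re k"
          by (rule scalar_equation_estimate[where h="\<lambda>_. 0"]) (use a z elim in auto)
        also have "\<dots> \<le> exp (- Re k * (T - t)) * M" using M by (simp add: mult_left_mono)
        finally show ?case .
      qed
    qed simp
    then show ?thesis by simp
  qed
  show ?thesis
  proof (cases "Re l > 0")
    case True then show ?thesis using pos y M by blast
  next
    case False
    have "((\<lambda>t. y (- t)) has_vector_derivative (- l) *s y (- t)) (at t)" for t
    proof -
      have "((\<lambda>t::real. - t) has_vector_derivative - 1) (at t)" by (auto intro!: derivative_eq_intros)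
      from vector_diff_chain_at[OF this y]
      show ?thesis by (simp add: o_def vec_eq_iff)
    qed
    from pos[OF _ this M, of "- t"] False a show ?thesis by simp
  qed
qed

section \<open>Constant hyperbolic systems via products of the factors \<open>A - l\<close>\<close>

primrec shift_prod :: "complex ^ 'n ^ 'n \<Rightarrow> complex list \<Rightarrow> complex ^ 'n \<Rightarrow> complex ^ 'n" where
  "shift_prod A [] v = v"
| "shift_prod A (l # ls) v = shift_prod A ls (A *v v - l *s v)"

lemma bounded_linear_complex_matrix: "bounded_linear ((*v) (A :: complex ^ 'n ^ 'n))"
  by (rule matrix_vector_mul_bounded_linear)

lemma shift_prod_linear:
  "bounded_linear (shift_prod A ls)" "shift_prod A ls (c *s v) = c *s shift_prod A ls v"
proof (induction ls arbitrary: v)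
  case Nil
  { case 1 show ?case by (simp add: bounded_linear_ident) }
  { case 2 show ?case by simp }
next
  case (Cons l ls)
  { case 1
    have "bounded_linear (\<lambda>v. A *v v - l *s v)"
      by (intro bounded_linear_sub bounded_linear_complex_matrix bounded_bilinear.bounded_linear_right[OF bounded_bilinear_vector_smult])
    from bounded_linear_compose[OF Cons.IH(1) this] show ?case by simp }
  { case 2
    have "A *v (c *s v) - l *s (c *s v) = c *s (A *v v - l *s v)"
      by (simp add: vec_eq_iff matrix_vector_mult_def sum_distrib_left algebra_simps)
    then show ?case by (simp only: shift_prod.simps(2) Cons.IH(2)) }
qed

lemma shift_prod_diff: "shift_prod A ls (v - w) = shift_prod A ls v - shift_prod A ls w"
  by (rule linear_diff[OF bounded_linear.linear[OF shift_prod_linear(1)]])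

lemma matrix_vector_smult: "A *v (c *s v) = c *s (A *v (v :: complex ^ 'n))"
  by (simp add: vec_eq_iff matrix_vector_mult_def sum_distrib_left algebra_simps)

lemma shift_prod_mult_commute: "shift_prod A ls (A *v v) = A *v shift_prod A ls v"
proof (induction ls arbitrary: v)
  case (Cons l ls)
  have "A *v (A *v v) - l *s (A *v v) = A *v (A *v v - l *s v)"
    by (simp add: matrix_vector_mult_diff_distrib matrix_vector_smult)
  then show ?case using Cons.IH by simp
qed simp

lemma shift_prod_Cons: "shift_prod A (l # ls) v = A *v shift_prod A ls v - l *s shift_prod A ls v"
  by (simp add: shift_prod_diff shift_prod_mult_commute shift_prod_linear(2))

lemma shift_prod_middle: "shift_prod A (xs @ l # ys) v = shift_prod A (l # xs @ ys) v"
  by (induction xs arbitrary: v) (simp_all add: shift_prod_Cons matrix_vector_mult_diff_distrib matrix_vector_smult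
      vec.scale_right_diff_distrib vec.scale_left_commute del: shift_prod.simps(2))

text \<open>Linear dependence is a property of sets, so a repeated value in the sequence is treated
  separately; it gives a relation on its own.\<close>

lemma euclidean_sequence_dependent:
  fixes g :: "nat \<Rightarrow> 'e::euclidean_space"
  shows "\<exists>N u. (\<exists>i<N. u i \<noteq> 0) \<and> (\<Sum>i<N. u i *\<^sub>R g i) = 0"
proof (cases "inj_on g {..DIM('e)}")
  case False
  then obtain i j where ij: "i \<noteq> j" "g i = g j" "i \<le> DIM('e)" "j \<le> DIM('e)" by (auto simp: inj_on_def)
  define u where "u k = (if k = i then 1 else if k = j then -1 else 0 :: real)" for k
  have "(\<Sum>k<Suc DIM('e). u k *\<^sub>R g k) = (\<Sum>k\<in>{i, j}. u k *\<^sub>R g k)"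
    using ij by (intro sum.mono_neutral_right) (auto simp: u_def)
  also have "\<dots> = 0" using ij by (simp add: u_def)
  finally show ?thesis using ij by (intro exI[of _ "Suc DIM('e)"] exI[of _ u] conjI exI[of _ i]) (auto simp: u_def)
next
  case True
  let ?S = "g ` {..DIM('e)}"
  have "card ?S = Suc DIM('e)" using card_image[OF True] by simp
  then have "dependent ?S" by (intro dependent_biggerset) auto
  then obtain u v where u: "v \<in> ?S" "u v \<noteq> 0" "(\<Sum>v\<in>?S. u v *\<^sub>R v) = 0"
    by (auto simp: dependent_finite)
  from u(1) obtain i where i: "i \<le> DIM('e)" "v = g i" by auto
  have "(\<Sum>k<Suc DIM('e). u (g k) *\<^sub>R g k) = 0"
    using u(3) unfolding sum.reindex[OF True] by (simp add: lessThan_Suc_atMost)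
  then show ?thesis using u(2) i by (intro exI[of _ "Suc DIM('e)"] exI[of _ "\<lambda>k. u (g k)"] conjI exI[of _ i]) auto
qed

text \<open>Over the complex numbers a root splits off a linear factor. The number of summands is
  left free above the degree because the recursion compares sums of different lengths for
  \<open>p\<close> and for the quotient \<open>q\<close>.\<close>

lemma poly_matrix_factorization:
  fixes A :: "complex ^ 'n ^ 'n" and p :: "complex poly"
  assumes "p \<noteq> 0"
  shows "\<exists>ls c. c \<noteq> 0 \<and> (\<forall>v N. degree p < N \<longrightarrow> (\<Sum>i<N. coeff p i *s (((*v) A) ^^ i) v) = c *s shift_prod A ls v)"
  using assms
proof (induction "degree p" arbitrary: p rule: less_induct)
  case less
  show ?case
  proof (cases "degree p = 0")
    case True
    then obtain c where c: "p = [:c:]" "c \<noteq> 0" using less.prems by (auto elim: degree_eq_zeroE)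
    have "(\<Sum>i<N. coeff p i *s (((*v) A) ^^ i) v) = c *s v" if "N > 0" for N v
    proof -
      have "(\<Sum>i<N. coeff p i *s (((*v) A) ^^ i) v) = (\<Sum>i\<in>{0}. coeff p i *s (((*v) A) ^^ i) v)"
        using that by (intro sum.mono_neutral_right) (auto simp: c coeff_pCons split: nat.splits)
      then show ?thesis by (simp add: c)
    qed
    then show ?thesis using c by (intro exI[of _ "[]"] exI[of _ c]) auto
  next
    case False
    have "\<not> constant (poly p)" using False by (simp add: constant_degree)
    then obtain z where z: "poly p z = 0" using fundamental_theorem_of_algebra by blast
    then obtain q where q: "p = [:- z, 1:] * q" by (auto simp: poly_eq_0_iff_dvd)
    have q0: "q \<noteq> 0" using q less.prems by auto
    have deg: "degree p = Suc (degree q)" unfolding q using q0 by (subst degree_mult_eq) auto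
    obtain ls c where c: "c \<noteq> 0" and ls: "\<And>v N. degree q < N \<Longrightarrow> (\<Sum>i<N. coeff q i *s (((*v) A) ^^ i) v) = c *s shift_prod A ls v"
      using less.hyps[of q] deg q0 by auto
    have "(\<Sum>i<N. coeff p i *s (((*v) A) ^^ i) v) = c *s shift_prod A (z # ls) v" if dN: "degree p < N" for v N
    proof -
      obtain M where M: "N = Suc M" using dN by (cases N) auto
      have dM: "degree q < M" using dN deg M by simp
      have p_eq: "p = pCons 0 q - smult z q" unfolding q by simp
      have co: "coeff p i = (case i of 0 \<Rightarrow> 0 | Suc k \<Rightarrow> coeff q k) - z * coeff q i" for i
        unfolding p_eq by (simp add: coeff_pCons)
      have "(\<Sum>i<N. coeff p i *s (((*v) A) ^^ i) v) =
          (\<Sum>i<Suc M. (case i of 0 \<Rightarrow> 0 | Suc k \<Rightarrow> coeff q k) *s (((*v) A) ^^ i) v) - z *s (\<Sum>i<Suc M. coeff q i *s (((*v) A) ^^ i) v)"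
        unfolding co M by (simp only: vector_sub_rdistrib sum_subtractf vector_smult_assoc[symmetric] vec.scale_sum_right)
      also have "(\<Sum>i<Suc M. (case i of 0 \<Rightarrow> 0 | Suc k \<Rightarrow> coeff q k) *s (((*v) A) ^^ i) v) = (\<Sum>i<M. coeff q i *s (((*v) A) ^^ i) (A *v v))"
        unfolding sum.lessThan_Suc_shift by (simp add: funpow_swap1)
      also have "\<dots> = c *s shift_prod A ls (A *v v)" by (rule ls[OF dM])
      also have "(\<Sum>i<Suc M. coeff q i *s (((*v) A) ^^ i) v) = c *s shift_prod A ls v" by (rule ls) (use dM in simp)
      finally show ?thesis
        by (simp add: shift_prod_Cons shift_prod_mult_commute vec.scale_right_diff_distrib vec.scale_left_commute del: shift_prod.simps(2))
    qed
    then show ?thesis using c by blast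
  qed
qed

text \<open>The powers of \<open>A\<close> form a sequence in a finite-dimensional real space, so
  they satisfy a nontrivial linear relation, that is, a nonzero polynomial annihilates
  \<open>A\<close>.\<close>

lemma shift_prod_annihilates:
  fixes A :: "complex ^ 'n ^ 'n"
  shows "\<exists>ls. \<forall>v. shift_prod A ls v = 0"
proof -
  define g where "g i = ((\<lambda>X. A ** X) ^^ i) (mat 1)" for i
  have g: "g i *v v = (((*v) A) ^^ i) v" for i v
    unfolding g_def by (induction i) (simp_all add: matrix_vector_mul_assoc[symmetric])
  obtain N u i0 where u: "i0 < N" "u i0 \<noteq> 0" "(\<Sum>i<N. u i *\<^sub>R g i) = 0"
    using euclidean_sequence_dependent[of g] by blast
  define p where "p = (\<Sum>i<N. monom (complex_of_real (u i)) i)"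
  have co: "coeff p i = (if i < N then complex_of_real (u i) else 0)" for i
    unfolding p_def coeff_sum by (simp add: if_distrib cong: if_cong)
  have p: "p \<noteq> 0" using co[of i0] u by auto
  have "degree p < N"
  proof -
    have "degree p \<le> N - 1" by (rule degree_le) (use u in \<open>auto simp: co\<close>)
    then show ?thesis using u by linarith
  qed
  moreover obtain ls c where "c \<noteq> 0" and ls: "\<And>v N. degree p < N \<Longrightarrow> (\<Sum>i<N. coeff p i *s (((*v) A) ^^ i) v) = c *s shift_prod A ls v"
    using poly_matrix_factorization[OF p, of A] by blast
  moreover have "(\<Sum>i<N. coeff p i *s (((*v) A) ^^ i) v) = 0" for v
  proof -
    have "(\<Sum>i<N. coeff p i *s (((*v) A) ^^ i) v) = (\<Sum>i<N. (u i *\<^sub>R g i) *v v)"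
      by (intro sum.cong refl) (simp add: co g[symmetric] vec_eq_iff matrix_vector_mult_def sum_distrib_left scaleR_conv_of_real[where 'a=complex] mult.assoc scaleR_sum_right)
    also have "\<dots> = (\<Sum>i<N. u i *\<^sub>R g i) *v v"
      by (induction N) (simp_all add: matrix_vector_mult_add_rdistrib)
    finally show ?thesis using u(3) by simp
  qed
  ultimately have "c *s shift_prod A ls v = 0" for v by metis
  then show ?thesis using \<open>c \<noteq> 0\<close> by (metis vec.scale_eq_0_iff)
qed

text \<open>A shortest annihilating list contains only eigenvalues, just as the roots of the minimal
  polynomial are eigenvalues: a factor \<open>A - l\<close> with trivial kernel could be moved
  outermost and cancelled.\<close>

lemma shift_prod_eigenvalues:
  fixes A :: "complex ^ 'n ^ 'n"
  shows "\<exists>ls. (\<forall>v. shift_prod A ls v = 0) \<and> (\<forall>l\<in>set ls. \<exists>v. v \<noteq> 0 \<and> A *v v = l *s v)"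
proof -
  define P where "P n \<longleftrightarrow> (\<exists>ls. length ls = n \<and> (\<forall>v. shift_prod A ls v = 0))" for n
  have "\<exists>n. P n" unfolding P_def using shift_prod_annihilates[of A] by blast
  then have "P (Least P)" by (rule LeastI_ex)
  then obtain ls where ls: "length ls = Least P" "\<And>v. shift_prod A ls v = 0" unfolding P_def by blast
  have "\<exists>v. v \<noteq> 0 \<and> A *v v = l *s v" if "l \<in> set ls" for l
  proof (rule ccontr)
    assume no: "\<not> ?thesis"
    from that obtain xs ys where xy: "ls = xs @ l # ys" by (auto simp: in_set_conv_decomp)
    have "shift_prod A (xs @ ys) v = 0" for v
    proof -
      have "A *v shift_prod A (xs @ ys) v - l *s shift_prod A (xs @ ys) v = 0"
        using ls(2)[of v] unfolding xy shift_prod_middle by (simp only: shift_prod_Cons)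
      then show ?thesis using no by auto
    qed
    then have "P (length (xs @ ys))" unfolding P_def by blast
    then have "Least P \<le> length (xs @ ys)" by (rule Least_le)
    then show False using ls(1) xy by simp
  qed
  then show ?thesis using ls by blast
qed

text \<open>Induction on the annihilating list replaces a Jordan form. The scalar equation
  \<open>g' = l g + h\<close> is solved first; the defect \<open>(A - l) g\<close> is then a forcing
  annihilated by the shorter list, and the two solutions add up.\<close>

lemma complex_system_solvable:
  fixes A :: "complex ^ 'n ^ 'n"
  assumes "\<And>l. l \<in> set ls \<Longrightarrow> Re l \<noteq> 0"
  shows "\<exists>C\<ge>0. \<forall>h M. continuous_on UNIV h \<longrightarrow> (\<forall>t. norm (h t) \<le> M) \<longrightarrow> (\<forall>t. shift_prod A ls (h t) = 0) \<longrightarrow>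
     (\<exists>y. (\<forall>t. (y has_vector_derivative A *v y t + h t) (at t)) \<and> (\<forall>t. norm (y t) \<le> C * M) \<and>
      ((h \<longlongrightarrow> 0) at_top \<longrightarrow> (y \<longlongrightarrow> 0) at_top) \<and> ((h \<longlongrightarrow> 0) at_bot \<longrightarrow> (y \<longlongrightarrow> 0) at_bot))"
  using assms
proof (induction ls)
  case Nil
  show ?case
  proof (intro exI[of _ 0] conjI allI impI)
    fix h :: "real \<Rightarrow> complex ^ 'n" and M
    assume "\<forall>t. shift_prod A [] (h t) = 0"
    then show "\<exists>y. (\<forall>t. (y has_vector_derivative A *v y t + h t) (at t)) \<and> (\<forall>t. norm (y t) \<le> 0 * M) \<and>
      ((h \<longlongrightarrow> 0) at_top \<longrightarrow> (y \<longlongrightarrow> 0) at_top) \<and> ((h \<longlongrightarrow> 0) at_bot \<longrightarrow> (y \<longlongrightarrow> 0) at_bot)"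
      by (intro exI[of _ "\<lambda>_. 0"]) auto
  qed simp
next
  case (Cons l ls)
  have l: "Re l \<noteq> 0" using Cons.prems by simp
  let ?B = "\<lambda>v. A *v v - l *s v"
  have B: "bounded_linear ?B"
    by (intro bounded_linear_sub bounded_linear_complex_matrix bounded_bilinear.bounded_linear_right[OF bounded_bilinear_vector_smult])
  obtain K where K: "K \<ge> 0" "\<And>v. norm (?B v) \<le> norm v * K" using bounded_linear.nonneg_bounded[OF B] by blast
  obtain C where C: "C \<ge> 0" and sol: "\<And>h M. continuous_on UNIV h \<Longrightarrow> (\<forall>t. norm (h t) \<le> M) \<Longrightarrow> (\<forall>t. shift_prod A ls (h t) = 0) \<Longrightarrow>
     (\<exists>y. (\<forall>t. (y has_vector_derivative A *v y t + h t) (at t)) \<and> (\<forall>t. norm (y t) \<le> C * M) \<and>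
      ((h \<longlongrightarrow> 0) at_top \<longrightarrow> (y \<longlongrightarrow> 0) at_top) \<and> ((h \<longlongrightarrow> 0) at_bot \<longrightarrow> (y \<longlongrightarrow> 0) at_bot))"
    using Cons.IH Cons.prems by auto
  let ?C = "(1 + C * K) / \<bar>Re l\<bar>"
  show ?case
  proof (intro exI[of _ ?C] conjI allI impI)
    show "?C \<ge> 0" using C K by simp
    fix h :: "real \<Rightarrow> complex ^ 'n" and M
    assume h: "continuous_on UNIV h" "\<forall>t. norm (h t) \<le> M" and h0: "\<forall>t. shift_prod A (l # ls) (h t) = 0"
    obtain g where g: "\<And>t. (g has_vector_derivative l *s g t + h t) (at t)" "\<And>t. norm (g t) \<le> M / \<bar>Re l\<bar>"
      "(h \<longlongrightarrow> 0) at_top \<Longrightarrow> (g \<longlongrightarrow> 0) at_top" "(h \<longlongrightarrow> 0) at_bot \<Longrightarrow> (g \<longlongrightarrow> 0) at_bot"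
      using scalar_equation[OF l h(1) h(2)[rule_format]] by auto
    have gc: "continuous_on UNIV g"
      by (rule continuous_at_imp_continuous_on) (auto intro: has_vector_derivative_continuous g(1))
    let ?k = "\<lambda>t. ?B (g t)"
    have k1: "continuous_on UNIV ?k" by (rule bounded_linear.continuous_on[OF B gc])
    have k2: "\<forall>t. norm (?k t) \<le> K * (M / \<bar>Re l\<bar>)"
    proof
      fix t show "norm (?k t) \<le> K * (M / \<bar>Re l\<bar>)"
        using K(2)[of "g t"] mult_left_mono[OF g(2)[of t] K(1)] by (simp add: mult.commute)
    qed
    have k3: "\<forall>t. shift_prod A ls (?k t) = 0"
    proof
      fix t
      let ?w = "\<lambda>t. shift_prod A (l # ls) (g t)"
      obtain N where N: "\<And>v. norm (shift_prod A (l # ls) v) \<le> norm v * N" "N \<ge> 0"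
        using bounded_linear.nonneg_bounded[OF shift_prod_linear(1)] by metis
      \<comment> \<open>The full product applied to \<open>g\<close> solves the homogeneous scalar
        equation, because \<open>h\<close> is annihilated, and it is bounded; hence it
        vanishes.\<close>
      have "?w t = 0"
      proof (rule scalar_equation_unique_0[OF l])
        fix t
        have "(?w has_vector_derivative shift_prod A (l # ls) (l *s g t + h t)) (at t)"
          by (rule bounded_linear.has_vector_derivative[OF shift_prod_linear(1) g(1)])
        moreover have "shift_prod A (l # ls) (l *s g t + h t) = l *s ?w t"
          using h0 by (simp only: linear_add[OF bounded_linear.linear[OF shift_prod_linear(1)]] shift_prod_linear(2)) simp
        ultimately show "(?w has_vector_derivative l *s ?w t) (at t)" by (rule has_vector_derivative_eq_rhs)
        show "norm (?w t) \<le> (M / \<bar>Re l\<bar>) * N"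
          using N(1)[of "g t"] mult_right_mono[OF g(2)[of t] N(2)] by linarith
      qed
      then show "shift_prod A ls (?k t) = 0" by simp
    qed
    obtain y where y: "\<And>t. (y has_vector_derivative A *v y t + ?k t) (at t)" "\<And>t. norm (y t) \<le> C * (K * (M / \<bar>Re l\<bar>))"
      "(?k \<longlongrightarrow> 0) at_top \<Longrightarrow> (y \<longlongrightarrow> 0) at_top" "(?k \<longlongrightarrow> 0) at_bot \<Longrightarrow> (y \<longlongrightarrow> 0) at_bot"
      using sol[OF k1 k2 k3] by auto
    have B0: "(?k \<longlongrightarrow> 0) F" if "(g \<longlongrightarrow> 0) F" for F
      using bounded_linear.tendsto[OF B that] by simp
    show "\<exists>y. (\<forall>t. (y has_vector_derivative A *v y t + h t) (at t)) \<and> (\<forall>t. norm (y t) \<le> ?C * M) \<and>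
      ((h \<longlongrightarrow> 0) at_top \<longrightarrow> (y \<longlongrightarrow> 0) at_top) \<and> ((h \<longlongrightarrow> 0) at_bot \<longrightarrow> (y \<longlongrightarrow> 0) at_bot)"
    proof (intro exI[of _ "\<lambda>t. g t + y t"] conjI allI impI)
      fix t
      show "((\<lambda>t. g t + y t) has_vector_derivative A *v (g t + y t) + h t) (at t)"
        by (rule has_vector_derivative_eq_rhs[OF has_vector_derivative_add[OF g(1) y(1)]])
          (simp add: matrix_vector_right_distrib)
      have "norm (g t + y t) \<le> M / \<bar>Re l\<bar> + C * (K * (M / \<bar>Re l\<bar>))"
        using norm_triangle_ineq[of "g t" "y t"] g(2)[of t] y(2)[of t] by linarith
      also have "\<dots> = ?C * M" by (simp add: algebra_simps add_divide_distrib)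
      finally show "norm (g t + y t) \<le> ?C * M" .
    next
      assume "(h \<longlongrightarrow> 0) at_top" then show "((\<lambda>t. g t + y t) \<longlongrightarrow> 0) at_top"
        using tendsto_add[OF g(3) y(3)[OF B0[OF g(3)]]] by simp
    next
      assume "(h \<longlongrightarrow> 0) at_bot" then show "((\<lambda>t. g t + y t) \<longlongrightarrow> 0) at_bot"
        using tendsto_add[OF g(4) y(4)[OF B0[OF g(4)]]] by simp
    qed
  qed
qed

text \<open>The function \<open>(A - l) y\<close> solves the same system and is annihilated by the
  shorter list. By induction it is 0, so \<open>y\<close> solves a homogeneous scalar
  equation.\<close>

lemma complex_system_unique_0:
  fixes A :: "complex ^ 'n ^ 'n"
  assumes "\<And>l. l \<in> set ls \<Longrightarrow> Re l \<noteq> 0"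
    and "\<And>t. (y has_vector_derivative A *v y t) (at t)" "\<And>t. norm (y t) \<le> M" "\<And>t. shift_prod A ls (y t) = 0"
  shows "y t = 0"
  using assms
proof (induction ls arbitrary: y M t)
  case (Cons l ls)
  let ?B = "\<lambda>v. A *v v - l *s v"
  have B: "bounded_linear ?B"
    by (intro bounded_linear_sub bounded_linear_complex_matrix bounded_bilinear.bounded_linear_right[OF bounded_bilinear_vector_smult])
  obtain K where K: "K \<ge> 0" "\<And>v. norm (?B v) \<le> norm v * K" using bounded_linear.nonneg_bounded[OF B] by blast
  have "?B (y t) = 0" for t
  proof (rule Cons.IH)
    show "((\<lambda>t. ?B (y t)) has_vector_derivative A *v ?B (y t)) (at t)" for t
      by (rule has_vector_derivative_eq_rhs[OF bounded_linear.has_vector_derivative[OF B Cons.prems(2)]])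
        (simp add: matrix_vector_mult_diff_distrib matrix_vector_smult)
    show "norm (?B (y t)) \<le> M * K" for t
      using K(2)[of "y t"] mult_right_mono[OF Cons.prems(3)[of t] K(1)] by linarith
    show "shift_prod A ls (?B (y t)) = 0" for t using Cons.prems(4)[of t] by simp
  qed (use Cons.prems in auto)
  then have "A *v y t = l *s y t" for t by simp
  then have "(y has_vector_derivative l *s y t) (at t)" for t using Cons.prems(2)[of t] by simp
  then show ?case by (rule scalar_equation_unique_0[rotated]) (use Cons.prems in auto)
qed simp

text \<open>
  The second conjunct, uniqueness of bounded solutions, is what turns the solvability estimate into
  a bounded linear Green operator. Unlike an exponential dichotomy this property is stable under small
  perturbations by a Neumann series alone.
\<close>

definition boundedly_solvable :: "(real \<Rightarrow> real ^ 'n ^ 'n) \<Rightarrow> real \<Rightarrow> bool" where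
  "boundedly_solvable A C \<longleftrightarrow>
     (\<forall>h M. continuous_on UNIV h \<longrightarrow> (\<forall>t. norm (h t) \<le> M) \<longrightarrow>
       (\<exists>y. (\<forall>t. (y has_vector_derivative A t *v y t + h t) (at t)) \<and> (\<forall>t. norm (y t) \<le> C * M) \<and>
         ((h \<longlongrightarrow> 0) at_top \<longrightarrow> (y \<longlongrightarrow> 0) at_top) \<and> ((h \<longlongrightarrow> 0) at_bot \<longrightarrow> (y \<longlongrightarrow> 0) at_bot))) \<and>
     (\<forall>y M. (\<forall>t. (y has_vector_derivative A t *v y t) (at t)) \<longrightarrow> (\<forall>t. norm (y t) \<le> M) \<longrightarrow> (\<forall>t. y t = 0))"

text \<open>The eigenvalues are complex, so the system is solved after complexification; since
  \<open>A\<close> is real, taking real parts commutes with it, and it does not increase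
  norms.\<close>

lemma hyperbolic_boundedly_solvable:
  fixes A :: "real ^ 'n ^ 'n"
  assumes hyp: "\<And>l. complex_eigenvalue A l \<Longrightarrow> Re l \<noteq> 0"
  shows "\<exists>C\<ge>0. boundedly_solvable (\<lambda>_. A) C"
proof -
  let ?A = "map_matrix complex_of_real A"
  define c where "c v = (\<chi> i. complex_of_real (v $ i))" for v :: "real ^ 'n"
  define r where "r v = (\<chi> i. Re (v $ i))" for v :: "complex ^ 'n"
  have normc: "norm (c v) = norm v" for v by (simp add: c_def norm_vec_def)
  have normr: "norm (r v) \<le> norm v" for v
    unfolding r_def norm_vec_def by (intro L2_set_mono) (auto simp: abs_Re_le_cmod)
  have c: "bounded_linear c"
    by (rule bounded_linear_intro[where K=1]) (auto simp: c_def[abs_def] vec_eq_iff scaleR_conv_of_real[where 'a=complex] simp flip: normc)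
  have r: "bounded_linear r"
    by (rule bounded_linear_intro[where K=1]) (use normr in \<open>auto simp: r_def[abs_def] vec_eq_iff\<close>)
  have rA: "r (?A *v v) = A *v r v" for v by (simp add: r_def vec_eq_iff matrix_vector_mult_def map_matrix_def)
  have cA: "c (A *v v) = ?A *v c v" for v by (simp add: c_def vec_eq_iff matrix_vector_mult_def map_matrix_def)
  have rc: "r (c v) = v" for v by (simp add: r_def c_def vec_eq_iff)
  obtain ls where ls: "\<And>v. shift_prod ?A ls v = 0" "\<And>l. l \<in> set ls \<Longrightarrow> \<exists>v. v \<noteq> 0 \<and> ?A *v v = l *s v"
    using shift_prod_eigenvalues[of ?A] by blast
  have ls': "Re l \<noteq> 0" if "l \<in> set ls" for l using hyp ls(2)[OF that] unfolding complex_eigenvalue_def by blast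
  obtain C where C: "C \<ge> 0" and sol: "\<And>h M. continuous_on UNIV h \<Longrightarrow> (\<forall>t. norm (h t) \<le> M) \<Longrightarrow> (\<forall>t. shift_prod ?A ls (h t) = 0) \<Longrightarrow>
     (\<exists>y. (\<forall>t. (y has_vector_derivative ?A *v y t + h t) (at t)) \<and> (\<forall>t. norm (y t) \<le> C * M) \<and>
      ((h \<longlongrightarrow> 0) at_top \<longrightarrow> (y \<longlongrightarrow> 0) at_top) \<and> ((h \<longlongrightarrow> 0) at_bot \<longrightarrow> (y \<longlongrightarrow> 0) at_bot))"
    using complex_system_solvable[of ls ?A] ls' by blast
  have "boundedly_solvable (\<lambda>_. A) C"
    unfolding boundedly_solvable_def
  proof (rule conjI; intro allI impI)
    fix h :: "real \<Rightarrow> real ^ 'n" and M assume h: "continuous_on UNIV h" "\<forall>t. norm (h t) \<le> M"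
    have "continuous_on UNIV (\<lambda>t. c (h t))" by (rule bounded_linear.continuous_on[OF c h(1)])
    moreover have "\<forall>t. norm (c (h t)) \<le> M" using h by (simp add: normc)
    ultimately obtain y where y: "\<And>t. (y has_vector_derivative ?A *v y t + c (h t)) (at t)" "\<And>t. norm (y t) \<le> C * M"
      "((\<lambda>t. c (h t)) \<longlongrightarrow> 0) at_top \<Longrightarrow> (y \<longlongrightarrow> 0) at_top" "((\<lambda>t. c (h t)) \<longlongrightarrow> 0) at_bot \<Longrightarrow> (y \<longlongrightarrow> 0) at_bot"
      using sol[of "\<lambda>t. c (h t)" M] ls(1) by auto
    have c0: "((\<lambda>t. c (h t)) \<longlongrightarrow> 0) F" if "(h \<longlongrightarrow> 0) F" for F using bounded_linear.tendsto_zero[OF c that] .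
    show "\<exists>y. (\<forall>t. (y has_vector_derivative A *v y t + h t) (at t)) \<and> (\<forall>t. norm (y t) \<le> C * M) \<and>
         ((h \<longlongrightarrow> 0) at_top \<longrightarrow> (y \<longlongrightarrow> 0) at_top) \<and> ((h \<longlongrightarrow> 0) at_bot \<longrightarrow> (y \<longlongrightarrow> 0) at_bot)"
    proof (intro exI[of _ "\<lambda>t. r (y t)"] conjI allI impI)
      fix t
      show "((\<lambda>t. r (y t)) has_vector_derivative A *v r (y t) + h t) (at t)"
        by (rule has_vector_derivative_eq_rhs[OF bounded_linear.has_vector_derivative[OF r y(1)]])
          (simp add: linear_add[OF bounded_linear.linear[OF r]] rA rc)
      show "norm (r (y t)) \<le> C * M" using normr y(2) by (rule order_trans)
    next
      assume "(h \<longlongrightarrow> 0) at_top" then show "((\<lambda>t. r (y t)) \<longlongrightarrow> 0) at_top"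
        by (intro bounded_linear.tendsto_zero[OF r] y c0)
    next
      assume "(h \<longlongrightarrow> 0) at_bot" then show "((\<lambda>t. r (y t)) \<longlongrightarrow> 0) at_bot"
        by (intro bounded_linear.tendsto_zero[OF r] y c0)
    qed
  next
    fix y :: "real \<Rightarrow> real ^ 'n" and M t
    assume y: "\<forall>t. (y has_vector_derivative A *v y t) (at t)" "\<forall>t. norm (y t) \<le> M"
    have "c (y t) = 0"
    proof (rule complex_system_unique_0[OF ls'])
      show "((\<lambda>t. c (y t)) has_vector_derivative ?A *v c (y t)) (at t)" for t
        using bounded_linear.has_vector_derivative[OF c y(1)[rule_format]] by (simp add: cA)
      show "norm (c (y t)) \<le> M" for t using y by (simp add: normc)
    qed (auto simp: ls)
    then show "y t = 0" using normc[of "y t"] by simp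
  qed
  then show ?thesis using C by blast
qed

section \<open>Perturbation of uniformly solvable systems\<close>

lemma apply_Bcontfun:
  assumes "continuous_on UNIV f" "\<And>x. norm (f x) \<le> b"
  shows "apply_bcontfun (Bcontfun f) = f"
  by (rule Bcontfun_inverse) (rule bcontfun_normI[OF assms])

lemma closed_bcontfun_tendsto_0:
  fixes F :: "'a::topological_space filter"
  shows "closed {u :: 'a \<Rightarrow>\<^sub>C 'b::real_normed_vector. (apply_bcontfun u \<longlongrightarrow> 0) F}"
  unfolding closed_sequential_limits
proof (intro allI impI, elim conjE)
  fix x :: "nat \<Rightarrow> 'a \<Rightarrow>\<^sub>C 'b" and l
  assume x: "\<forall>n. x n \<in> {u. (apply_bcontfun u \<longlongrightarrow> 0) F}" and l: "x \<longlonglongrightarrow> l"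
  have "(apply_bcontfun l \<longlongrightarrow> 0) F"
  proof (rule tendstoI)
    fix e :: real assume e: "e > 0"
    have "\<forall>\<^sub>F n in sequentially. dist (x n) l < e / 2" using l e by (intro tendstoD) auto
    then obtain n where n: "dist (x n) l < e / 2" by (auto simp: eventually_sequentially)
    have "\<forall>\<^sub>F t in F. dist (x n t) 0 < e / 2" using x e by (intro tendstoD) auto
    then show "\<forall>\<^sub>F t in F. dist (l t) 0 < e"
    proof eventually_elim
      case (elim t)
      have "dist (x n t) (l t) \<le> dist (x n) l" by (rule dist_bounded)
      then have "dist (x n t) (l t) < e / 2" using n by simp
      then show ?case using elim by (rule dist_triangle_half_r)
    qed
  qed
  then show "l \<in> {u. (apply_bcontfun u \<longlongrightarrow> 0) F}" by simp
qed

lemma bounded_bilinear_matrix_vector_mult: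
  "bounded_bilinear ((*v) :: real ^ 'n ^ 'm \<Rightarrow> real ^ 'n \<Rightarrow> real ^ 'm)"
proof -
  have "bilinear ((*v) :: real ^ 'n ^ 'm \<Rightarrow> real ^ 'n \<Rightarrow> real ^ 'm)"
    unfolding bilinear_def
    by (auto intro!: linearI simp: matrix_vector_right_distrib matrix_vector_mult_add_rdistrib
         vec_eq_iff matrix_vector_mult_def sum_distrib_left sum.distrib algebra_simps)
  then show ?thesis by (simp add: bilinear_conv_bounded_bilinear)
qed

lemma bounded_bilinear_matrix_matrix_mult:
  "bounded_bilinear ((**) :: real ^ 'n ^ 'm \<Rightarrow> real ^ 'p ^ 'n \<Rightarrow> real ^ 'p ^ 'm)"
proof -
  have "bilinear ((**) :: real ^ 'n ^ 'm \<Rightarrow> real ^ 'p ^ 'n \<Rightarrow> real ^ 'p ^ 'm)"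
    unfolding bilinear_def
    by (auto intro!: linearI simp: vec_eq_iff matrix_matrix_mult_def sum_distrib_left algebra_simps sum.distrib)
  then show ?thesis by (simp add: bilinear_conv_bounded_bilinear)
qed

lemmas continuous_on_matrix_vector_mult = bounded_bilinear.continuous_on[OF bounded_bilinear_matrix_vector_mult]

lemma has_vector_derivative_imp_continuous_on:
  "(\<And>t. (y has_vector_derivative y' t) (at t)) \<Longrightarrow> continuous_on S y"
  by (rule continuous_at_imp_continuous_on) (auto intro: has_vector_derivative_continuous)

lemma boundedly_solvable_operator:
  fixes A :: "real \<Rightarrow> real ^ 'n ^ 'n"
  assumes A: "boundedly_solvable A C" and C: "C \<ge> 0"
  obtains G :: "(real \<Rightarrow>\<^sub>C (real ^ 'n)) \<Rightarrow> (real \<Rightarrow>\<^sub>C (real ^ 'n))" where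
    "bounded_linear G" "\<And>h. norm (G h) \<le> C * norm h"
    "\<And>h t. (apply_bcontfun (G h) has_vector_derivative A t *v apply_bcontfun (G h) t + apply_bcontfun h t) (at t)"
    "\<And>h. (apply_bcontfun h \<longlongrightarrow> 0) at_top \<Longrightarrow> (apply_bcontfun (G h) \<longlongrightarrow> 0) at_top"
    "\<And>h. (apply_bcontfun h \<longlongrightarrow> 0) at_bot \<Longrightarrow> (apply_bcontfun (G h) \<longlongrightarrow> 0) at_bot"
    "\<And>h y M. (\<And>t. (y has_vector_derivative A t *v y t + apply_bcontfun h t) (at t)) \<Longrightarrow> (\<And>t. norm (y t) \<le> M) \<Longrightarrow> y = G h"
proof -
  have ex: "\<exists>u :: real \<Rightarrow>\<^sub>C (real ^ 'n). (\<forall>t. (apply_bcontfun u has_vector_derivative A t *v u t + h t) (at t)) \<and> norm u \<le> C * norm h \<and>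
      ((apply_bcontfun h \<longlongrightarrow> 0) at_top \<longrightarrow> (apply_bcontfun u \<longlongrightarrow> 0) at_top) \<and> ((apply_bcontfun h \<longlongrightarrow> 0) at_bot \<longrightarrow> (apply_bcontfun u \<longlongrightarrow> 0) at_bot)" for h :: "real \<Rightarrow>\<^sub>C (real ^ 'n)"
  proof -
    have "continuous_on UNIV (apply_bcontfun h)" "\<forall>t. norm (h t) \<le> norm h" by (auto simp: norm_bounded)
    then obtain y where y: "\<forall>t. (y has_vector_derivative A t *v y t + h t) (at t)" "\<forall>t. norm (y t) \<le> C * norm h"
       "((apply_bcontfun h \<longlongrightarrow> 0) at_top \<longrightarrow> (y \<longlongrightarrow> 0) at_top)" "((apply_bcontfun h \<longlongrightarrow> 0) at_bot \<longrightarrow> (y \<longlongrightarrow> 0) at_bot)"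
      using A unfolding boundedly_solvable_def by blast
    have "continuous_on UNIV y" using y(1) by (intro has_vector_derivative_imp_continuous_on) auto
    then have ap: "apply_bcontfun (Bcontfun y) = y" using y(2) by (intro apply_Bcontfun) auto
    show ?thesis using y by (intro exI[of _ "Bcontfun y"]) (auto simp: ap intro: norm_bound)
  qed
  define G where "G h = (SOME u :: real \<Rightarrow>\<^sub>C (real ^ 'n). (\<forall>t. (apply_bcontfun u has_vector_derivative A t *v u t + h t) (at t)) \<and> norm u \<le> C * norm h \<and>
      ((apply_bcontfun h \<longlongrightarrow> 0) at_top \<longrightarrow> (apply_bcontfun u \<longlongrightarrow> 0) at_top) \<and> ((apply_bcontfun h \<longlongrightarrow> 0) at_bot \<longrightarrow> (apply_bcontfun u \<longlongrightarrow> 0) at_bot))" for h :: "real \<Rightarrow>\<^sub>C (real ^ 'n)"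
  have G: "(apply_bcontfun (G h) has_vector_derivative A t *v apply_bcontfun (G h) t + apply_bcontfun h t) (at t)" "norm (G h) \<le> C * norm h"
    "(apply_bcontfun h \<longlongrightarrow> 0) at_top \<Longrightarrow> (apply_bcontfun (G h) \<longlongrightarrow> 0) at_top" "(apply_bcontfun h \<longlongrightarrow> 0) at_bot \<Longrightarrow> (apply_bcontfun (G h) \<longlongrightarrow> 0) at_bot" for h t
    using someI_ex[OF ex[of h]] unfolding G_def[symmetric] by auto
  have un: "y = G h" if y: "\<And>t. (y has_vector_derivative A t *v y t + apply_bcontfun h t) (at t)" "\<And>t. norm (y t) \<le> M" for h y M
  proof
    fix t
    have "\<forall>t. ((\<lambda>t. y t - G h t) has_vector_derivative A t *v (y t - G h t)) (at t)"
    proof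
      fix t
      show "((\<lambda>t. y t - G h t) has_vector_derivative A t *v (y t - G h t)) (at t)"
        by (rule has_vector_derivative_eq_rhs[OF has_vector_derivative_diff[OF y(1) G(1)]])
          (simp add: matrix_vector_mult_diff_distrib)
    qed
    moreover have "\<forall>t. norm (y t - G h t) \<le> M + norm (G h)"
      using y(2) by (auto intro!: norm_triangle_le_diff add_mono norm_bounded)
    ultimately have "\<forall>t. y t - G h t = 0" using A unfolding boundedly_solvable_def by blast
    then show "y t = G h t" by simp
  qed
  have "bounded_linear G"
  proof (rule bounded_linear_intro[where K=C])
    fix h k :: "real \<Rightarrow>\<^sub>C (real ^ 'n)" and r :: real
    have "apply_bcontfun (G h + G k) = G (h + k)"
    proof (rule un)
      fix t
      show "(apply_bcontfun (G h + G k) has_vector_derivative A t *v (G h + G k) t + (h + k) t) (at t)"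
        using has_vector_derivative_add[OF G(1)[of h t] G(1)[of k t]]
        by (simp add: matrix_vector_right_distrib add_ac plus_bcontfun.rep_eq[abs_def])
      show "norm ((G h + G k) t) \<le> norm (G h + G k)" by (rule norm_bounded)
    qed
    then show "G (h + k) = G h + G k" by (simp only: apply_bcontfun_inject)
    have "apply_bcontfun (r *\<^sub>R G h) = G (r *\<^sub>R h)"
    proof (rule un)
      fix t
      show "(apply_bcontfun (r *\<^sub>R G h) has_vector_derivative A t *v (r *\<^sub>R G h) t + (r *\<^sub>R h) t) (at t)"
        using bounded_linear.has_vector_derivative[OF bounded_linear_scaleR_right G(1)[of h t], of r]
        by (simp add: scaleR_add_right matrix_vector_mult_scaleR scaleR_bcontfun.rep_eq[abs_def])
      show "norm ((r *\<^sub>R G h) t) \<le> norm (r *\<^sub>R G h)" by (rule norm_bounded)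
    qed
    then show "G (r *\<^sub>R h) = r *\<^sub>R G h" by (simp only: apply_bcontfun_inject)
    show "norm (G h) \<le> norm h * C" using G(2)[of h] by (simp add: mult.commute)
  qed
  with that G un show ?thesis by blast
qed

text \<open>A bounded function solves the system with \<open>B\<close> when it is a fixed point of
  \<open>u \<mapsto> G (h + (B - A) u)\<close>, a contraction with factor \<open>1/2\<close>. The
  new constant comes from \<open>norm u \<le> C * M + norm u / 2\<close>.\<close>

lemma boundedly_solvable_perturb:
  fixes A B :: "real \<Rightarrow> real ^ 'n ^ 'n"
  assumes A: "boundedly_solvable A C" and C: "C \<ge> 0" and c: "continuous_on UNIV (\<lambda>t. B t - A t)"
    and \<epsilon>: "\<And>t v. norm ((B t - A t) *v v) \<le> \<epsilon> * norm v" "C * \<epsilon> \<le> 1/2" "\<epsilon> \<ge> 0"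
  shows "boundedly_solvable B (2 * C)"
proof -
  obtain G :: "(real \<Rightarrow>\<^sub>C (real ^ 'n)) \<Rightarrow> (real \<Rightarrow>\<^sub>C (real ^ 'n))" where
    G: "bounded_linear G" "\<And>h. norm (G h) \<le> C * norm h"
    "\<And>h t. (apply_bcontfun (G h) has_vector_derivative A t *v apply_bcontfun (G h) t + apply_bcontfun h t) (at t)"
    "\<And>h. (apply_bcontfun h \<longlongrightarrow> 0) at_top \<Longrightarrow> (apply_bcontfun (G h) \<longlongrightarrow> 0) at_top"
    "\<And>h. (apply_bcontfun h \<longlongrightarrow> 0) at_bot \<Longrightarrow> (apply_bcontfun (G h) \<longlongrightarrow> 0) at_bot" and
    Gun: "\<And>h y M. (\<And>t. (y has_vector_derivative A t *v y t + apply_bcontfun h t) (at t)) \<Longrightarrow> (\<And>t. norm (y t) \<le> M) \<Longrightarrow> y = G h"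
    using boundedly_solvable_operator[OF A C] by metis
  define mul where "mul u = Bcontfun (\<lambda>t. (B t - A t) *v apply_bcontfun u t)" for u
  have mul: "apply_bcontfun (mul u) = (\<lambda>t. (B t - A t) *v u t)" for u
    unfolding mul_def
  proof (rule apply_Bcontfun)
    show "continuous_on UNIV (\<lambda>t. (B t - A t) *v u t)" by (intro continuous_on_matrix_vector_mult c) simp
    show "norm ((B t - A t) *v u t) \<le> \<epsilon> * norm u" for t
      using \<epsilon>(1)[of t "u t"] mult_left_mono[OF norm_bounded[of u t] \<epsilon>(3)] by simp
  qed
  have mul_norm: "norm (mul u) \<le> \<epsilon> * norm u" for u
  proof (rule norm_bound)
    show "norm (mul u t) \<le> \<epsilon> * norm u" for t
      unfolding mul using \<epsilon>(1)[of t "u t"] mult_left_mono[OF norm_bounded[of u t] \<epsilon>(3)] by simp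
  qed
  have mul_diff: "mul u - mul v = mul (u - v)" for u v
    by (rule bcontfun_eqI) (simp add: mul matrix_vector_mult_diff_distrib)
  have G_diff: "G u - G v = G (u - v)" for u v using linear_diff[OF bounded_linear.linear[OF G(1)]] by simp
  have mul0: "(apply_bcontfun (mul u) \<longlongrightarrow> 0) F" if "(apply_bcontfun u \<longlongrightarrow> 0) F" for u and F :: "real filter"
  proof (rule Lim_null_comparison)
    show "\<forall>\<^sub>F t in F. norm (mul u t) \<le> \<epsilon> * norm (u t)" unfolding mul using \<epsilon>(1) by simp
    show "((\<lambda>t. \<epsilon> * norm (u t)) \<longlongrightarrow> 0) F"
      using tendsto_mult_right_zero[OF tendsto_norm_zero[OF that]] .
  qed
  show ?thesis unfolding boundedly_solvable_def
  proof (rule conjI; intro allI impI)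
    fix h0 :: "real \<Rightarrow> real ^ 'n" and M assume h0: "continuous_on UNIV h0" "\<forall>t. norm (h0 t) \<le> M"
    define h where "h = Bcontfun h0"
    have h: "apply_bcontfun h = h0" unfolding h_def using h0 by (intro apply_Bcontfun) auto
    have hM: "norm h \<le> M" using h0 h by (intro norm_bound) auto
    \<comment> \<open>The contraction is run in the closed subspace prescribed by the decay of
      \<open>h0\<close>, so the fixed point inherits whatever decay the forcing has.\<close>
    define V :: "(real \<Rightarrow>\<^sub>C (real ^ 'n)) set" where
      "V = (if (h0 \<longlongrightarrow> 0) at_top then {u. (apply_bcontfun u \<longlongrightarrow> 0) at_top} else UNIV) \<inter>
           (if (h0 \<longlongrightarrow> 0) at_bot then {u. (apply_bcontfun u \<longlongrightarrow> 0) at_bot} else UNIV)"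
    have "closed V" unfolding V_def by (auto intro!: closed_Int closed_bcontfun_tendsto_0)
    moreover have "0 \<in> V" unfolding V_def by (auto simp: zero_bcontfun.rep_eq[abs_def])
    moreover have "G (h + mul u) \<in> V" if "u \<in> V" for u
    proof -
      have "(apply_bcontfun (h + mul u) \<longlongrightarrow> 0) F" if "(h0 \<longlongrightarrow> 0) F" "(apply_bcontfun u \<longlongrightarrow> 0) F" for F
        using tendsto_add[OF that(1) mul0[OF that(2)]] by (simp add: plus_bcontfun.rep_eq[abs_def] h)
      then show ?thesis using that G(4,5) unfolding V_def by (auto split: if_splits)
    qed
    moreover have "dist (G (h + mul u)) (G (h + mul v)) \<le> 1/2 * dist u v" for u v
    proof -
      have "dist (G (h + mul u)) (G (h + mul v)) = norm (G (mul (u - v)))"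
        by (simp add: dist_norm G_diff mul_diff)
      also have "\<dots> \<le> C * (\<epsilon> * norm (u - v))" using G(2) mult_left_mono[OF mul_norm C] by (rule order_trans)
      also have "\<dots> \<le> 1/2 * norm (u - v)" using mult_right_mono[OF \<epsilon>(2) norm_ge_zero[of "u - v"]] by (simp add: mult.assoc)
      finally show ?thesis by (simp add: dist_norm)
    qed
    ultimately obtain u where u: "u \<in> V" "G (h + mul u) = u"
      using Banach_fix[of V "1/2" "\<lambda>u. G (h + mul u)"] by (auto simp: complete_eq_closed)
    have "norm u \<le> 2 * C * M"
    proof -
      have "norm u \<le> C * norm (h + mul u)" using G(2)[of "h + mul u"] u(2) by simp
      also have "\<dots> \<le> C * (M + \<epsilon> * norm u)"
        using hM mul_norm[of u] norm_triangle_ineq[of h "mul u"] C by (intro mult_left_mono) auto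
      also have "\<dots> \<le> C * M + 1/2 * norm u" using mult_right_mono[OF \<epsilon>(2) norm_ge_zero[of u]] by (simp add: algebra_simps)
      finally show ?thesis by simp
    qed
    then have "norm (u t) \<le> 2 * C * M" for t using norm_bounded[of u t] by simp
    moreover have "(apply_bcontfun u has_vector_derivative B t *v u t + h0 t) (at t)" for t
      using G(3)[of "h + mul u" t] unfolding u(2)
      by (simp add: mul h algebra_simps matrix_vector_mult_diff_rdistrib)
    ultimately show "\<exists>y. (\<forall>t. (y has_vector_derivative B t *v y t + h0 t) (at t)) \<and> (\<forall>t. norm (y t) \<le> 2 * C * M) \<and>
         ((h0 \<longlongrightarrow> 0) at_top \<longrightarrow> (y \<longlongrightarrow> 0) at_top) \<and> ((h0 \<longlongrightarrow> 0) at_bot \<longrightarrow> (y \<longlongrightarrow> 0) at_bot)"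
      using u(1) unfolding V_def by (intro exI[of _ "apply_bcontfun u"]) (auto split: if_splits)
  next
    fix y :: "real \<Rightarrow> real ^ 'n" and M t
    assume y: "\<forall>t. (y has_vector_derivative B t *v y t) (at t)" "\<forall>t. norm (y t) \<le> M"
    define u where "u = Bcontfun y"
    have u: "apply_bcontfun u = y" unfolding u_def
      by (rule apply_Bcontfun[OF has_vector_derivative_imp_continuous_on]) (use y in auto)
    have "y = G (mul u)"
    proof (rule Gun)
      fix t show "(y has_vector_derivative A t *v y t + mul u t) (at t)"
        using y(1) by (simp add: mul u matrix_vector_mult_diff_rdistrib)
    qed (use y in auto)
    then have "u = G (mul u)" using u by (simp add: apply_bcontfun_inject[symmetric])
    then have "norm u \<le> C * norm (mul u)" using G(2)[of "mul u"] by simp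
    also have "\<dots> \<le> C * (\<epsilon> * norm u)" using mul_norm C by (intro mult_left_mono)
    also have "\<dots> \<le> 1/2 * norm u" using mult_right_mono[OF \<epsilon>(2) norm_ge_zero[of u]] by (simp add: mult.assoc)
    finally have "u = 0" by simp
    then show "y t = 0" using u by (metis zero_bcontfun.rep_eq)
  qed
qed

text \<open>Closeness to \<open>A0\<close> is known only near both ends, so inside a large interval
  \<open>A\<close> is blended into \<open>A0\<close>. The blend stays within the tolerance of
  \<open>A0\<close> for all times and is covered by the perturbation result. The bound
  \<open>T0\<close> lets given compact supports fit inside the modified interval.\<close>

lemma asymptotically_hyperbolic_cutoff:
  fixes A :: "real \<Rightarrow> real ^ 'n ^ 'n"
  assumes A0: "\<And>l. complex_eigenvalue A0 l \<Longrightarrow> Re l \<noteq> 0"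
    and A: "continuous_on UNIV A" "(A \<longlongrightarrow> A0) at_top" "(A \<longlongrightarrow> A0) at_bot"
  obtains B C T where "C \<ge> 0" "boundedly_solvable B C" "continuous_on UNIV B" "T > 0" "T \<ge> T0" "\<And>t. \<bar>t\<bar> \<ge> T \<Longrightarrow> B t = A t"
proof -
  obtain C where C: "C \<ge> 0" "boundedly_solvable (\<lambda>_. A0) C" using hyperbolic_boundedly_solvable[OF A0] by auto
  obtain K where K: "K > 0" "\<And>M v. norm ((M :: real ^ 'n ^ 'n) *v v) \<le> norm M * norm v * K"
    using bounded_bilinear.pos_bounded[OF bounded_bilinear_matrix_vector_mult] by metis
  define \<epsilon> where "\<epsilon> = 1 / (2 * (C + 1))"
  have \<epsilon>: "\<epsilon> > 0" "C * \<epsilon> \<le> 1/2" using C by (auto simp: \<epsilon>_def field_simps)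
  have "\<forall>\<^sub>F t in at_top. dist (A t) A0 < \<epsilon> / K" "\<forall>\<^sub>F t in at_bot. dist (A t) A0 < \<epsilon> / K"
    using A(2,3) \<epsilon> K by (auto intro!: tendstoD)
  then obtain R1 R2 where R12: "\<And>t. t \<ge> R1 \<Longrightarrow> dist (A t) A0 < \<epsilon> / K" "\<And>t. t \<le> R2 \<Longrightarrow> dist (A t) A0 < \<epsilon> / K"
    unfolding eventually_at_top_linorder eventually_at_bot_linorder by blast
  define R where "R = Max {\<bar>R1\<bar>, \<bar>R2\<bar>, \<bar>T0\<bar>}"
  have R: "norm (A t - A0) \<le> \<epsilon> / K" if "\<bar>t\<bar> \<ge> R" for t
  proof -
    have "\<bar>R1\<bar> \<le> R" "\<bar>R2\<bar> \<le> R" unfolding R_def by (auto intro: Max_ge)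
    then have "t \<ge> R1 \<or> t \<le> R2" using that by linarith
    then show ?thesis using R12 by (auto simp: dist_norm less_imp_le)
  qed
  define c where "c t = min 1 (max 0 (\<bar>t\<bar> - R))" for t :: real
  have c: "0 \<le> c t" "c t \<le> 1" for t by (auto simp: c_def)
  have cc: "continuous_on UNIV c" unfolding c_def by (intro continuous_intros)
  define B where "B t = A0 + c t *\<^sub>R (A t - A0)" for t
  have Bc: "continuous_on UNIV B" unfolding B_def by (intro continuous_intros cc A)
  have "boundedly_solvable B (2 * C)"
  proof (rule boundedly_solvable_perturb[OF C(2,1) _ _ \<epsilon>(2)])
    show "continuous_on UNIV (\<lambda>t. B t - A0)" by (intro continuous_intros Bc)
    fix t and v :: "real ^ 'n"
    have "norm (B t - A0) \<le> \<epsilon> / K"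
    proof (cases "\<bar>t\<bar> \<ge> R")
      case True
      have "norm (B t - A0) = c t * norm (A t - A0)" using c by (simp add: B_def)
      also have "\<dots> \<le> 1 * norm (A t - A0)" by (intro mult_right_mono c) auto
      finally show ?thesis using R[OF True] by simp
    next
      case False
      then have "B t = A0" by (simp add: B_def c_def)
      then show ?thesis using \<epsilon> K by simp
    qed
    then have "norm (B t - A0) * norm v * K \<le> (\<epsilon> / K) * norm v * K" using K by (intro mult_right_mono) auto
    then show "norm ((B t - A0) *v v) \<le> \<epsilon> * norm v" using K(2)[of "B t - A0" v] K(1) by simp
  qed (use \<epsilon> in auto)
  moreover have "B t = A t" if "\<bar>t\<bar> \<ge> R + 1" for t using that by (simp add: B_def c_def)
  moreover have "R \<ge> T0" "R \<ge> 0" unfolding R_def by (auto simp: Max_ge_iff)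
  ultimately show ?thesis using C Bc by (intro that[of "2 * C" B "R + 1"]) auto
qed

section \<open>Correction of the defect by variation of constants\<close>

lemma matrix_inv_both:
  fixes M :: "real ^ 'n ^ 'n"
  assumes "invertible M"
  shows "M ** matrix_inv M = mat 1" "matrix_inv M ** M = mat 1"
  using someI_ex[OF assms[unfolded invertible_def]] unfolding matrix_inv_def by auto

text \<open>Cramer's rule exhibits the entries of the inverse as quotients of polynomials in the
  entries of \<open>\<Phi> t\<close>.\<close>

lemma continuous_on_matrix_inv:
  fixes \<Phi> :: "real \<Rightarrow> real ^ 'n ^ 'n"
  assumes c: "continuous_on S \<Phi>" and inv: "\<And>t. invertible (\<Phi> t)"
  shows "continuous_on S (\<lambda>t. matrix_inv (\<Phi> t))"
proof -
  have det0: "det (\<Phi> t) \<noteq> 0" for t using inv[of t] by (simp add: invertible_det_nz)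
  have cij: "continuous_on S (\<lambda>t. \<Phi> t $ i $ j)" for i j
    by (intro continuous_intros c)
  have "matrix_inv (\<Phi> t) $ i $ j = det (\<chi> p q. if q = i then (axis j 1 :: real ^ 'n) $ p else \<Phi> t $ p $ q) / det (\<Phi> t)" for t i j
  proof -
    have "\<Phi> t *v (matrix_inv (\<Phi> t) *v axis j 1) = axis j 1"
      by (simp add: matrix_vector_mul_assoc matrix_inv_both[OF inv])
    then have "matrix_inv (\<Phi> t) *v axis j 1 = (\<chi> k. det (\<chi> p q. if q = k then (axis j 1 :: real ^ 'n) $ p else \<Phi> t $ p $ q) / det (\<Phi> t))"
      by (simp add: cramer[OF det0])
    moreover have "matrix_inv (\<Phi> t) $ i $ j = (matrix_inv (\<Phi> t) *v axis j 1) $ i"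
      by (simp add: matrix_vector_mul_component inner_axis)
    ultimately show ?thesis by simp
  qed
  moreover have "continuous_on S (\<lambda>t. det (\<chi> p q. if q = i then (axis j 1 :: real ^ 'n) $ p else \<Phi> t $ p $ q) / det (\<Phi> t))" for i j
    unfolding det_def
  proof (intro continuous_on_divide continuous_on_sum continuous_on_mult continuous_on_const continuous_on_prod)
    fix p :: "'n \<Rightarrow> 'n" and k :: 'n
    show "continuous_on S (\<lambda>t. (\<chi> p q. if q = i then (axis j 1 :: real ^ 'n) $ p else \<Phi> t $ p $ q) $ k $ p k)"
      by (cases "p k = i") (auto intro: cij)
    show "continuous_on S (\<lambda>t. \<Phi> t $ k $ p k)" by (rule cij)
  qed (use det0 in \<open>simp add: det_def\<close>)
  ultimately have "continuous_on S (\<lambda>t. matrix_inv (\<Phi> t) $ i $ j)" for i j by simp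
  then have "continuous_on S (\<lambda>t. \<chi> i j. matrix_inv (\<Phi> t) $ i $ j)"
    by (intro continuous_on_vec_lambda)
  then show ?thesis by simp
qed

lemma has_vector_derivative_matrix_inv:
  fixes \<Phi> :: "real \<Rightarrow> real ^ 'n ^ 'n"
  assumes d: "(\<Phi> has_vector_derivative \<Phi>') (at t)" and c: "continuous_on UNIV \<Phi>" and inv: "\<And>t. invertible (\<Phi> t)"
  shows "((\<lambda>t. matrix_inv (\<Phi> t)) has_vector_derivative - (matrix_inv (\<Phi> t) ** \<Phi>' ** matrix_inv (\<Phi> t))) (at t)"
proof -
  let ?T = "\<lambda>t. matrix_inv (\<Phi> t)"
  note bb = bounded_bilinear_matrix_matrix_mult
  interpret mm: bounded_bilinear "(**) :: real ^ 'n ^ 'n \<Rightarrow> real ^ 'n ^ 'n \<Rightarrow> real ^ 'n ^ 'n" by (rule bb)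
  define E where "E s = (1 / norm (s - t)) *\<^sub>R (\<Phi> s - (\<Phi> t + (s - t) *\<^sub>R \<Phi>'))" for s
  have E: "(E \<longlongrightarrow> 0) (at t)"
    using d unfolding has_vector_derivative_def has_derivative_within E_def by auto
  have T: "(?T \<longlongrightarrow> ?T t) (at t)"
    using continuous_on_matrix_inv[OF c inv] by (simp add: continuous_on_eq_continuous_at isCont_def)
  \<comment> \<open>This rests on the identity for the difference of two inverses,
    \<open>?T s - ?T t = - (?T s ** (\<Phi> s - \<Phi> t) ** ?T t)\<close>, with the increment of
    \<open>\<Phi>\<close> split into its linear part and the normalized error \<open>E\<close>. Each
    term on the right tends to 0.\<close>
  have eq: "(1 / norm (s - t)) *\<^sub>R (?T s - (?T t + (s - t) *\<^sub>R - (?T t ** \<Phi>' ** ?T t))) =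
      - (?T s ** E s ** ?T t) - ((s - t) / norm (s - t)) *\<^sub>R ((?T s - ?T t) ** \<Phi>' ** ?T t)" if "s \<noteq> t" for s
  proof -
    have "?T s - ?T t = - (?T s ** (\<Phi> s - \<Phi> t) ** ?T t)"
      using matrix_inv_both[OF inv, of s] matrix_inv_both[OF inv, of t]
      by (simp add: mm.diff_left mm.diff_right matrix_mul_assoc[symmetric])
    also have "\<Phi> s - \<Phi> t = norm (s - t) *\<^sub>R E s + (s - t) *\<^sub>R \<Phi>'" using that by (simp add: E_def)
    finally have "?T s - ?T t = - (norm (s - t) *\<^sub>R (?T s ** E s ** ?T t)) - (s - t) *\<^sub>R (?T s ** \<Phi>' ** ?T t)"
      by (simp add: mm.add_left mm.add_right mm.scaleR_left mm.scaleR_right)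
    then have "?T s - (?T t + (s - t) *\<^sub>R - (?T t ** \<Phi>' ** ?T t)) =
        - (norm (s - t) *\<^sub>R (?T s ** E s ** ?T t)) - (s - t) *\<^sub>R ((?T s - ?T t) ** \<Phi>' ** ?T t)"
      by (simp add: mm.diff_left algebra_simps)
    then show ?thesis using that by (simp add: scaleR_diff_right)
  qed
  have "((\<lambda>s. - (?T s ** E s ** ?T t) - ((s - t) / norm (s - t)) *\<^sub>R ((?T s - ?T t) ** \<Phi>' ** ?T t)) \<longlongrightarrow>
      - (?T t ** 0 ** ?T t) - 0) (at t)"
  proof (intro tendsto_intros mm.tendsto T E)
    show "((\<lambda>s. ((s - t) / norm (s - t)) *\<^sub>R ((?T s - ?T t) ** \<Phi>' ** ?T t)) \<longlongrightarrow> 0) (at t)"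
    proof (rule Lim_null_comparison)
      show "\<forall>\<^sub>F s in at t. norm (((s - t) / norm (s - t)) *\<^sub>R ((?T s - ?T t) ** \<Phi>' ** ?T t)) \<le> norm ((?T s - ?T t) ** \<Phi>' ** ?T t)"
        by (intro always_eventually allI) (auto simp: abs_divide mult_left_le_one_le)
      have "((\<lambda>s. norm ((?T s - ?T t) ** \<Phi>' ** ?T t)) \<longlongrightarrow> norm ((?T t - ?T t) ** \<Phi>' ** ?T t)) (at t)"
        by (intro tendsto_intros mm.tendsto T)
      then show "((\<lambda>s. norm ((?T s - ?T t) ** \<Phi>' ** ?T t)) \<longlongrightarrow> 0) (at t)" by (simp add: mm.zero_left)
    qed
  qed
  then have "((\<lambda>s. - (?T s ** E s ** ?T t) - ((s - t) / norm (s - t)) *\<^sub>R ((?T s - ?T t) ** \<Phi>' ** ?T t)) \<longlongrightarrow> 0) (at t)"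
    by (simp add: mm.zero_left mm.zero_right)
  then have "((\<lambda>s. (1 / norm (s - t)) *\<^sub>R (?T s - (?T t + (s - t) *\<^sub>R - (?T t ** \<Phi>' ** ?T t)))) \<longlongrightarrow> 0) (at t)"
    by (rule Lim_transform_eventually) (use eq in \<open>auto simp: eventually_at_filter\<close>)
  then show ?thesis
    unfolding has_vector_derivative_def has_derivative_within
    by (intro conjI bounded_linear_scaleR_left)
qed

lemma bounded_linear_integral_bcontfun:
  fixes f :: "real \<Rightarrow> 'b::real_normed_vector \<Rightarrow> 'c::banach"
  assumes lin: "\<And>t. linear (f t)" and c: "\<And>u :: real \<Rightarrow>\<^sub>C 'b. continuous_on UNIV (\<lambda>t. f t (u t))"
    and b: "\<And>t v. a \<le> t \<Longrightarrow> t \<le> b \<Longrightarrow> norm (f t v) \<le> K * norm v" and ab: "a \<le> b" and K: "K \<ge> 0"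
  shows "bounded_linear (\<lambda>u :: real \<Rightarrow>\<^sub>C 'b. integral {a..b} (\<lambda>t. f t (u t)))"
    and "norm (integral {a..b} (\<lambda>t. f t (apply_bcontfun u t))) \<le> K * (b - a) * norm u"
proof -
  have int: "(\<lambda>t. f t (apply_bcontfun u t)) integrable_on {a..b}" for u
    by (intro integrable_continuous_real continuous_on_subset[OF c]) auto
  have bd: "norm (integral {a..b} (\<lambda>t. f t (apply_bcontfun u t))) \<le> K * (b - a) * norm u" for u :: "real \<Rightarrow>\<^sub>C 'b"
  proof -
    have "norm (integral {a..b} (\<lambda>t. f t (apply_bcontfun u t))) \<le> K * norm u * (b - a)"
    proof (rule integral_bound[OF ab])
      show "continuous_on {a..b} (\<lambda>t. f t (apply_bcontfun u t))" by (rule continuous_on_subset[OF c]) auto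
      fix t assume "t \<in> {a..b}"
      then show "norm (f t (apply_bcontfun u t)) \<le> K * norm u"
        using b[of t "u t"] mult_left_mono[OF norm_bounded[of u t] K] by auto
    qed
    then show ?thesis by (simp add: mult_ac)
  qed
  then show "norm (integral {a..b} (\<lambda>t. f t (apply_bcontfun u t))) \<le> K * (b - a) * norm u" .
  show "bounded_linear (\<lambda>u :: real \<Rightarrow>\<^sub>C 'b. integral {a..b} (\<lambda>t. f t (u t)))"
  proof (rule bounded_linear_intro[where K="K * (b - a)"])
    fix u v :: "real \<Rightarrow>\<^sub>C 'b" and r :: real
    show "integral {a..b} (\<lambda>t. f t ((u + v) t)) = integral {a..b} (\<lambda>t. f t (u t)) + integral {a..b} (\<lambda>t. f t (v t))"
      using integral_add[OF int[of u] int[of v]] by (simp add: linear_add[OF lin])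
    show "integral {a..b} (\<lambda>t. f t ((r *\<^sub>R u) t)) = r *\<^sub>R integral {a..b} (\<lambda>t. f t (u t))"
      by (simp add: linear_scale[OF lin])
    show "norm (integral {a..b} (\<lambda>t. f t (u t))) \<le> norm u * (K * (b - a))" using bd[of u] by (simp add: mult_ac)
  qed
qed

lemma continuous_tendsto_0_bounded_half_line:
  fixes f :: "real \<Rightarrow> 'b::real_normed_vector"
  assumes c: "continuous_on UNIV f"
  shows "(f \<longlongrightarrow> 0) at_top \<Longrightarrow> \<exists>b\<ge>0. \<forall>t\<ge>a. norm (f t) \<le> b"
    and "(f \<longlongrightarrow> 0) at_bot \<Longrightarrow> \<exists>b\<ge>0. \<forall>t\<le>a. norm (f t) \<le> b"
proof -
  have comp: "\<exists>b\<ge>0. \<forall>t\<in>{c..d}. norm (f t) \<le> b" for c d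
  proof -
    have "bounded (f ` {c..d})"
      by (intro compact_imp_bounded compact_continuous_image continuous_on_subset[OF c]) auto
    then obtain b where "\<forall>x\<in>f ` {c..d}. norm x \<le> b" by (auto simp: bounded_iff)
    then show ?thesis by (intro exI[of _ "\<bar>b\<bar>"]) force
  qed
  show "\<exists>b\<ge>0. \<forall>t\<ge>a. norm (f t) \<le> b" if "(f \<longlongrightarrow> 0) at_top"
  proof -
    have "\<forall>\<^sub>F t in at_top. dist (f t) 0 < 1" by (intro tendstoD that) auto
    then obtain R where R: "\<And>t. t \<ge> R \<Longrightarrow> norm (f t) < 1" by (auto simp: eventually_at_top_linorder)
    obtain b where b: "b \<ge> 0" "\<And>t. t \<in> {a..R} \<Longrightarrow> norm (f t) \<le> b" using comp by blast
    have "norm (f t) \<le> max 1 b" if "t \<ge> a" for t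
      using b(2)[of t] R[of t] that by (cases "t \<le> R") auto
    then show ?thesis by (intro exI[of _ "max 1 b"]) auto
  qed
  show "\<exists>b\<ge>0. \<forall>t\<le>a. norm (f t) \<le> b" if "(f \<longlongrightarrow> 0) at_bot"
  proof -
    have "\<forall>\<^sub>F t in at_bot. dist (f t) 0 < 1" by (intro tendstoD that) auto
    then obtain R where R: "\<And>t. t \<le> R \<Longrightarrow> norm (f t) < 1" by (auto simp: eventually_at_bot_linorder)
    obtain b where b: "b \<ge> 0" "\<And>t. t \<in> {R..a} \<Longrightarrow> norm (f t) \<le> b" using comp by blast
    have "norm (f t) \<le> max 1 b" if "t \<le> a" for t
      using b(2)[of t] R[of t] that by (cases "R \<le> t") auto
    then show ?thesis by (intro exI[of _ "max 1 b"]) auto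
  qed
qed

lemma integral_vanishing_outside:
  fixes f :: "real \<Rightarrow> 'b::euclidean_space"
  assumes "continuous_on UNIV f" "\<And>t. t \<notin> {c..d} \<Longrightarrow> f t = 0" "a \<le> c" "d \<le> b"
  shows "integral {a..b} f = integral {c..d} f"
proof -
  have "(f has_integral integral {c..d} f) {c..d}"
    by (intro integrable_integral integrable_continuous_real continuous_on_subset[OF assms(1)]) auto
  then have "(f has_integral integral {c..d} f) {a..b}"
    by (rule has_integral_on_superset) (use assms in auto)
  then show ?thesis by (rule integral_unique)
qed

text \<open>
  Solve with a uniformly solvable \<open>B\<close> that agrees with \<open>A\<close> outside a compact interval, and correct the
  defect \<open>A - B\<close> there by variation of constants; the columns of \<open>\<Phi>\<close> in \<open>P\<close> extend the correction to the
  right, those outside \<open>P \<union> E\<close> to the left, and the remaining coefficients are cancelled by the \<open>\<rho> k\<close>.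
\<close>

lemma bounded_solution_operator:
  fixes A \<Phi> :: "real \<Rightarrow> real ^ 'n ^ 'n" and P E :: "'n set" and \<rho> :: "'n \<Rightarrow> real \<Rightarrow> real ^ 'n"
  defines "\<psi> k t \<equiv> matrix_inv (\<Phi> t) $ k"
  assumes A0: "\<And>l. complex_eigenvalue A0 l \<Longrightarrow> Re l \<noteq> 0"
    and A: "continuous_on UNIV A" "(A \<longlongrightarrow> A0) at_top" "(A \<longlongrightarrow> A0) at_bot"
    and \<Phi>: "\<And>t. (\<Phi> has_vector_derivative A t ** \<Phi> t) (at t)" "\<And>t. invertible (\<Phi> t)"
    and P: "\<And>j. j \<in> P \<Longrightarrow> ((\<lambda>t. column j (\<Phi> t)) \<longlongrightarrow> 0) at_top"
    and N: "\<And>j. j \<notin> P \<Longrightarrow> j \<notin> E \<Longrightarrow> ((\<lambda>t. column j (\<Phi> t)) \<longlongrightarrow> 0) at_bot"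
    and PE: "P \<inter> E = {}"
    and E: "\<And>k. k \<in> E \<Longrightarrow> (\<psi> k \<longlongrightarrow> 0) at_top" "\<And>k. k \<in> E \<Longrightarrow> (\<psi> k \<longlongrightarrow> 0) at_bot"
    and \<rho>: "\<And>k. k \<in> E \<Longrightarrow> continuous_on UNIV (\<rho> k)" "\<And>k t. k \<in> E \<Longrightarrow> \<bar>t\<bar> \<ge> T0 \<Longrightarrow> \<rho> k t = 0"
      "\<And>k l. k \<in> E \<Longrightarrow> l \<in> E \<Longrightarrow> integral {-T0..T0} (\<lambda>t. \<psi> k t \<bullet> \<rho> l t) = (if k = l then 1 else 0)"
  obtains L :: "(real \<Rightarrow>\<^sub>C (real ^ 'n)) \<Rightarrow> (real \<Rightarrow>\<^sub>C (real ^ 'n))" and \<Lambda> :: "'n \<Rightarrow> (real \<Rightarrow>\<^sub>C (real ^ 'n)) \<Rightarrow> real" where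
    "bounded_linear L" "\<And>k. bounded_linear (\<Lambda> k)"
    "\<And>h t. (apply_bcontfun (L h) has_vector_derivative A t *v apply_bcontfun (L h) t + apply_bcontfun h t - (\<Sum>k\<in>E. \<Lambda> k h *\<^sub>R \<rho> k t)) (at t)"
    "\<And>h. (apply_bcontfun h \<longlongrightarrow> 0) at_top \<Longrightarrow> (apply_bcontfun (L h) \<longlongrightarrow> 0) at_top"
    "\<And>h. (apply_bcontfun h \<longlongrightarrow> 0) at_bot \<Longrightarrow> (apply_bcontfun (L h) \<longlongrightarrow> 0) at_bot"
    "\<And>k h. k \<in> E \<Longrightarrow> ((\<lambda>S. integral {-S..S} (\<lambda>t. \<psi> k t \<bullet> apply_bcontfun h t)) \<longlongrightarrow> \<Lambda> k h) at_top"
proof -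
  define \<Theta> where "\<Theta> t = matrix_inv (\<Phi> t)" for t
  have \<psi>: "\<psi> k t = \<Theta> t $ k" for k t by (simp add: \<psi>_def \<Theta>_def)
  obtain B C T where C: "C \<ge> 0" and B: "boundedly_solvable B C" and Bc: "continuous_on UNIV B" and T: "T > 0" "T \<ge> T0"
    and BA: "\<And>t. \<bar>t\<bar> \<ge> T \<Longrightarrow> B t = A t"
    using asymptotically_hyperbolic_cutoff[OF A0 A] by metis
  obtain K where K: "bounded_linear K" "\<And>h t. (apply_bcontfun (K h) has_vector_derivative B t *v apply_bcontfun (K h) t + apply_bcontfun h t) (at t)"
    "\<And>h. (apply_bcontfun h \<longlongrightarrow> 0) at_top \<Longrightarrow> (apply_bcontfun (K h) \<longlongrightarrow> 0) at_top"
    "\<And>h. (apply_bcontfun h \<longlongrightarrow> 0) at_bot \<Longrightarrow> (apply_bcontfun (K h) \<longlongrightarrow> 0) at_bot"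
    using boundedly_solvable_operator[OF B C] by metis
  have \<Phi>c: "continuous_on S \<Phi>" for S by (rule has_vector_derivative_imp_continuous_on[OF \<Phi>(1)])
  have \<Theta>c: "continuous_on S \<Theta>" for S unfolding \<Theta>_def by (rule continuous_on_matrix_inv[OF \<Phi>c \<Phi>(2)])
  have \<psi>c: "continuous_on S (\<lambda>t. \<Theta> t $ k)" for S k by (intro continuous_intros \<Theta>c)
  have \<Phi>\<Theta>: "\<Phi> t *v (\<Theta> t *v v) = v" for t v
    by (simp add: matrix_vector_mul_assoc \<Theta>_def matrix_inv_both[OF \<Phi>(2)])
  have \<Theta>': "(\<Theta> has_vector_derivative - (\<Theta> t ** A t)) (at t)" for t
  proof -
    have "\<Theta> t ** (A t ** \<Phi> t) ** \<Theta> t = \<Theta> t ** A t"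
      using matrix_inv_both(1)[OF \<Phi>(2), of t] by (simp add: \<Theta>_def matrix_mul_assoc[symmetric])
    then show ?thesis
      using has_vector_derivative_matrix_inv[OF \<Phi>(1) \<Phi>c \<Phi>(2), of t] unfolding \<Theta>_def[abs_def] by simp
  qed
  define dA where "dA t = A t - B t" for t
  have dAc: "continuous_on UNIV dA" unfolding dA_def by (intro continuous_intros A Bc)
  have dA0: "dA t = 0" if "\<bar>t\<bar> \<ge> T" for t using BA[OF that] by (simp add: dA_def)
  have compact_bound: "\<exists>K\<ge>0. \<forall>t v. a \<le> t \<longrightarrow> t \<le> b \<longrightarrow> norm (M t *v v) \<le> K * norm v"
    if "continuous_on UNIV M" for M :: "real \<Rightarrow> real ^ 'n ^ 'n" and a b
  proof -
    obtain k where k: "k > 0" "\<And>(M :: real ^ 'n ^ 'n) v. norm (M *v v) \<le> norm M * norm v * k"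
      using bounded_bilinear.pos_bounded[OF bounded_bilinear_matrix_vector_mult] by metis
    have "bounded (M ` {a..b})"
      by (intro compact_imp_bounded compact_continuous_image continuous_on_subset[OF that]) auto
    then obtain c where c: "\<forall>x\<in>M ` {a..b}. norm x \<le> c" by (auto simp: bounded_iff)
    have "norm (M t *v v) \<le> \<bar>c\<bar> * k * norm v" if "a \<le> t" "t \<le> b" for t v
    proof -
      have "norm (M t) \<le> \<bar>c\<bar>" using c that by force
      then have "norm (M t) * norm v * k \<le> \<bar>c\<bar> * norm v * k" using k by (intro mult_right_mono) auto
      then show ?thesis using k(2)[of "M t" v] by (simp add: mult_ac)
    qed
    then show ?thesis using k by (intro exI[of _ "\<bar>c\<bar> * k"]) auto
  qed
  obtain KA where KA: "KA \<ge> 0" "\<And>t v. -T \<le> t \<Longrightarrow> t \<le> T \<Longrightarrow> norm (dA t *v v) \<le> KA * norm v" using compact_bound[OF dAc] by metis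
  have KA': "norm (dA t *v v) \<le> KA * norm v" for t v
    using KA(2)[of t v] dA0[of t] KA(1) by (cases "\<bar>t\<bar> \<ge> T") (auto simp: abs_le_iff)
  define D where "D u = Bcontfun (\<lambda>t. dA t *v apply_bcontfun u t)" for u
  have D: "apply_bcontfun (D u) = (\<lambda>t. dA t *v apply_bcontfun u t)" for u
    unfolding D_def
  proof (rule apply_Bcontfun)
    show "continuous_on UNIV (\<lambda>t. dA t *v apply_bcontfun u t)" by (intro continuous_on_matrix_vector_mult dAc) simp
    show "norm (dA t *v apply_bcontfun u t) \<le> KA * norm u" for t
      using KA'[of t "u t"] mult_left_mono[OF norm_bounded[of u t] KA(1)] by simp
  qed
  have Dlin: "bounded_linear D"
  proof (rule bounded_linear_intro[where K=KA])
    fix u v :: "real \<Rightarrow>\<^sub>C (real ^ 'n)" and r :: real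
    show "D (u + v) = D u + D v" by (rule bcontfun_eqI) (simp add: D matrix_vector_right_distrib)
    show "D (r *\<^sub>R u) = r *\<^sub>R D u" by (rule bcontfun_eqI) (simp add: D matrix_vector_mult_scaleR)
    show "norm (D u) \<le> norm u * KA"
    proof (rule norm_bound)
      fix t show "norm (D u t) \<le> norm u * KA"
        unfolding D using KA'[of t "u t"] mult_left_mono[OF norm_bounded[of u t] KA(1)] by (simp add: mult.commute)
    qed
  qed
  have \<psi>int: "bounded_linear (\<lambda>u :: real \<Rightarrow>\<^sub>C (real ^ 'n). integral {-T..T} (\<lambda>t. \<Theta> t $ k \<bullet> u t))" for k
  proof -
    have "bounded ((\<lambda>t. \<Theta> t $ k) ` {-T..T})"
      by (intro compact_imp_bounded compact_continuous_image \<psi>c) auto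
    then obtain c where c: "\<forall>x\<in>(\<lambda>t. \<Theta> t $ k) ` {-T..T}. norm x \<le> c" by (auto simp: bounded_iff)
    show ?thesis
    proof (rule bounded_linear_integral_bcontfun(1)[where K="\<bar>c\<bar>"])
      fix t and v :: "real ^ 'n" assume "-T \<le> t" "t \<le> T"
      then have "norm (\<Theta> t $ k) \<le> \<bar>c\<bar>" using c by force
      then show "norm (\<Theta> t $ k \<bullet> v) \<le> \<bar>c\<bar> * norm v"
        using mult_right_mono[of "norm (\<Theta> t $ k)" "\<bar>c\<bar>" "norm v"]
          Cauchy_Schwarz_ineq2[of "\<Theta> t $ k" v] by simp
    qed (use T in \<open>auto intro!: continuous_intros \<psi>c bounded_linear.linear bounded_linear_inner_right\<close>)
  qed
  \<comment> \<open>Integrating the compactly supported defect makes \<open>\<Lambda> k\<close>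
    visibly bounded and linear. The last claim identifies it with the improper integral of
    \<open>\<psi> k \<bullet> h\<close>: the derivative of \<open>\<psi> k \<bullet> K h\<close> is
    the difference of the two integrands, and \<open>\<psi> k\<close> vanishes at both ends.\<close>
  define \<Lambda> where "\<Lambda> k h = integral {-T..T} (\<lambda>t. \<Theta> t $ k \<bullet> apply_bcontfun (D (K h)) t)" for k h
  have \<Lambda>lin: "bounded_linear (\<Lambda> k)" for k
    using bounded_linear_compose[OF \<psi>int bounded_linear_compose[OF Dlin K(1)]] unfolding \<Lambda>_def[abs_def] .
  define rb where "rb k = Bcontfun (\<rho> k)" for k
  have rb: "apply_bcontfun (rb k) = \<rho> k" if "k \<in> E" for k
  proof -
    have "bounded (\<rho> k ` {-T0..T0})"
      by (intro compact_imp_bounded compact_continuous_image continuous_on_subset[OF \<rho>(1)[OF that]]) auto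
    then obtain c where c: "\<forall>x\<in>\<rho> k ` {-T0..T0}. norm x \<le> c" by (auto simp: bounded_iff)
    have "norm (\<rho> k t) \<le> \<bar>c\<bar>" for t
    proof (cases "\<bar>t\<bar> \<ge> T0")
      case False then have "t \<in> {-T0..T0}" by auto
      then have "norm (\<rho> k t) \<le> c" using c by blast
      then show ?thesis by linarith
    qed (use \<rho>(2)[OF that] in auto)
    then show ?thesis unfolding rb_def by (intro apply_Bcontfun \<rho>(1)[OF that])
  qed
  \<comment> \<open>\<open>K h\<close> solves the equation with \<open>B\<close>, so
    \<open>K h + \<zeta>\<close> solves the corrected equation with \<open>A\<close> precisely when
    \<open>\<zeta>' = A \<zeta> + \<kappa>\<close>.\<close>
  define \<kappa> where "\<kappa> h = D (K h) - (\<Sum>k\<in>E. \<Lambda> k h *\<^sub>R rb k)" for h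
  have \<kappa>lin: "bounded_linear \<kappa>"
    unfolding \<kappa>_def
    by (intro bounded_linear_sub bounded_linear_compose[OF Dlin K(1)] bounded_linear_sum
       bounded_linear_compose[OF bounded_linear_scaleR_left \<Lambda>lin])
  have sum_apply: "apply_bcontfun (\<Sum>k\<in>E. g k) t = (\<Sum>k\<in>E. apply_bcontfun (g k) t)" for g :: "'n \<Rightarrow> real \<Rightarrow>\<^sub>C (real ^ 'n)" and t
    by (induction E rule: infinite_finite_induct) (auto simp: zero_bcontfun.rep_eq)
  have \<kappa>: "apply_bcontfun (\<kappa> h) t = dA t *v apply_bcontfun (K h) t - (\<Sum>k\<in>E. \<Lambda> k h *\<^sub>R \<rho> k t)" for h t
    unfolding \<kappa>_def by (simp add: D sum_apply rb)
  have \<kappa>0: "apply_bcontfun (\<kappa> h) t = 0" if "\<bar>t\<bar> \<ge> T" for h t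
    unfolding \<kappa> using dA0[OF that] \<rho>(2) that T by simp
  define g where "g h t = \<Theta> t *v apply_bcontfun (\<kappa> h) t" for h t
  have gc: "continuous_on S (g h)" for h S
    unfolding g_def by (intro continuous_on_matrix_vector_mult \<Theta>c) simp
  have g0: "g h t = 0" if "\<bar>t\<bar> \<ge> T" for h t unfolding g_def using \<kappa>0[OF that] by simp
  \<comment> \<open>\<open>U\<close> collects coefficients with respect to the columns of
    \<open>\<Phi>\<close>. Starting one unit to the left of the support leaves room for a two-sided
    derivative at \<open>-T\<close>.\<close>
  define U where "U t h = integral {-T-1..t} (g h)" for t h
  have U_left: "U t h = 0" if "t \<le> -T" for t h
    unfolding U_def using that T by (subst integral_cong[where g="\<lambda>_. 0"]) (auto intro: g0)
  have U_right: "U t h = U T h" if "t \<ge> T" for t h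
    unfolding U_def using that T
    by (subst (1 2) integral_vanishing_outside[where c="-T" and d=T]) (auto intro: gc g0)
  have U': "(U' has_vector_derivative g h t) (at t)" if "U' = (\<lambda>t. U t h)" for h t U'
  proof (cases "t > -T-1")
    case True
    have "((\<lambda>t. integral {-T-1..t} (g h)) has_vector_derivative g h t) (at t within {-T-1..t+1})"
      by (rule integral_has_vector_derivative) (use gc True in auto)
    moreover have "at t within {-T-1..t+1} = at t" using True by (intro at_within_interior) auto
    ultimately show ?thesis unfolding that U_def by simp
  next
    case False
    have "((\<lambda>t. 0) has_vector_derivative 0) (at t)" by simp
    then have "((\<lambda>t. U t h) has_vector_derivative 0) (at t)"
      by (rule has_vector_derivative_transform_within_open[of _ _ _ "{..<-T}"]) (use False U_left in auto)
    moreover have "g h t = 0" using False T by (intro g0) auto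
    ultimately show ?thesis using that by simp
  qed
  obtain K\<Theta> where K\<Theta>: "K\<Theta> \<ge> 0" "\<And>t v. -T-1 \<le> t \<Longrightarrow> t \<le> T \<Longrightarrow> norm (\<Theta> t *v v) \<le> K\<Theta> * norm v" using compact_bound[OF \<Theta>c] by metis
  have Ulin: "U t (h + k) = U t h + U t k" "U t (r *\<^sub>R h) = r *\<^sub>R U t h" for t h k r
  proof -
    have i: "g h integrable_on {-T-1..t}" for h by (intro integrable_continuous_real gc)
    have "g (h + k) = (\<lambda>t. g h t + g k t)" "g (r *\<^sub>R h) = (\<lambda>t. r *\<^sub>R g h t)"
      unfolding g_def linear_add[OF bounded_linear.linear[OF \<kappa>lin]] linear_scale[OF bounded_linear.linear[OF \<kappa>lin]]
      by (auto simp: matrix_vector_right_distrib matrix_vector_mult_scaleR)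
    then show "U t (h + k) = U t h + U t k" "U t (r *\<^sub>R h) = r *\<^sub>R U t h"
      unfolding U_def using integral_add[OF i i] by auto
  qed
  obtain K\<kappa> where K\<kappa>: "K\<kappa> \<ge> 0" "\<And>h. norm (\<kappa> h) \<le> norm h * K\<kappa>" using bounded_linear.nonneg_bounded[OF \<kappa>lin] by blast
  define M where "M = K\<Theta> * K\<kappa> * (2 * T + 1)"
  have M: "M \<ge> 0" using K\<Theta> K\<kappa> T by (simp add: M_def)
  have Ub: "norm (U t h) \<le> M * norm h" for t h
  proof -
    have *: "norm (U t h) \<le> M * norm h" if "t \<le> T" for t
    proof (cases "t \<ge> -T-1")
      case True
      have "norm (U t h) \<le> (K\<Theta> * (norm h * K\<kappa>)) * (t - (-T-1))"
        unfolding U_def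
      proof (rule integral_bound[OF True gc])
        fix s assume "s \<in> {-T-1..t}"
        then have "norm (g h s) \<le> K\<Theta> * norm (apply_bcontfun (\<kappa> h) s)"
          unfolding g_def using \<open>t \<le> T\<close> by (intro K\<Theta>) auto
        also have "\<dots> \<le> K\<Theta> * (norm h * K\<kappa>)"
          by (intro mult_left_mono K\<Theta> order_trans[OF norm_bounded K\<kappa>(2)])
        finally show "norm (g h s) \<le> K\<Theta> * (norm h * K\<kappa>)" .
      qed
      also have "\<dots> \<le> (K\<Theta> * (norm h * K\<kappa>)) * (2 * T + 1)"
        using \<open>t \<le> T\<close> K\<Theta> K\<kappa> by (intro mult_left_mono) auto
      finally show ?thesis by (simp add: M_def mult_ac)
    next
      case False
      then have "U t h = 0" by (intro U_left) auto
      then show ?thesis using M by simp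
    qed
    show ?thesis using *[of t] *[of T] U_right[of t h] by (cases "t \<le> T") auto
  qed
  \<comment> \<open>Subtracting the final value for the columns outside \<open>P \<union> E\<close>
    makes their coefficients vanish to the right of \<open>T\<close>, while those of
    \<open>P\<close> vanish to the left of \<open>-T\<close>. A coefficient in \<open>E\<close> must
    vanish on both sides; \<open>UE\<close> shows that biorthogonality and the choice of
    \<open>\<Lambda>\<close> achieve this.\<close>
  define Pr where "Pr w = (\<chi> j. if j \<in> P \<union> E then 0 else w $ j)" for w :: "real ^ 'n"
  define \<zeta> where "\<zeta> h t = \<Phi> t *v (U t h - Pr (U T h))" for h t
  have UE: "U T h $ k = 0" if k: "k \<in> E" for h k
  proof -
    have c1: "continuous_on UNIV (\<lambda>t. \<Theta> t $ k \<bullet> apply_bcontfun u t)" for u by (intro continuous_intros \<psi>c) auto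
    have i1: "(\<lambda>t. \<Theta> t $ k \<bullet> apply_bcontfun u t) integrable_on {-T..T}" for u
      by (intro integrable_continuous_real continuous_on_subset[OF c1]) auto
    have c2: "continuous_on UNIV (\<lambda>t. \<Theta> t $ k \<bullet> \<rho> l t)" if "l \<in> E" for l by (intro continuous_intros \<psi>c \<rho>(1) that)
    have i2: "(\<lambda>t. \<Theta> t $ k \<bullet> \<rho> l t) integrable_on {-T..T}" if "l \<in> E" for l
      by (intro integrable_continuous_real continuous_on_subset[OF c2] that) auto
    have r: "integral {-T..T} (\<lambda>t. \<Theta> t $ k \<bullet> \<rho> l t) = (if k = l then 1 else 0)" if "l \<in> E" for l
    proof -
      have "integral {-T..T} (\<lambda>t. \<Theta> t $ k \<bullet> \<rho> l t) = integral {-T0..T0} (\<lambda>t. \<Theta> t $ k \<bullet> \<rho> l t)"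
        by (rule integral_vanishing_outside[OF c2[OF that]]) (use \<rho>(2)[OF that] T in auto)
      then show ?thesis using \<rho>(3)[OF k that] by (simp add: \<psi>)
    qed
    have "U T h $ k = integral {-T-1..T} (\<lambda>t. g h t $ k)"
      unfolding U_def using integral_linear[OF integrable_continuous_real[OF gc] bounded_linear_vec_nth]
      by (simp add: o_def)
    also have "\<dots> = integral {-T..T} (\<lambda>t. g h t $ k)"
      by (rule integral_vanishing_outside) (auto intro!: continuous_intros gc simp: g0)
    also have "\<dots> = integral {-T..T} (\<lambda>t. \<Theta> t $ k \<bullet> apply_bcontfun (D (K h)) t - (\<Sum>l\<in>E. \<Lambda> l h * (\<Theta> t $ k \<bullet> \<rho> l t)))"
      by (intro integral_cong) (simp add: g_def matrix_vector_mul_component \<kappa> D inner_diff_right inner_sum_right)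
    also have "\<dots> = \<Lambda> k h - (\<Sum>l\<in>E. \<Lambda> l h * (if k = l then 1 else 0))"
      unfolding \<Lambda>_def[of k]
      by (subst integral_diff[OF i1]) (auto intro!: integrable_sum integrable_on_mult_right i2 simp: integral_sum i2 integrable_on_mult_right r)
    also have "\<dots> = 0" using k by (simp add: mult_delta_right finite)
    finally show ?thesis .
  qed
  have \<zeta>': "(\<zeta> h has_vector_derivative A t *v \<zeta> h t + apply_bcontfun (\<kappa> h) t) (at t)" for h t
  proof -
    have "((\<lambda>t. U t h - Pr (U T h)) has_vector_derivative g h t) (at t)"
      using has_vector_derivative_diff[OF U'[OF refl] has_vector_derivative_const] by simp
    from bounded_bilinear.has_vector_derivative[OF bounded_bilinear_matrix_vector_mult \<Phi>(1) this]
    have "(\<zeta> h has_vector_derivative \<Phi> t *v g h t + (A t ** \<Phi> t) *v (U t h - Pr (U T h))) (at t)"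
      unfolding \<zeta>_def[abs_def] .
    then show ?thesis
      by (rule has_vector_derivative_eq_rhs) (simp add: g_def \<Phi>\<Theta> \<zeta>_def matrix_vector_mul_assoc[symmetric])
  qed
  have \<zeta>_sum: "\<zeta> h t = (\<Sum>j\<in>UNIV. (U t h - Pr (U T h)) $ j *\<^sub>R column j (\<Phi> t))" for h t
    unfolding \<zeta>_def by (simp add: matrix_mult_sum scalar_mult_eq_scaleR)
  have colc: "continuous_on S (\<lambda>t. column j (\<Phi> t))" for S j
    unfolding column_def by (intro continuous_intros \<Phi>c)
  have "\<exists>b\<ge>0. (j \<in> P \<longrightarrow> (\<forall>t\<ge>-T. norm (column j (\<Phi> t)) \<le> b)) \<and> (j \<notin> P \<and> j \<notin> E \<longrightarrow> (\<forall>t\<le>T. norm (column j (\<Phi> t)) \<le> b))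
     \<and> (j \<in> E \<longrightarrow> (\<forall>t\<in>{-T..T}. norm (column j (\<Phi> t)) \<le> b))" for j
  proof -
    consider "j \<in> P" | "j \<notin> P" "j \<notin> E" | "j \<in> E" by blast
    then show ?thesis
    proof cases
      case 1
      then show ?thesis using continuous_tendsto_0_bounded_half_line(1)[OF colc P[OF 1], of "-T"] PE by auto
    next
      case 2
      then show ?thesis using continuous_tendsto_0_bounded_half_line(2)[OF colc N[OF 2], of T] by auto
    next
      case 3
      have "bounded ((\<lambda>t. column j (\<Phi> t)) ` {-T..T})"
        by (intro compact_imp_bounded compact_continuous_image colc) auto
      then obtain b where b: "\<forall>x\<in>(\<lambda>t. column j (\<Phi> t)) ` {-T..T}. norm x \<le> b" by (auto simp: bounded_iff)
      have "\<forall>t\<in>{-T..T}. norm (column j (\<Phi> t)) \<le> \<bar>b\<bar>" using b by force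
      then show ?thesis using 3 PE by (intro exI[of _ "\<bar>b\<bar>"]) auto
    qed
  qed
  then obtain b where b0: "\<And>j. b j \<ge> 0" and bP: "\<And>j t. j \<in> P \<Longrightarrow> t \<ge> -T \<Longrightarrow> norm (column j (\<Phi> t)) \<le> b j"
    and bN: "\<And>j t. j \<notin> P \<Longrightarrow> j \<notin> E \<Longrightarrow> t \<le> T \<Longrightarrow> norm (column j (\<Phi> t)) \<le> b j"
    and bE: "\<And>j t. j \<in> E \<Longrightarrow> t \<in> {-T..T} \<Longrightarrow> norm (column j (\<Phi> t)) \<le> b j" by metis
  have w0: "(U t h - Pr (U T h)) $ j = 0"
    if "(j \<in> P \<and> t < -T) \<or> (j \<notin> P \<and> j \<notin> E \<and> t > T) \<or> (j \<in> E \<and> t \<notin> {-T..T})" for t h j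
    using that U_left[of t h] U_right[of t h] UE[of j h] by (auto simp: Pr_def)
  have wb: "\<bar>(U t h - Pr (U T h)) $ j\<bar> \<le> 2 * M * norm h" for t h j
  proof -
    have "\<bar>U t h $ j\<bar> \<le> M * norm h" "\<bar>U T h $ j\<bar> \<le> M * norm h"
      using component_le_norm_cart Ub order_trans by blast+
    then show ?thesis by (auto simp: Pr_def)
  qed
  define c where "c = (\<Sum>j\<in>UNIV. 2 * M * b j)"
  have c0: "c \<ge> 0" unfolding c_def using M b0 by (intro sum_nonneg) auto
  have \<zeta>b: "norm (\<zeta> h t) \<le> c * norm h" for h t
  proof -
    have "norm (\<zeta> h t) \<le> (\<Sum>j\<in>UNIV. norm ((U t h - Pr (U T h)) $ j *\<^sub>R column j (\<Phi> t)))"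
      unfolding \<zeta>_sum by (rule norm_sum)
    also have "\<dots> \<le> (\<Sum>j\<in>UNIV. 2 * M * norm h * b j)"
    proof (rule sum_mono)
      fix j
      show "norm ((U t h - Pr (U T h)) $ j *\<^sub>R column j (\<Phi> t)) \<le> 2 * M * norm h * b j"
      proof (cases "(U t h - Pr (U T h)) $ j = 0")
        case True then show ?thesis using M b0[of j] by simp
      next
        case False
        then have "norm (column j (\<Phi> t)) \<le> b j" using w0[of j t h] bP[of j t] bN[of j t] bE[of j t] by force
        then show ?thesis unfolding norm_scaleR real_norm_def using wb M b0 by (intro mult_mono) auto
      qed
    qed
    also have "\<dots> = c * norm h" by (simp add: c_def sum_distrib_left sum_distrib_right mult_ac)
    finally show ?thesis .
  qed
  have \<zeta>_top: "(\<zeta> h \<longlongrightarrow> 0) at_top" for h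
  proof -
    have "((\<lambda>t. \<Sum>j\<in>P. U T h $ j *\<^sub>R column j (\<Phi> t)) \<longlongrightarrow> (\<Sum>j\<in>P. U T h $ j *\<^sub>R 0)) at_top"
      by (intro tendsto_intros P)
    then have "((\<lambda>t. \<Sum>j\<in>P. U T h $ j *\<^sub>R column j (\<Phi> t)) \<longlongrightarrow> 0) at_top" by simp
    moreover have "\<forall>\<^sub>F t in at_top. (\<Sum>j\<in>P. U T h $ j *\<^sub>R column j (\<Phi> t)) = \<zeta> h t"
      using eventually_ge_at_top[of T]
    proof eventually_elim
      case (elim t)
      have "\<zeta> h t = (\<Sum>j\<in>UNIV. (U T h - Pr (U T h)) $ j *\<^sub>R column j (\<Phi> t))" unfolding \<zeta>_sum U_right[OF elim] ..
      also have "\<dots> = (\<Sum>j\<in>P. (U T h - Pr (U T h)) $ j *\<^sub>R column j (\<Phi> t))"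
        by (intro sum.mono_neutral_right) (auto simp: Pr_def UE)
      also have "\<dots> = (\<Sum>j\<in>P. U T h $ j *\<^sub>R column j (\<Phi> t))"
        by (intro sum.cong) (auto simp: Pr_def)
      finally show ?case by simp
    qed
    ultimately show ?thesis by (rule Lim_transform_eventually)
  qed
  have \<zeta>_bot: "(\<zeta> h \<longlongrightarrow> 0) at_bot" for h
  proof -
    have "((\<lambda>t. \<Sum>j\<in>-P-E. (- Pr (U T h)) $ j *\<^sub>R column j (\<Phi> t)) \<longlongrightarrow> (\<Sum>j\<in>-P-E. (- Pr (U T h)) $ j *\<^sub>R 0)) at_bot"
      by (intro tendsto_intros N) auto
    then have "((\<lambda>t. \<Sum>j\<in>-P-E. (- Pr (U T h)) $ j *\<^sub>R column j (\<Phi> t)) \<longlongrightarrow> 0) at_bot" by simp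
    moreover have "\<forall>\<^sub>F t in at_bot. (\<Sum>j\<in>-P-E. (- Pr (U T h)) $ j *\<^sub>R column j (\<Phi> t)) = \<zeta> h t"
      using eventually_le_at_bot[of "-T"]
    proof eventually_elim
      case (elim t)
      have "\<zeta> h t = (\<Sum>j\<in>UNIV. (- Pr (U T h)) $ j *\<^sub>R column j (\<Phi> t))" unfolding \<zeta>_sum U_left[OF elim] by simp
      also have "\<dots> = (\<Sum>j\<in>-P-E. (- Pr (U T h)) $ j *\<^sub>R column j (\<Phi> t))"
        by (intro sum.mono_neutral_right) (auto simp: Pr_def)
      finally show ?case by simp
    qed
    ultimately show ?thesis by (rule Lim_transform_eventually)
  qed
  define Z where "Z h = Bcontfun (\<zeta> h)" for h
  have Z: "apply_bcontfun (Z h) = \<zeta> h" for h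
    unfolding Z_def by (rule apply_Bcontfun[OF has_vector_derivative_imp_continuous_on[OF \<zeta>'] \<zeta>b])
  have Pr: "Pr (v + w) = Pr v + Pr w" "Pr (r *\<^sub>R v) = r *\<^sub>R Pr v" for v w r by (auto simp: Pr_def vec_eq_iff)
  have Zlin: "bounded_linear Z"
  proof (rule bounded_linear_intro[where K=c])
    fix h k :: "real \<Rightarrow>\<^sub>C (real ^ 'n)" and r :: real
    show "Z (h + k) = Z h + Z k"
      by (rule bcontfun_eqI)
         (simp add: Z \<zeta>_def Ulin Pr matrix_vector_right_distrib matrix_vector_mult_diff_distrib)
    show "Z (r *\<^sub>R h) = r *\<^sub>R Z h"
      by (rule bcontfun_eqI)
         (simp add: Z \<zeta>_def Ulin Pr matrix_vector_mult_scaleR matrix_vector_mult_diff_distrib scaleR_diff_right)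
    show "norm (Z h) \<le> norm h * c" by (rule norm_bound) (use \<zeta>b in \<open>simp add: Z mult.commute\<close>)
  qed
  show ?thesis
  proof (rule that[of "\<lambda>h. K h + Z h" \<Lambda>])
    show "bounded_linear (\<lambda>h. K h + Z h)" by (intro bounded_linear_add K Zlin)
    show "bounded_linear (\<Lambda> k)" for k by (rule \<Lambda>lin)
    fix h :: "real \<Rightarrow>\<^sub>C (real ^ 'n)"
    have KZ: "apply_bcontfun (K h + Z h) = (\<lambda>t. apply_bcontfun (K h) t + \<zeta> h t)" by (simp add: plus_bcontfun.rep_eq Z)
    show "(apply_bcontfun (K h + Z h) has_vector_derivative A t *v apply_bcontfun (K h + Z h) t + apply_bcontfun h t - (\<Sum>k\<in>E. \<Lambda> k h *\<^sub>R \<rho> k t)) (at t)" for t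
      unfolding KZ
      by (rule has_vector_derivative_eq_rhs[OF has_vector_derivative_add[OF K(2) \<zeta>']])
        (simp add: \<kappa> dA_def matrix_vector_right_distrib matrix_vector_mult_diff_rdistrib)
    show "(apply_bcontfun (K h + Z h) \<longlongrightarrow> 0) at_top" if "(apply_bcontfun h \<longlongrightarrow> 0) at_top"
      unfolding KZ using tendsto_add[OF K(3)[OF that] \<zeta>_top[of h]] by simp
    show "(apply_bcontfun (K h + Z h) \<longlongrightarrow> 0) at_bot" if "(apply_bcontfun h \<longlongrightarrow> 0) at_bot"
      unfolding KZ using tendsto_add[OF K(4)[OF that] \<zeta>_bot[of h]] by simp
    fix k assume k: "k \<in> E"
    define p where "p t = \<Theta> t $ k \<bullet> apply_bcontfun (K h) t" for t
    have p': "(p has_vector_derivative (\<Theta> t $ k \<bullet> apply_bcontfun h t - \<Theta> t $ k \<bullet> apply_bcontfun (D (K h)) t)) (at t)" for t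
    proof -
      have "((\<lambda>t. \<Theta> t *v apply_bcontfun (K h) t) has_vector_derivative
          \<Theta> t *v (B t *v apply_bcontfun (K h) t + apply_bcontfun h t) + - (\<Theta> t ** A t) *v apply_bcontfun (K h) t) (at t)"
        by (rule bounded_bilinear.has_vector_derivative[OF bounded_bilinear_matrix_vector_mult \<Theta>' K(2)])
      from bounded_linear.has_vector_derivative[OF bounded_linear_vec_nth this, of k]
      have "(p has_vector_derivative (\<Theta> t *v (B t *v apply_bcontfun (K h) t + apply_bcontfun h t) + - (\<Theta> t ** A t) *v apply_bcontfun (K h) t) $ k) (at t)"
        unfolding p_def[abs_def] by (simp add: matrix_vector_mul_component)
      moreover have "(\<Theta> t *v (B t *v apply_bcontfun (K h) t + apply_bcontfun h t) + - (\<Theta> t ** A t) *v apply_bcontfun (K h) t)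
         = \<Theta> t *v (apply_bcontfun h t - dA t *v apply_bcontfun (K h) t)"
      proof -
        have neg: "- (\<Theta> t ** A t) *v x = - (\<Theta> t *v (A t *v x))" for x
          using matrix_vector_mult_diff_rdistrib[of 0 "\<Theta> t ** A t" x] by (simp add: matrix_vector_mul_assoc)
        show ?thesis
          unfolding neg dA_def matrix_vector_right_distrib matrix_vector_mult_diff_rdistrib matrix_vector_mult_diff_distrib
          by simp
      qed
      ultimately show ?thesis
        by (simp add: matrix_vector_mul_component inner_diff_right D)
    qed
    have K_bd: "norm (apply_bcontfun (K h) t) \<le> norm (K h)" for t by (rule norm_bounded)
    have p0: "(p \<longlongrightarrow> 0) F" if "(\<psi> k \<longlongrightarrow> 0) F" for F
    proof (rule Lim_null_comparison)
      show "\<forall>\<^sub>F t in F. norm (p t) \<le> norm (\<psi> k t) * norm (K h)"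
      proof (intro always_eventually allI)
        fix t
        have "norm (p t) \<le> norm (\<psi> k t) * norm (apply_bcontfun (K h) t)"
          unfolding p_def \<psi> by (simp add: Cauchy_Schwarz_ineq2)
        also have "\<dots> \<le> norm (\<psi> k t) * norm (K h)" by (intro mult_left_mono K_bd) auto
        finally show "norm (p t) \<le> norm (\<psi> k t) * norm (K h)" .
      qed
      show "((\<lambda>t. norm (\<psi> k t) * norm (K h)) \<longlongrightarrow> 0) F"
        using tendsto_mult_left_zero[OF tendsto_norm_zero[OF that]] .
    qed
    have eq: "p S - p (-S) + \<Lambda> k h = integral {-S..S} (\<lambda>t. \<psi> k t \<bullet> apply_bcontfun h t)" if S: "S \<ge> T" for S
    proof -
      have c1: "continuous_on UNIV (\<lambda>t. \<Theta> t $ k \<bullet> apply_bcontfun u t)" for u by (intro continuous_intros \<psi>c) auto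
      have i1: "(\<lambda>t. \<Theta> t $ k \<bullet> apply_bcontfun u t) integrable_on {-S..S}" for u
        by (intro integrable_continuous_real continuous_on_subset[OF c1]) auto
      have "((\<lambda>t. \<Theta> t $ k \<bullet> apply_bcontfun h t - \<Theta> t $ k \<bullet> apply_bcontfun (D (K h)) t) has_integral p S - p (-S)) {-S..S}"
        by (rule fundamental_theorem_of_calculus) (use S T p' in \<open>auto intro: has_vector_derivative_at_within\<close>)
      then have "p S - p (-S) = integral {-S..S} (\<lambda>t. \<Theta> t $ k \<bullet> apply_bcontfun h t) - integral {-S..S} (\<lambda>t. \<Theta> t $ k \<bullet> apply_bcontfun (D (K h)) t)"
        by (subst integral_diff[OF i1 i1, symmetric], intro integral_unique[symmetric])
      moreover have "integral {-S..S} (\<lambda>t. \<Theta> t $ k \<bullet> apply_bcontfun (D (K h)) t) = \<Lambda> k h"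
        unfolding \<Lambda>_def by (rule integral_vanishing_outside[OF c1]) (use S dA0 in \<open>auto simp: D\<close>)
      ultimately show ?thesis by (simp add: \<psi>)
    qed
    have "((\<lambda>S. p S - p (-S) + \<Lambda> k h) \<longlongrightarrow> 0 - 0 + \<Lambda> k h) at_top"
      by (intro tendsto_intros p0[OF E(1)[OF k]] filterlim_compose[OF p0[OF E(2)[OF k]] filterlim_uminus_at_bot_at_top])
    then have "((\<lambda>S. p S - p (-S) + \<Lambda> k h) \<longlongrightarrow> \<Lambda> k h) at_top" by simp
    then show "((\<lambda>S. integral {-S..S} (\<lambda>t. \<psi> k t \<bullet> apply_bcontfun h t)) \<longlongrightarrow> \<Lambda> k h) at_top"
      by (rule Lim_transform_eventually) (use eq in \<open>auto simp: eventually_at_top_linorder\<close>)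
  qed
qed

section \<open>Contraction and remainder estimates\<close>

text \<open>The dependence on \<open>Z\<close> carries the factor \<open>\<bar>a\<bar>\<close>, so a
  ball large enough for all \<open>T \<sigma> 0 0\<close> is fixed first and \<open>a\<close> is
  made small afterwards. The closed set \<open>V\<close> serves to carry decay at both ends through
  the iteration.\<close>

lemma parametric_contraction:
  fixes T :: "real \<Rightarrow> real \<Rightarrow> 'z::{real_normed_vector, complete_space} \<Rightarrow> 'z"
  assumes lip: "\<And>M. \<exists>L\<ge>0. \<forall>\<sigma>\<in>{0..2}. \<forall>\<sigma>'\<in>{0..2}. \<forall>a Z Z'. \<bar>a\<bar> \<le> 1 \<longrightarrow> norm Z \<le> M \<longrightarrow> norm Z' \<le> M \<longrightarrow>
      norm (T \<sigma> a Z - T \<sigma>' a Z') \<le> L * (\<bar>\<sigma> - \<sigma>'\<bar> + \<bar>a\<bar> * norm (Z - Z')) \<and> norm (T \<sigma> a Z - T \<sigma> 0 0) \<le> L * \<bar>a\<bar>"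
    and V: "closed V" "0 \<in> V" "\<And>\<sigma> a Z. \<sigma> \<in> {0..2} \<Longrightarrow> \<bar>a\<bar> \<le> a1 \<Longrightarrow> Z \<in> V \<Longrightarrow> T \<sigma> a Z \<in> V"
    and a1: "0 < a1" "a1 \<le> 1"
  obtains a0 M where "0 < a0" "a0 \<le> a1" "0 \<le> M"
    "\<And>a. \<bar>a\<bar> \<le> a0 \<Longrightarrow> \<exists>Z. continuous_on {0..2} Z \<and> (\<forall>\<sigma>\<in>{0..2}. Z \<sigma> \<in> V \<and> norm (Z \<sigma>) \<le> M \<and> T \<sigma> a (Z \<sigma>) = Z \<sigma>)"
proof -
  obtain L0 where L0: "L0 \<ge> 0" "\<And>\<sigma>. \<sigma> \<in> {0..2} \<Longrightarrow> norm (T \<sigma> 0 0 - T 0 0 0) \<le> L0 * \<bar>\<sigma>\<bar>"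
  proof -
    from lip[of 0] obtain L where L: "L \<ge> 0" "\<forall>\<sigma>\<in>{0..2}. \<forall>\<sigma>'\<in>{0..2}. \<forall>a Z Z'. \<bar>a\<bar> \<le> 1 \<longrightarrow> norm Z \<le> 0 \<longrightarrow> norm Z' \<le> 0 \<longrightarrow>
      norm (T \<sigma> a Z - T \<sigma>' a Z') \<le> L * (\<bar>\<sigma> - \<sigma>'\<bar> + \<bar>a\<bar> * norm (Z - Z')) \<and> norm (T \<sigma> a Z - T \<sigma> 0 0) \<le> L * \<bar>a\<bar>" by auto
    show ?thesis
    proof (rule that[OF L(1)])
      fix \<sigma> :: real assume "\<sigma> \<in> {0..2}"
      then show "norm (T \<sigma> 0 0 - T 0 0 0) \<le> L * \<bar>\<sigma>\<bar>" using L(2)[rule_format, of \<sigma> 0 0 0 0] by simp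
    qed
  qed
  \<comment> \<open>\<open>2 * L0\<close> covers the variation over
    \<open>\<sigma> \<in> {0..2}\<close>; the margin 1 absorbs the displacement of size
    \<open>L * \<bar>a\<bar>\<close> caused by \<open>a \<noteq> 0\<close>.\<close>
  define M where "M = norm (T 0 0 0) + 2 * L0 + 1"
  have M: "M \<ge> 1" using L0 by (simp add: M_def)
  have T0: "norm (T \<sigma> 0 0) \<le> M - 1" if "\<sigma> \<in> {0..2}" for \<sigma>
  proof -
    have "L0 * \<bar>\<sigma>\<bar> \<le> L0 * 2" using that L0 by (intro mult_left_mono) auto
    then show ?thesis using L0(2)[OF that] norm_triangle_sub[of "T \<sigma> 0 0" "T 0 0 0"] by (simp add: M_def)
  qed
  from lip[of M] obtain L where L: "L \<ge> 0" "\<forall>\<sigma>\<in>{0..2}. \<forall>\<sigma>'\<in>{0..2}. \<forall>a Z Z'. \<bar>a\<bar> \<le> 1 \<longrightarrow> norm Z \<le> M \<longrightarrow> norm Z' \<le> M \<longrightarrow>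
      norm (T \<sigma> a Z - T \<sigma>' a Z') \<le> L * (\<bar>\<sigma> - \<sigma>'\<bar> + \<bar>a\<bar> * norm (Z - Z')) \<and> norm (T \<sigma> a Z - T \<sigma> 0 0) \<le> L * \<bar>a\<bar>" by auto
  note Ld = L(2)[rule_format, THEN conjunct1] and Lz = L(2)[rule_format, THEN conjunct2]
  define a0 where "a0 = min a1 (1 / (2 * (L + 1)))"
  have a0: "0 < a0" "a0 \<le> a1" using L(1) a1 by (auto simp: a0_def)
  have "L * a0 \<le> L * (1 / (2 * (L + 1)))" using L(1) by (intro mult_left_mono) (auto simp: a0_def)
  also have "\<dots> \<le> 1/2" using L(1) by (simp add: field_simps)
  finally have La0: "L * a0 \<le> 1/2" .
  show ?thesis
  proof (rule that[of a0 M])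
    fix a :: real assume a: "\<bar>a\<bar> \<le> a0"
    have La: "L * \<bar>a\<bar> \<le> 1/2" using mult_left_mono[OF a L(1)] La0 by linarith
    have aa1: "\<bar>a\<bar> \<le> a1" using a a0 by linarith
    then have a1: "\<bar>a\<bar> \<le> 1" using a1 by linarith
    let ?S = "V \<inter> cball 0 M"
    have fixpt: "\<exists>Z\<in>?S. T \<sigma> a Z = Z" if \<sigma>: "\<sigma> \<in> {0..2}" for \<sigma>
    proof -
      have "\<exists>!Z\<in>?S. T \<sigma> a Z = Z"
      proof (rule Banach_fix[of _ "1/2"])
        show "complete ?S" using V by (auto intro: closed_Int simp: complete_eq_closed)
        show "?S \<noteq> {}" using V(2) M by auto
        show "T \<sigma> a ` ?S \<subseteq> ?S"
        proof (intro image_subsetI IntI)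
          fix Z assume Z: "Z \<in> ?S"
          show "T \<sigma> a Z \<in> V" using V(3)[OF \<sigma> aa1] Z by auto
          have "norm (T \<sigma> a Z - T \<sigma> 0 0) \<le> L * \<bar>a\<bar>" using Z M by (intro Lz[OF \<sigma> \<sigma> a1, of Z 0]) auto
          then have "norm (T \<sigma> a Z) \<le> M" using T0[OF \<sigma>] La norm_triangle_sub[of "T \<sigma> a Z" "T \<sigma> 0 0"] by linarith
          then show "T \<sigma> a Z \<in> cball 0 M" by simp
        qed
        fix Z Z' assume Z: "Z \<in> ?S" "Z' \<in> ?S"
        have "norm (T \<sigma> a Z - T \<sigma> a Z') \<le> L * (\<bar>\<sigma> - \<sigma>\<bar> + \<bar>a\<bar> * norm (Z - Z'))"
          using Z by (intro Ld[OF \<sigma> \<sigma> a1]) auto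
        also have "\<dots> = (L * \<bar>a\<bar>) * norm (Z - Z')" by simp
        also have "\<dots> \<le> 1/2 * norm (Z - Z')" by (intro mult_right_mono La) auto
        finally show "dist (T \<sigma> a Z) (T \<sigma> a Z') \<le> 1/2 * dist Z Z'" by (simp add: dist_norm)
      qed auto
      then show ?thesis by blast
    qed
    then obtain Z where Z: "\<And>\<sigma>. \<sigma> \<in> {0..2} \<Longrightarrow> Z \<sigma> \<in> ?S" "\<And>\<sigma>. \<sigma> \<in> {0..2} \<Longrightarrow> T \<sigma> a (Z \<sigma>) = Z \<sigma>" by metis
    have ZL: "norm (Z \<sigma> - Z \<sigma>') \<le> 2 * L * \<bar>\<sigma> - \<sigma>'\<bar>" if \<sigma>: "\<sigma> \<in> {0..2}" "\<sigma>' \<in> {0..2}" for \<sigma> \<sigma>'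
    proof -
      have "norm (Z \<sigma> - Z \<sigma>') \<le> L * (\<bar>\<sigma> - \<sigma>'\<bar> + \<bar>a\<bar> * norm (Z \<sigma> - Z \<sigma>'))"
        using Ld[OF \<sigma> a1, of "Z \<sigma>" "Z \<sigma>'"] Z(1)[OF \<sigma>(1)] Z(1)[OF \<sigma>(2)] Z(2)[OF \<sigma>(1)] Z(2)[OF \<sigma>(2)] by simp
      also have "\<dots> = L * \<bar>\<sigma> - \<sigma>'\<bar> + (L * \<bar>a\<bar>) * norm (Z \<sigma> - Z \<sigma>')" by (simp add: algebra_simps)
      also have "\<dots> \<le> L * \<bar>\<sigma> - \<sigma>'\<bar> + 1/2 * norm (Z \<sigma> - Z \<sigma>')" by (intro add_left_mono mult_right_mono La) auto
      finally show ?thesis by simp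
    qed
    have "continuous_on {0..2} Z"
    proof (rule continuous_onI)
      fix \<sigma> e :: real assume "\<sigma> \<in> {0..2}" "e > 0"
      show "\<exists>d>0. \<forall>\<sigma>'\<in>{0..2}. dist \<sigma>' \<sigma> < d \<longrightarrow> dist (Z \<sigma>') (Z \<sigma>) \<le> e"
      proof (intro exI[of _ "e / (2 * L + 1)"] conjI ballI impI)
        show "e / (2 * L + 1) > 0" using L(1) \<open>e > 0\<close> by simp
        fix \<sigma>' assume s: "\<sigma>' \<in> {0..2}" "dist \<sigma>' \<sigma> < e / (2 * L + 1)"
        have "2 * L * \<bar>\<sigma>' - \<sigma>\<bar> \<le> (2 * L + 1) * \<bar>\<sigma>' - \<sigma>\<bar>" by (intro mult_right_mono) auto
        also have "\<dots> \<le> e" using s(2) L(1) by (simp add: dist_real_def field_simps)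
        finally show "dist (Z \<sigma>') (Z \<sigma>) \<le> e" using ZL[OF s(1) \<open>\<sigma> \<in> {0..2}\<close>] by (simp add: dist_norm)
      qed
    qed
    then show "\<exists>Z. continuous_on {0..2} Z \<and> (\<forall>\<sigma>\<in>{0..2}. Z \<sigma> \<in> V \<and> norm (Z \<sigma>) \<le> M \<and> T \<sigma> a (Z \<sigma>) = Z \<sigma>)"
      using Z by (intro exI[of _ Z]) auto
  qed (use a0 M in auto)
qed

lemma norm_quadruple_le:
  "norm ((x, b :: real), (y, c :: real), (z, d :: real), e :: real) \<le>
     norm x + \<bar>b\<bar> + (norm y + \<bar>c\<bar>) + (norm z + \<bar>d\<bar>) + \<bar>e\<bar>"
  using norm_Pair_le[of "(x, b)" "((y, c), (z, d), e)"] norm_Pair_le[of "(y, c)" "((z, d), e)"]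
    norm_Pair_le[of "(z, d)" e] norm_Pair_le[of x b] norm_Pair_le[of y c] norm_Pair_le[of z d]
  unfolding real_norm_def by linarith

text \<open>The superposition operator of the Taylor remainder, in the phase space extended by the
  parameter. The entry \<open>c\<close> beside the quadratic direction is how
  \<open>\<mu> = c * a\<^sup>2\<close> enters: the parameter moves at second order along the
  curve.\<close>

definition remainder_op ::
  "(('a::real_normed_vector \<times> real) \<times> ('a \<times> real) \<times> ('a \<times> real) \<times> real \<Rightarrow> 'a) \<Rightarrow> (real \<Rightarrow>\<^sub>C 'a) \<Rightarrow> (real \<Rightarrow>\<^sub>C 'a) \<Rightarrow>
    (real \<Rightarrow>\<^sub>C 'a) \<Rightarrow> (real \<Rightarrow>\<^sub>C 'a) \<Rightarrow> real \<Rightarrow> real \<Rightarrow> real \<Rightarrow> (real \<Rightarrow>\<^sub>C 'a) \<Rightarrow> (real \<Rightarrow>\<^sub>C 'a)" where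
  "remainder_op R xh p \<xi>1 \<xi>2 c \<sigma> a Z = Bcontfun (\<lambda>t. R ((apply_bcontfun xh t, 0), (\<sigma> *\<^sub>R apply_bcontfun p t, 0),
      (c *\<^sub>R apply_bcontfun \<xi>1 t + \<sigma>\<^sup>2 *\<^sub>R apply_bcontfun \<xi>2 t + a *\<^sub>R apply_bcontfun Z t, c), a))"

context
  fixes R :: "('a::real_normed_vector \<times> real) \<times> ('a \<times> real) \<times> ('a \<times> real) \<times> real \<Rightarrow> 'a"
  assumes R: "\<And>M. \<exists>L\<ge>0. \<forall>x y. norm x \<le> M \<longrightarrow> norm y \<le> M \<longrightarrow> norm (R x - R y) \<le> L * norm (x - y)"
begin

lemma apply_remainder_op:
  "apply_bcontfun (remainder_op R xh p \<xi>1 \<xi>2 c \<sigma> a Z) = (\<lambda>t. R ((apply_bcontfun xh t, 0), (\<sigma> *\<^sub>R apply_bcontfun p t, 0),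
      (c *\<^sub>R apply_bcontfun \<xi>1 t + \<sigma>\<^sup>2 *\<^sub>R apply_bcontfun \<xi>2 t + a *\<^sub>R apply_bcontfun Z t, c), a))"
proof -
  define v where "v t = ((apply_bcontfun xh t, 0::real), (\<sigma> *\<^sub>R apply_bcontfun p t, 0::real),
      (c *\<^sub>R apply_bcontfun \<xi>1 t + \<sigma>\<^sup>2 *\<^sub>R apply_bcontfun \<xi>2 t + a *\<^sub>R apply_bcontfun Z t, c), a)" for t
  define M where "M = norm xh + \<bar>\<sigma>\<bar> * norm p + (\<bar>c\<bar> * norm \<xi>1 + \<sigma>\<^sup>2 * norm \<xi>2 + \<bar>a\<bar> * norm Z + \<bar>c\<bar>) + \<bar>a\<bar>"
  have vc: "continuous_on UNIV v" unfolding v_def by (intro continuous_intros) auto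
  have vM: "norm (v t) \<le> M" for t
  proof -
    have n: "norm (apply_bcontfun u t) \<le> norm u" for u :: "real \<Rightarrow>\<^sub>C 'a" by (rule norm_bounded)
    have "norm (c *\<^sub>R apply_bcontfun \<xi>1 t + \<sigma>\<^sup>2 *\<^sub>R apply_bcontfun \<xi>2 t + a *\<^sub>R apply_bcontfun Z t) \<le> \<bar>c\<bar> * norm \<xi>1 + \<sigma>\<^sup>2 * norm \<xi>2 + \<bar>a\<bar> * norm Z"
      by (intro norm_triangle_mono) (auto intro!: mult_left_mono n)
    moreover have "norm (\<sigma> *\<^sub>R apply_bcontfun p t) \<le> \<bar>\<sigma>\<bar> * norm p" by (auto intro!: mult_left_mono n)
    moreover have "norm (v t) \<le> norm (apply_bcontfun xh t) + \<bar>0\<bar> + (norm (\<sigma> *\<^sub>R apply_bcontfun p t) + \<bar>0\<bar>) +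
      (norm (c *\<^sub>R apply_bcontfun \<xi>1 t + \<sigma>\<^sup>2 *\<^sub>R apply_bcontfun \<xi>2 t + a *\<^sub>R apply_bcontfun Z t) + \<bar>c\<bar>) + \<bar>a\<bar>"
      unfolding v_def by (rule norm_quadruple_le)
    ultimately show ?thesis unfolding M_def using n[of xh] by linarith
  qed
  obtain L where L: "L \<ge> 0" "\<And>x y. norm x \<le> M \<Longrightarrow> norm y \<le> M \<Longrightarrow> norm (R x - R y) \<le> L * norm (x - y)" using R[of M] by auto
  have "continuous_on UNIV (\<lambda>t. R (v t))"
  proof -
    have "continuous_on (cball 0 M) R"
    proof (rule lipschitz_on_continuous_on[of L], rule lipschitz_onI)
      fix x y :: "('a \<times> real) \<times> ('a \<times> real) \<times> ('a \<times> real) \<times> real"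
      assume "x \<in> cball 0 M" "y \<in> cball 0 M"
      then show "dist (R x) (R y) \<le> L * dist x y" unfolding dist_norm mem_cball_0 by (rule L(2))
    qed (rule L(1))
    then show ?thesis by (rule continuous_on_compose2[OF _ vc]) (use vM in auto)
  qed
  moreover have "norm (R (v t)) \<le> norm (R (v 0)) + L * (M + M)" for t
  proof -
    have "norm (R (v t) - R (v 0)) \<le> L * norm (v t - v 0)" by (intro L vM)
    also have "\<dots> \<le> L * (M + M)" using vM[of t] vM[of 0] by (intro mult_left_mono L norm_triangle_le_diff) auto
    finally show ?thesis using norm_triangle_sub[of "R (v t)" "R (v 0)"] by linarith
  qed
  ultimately have "apply_bcontfun (Bcontfun (\<lambda>t. R (v t))) = (\<lambda>t. R (v t))" by (rule apply_Bcontfun)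
  then show ?thesis unfolding remainder_op_def v_def .
qed

text \<open>\<open>Z\<close> occurs only multiplied by \<open>a\<close>, which is the source of the
  factor \<open>\<bar>a\<bar>\<close> in front of \<open>norm (Z - Z')\<close>. The quadratic
  dependence on \<open>\<sigma>\<close> is Lipschitz with constant 4 on
  \<open>{0..2}\<close>.\<close>

lemma remainder_op_Lipschitz:
  "\<exists>L\<ge>0. \<forall>\<sigma>\<in>{0..2}. \<forall>\<sigma>'\<in>{0..2}. \<forall>a Z Z'. \<bar>a\<bar> \<le> 1 \<longrightarrow> norm Z \<le> M \<longrightarrow> norm Z' \<le> M \<longrightarrow>
      norm (remainder_op R xh p \<xi>1 \<xi>2 c \<sigma> a Z - remainder_op R xh p \<xi>1 \<xi>2 c \<sigma>' a Z') \<le> L * (\<bar>\<sigma> - \<sigma>'\<bar> + \<bar>a\<bar> * norm (Z - Z'))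
      \<and> norm (remainder_op R xh p \<xi>1 \<xi>2 c \<sigma> a Z - remainder_op R xh p \<xi>1 \<xi>2 c \<sigma> 0 0) \<le> L * \<bar>a\<bar>"
proof -
  define v where "v \<sigma> a Z t = ((apply_bcontfun xh t, 0::real), (\<sigma> *\<^sub>R apply_bcontfun p t, 0::real),
      (c *\<^sub>R apply_bcontfun \<xi>1 t + \<sigma>\<^sup>2 *\<^sub>R apply_bcontfun \<xi>2 t + a *\<^sub>R apply_bcontfun Z t, c), a)" for \<sigma> a Z t
  define B where "B = norm xh + 2 * norm p + (\<bar>c\<bar> * norm \<xi>1 + 4 * norm \<xi>2 + 1 * M + \<bar>c\<bar>) + 1"
  have n: "norm (apply_bcontfun u t) \<le> norm u" for u :: "real \<Rightarrow>\<^sub>C 'a" and t by (rule norm_bounded)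
  have vB: "norm (v \<sigma> a Z t) \<le> B" if s: "\<sigma> \<in> {0..2}" and a: "\<bar>a\<bar> \<le> 1" and Z: "norm Z \<le> M" for \<sigma> a Z t
  proof -
    have s2: "\<sigma>\<^sup>2 \<le> 4" using s power_mono[of \<sigma> 2 2] by auto
    have "norm (c *\<^sub>R apply_bcontfun \<xi>1 t) \<le> \<bar>c\<bar> * norm \<xi>1" by (auto intro!: mult_left_mono n)
    moreover have "norm (\<sigma>\<^sup>2 *\<^sub>R apply_bcontfun \<xi>2 t) \<le> 4 * norm \<xi>2" using s2 by (auto intro!: mult_mono n)
    moreover have "norm (a *\<^sub>R apply_bcontfun Z t) \<le> 1 * M"
      unfolding norm_scaleR real_norm_def using a order_trans[OF n Z] by (intro mult_mono) auto
    ultimately have "norm (c *\<^sub>R apply_bcontfun \<xi>1 t + \<sigma>\<^sup>2 *\<^sub>R apply_bcontfun \<xi>2 t + a *\<^sub>R apply_bcontfun Z t) \<le> \<bar>c\<bar> * norm \<xi>1 + 4 * norm \<xi>2 + 1 * M"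
      by (intro norm_triangle_mono)
    moreover have "norm (\<sigma> *\<^sub>R apply_bcontfun p t) \<le> 2 * norm p" unfolding norm_scaleR using s by (intro mult_mono n) auto
    moreover have "norm (v \<sigma> a Z t) \<le> norm (apply_bcontfun xh t) + \<bar>0\<bar> + (norm (\<sigma> *\<^sub>R apply_bcontfun p t) + \<bar>0\<bar>) +
      (norm (c *\<^sub>R apply_bcontfun \<xi>1 t + \<sigma>\<^sup>2 *\<^sub>R apply_bcontfun \<xi>2 t + a *\<^sub>R apply_bcontfun Z t) + \<bar>c\<bar>) + \<bar>a\<bar>"
      unfolding v_def by (rule norm_quadruple_le)
    ultimately show ?thesis unfolding B_def using n[of xh t] a by linarith
  qed
  obtain L where L: "L \<ge> 0" "\<And>x y. norm x \<le> B \<Longrightarrow> norm y \<le> B \<Longrightarrow> norm (R x - R y) \<le> L * norm (x - y)" using R[of B] by auto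
  define K where "K = norm p + 4 * norm \<xi>2 + 1 + \<bar>M\<bar>"
  have K: "1 \<le> K" "norm p + 4 * norm \<xi>2 \<le> K" "M + 1 \<le> K"
    unfolding K_def using norm_ge_zero[of p] norm_ge_zero[of \<xi>2] by linarith+
  define L' where "L' = L * K"
  have L': "L' \<ge> 0" using L K by (simp add: L'_def)
  have op: "apply_bcontfun (remainder_op R xh p \<xi>1 \<xi>2 c \<sigma> a Z) t = R (v \<sigma> a Z t)" for \<sigma> a Z t
    unfolding apply_remainder_op v_def ..
  show ?thesis
  proof (intro exI[of _ L'] conjI ballI allI impI L')
    fix \<sigma> \<sigma>' a :: real and Z Z' :: "real \<Rightarrow>\<^sub>C 'a"
    assume s: "\<sigma> \<in> {0..2}" "\<sigma>' \<in> {0..2}" and a: "\<bar>a\<bar> \<le> 1" and Z: "norm Z \<le> M" "norm Z' \<le> M"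
    have M0: "M \<ge> 0" using Z norm_ge_zero order_trans by blast
    show "norm (remainder_op R xh p \<xi>1 \<xi>2 c \<sigma> a Z - remainder_op R xh p \<xi>1 \<xi>2 c \<sigma>' a Z') \<le> L' * (\<bar>\<sigma> - \<sigma>'\<bar> + \<bar>a\<bar> * norm (Z - Z'))"
    proof (rule norm_bound)
      fix t
      let ?d = "\<bar>\<sigma> - \<sigma>'\<bar>"
      have d: "v \<sigma> a Z t - v \<sigma>' a Z' t = ((0, 0), ((\<sigma> - \<sigma>') *\<^sub>R apply_bcontfun p t, 0), ((\<sigma>\<^sup>2 - \<sigma>'\<^sup>2) *\<^sub>R apply_bcontfun \<xi>2 t + a *\<^sub>R apply_bcontfun (Z - Z') t, 0), 0)"
        unfolding v_def by (simp add: algebra_simps zero_prod_def)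
      have sq: "\<bar>\<sigma>\<^sup>2 - \<sigma>'\<^sup>2\<bar> \<le> 4 * ?d"
      proof -
        have "\<sigma>\<^sup>2 - \<sigma>'\<^sup>2 = (\<sigma> + \<sigma>') * (\<sigma> - \<sigma>')" by (simp add: power2_eq_square algebra_simps)
        then have "\<bar>\<sigma>\<^sup>2 - \<sigma>'\<^sup>2\<bar> = \<bar>\<sigma> + \<sigma>'\<bar> * ?d" by (simp add: abs_mult)
        also have "\<dots> \<le> 4 * ?d" using s by (intro mult_right_mono) auto
        finally show ?thesis .
      qed
      have "norm (v \<sigma> a Z t - v \<sigma>' a Z' t) = norm ((((0, 0), ((\<sigma> - \<sigma>') *\<^sub>R apply_bcontfun p t, 0), ((\<sigma>\<^sup>2 - \<sigma>'\<^sup>2) *\<^sub>R apply_bcontfun \<xi>2 t + a *\<^sub>R apply_bcontfun (Z - Z') t, 0), 0)) ::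
          ('a \<times> real) \<times> ('a \<times> real) \<times> ('a \<times> real) \<times> real)" unfolding d ..
      also have "\<dots> \<le> norm ((\<sigma> - \<sigma>') *\<^sub>R apply_bcontfun p t) + norm ((\<sigma>\<^sup>2 - \<sigma>'\<^sup>2) *\<^sub>R apply_bcontfun \<xi>2 t + a *\<^sub>R apply_bcontfun (Z - Z') t)"
        by (rule order_trans[OF norm_quadruple_le]) simp
      also have "\<dots> \<le> ?d * norm p + (4 * ?d * norm \<xi>2 + \<bar>a\<bar> * norm (Z - Z'))"
      proof (intro add_mono norm_triangle_mono; unfold norm_scaleR real_norm_def)
        show "?d * norm (apply_bcontfun p t) \<le> ?d * norm p" by (intro mult_left_mono n) auto
        show "\<bar>\<sigma>\<^sup>2 - \<sigma>'\<^sup>2\<bar> * norm (apply_bcontfun \<xi>2 t) \<le> 4 * ?d * norm \<xi>2" by (intro mult_mono n sq) auto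
        show "\<bar>a\<bar> * norm (apply_bcontfun (Z - Z') t) \<le> \<bar>a\<bar> * norm (Z - Z')" by (rule mult_left_mono[OF n]) simp
      qed
      also have "\<dots> \<le> K * (?d + \<bar>a\<bar> * norm (Z - Z'))"
      proof -
        have "?d * norm p + (4 * ?d * norm \<xi>2 + \<bar>a\<bar> * norm (Z - Z')) = (norm p + 4 * norm \<xi>2) * ?d + 1 * (\<bar>a\<bar> * norm (Z - Z'))"
          by (simp add: algebra_simps)
        also have "\<dots> \<le> K * ?d + K * (\<bar>a\<bar> * norm (Z - Z'))"
          by (rule add_mono; rule mult_right_mono) (use K in auto)
        finally show ?thesis by (simp add: algebra_simps)
      qed
      finally have "norm (v \<sigma> a Z t - v \<sigma>' a Z' t) \<le> K * (?d + \<bar>a\<bar> * norm (Z - Z'))" .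
      from mult_left_mono[OF this L(1)] L(2)[OF vB[OF s(1) a Z(1)] vB[OF s(2) a Z(2)], of t t]
      show "norm ((remainder_op R xh p \<xi>1 \<xi>2 c \<sigma> a Z - remainder_op R xh p \<xi>1 \<xi>2 c \<sigma>' a Z') t) \<le> L' * (?d + \<bar>a\<bar> * norm (Z - Z'))"
        by (simp add: op L'_def mult.assoc)
    qed
    show "norm (remainder_op R xh p \<xi>1 \<xi>2 c \<sigma> a Z - remainder_op R xh p \<xi>1 \<xi>2 c \<sigma> 0 0) \<le> L' * \<bar>a\<bar>"
    proof (rule norm_bound)
      fix t
      have d: "v \<sigma> a Z t - v \<sigma> 0 0 t = ((0, 0), (0, 0), (a *\<^sub>R apply_bcontfun Z t, 0), a)"
        unfolding v_def by (simp add: algebra_simps zero_bcontfun.rep_eq zero_prod_def)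
      have "norm (((0, 0), (0, 0), (a *\<^sub>R apply_bcontfun Z t, 0), a) :: ('a \<times> real) \<times> ('a \<times> real) \<times> ('a \<times> real) \<times> real) \<le>
          \<bar>a\<bar> * norm (apply_bcontfun Z t) + \<bar>a\<bar>"
        by (rule order_trans[OF norm_quadruple_le]) simp
      also have "\<dots> \<le> \<bar>a\<bar> * M + \<bar>a\<bar>" using order_trans[OF n Z(1)] by (intro add_right_mono mult_left_mono) auto
      also have "\<dots> \<le> K * \<bar>a\<bar>"
        using mult_right_mono[OF K(3), of "\<bar>a\<bar>"] by (simp add: algebra_simps)
      finally have "norm (v \<sigma> a Z t - v \<sigma> 0 0 t) \<le> K * \<bar>a\<bar>" unfolding d .
      from mult_left_mono[OF this L(1)] L(2)[OF vB[OF s(1) a Z(1)] vB[OF s(1), of 0 0], of t t] M0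
      show "norm ((remainder_op R xh p \<xi>1 \<xi>2 c \<sigma> a Z - remainder_op R xh p \<xi>1 \<xi>2 c \<sigma> 0 0) t) \<le> L' * \<bar>a\<bar>"
        by (simp add: op L'_def mult.assoc)
    qed
  qed
qed

end

text \<open>Seen through the cutoff system \<open>B\<close>, the solution is driven by a compactly
  supported forcing. That forcing has a bounded response decaying at both ends, and uniqueness of
  bounded solutions identifies the two.\<close>

lemma bounded_homogeneous_solution_tendsto_0:
  fixes A :: "real \<Rightarrow> real ^ 'n ^ 'n"
  assumes A0: "\<And>l. complex_eigenvalue A0 l \<Longrightarrow> Re l \<noteq> 0"
    and A: "continuous_on UNIV A" "(A \<longlongrightarrow> A0) at_top" "(A \<longlongrightarrow> A0) at_bot"
    and y: "\<And>t. (y has_vector_derivative A t *v y t) (at t)" "\<And>t. norm (y t) \<le> M"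
  shows "(y \<longlongrightarrow> 0) at_top" "(y \<longlongrightarrow> 0) at_bot"
proof -
  obtain B C T where C: "C \<ge> 0" and B: "boundedly_solvable B C" and Bc: "continuous_on UNIV B" and T: "T > 0"
    and BA: "\<And>t. \<bar>t\<bar> \<ge> T \<Longrightarrow> B t = A t"
    using asymptotically_hyperbolic_cutoff[OF A0 A] by metis
  define h where "h t = (A t - B t) *v y t" for t
  have yc: "continuous_on UNIV y" by (rule has_vector_derivative_imp_continuous_on[OF y(1)])
  have hc: "continuous_on UNIV h" unfolding h_def by (intro continuous_on_matrix_vector_mult continuous_intros A Bc yc)
  have h0: "h t = 0" if "\<bar>t\<bar> \<ge> T" for t using BA[OF that] by (simp add: h_def)
  have "bounded (h ` {-T..T})" by (intro compact_imp_bounded compact_continuous_image continuous_on_subset[OF hc]) auto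
  then obtain b where b: "\<forall>x\<in>h ` {-T..T}. norm x \<le> b" by (auto simp: bounded_iff)
  have hb: "norm (h t) \<le> \<bar>b\<bar>" for t
  proof (cases "\<bar>t\<bar> \<ge> T")
    case False then have "t \<in> {-T..T}" by auto
    then have "norm (h t) \<le> b" using b by blast
    then show ?thesis by linarith
  qed (simp add: h0)
  have top: "(h \<longlongrightarrow> 0) at_top"
    by (rule tendsto_eventually) (auto simp: eventually_at_top_linorder intro!: exI[of _ T] h0)
  have bot: "(h \<longlongrightarrow> 0) at_bot"
    by (rule tendsto_eventually) (auto simp: eventually_at_bot_linorder intro!: exI[of _ "-T"] h0)
  obtain z where z: "\<forall>t. (z has_vector_derivative B t *v z t + h t) (at t)" "\<forall>t. norm (z t) \<le> C * \<bar>b\<bar>"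
    "(z \<longlongrightarrow> 0) at_top" "(z \<longlongrightarrow> 0) at_bot"
    using B hc hb top bot unfolding boundedly_solvable_def by meson
  have "\<forall>t. ((\<lambda>t. y t - z t) has_vector_derivative B t *v (y t - z t)) (at t)"
  proof
    fix t
    show "((\<lambda>t. y t - z t) has_vector_derivative B t *v (y t - z t)) (at t)"
      by (rule has_vector_derivative_eq_rhs[OF has_vector_derivative_diff[OF y(1) z(1)[rule_format]]])
        (simp add: h_def matrix_vector_mult_diff_distrib matrix_vector_mult_diff_rdistrib)
  qed
  moreover have "\<forall>t. norm (y t - z t) \<le> M + C * \<bar>b\<bar>" using y(2) z(2) by (auto intro!: norm_triangle_le_diff add_mono)
  ultimately have "y t - z t = 0" for t using B unfolding boundedly_solvable_def by blast
  then have "y = z" by (auto simp: fun_eq_iff)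
  then show "(y \<longlongrightarrow> 0) at_top" "(y \<longlongrightarrow> 0) at_bot" using z by auto
qed

section \<open>Bump functions, energy balance and uniqueness of orbits\<close>

definition hat :: "real \<Rightarrow> real" where "hat t = max 0 (1 - \<bar>t\<bar>)"

lemma hat: "continuous_on S hat" "hat t \<ge> 0" "\<bar>t\<bar> \<ge> 1 \<Longrightarrow> hat t = 0" "hat 0 = 1"
  by (auto simp: hat_def[abs_def] intro!: continuous_intros)

lemma integral_hat_norm_pos:
  fixes v :: "real \<Rightarrow> 'a::real_inner"
  assumes "continuous_on UNIV v" "v 0 \<noteq> 0"
  shows "integral {-1..1} (\<lambda>t. hat t * (v t \<bullet> v t)) > 0"
proof -
  let ?f = "\<lambda>t. hat t * (v t \<bullet> v t)"
  have c: "continuous_on {-1..1} ?f" by (intro continuous_intros hat continuous_on_subset[OF assms(1)]) auto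
  have nn: "?f t \<ge> 0" for t using hat(2) by simp
  have "integral {-1..1} ?f \<ge> 0" by (intro integral_nonneg integrable_continuous_real c nn)
  moreover have "integral {-1..1} ?f \<noteq> 0"
  proof
    assume "integral {-1..1} ?f = 0"
    then have "\<forall>t\<in>{-1..1}. ?f t = 0" using integral_eq_0_iff[of "-1" 1 ?f] c nn by simp
    then have "?f 0 = 0" by (rule bspec) auto
    then show False using assms(2) hat(4) by simp
  qed
  ultimately show ?thesis by linarith
qed

text \<open>The coefficients are the entries of the inverse of the Gram matrix of \<open>p1\<close>
  and \<open>p2\<close> with weight \<open>hat\<close>. That matrix is positive definite because a
  nontrivial combination is nonzero at 0, where \<open>hat\<close> is 1.\<close>

lemma biorthogonal_bumps:
  fixes p1 p2 :: "real \<Rightarrow> 'a::real_inner"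
  assumes c: "continuous_on UNIV p1" "continuous_on UNIV p2"
    and ind: "\<And>u v. u *\<^sub>R p1 0 + v *\<^sub>R p2 0 = 0 \<Longrightarrow> u = 0 \<and> v = 0"
  obtains m11 m12 m21 m22 :: real where
    "integral {-1..1} (\<lambda>t. p1 t \<bullet> (hat t *\<^sub>R (m11 *\<^sub>R p1 t + m12 *\<^sub>R p2 t))) = 1"
    "integral {-1..1} (\<lambda>t. p2 t \<bullet> (hat t *\<^sub>R (m11 *\<^sub>R p1 t + m12 *\<^sub>R p2 t))) = 0"
    "integral {-1..1} (\<lambda>t. p1 t \<bullet> (hat t *\<^sub>R (m21 *\<^sub>R p1 t + m22 *\<^sub>R p2 t))) = 0"
    "integral {-1..1} (\<lambda>t. p2 t \<bullet> (hat t *\<^sub>R (m21 *\<^sub>R p1 t + m22 *\<^sub>R p2 t))) = 1"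
proof -
  define G where "G v w = integral {-1..1} (\<lambda>t. hat t * (v t \<bullet> w t))" for v w :: "real \<Rightarrow> 'a"
  have int: "(\<lambda>t. hat t * (v t \<bullet> w t)) integrable_on {-1..1}" if "continuous_on UNIV v" "continuous_on UNIV w" for v w :: "real \<Rightarrow> 'a"
    by (intro integrable_continuous_real continuous_intros hat continuous_on_subset[OF that(1)] continuous_on_subset[OF that(2)]) auto
  have G: "integral {-1..1} (\<lambda>t. q t \<bullet> (hat t *\<^sub>R (u *\<^sub>R p1 t + v *\<^sub>R p2 t))) = u * G q p1 + v * G q p2" if "continuous_on UNIV q" for q u v
  proof -
    have "(\<lambda>t. q t \<bullet> (hat t *\<^sub>R (u *\<^sub>R p1 t + v *\<^sub>R p2 t))) = (\<lambda>t. u * (hat t * (q t \<bullet> p1 t)) + v * (hat t * (q t \<bullet> p2 t)))"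
      by (auto simp: inner_add_right algebra_simps)
    then show ?thesis
      unfolding G_def by (simp add: integral_add integrable_on_mult_right int[OF that c(1)] int[OF that c(2)])
  qed
  have sym: "G p2 p1 = G p1 p2" unfolding G_def by (simp add: inner_commute)
  have q: "u\<^sup>2 * G p1 p1 + 2 * u * v * G p1 p2 + v\<^sup>2 * G p2 p2 > 0" if "u \<noteq> 0 \<or> v \<noteq> 0" for u v
  proof -
    let ?w = "\<lambda>t. u *\<^sub>R p1 t + v *\<^sub>R p2 t"
    have wc: "continuous_on UNIV ?w" by (intro continuous_intros c)
    have "?w 0 \<noteq> 0" using ind that by blast
    from integral_hat_norm_pos[OF wc this] have "0 < integral {-1..1} (\<lambda>t. hat t * (?w t \<bullet> ?w t))" .
    also have "integral {-1..1} (\<lambda>t. hat t * (?w t \<bullet> ?w t)) = integral {-1..1} (\<lambda>t. ?w t \<bullet> (hat t *\<^sub>R ?w t))" by simp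
    also have "\<dots> = u * G ?w p1 + v * G ?w p2" by (rule G[OF wc])
    also have "G ?w z = u * G z p1 + v * G z p2" if "continuous_on UNIV z" for z
      using G[OF that, of u v] unfolding G_def[of ?w] by (simp add: inner_commute)
    then have "u * G ?w p1 + v * G ?w p2 = u * (u * G p1 p1 + v * G p1 p2) + v * (u * G p2 p1 + v * G p2 p2)"
      using c by simp
    finally show ?thesis by (simp add: sym algebra_simps power2_eq_square)
  qed
  have G11: "G p1 p1 > 0" using q[of 1 0] by simp
  define D where "D = G p1 p1 * G p2 p2 - (G p1 p2)\<^sup>2"
  \<comment> \<open>The vector \<open>(- G p1 p2, G p1 p1)\<close> turns the quadratic form into
    \<open>G p1 p1\<close> times the determinant \<open>D\<close>.\<close>
  have "0 < G p1 p1 * D"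
    using q[of "- G p1 p2" "G p1 p1"] G11 by (simp add: D_def power2_eq_square algebra_simps)
  then have D: "D > 0" using G11 by (simp add: zero_less_mult_iff)
  show ?thesis
  proof (rule that[of "G p2 p2 / D" "- G p1 p2 / D" "- G p1 p2 / D" "G p1 p1 / D"]; subst G)
    show "G p2 p2 / D * G p1 p1 + - G p1 p2 / D * G p1 p2 = 1"
      using D by (simp add: field_simps) (simp add: D_def power2_eq_square)
    show "- G p1 p2 / D * G p2 p1 + G p1 p1 / D * G p2 p2 = 1"
      using D by (simp add: field_simps sym) (simp add: D_def power2_eq_square)
  qed (use c D in \<open>auto simp: sym field_simps\<close>)
qed

text \<open>
  Along \<open>x\<close> only the forcing \<open>r\<close> changes the energy, and the energies at both ends agree.
\<close>

lemma energy_balance: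
  fixes x :: "real \<Rightarrow> 'a::euclidean_space" and E :: "'a \<Rightarrow> real"
  assumes E: "\<And>y. (E has_derivative (\<lambda>v. g y \<bullet> v)) (at y)" and gc: "continuous_on UNIV g"
    and J: "\<And>v. v \<bullet> J v = 0"
    and x: "\<And>t. (x has_vector_derivative J (g (x t)) - r t) (at t)"
    and r: "continuous_on UNIV r" "\<And>t. \<bar>t\<bar> \<ge> T \<Longrightarrow> r t = 0"
    and lim: "(x \<longlongrightarrow> 0) at_top" "(x \<longlongrightarrow> 0) at_bot"
  shows "integral {-T..T} (\<lambda>t. g (x t) \<bullet> r t) = 0"
proof -
  have xc: "continuous_on UNIV x" by (rule has_vector_derivative_imp_continuous_on[OF x])
  have d: "((\<lambda>t. E (x t)) has_vector_derivative - (g (x t) \<bullet> r t)) (at t)" for t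
  proof -
    have "((\<lambda>t. E (x t)) has_derivative (\<lambda>h. g (x t) \<bullet> (h *\<^sub>R (J (g (x t)) - r t)))) (at t)"
      using has_derivative_compose[OF x[unfolded has_vector_derivative_def] E] .
    then show ?thesis
      by (simp add: has_vector_derivative_def inner_diff_right J algebra_simps)
  qed
  let ?f = "\<lambda>t. g (x t) \<bullet> r t"
  have fc: "continuous_on UNIV ?f" by (intro continuous_intros r continuous_on_compose2[OF gc xc]) auto
  have eq: "E (x S) - E (x (-S)) = - integral {-T..T} ?f" if S: "S \<ge> \<bar>T\<bar>" for S
  proof -
    have "((\<lambda>t. - ?f t) has_integral E (x S) - E (x (-S))) {-S..S}"
      by (rule fundamental_theorem_of_calculus) (use S d in \<open>auto intro: has_vector_derivative_at_within\<close>)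
    then have "integral {-S..S} (\<lambda>t. - ?f t) = E (x S) - E (x (-S))" by (rule integral_unique)
    moreover have "integral {-S..S} ?f = integral {-T..T} ?f"
      by (rule integral_vanishing_outside[OF fc]) (use S r(2) in \<open>auto simp: abs_if split: if_splits\<close>)
    ultimately show ?thesis by (simp only: integral_neg)
  qed
  have Ec: "(E \<longlongrightarrow> E 0) (at 0)" "isCont E 0" using has_derivative_continuous[OF E] by (auto simp: isCont_def)
  have "((\<lambda>S. E (x S) - E (x (-S))) \<longlongrightarrow> E 0 - E 0) at_top"
    by (intro tendsto_intros isCont_tendsto_compose[OF Ec(2)] lim filterlim_compose[OF lim(2) filterlim_uminus_at_bot_at_top])
  then have "((\<lambda>S. E (x S) - E (x (-S))) \<longlongrightarrow> 0) at_top" by simp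
  moreover have "((\<lambda>S. E (x S) - E (x (-S))) \<longlongrightarrow> - integral {-T..T} ?f) at_top"
    by (rule tendsto_eventually) (use eq in \<open>auto simp: eventually_at_top_linorder\<close>)
  ultimately have "0 = - integral {-T..T} ?f" by (intro tendsto_unique[of at_top]) auto
  then show ?thesis by simp
qed

text \<open>Gronwall's argument for the squared distance, with a decaying exponential weight in each
  time direction. The Lipschitz bound is asked for along the two solutions only, so local Lipschitz
  continuity suffices for bounded orbits.\<close>

lemma autonomous_ode_unique:
  fixes x y :: "real \<Rightarrow> 'a::real_inner"
  assumes x: "\<And>t. (x has_vector_derivative g (x t)) (at t)" and y: "\<And>t. (y has_vector_derivative g (y t)) (at t)"
    and L: "L \<ge> 0" "\<And>t. norm (g (x t) - g (y t)) \<le> L * norm (x t - y t)" and eq: "x t0 = y t0"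
  shows "x t = y t"
proof -
  define u where "u s = (x s - y s) \<bullet> (x s - y s)" for s
  define u' where "u' s = 2 * ((x s - y s) \<bullet> (g (x s) - g (y s)))" for s
  have du: "(u has_real_derivative u' s) (at s)" for s
  proof -
    have z: "((\<lambda>s. x s - y s) has_vector_derivative g (x s) - g (y s)) (at s)"
      by (intro has_vector_derivative_diff x y)
    from bounded_bilinear.has_vector_derivative[OF bounded_bilinear_inner z z]
    show ?thesis unfolding u_def[abs_def] u'_def has_real_derivative_iff_has_vector_derivative by (simp add: inner_commute)
  qed
  have b: "\<bar>u' s\<bar> \<le> 2 * L * u s" for s
  proof -
    have "\<bar>u' s\<bar> \<le> 2 * (norm (x s - y s) * norm (g (x s) - g (y s)))"
      unfolding u'_def using Cauchy_Schwarz_ineq2[of "x s - y s" "g (x s) - g (y s)"] by (simp add: abs_mult)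
    also have "\<dots> \<le> 2 * (norm (x s - y s) * (L * norm (x s - y s)))" by (intro mult_left_mono L) auto
    also have "\<dots> = 2 * L * u s" by (simp add: u_def dot_square_norm power2_eq_square)
    finally show ?thesis .
  qed
  have u0: "u t0 = 0" using eq by (simp add: u_def)
  have "u t \<le> 0"
  proof (cases "t \<ge> t0")
    case True
    define k where "k s = u s * exp (- 2 * L * (s - t0))" for s
    have "k t \<le> k t0"
    proof (rule DERIV_nonpos_imp_nonincreasing[OF True])
      fix s
      have "(k has_real_derivative (u' s - 2 * L * u s) * exp (- 2 * L * (s - t0))) (at s)"
        unfolding k_def[abs_def] by (auto intro!: derivative_eq_intros du simp: algebra_simps)
      moreover have "(u' s - 2 * L * u s) * exp (- 2 * L * (s - t0)) \<le> 0"
        using b[of s] by (intro mult_nonpos_nonneg) auto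
      ultimately show "\<exists>y. (k has_real_derivative y) (at s) \<and> y \<le> 0" by blast
    qed
    then show ?thesis using u0 by (simp add: k_def mult_le_0_iff)
  next
    case False
    then have le: "t \<le> t0" by simp
    define k where "k s = u s * exp (2 * L * (s - t0))" for s
    have "k t \<le> k t0"
    proof (rule DERIV_nonneg_imp_nondecreasing[OF le])
      fix s
      have "(k has_real_derivative (u' s + 2 * L * u s) * exp (2 * L * (s - t0))) (at s)"
        unfolding k_def[abs_def] by (auto intro!: derivative_eq_intros du simp: algebra_simps)
      moreover have "(u' s + 2 * L * u s) * exp (2 * L * (s - t0)) \<ge> 0"
        using b[of s] by (intro mult_nonneg_nonneg) auto
      ultimately show "\<exists>y. (k has_real_derivative y) (at s) \<and> y \<ge> 0" by blast
    qed
    then show ?thesis using u0 by (simp add: k_def mult_le_0_iff)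
  qed
  then have "u t = 0" unfolding u_def using inner_ge_zero[of "x t - y t"] by linarith
  then show ?thesis by (simp add: u_def)
qed

section \<open>The ansatz\<close>

lemma has_derivative_partial_fst:
  assumes "Ck (Suc n) G"
  shows "((\<lambda>y. G (y, \<mu>)) has_derivative (\<lambda>v. ddir G (v, 0) (x, \<mu>))) (at x)"
  by (rule has_derivative_compose[OF _ Ck_Suc_has_derivative[OF assms]]) (auto intro!: derivative_eq_intros)

lemma frechet_derivative_partial_fst:
  assumes "Ck (Suc n) G"
  shows "frechet_derivative (\<lambda>y. G (y, \<mu>)) (at x) v = ddir G (v, 0) (x, \<mu>)"
  using frechet_derivative_at[OF has_derivative_partial_fst[OF assms]] by metis

lemma has_vector_derivative_partial_snd:
  fixes G :: "'a::euclidean_space \<times> real \<Rightarrow> 'b::real_normed_vector"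
  assumes "Ck (Suc n) G"
  shows "((\<lambda>\<nu>. G (x, \<nu>)) has_vector_derivative ddir G (0, 1) (x, \<mu>)) (at \<mu>)"
proof -
  have 1: "((\<lambda>\<nu>. G (x, \<nu>)) has_derivative (\<lambda>h. ddir G (0, h) (x, \<mu>))) (at \<mu>)"
    by (rule has_derivative_compose[OF _ Ck_Suc_has_derivative[OF assms]]) (auto intro!: derivative_eq_intros)
  have 2: "(\<lambda>h. ddir G (0, h) (x, \<mu>)) = (\<lambda>h. h *\<^sub>R ddir G (0, 1) (x, \<mu>))"
  proof
    show "ddir G (0, h) (x, \<mu>) = h *\<^sub>R ddir G (0, 1) (x, \<mu>)" for h
      using linear_scale[OF has_derivative_linear[OF Ck_Suc_has_derivative[OF assms]], of h "(0, 1)"] by simp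
  qed
  show ?thesis unfolding has_vector_derivative_def by (rule has_derivative_eq_rhs[OF 1 2])
qed

context
  fixes f :: "'a::euclidean_space \<Rightarrow> real \<Rightarrow> 'a" and F :: "'a \<times> real \<Rightarrow> 'a"
  assumes F: "\<And>n. Ck n F" and f: "\<And>x \<mu>. f x \<mu> = F (x, \<mu>)"
begin

lemma Dx_eq_ddir: "Dx f x \<mu> u = ddir F (u, 0) (x, \<mu>)"
  unfolding Dx_def f by (rule frechet_derivative_partial_fst[OF F])

lemma Dx2_eq_ddir: "Dx2 f x \<mu> u v = ddir (ddir F (u, 0)) (v, 0) (x, \<mu>)"
  unfolding Dx2_def Dx_eq_ddir by (rule frechet_derivative_partial_fst[OF Ck_ddir[OF F]])

lemma Dx3_eq_ddir: "Dx3 f x \<mu> u v w = ddir (ddir (ddir F (u, 0)) (v, 0)) (w, 0) (x, \<mu>)"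
  unfolding Dx3_def Dx2_eq_ddir by (rule frechet_derivative_partial_fst[OF Ck_ddir[OF Ck_ddir[OF F]]])

lemma Dmu_eq_ddir: "Dmu f x \<mu> = ddir F (0, 1) (x, \<mu>)"
  unfolding Dmu_def f by (rule vector_derivative_at[OF has_vector_derivative_partial_snd[OF F]])

lemma Dmux_eq_ddir: "Dmux f x \<mu> u = ddir (ddir F (u, 0)) (0, 1) (x, \<mu>)"
  unfolding Dmux_def Dx_eq_ddir by (rule vector_derivative_at[OF has_vector_derivative_partial_snd[OF Ck_ddir[OF F]]])

end

lemma Ck_ddir_linear: "Ck (Suc n) G \<Longrightarrow> linear (\<lambda>v. ddir G v x)"
  by (rule has_derivative_linear[OF Ck_Suc_has_derivative])

lemma UNIV_sum_split: "sum g (UNIV :: ('m::finite + 'm) set) = (\<Sum>i\<in>UNIV. g (Inl i)) + (\<Sum>i\<in>UNIV. g (Inr i))"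
  unfolding UNIV_Plus_UNIV[symmetric] by (subst sum.Plus) auto

lemma J_mat_mult:
  "(J_mat *v v) $ Inl i = v $ Inr i" "(J_mat *v v) $ Inr i = - v $ Inl i"
  unfolding matrix_vector_mult_def J_mat_def by (simp_all add: UNIV_sum_split if_distrib if_distribR sum.delta cong: if_cong)

lemma J_mat_J_mat: "J_mat *v (J_mat *v v) = - (v :: real ^ ('m::finite + 'm))"
proof -
  have "(J_mat *v (J_mat *v v)) $ k = (- v) $ k" for k by (cases k) (simp_all add: J_mat_mult)
  then show ?thesis by (simp add: vec_eq_iff)
qed

lemma inner_J_mat: "v \<bullet> (J_mat *v (v :: real ^ ('m::finite + 'm))) = 0"
  unfolding inner_vec_def by (simp add: UNIV_sum_split J_mat_mult sum_negf mult.commute)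

lemma grad_x_component:
  assumes "Ck (Suc n) H"
  shows "grad_x H x \<mu> $ i = ddir H (axis i 1, 0) (x, \<mu>)"
  unfolding grad_x_def by (simp add: frechet_derivative_partial_fst[OF assms])

lemma Ck_grad_x:
  assumes "Ck (Suc n) H"
  shows "Ck n (\<lambda>p. grad_x H (fst p) (snd p))"
proof -
  have "(\<lambda>p. grad_x H (fst p) (snd p)) = (\<lambda>p. \<Sum>i\<in>UNIV. ddir H (axis i 1, 0) p *\<^sub>R axis i 1)"
  proof
    fix p
    have "grad_x H (fst p) (snd p) = (\<Sum>i\<in>UNIV. (grad_x H (fst p) (snd p) $ i) *\<^sub>R axis i 1)"
      using basis_expansion[of "grad_x H (fst p) (snd p)"] by (simp add: scalar_mult_eq_scaleR)
    then show "grad_x H (fst p) (snd p) = (\<Sum>i\<in>UNIV. ddir H (axis i 1, 0) p *\<^sub>R axis i 1)"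
      by (simp add: grad_x_component[OF assms])
  qed
  then show ?thesis by (auto intro!: Ck_sum Ck_scaleR Ck_ddir[OF assms] Ck_const)
qed

lemma Ck_ham_vf:
  assumes "Ck (Suc n) H"
  shows "Ck n (\<lambda>p. ham_vf H (fst p) (snd p))"
  unfolding ham_vf_def by (intro Ck_compose_linear[OF _ Ck_grad_x[OF assms]]) simp

lemma has_derivative_grad_x:
  assumes "Ck (Suc n) H"
  shows "((\<lambda>y. H (y, \<mu>)) has_derivative (\<lambda>v. grad_x H y \<mu> \<bullet> v)) (at y)"
proof -
  have lin: "linear (\<lambda>v. ddir H (v, 0) (y, \<mu>))"
    by (rule has_derivative_linear[OF has_derivative_partial_fst[OF assms]])
  have "ddir H (v, 0) (y, \<mu>) = grad_x H y \<mu> \<bullet> v" for v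
  proof -
    have "ddir H (v, 0) (y, \<mu>) = (\<lambda>v. ddir H (v, 0) (y, \<mu>)) (\<Sum>i\<in>UNIV. (v $ i) *\<^sub>R axis i 1)"
      using basis_expansion[of v] by (simp add: scalar_mult_eq_scaleR)
    also have "\<dots> = (\<Sum>i\<in>UNIV. v $ i * ddir H (axis i 1, 0) (y, \<mu>))"
      by (subst linear_sum[OF lin]) (simp add: linear_scale[OF lin])
    finally show ?thesis by (simp add: inner_vec_def grad_x_component[OF assms] mult.commute)
  qed
  then show ?thesis using has_derivative_partial_fst[OF assms, of \<mu> y] by simp
qed

text \<open>Dominated convergence with majorant \<open>norm (g t)\<close>. It connects the symmetric
  limits that give the multipliers with the Lebesgue integrals in \<open>a2_bar\<close> and
  \<open>b2_bar\<close>.\<close>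

lemma LBINT_symmetric_limit:
  fixes g :: "real \<Rightarrow> real"
  assumes "integrable lborel g"
  shows "((\<lambda>S. integral {-S..S} g) \<longlongrightarrow> (LBINT t. g t)) at_top"
proof -
  have "((\<lambda>S. LBINT t. indicator {-S..S} t *\<^sub>R g t) \<longlongrightarrow> (LBINT t. g t)) at_top"
  proof (rule integral_dominated_convergence_at_top[where w="\<lambda>t. norm (g t)"])
    show "AE t in lborel. ((\<lambda>S. indicator {-S..S} t *\<^sub>R g t) \<longlongrightarrow> g t) at_top"
    proof (rule AE_I2)
      fix t :: real
      show "((\<lambda>S. indicator {-S..S} t *\<^sub>R g t) \<longlongrightarrow> g t) at_top"
        by (rule tendsto_eventually)
          (auto simp: eventually_at_top_linorder indicator_def abs_le_iff intro!: exI[of _ "\<bar>t\<bar>"])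
    qed
  qed (use assms in \<open>auto simp: indicator_def intro!: borel_measurable_integrable always_eventually\<close>)
  moreover have "(LBINT t. indicator {-S..S} t *\<^sub>R g t) = integral {-S..S} g" for S
  proof -
    have "set_integrable lborel {-S..S} g"
      unfolding set_integrable_def by (rule integrable_mult_indicator[OF _ assms]) simp
    from set_borel_integral_eq_integral(2)[OF this] show ?thesis
      unfolding set_lebesgue_integral_def .
  qed
  ultimately show ?thesis by simp
qed

text \<open>Decay passes through the remainder operator: as all inputs tend to 0, the argument of
  \<open>Rm\<close> tends to the point in \<open>z\<close>, where \<open>Rm\<close> vanishes and is
  continuous.\<close>

lemma tendsto_0_combination:
  fixes Rm :: "('a::real_normed_vector \<times> real) \<times> ('a \<times> real) \<times> ('a \<times> real) \<times> real \<Rightarrow> 'a"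
  assumes R: "\<And>M. \<exists>L\<ge>0. \<forall>x y. norm x \<le> M \<longrightarrow> norm y \<le> M \<longrightarrow> norm (Rm x - Rm y) \<le> L * norm (x - y)"
    and z: "Rm ((0, 0), (0, 0), (0, c), a) = 0"
    and lim: "(apply_bcontfun xh \<longlongrightarrow> 0) G" "(apply_bcontfun p \<longlongrightarrow> 0) G" "(apply_bcontfun \<xi>1 \<longlongrightarrow> 0) G"
      "(apply_bcontfun \<xi>2 \<longlongrightarrow> 0) G" "(apply_bcontfun Z \<longlongrightarrow> 0) G"
  shows "(apply_bcontfun (remainder_op Rm xh p \<xi>1 \<xi>2 c \<sigma> a Z) \<longlongrightarrow> 0) G"
proof -
  let ?v = "\<lambda>t. ((apply_bcontfun xh t, 0::real), (\<sigma> *\<^sub>R apply_bcontfun p t, 0::real),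
      (c *\<^sub>R apply_bcontfun \<xi>1 t + \<sigma>\<^sup>2 *\<^sub>R apply_bcontfun \<xi>2 t + a *\<^sub>R apply_bcontfun Z t, c), a)"
  have v: "(?v \<longlongrightarrow> ((0, 0), (\<sigma> *\<^sub>R 0, 0), (c *\<^sub>R 0 + \<sigma>\<^sup>2 *\<^sub>R 0 + a *\<^sub>R 0, c), a)) G" by (intro tendsto_intros lim)
  define v0 where "v0 = (((0, 0), (0, 0), (0, c), a) :: ('a \<times> real) \<times> ('a \<times> real) \<times> ('a \<times> real) \<times> real)"
  have v: "(?v \<longlongrightarrow> v0) G" using v by (simp add: v0_def)
  have "isCont Rm v0"
  proof -
    obtain L where L: "L \<ge> 0" "\<And>x y. norm x \<le> norm v0 + 1 \<Longrightarrow> norm y \<le> norm v0 + 1 \<Longrightarrow> norm (Rm x - Rm y) \<le> L * norm (x - y)"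
      using R[of "norm v0 + 1"] by auto
    have "continuous_on (ball v0 1) Rm"
    proof (rule lipschitz_on_continuous_on[of L], rule lipschitz_onI)
      fix x y :: "('a \<times> real) \<times> ('a \<times> real) \<times> ('a \<times> real) \<times> real"
      assume "x \<in> ball v0 1" "y \<in> ball v0 1"
      then have "norm x \<le> norm v0 + 1" "norm y \<le> norm v0 + 1"
        using norm_triangle_sub[of x v0] norm_triangle_sub[of y v0] by (auto simp: dist_norm norm_minus_commute)
      then show "dist (Rm x) (Rm y) \<le> L * dist x y" unfolding dist_norm by (rule L(2))
    qed (rule L(1))
    then show ?thesis by (rule continuous_on_interior) simp
  qed
  from isCont_tendsto_compose[OF this v] show ?thesis
    unfolding apply_remainder_op[OF R] v0_def z .
qed

definition ansatz ::
  "(real \<Rightarrow>\<^sub>C 'a) \<Rightarrow> (real \<Rightarrow>\<^sub>C 'a) \<Rightarrow> (real \<Rightarrow>\<^sub>C 'a) \<Rightarrow> (real \<Rightarrow>\<^sub>C 'a) \<Rightarrow> real \<Rightarrow> real \<Rightarrow> real \<Rightarrow> (real \<Rightarrow>\<^sub>C 'a) \<Rightarrow> real \<Rightarrow>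
    'a::real_normed_vector" where
  "ansatz xh p \<xi>1 \<xi>2 c a \<sigma> Z t = apply_bcontfun xh t + (a * \<sigma>) *\<^sub>R apply_bcontfun p t
      + a\<^sup>2 *\<^sub>R (c *\<^sub>R apply_bcontfun \<xi>1 t + \<sigma>\<^sup>2 *\<^sub>R apply_bcontfun \<xi>2 t + a *\<^sub>R apply_bcontfun Z t)"

text \<open>Both branches come from this lemma, so the right inverse \<open>L\<close> and its
  residual \<open>res\<close> are left abstract: the pair uses the corrected inverse itself, the
  symmetric branch its projection with \<open>p = \<xi>2 = 0\<close>. The last conclusion is the
  expansion of \<open>F\<close> from which the symmetry of the remainder is later read off.\<close>

lemma solution_family:
  fixes F :: "(real ^ 'n) \<times> real \<Rightarrow> real ^ 'n" and A :: "real \<Rightarrow> real ^ 'n ^ 'n"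
    and xh p \<xi>1 \<xi>2 :: "real \<Rightarrow>\<^sub>C (real ^ 'n)" and L :: "(real \<Rightarrow>\<^sub>C (real ^ 'n)) \<Rightarrow> (real \<Rightarrow>\<^sub>C (real ^ 'n))"
    and res :: "(real \<Rightarrow>\<^sub>C (real ^ 'n)) \<Rightarrow> real \<Rightarrow> real ^ 'n"
  assumes F: "\<And>n. Ck n F" and F0: "\<forall>\<^sub>F \<mu> in nhds 0. F (0, \<mu>) = 0"
    and A: "\<And>t v. A t *v v = ddir F (v, 0) (apply_bcontfun xh t, 0)"
    and xh: "\<And>t. (apply_bcontfun xh has_vector_derivative F (apply_bcontfun xh t, 0)) (at t)"
    and p: "\<And>t. (apply_bcontfun p has_vector_derivative A t *v apply_bcontfun p t) (at t)"
    and \<xi>1: "\<And>t. (apply_bcontfun \<xi>1 has_vector_derivative A t *v apply_bcontfun \<xi>1 t + ddir F (0, 1) (apply_bcontfun xh t, 0)) (at t)"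
    and \<xi>2: "\<And>t. (apply_bcontfun \<xi>2 has_vector_derivative A t *v apply_bcontfun \<xi>2 t
        + (1/2) *\<^sub>R ddir (ddir F (apply_bcontfun p t, 0)) (apply_bcontfun p t, 0) (apply_bcontfun xh t, 0)) (at t)"
    and top: "(apply_bcontfun xh \<longlongrightarrow> 0) at_top" "(apply_bcontfun p \<longlongrightarrow> 0) at_top" "(apply_bcontfun \<xi>1 \<longlongrightarrow> 0) at_top" "(apply_bcontfun \<xi>2 \<longlongrightarrow> 0) at_top"
    and bot: "(apply_bcontfun xh \<longlongrightarrow> 0) at_bot" "(apply_bcontfun p \<longlongrightarrow> 0) at_bot" "(apply_bcontfun \<xi>1 \<longlongrightarrow> 0) at_bot" "(apply_bcontfun \<xi>2 \<longlongrightarrow> 0) at_bot"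
    and L: "bounded_linear L"
      "\<And>h t. (apply_bcontfun (L h) has_vector_derivative A t *v apply_bcontfun (L h) t + apply_bcontfun h t - res h t) (at t)"
      "\<And>h. (apply_bcontfun h \<longlongrightarrow> 0) at_top \<Longrightarrow> (apply_bcontfun (L h) \<longlongrightarrow> 0) at_top"
      "\<And>h. (apply_bcontfun h \<longlongrightarrow> 0) at_bot \<Longrightarrow> (apply_bcontfun (L h) \<longlongrightarrow> 0) at_bot"
  obtains a0 M N K where "0 < a0" "a0 \<le> 1" "0 \<le> M" "0 \<le> K"
    "\<And>a. \<bar>a\<bar> \<le> a0 \<Longrightarrow> \<exists>Z. continuous_on {0..2} (\<lambda>\<sigma>. N \<sigma> a (Z \<sigma>)) \<and> (\<forall>\<sigma>\<in>{0..2}. norm (Z \<sigma>) \<le> M \<and> L (N \<sigma> a (Z \<sigma>)) = Z \<sigma> \<and>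
        norm (N \<sigma> a (Z \<sigma>) - N \<sigma> 0 0) \<le> K * \<bar>a\<bar> \<and>
        (ansatz xh p \<xi>1 \<xi>2 c a \<sigma> (Z \<sigma>) \<longlongrightarrow> 0) at_top \<and> (ansatz xh p \<xi>1 \<xi>2 c a \<sigma> (Z \<sigma>) \<longlongrightarrow> 0) at_bot \<and>
        (\<forall>t. (ansatz xh p \<xi>1 \<xi>2 c a \<sigma> (Z \<sigma>) has_vector_derivative F (ansatz xh p \<xi>1 \<xi>2 c a \<sigma> (Z \<sigma>) t, c * a\<^sup>2) - a^3 *\<^sub>R res (N \<sigma> a (Z \<sigma>)) t) (at t)))"
    "\<And>\<sigma> t. apply_bcontfun (N \<sigma> 0 0) t =
       ddir (ddir F (c *\<^sub>R apply_bcontfun \<xi>1 t + \<sigma>\<^sup>2 *\<^sub>R apply_bcontfun \<xi>2 t, c)) (\<sigma> *\<^sub>R apply_bcontfun p t, 0) (apply_bcontfun xh t, 0)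
       + (1/6) *\<^sub>R ddir (ddir (ddir F (\<sigma> *\<^sub>R apply_bcontfun p t, 0)) (\<sigma> *\<^sub>R apply_bcontfun p t, 0)) (\<sigma> *\<^sub>R apply_bcontfun p t, 0) (apply_bcontfun xh t, 0)"
    "\<And>\<sigma> a Z t. F (ansatz xh p \<xi>1 \<xi>2 c a \<sigma> Z t, c * a\<^sup>2) = F (apply_bcontfun xh t, 0) + (a * \<sigma>) *\<^sub>R (A t *v apply_bcontfun p t)
        + a\<^sup>2 *\<^sub>R (A t *v (c *\<^sub>R apply_bcontfun \<xi>1 t + \<sigma>\<^sup>2 *\<^sub>R apply_bcontfun \<xi>2 t + a *\<^sub>R apply_bcontfun Z t) + c *\<^sub>R ddir F (0, 1) (apply_bcontfun xh t, 0)
          + (\<sigma>\<^sup>2 / 2) *\<^sub>R ddir (ddir F (apply_bcontfun p t, 0)) (apply_bcontfun p t, 0) (apply_bcontfun xh t, 0)) + a^3 *\<^sub>R apply_bcontfun (N \<sigma> a Z) t"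
proof -
  obtain Rm :: "((real ^ 'n) \<times> real) \<times> ((real ^ 'n) \<times> real) \<times> ((real ^ 'n) \<times> real) \<times> real \<Rightarrow> real ^ 'n" where
    R1: "\<And>y w q a. F (y + a *\<^sub>R w + a\<^sup>2 *\<^sub>R q) = F y + a *\<^sub>R ddir F w y
        + a\<^sup>2 *\<^sub>R (ddir F q y + (1/2) *\<^sub>R ddir (ddir F w) w y) + a^3 *\<^sub>R Rm (y, w, q, a)" and
    R2: "\<And>y w q. Rm (y, w, q, 0) = ddir (ddir F q) w y + (1/6) *\<^sub>R ddir (ddir (ddir F w) w) w y" and
    R3: "\<And>M. \<exists>L\<ge>0. \<forall>x y. norm x \<le> M \<longrightarrow> norm y \<le> M \<longrightarrow> norm (Rm x - Rm y) \<le> L * norm (x - y)"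
    using cubic_Taylor_remainder[OF F] by metis
  define N where "N = remainder_op Rm xh p \<xi>1 \<xi>2 c"
  have N: "apply_bcontfun (N \<sigma> a Z) t = Rm ((apply_bcontfun xh t, 0), (\<sigma> *\<^sub>R apply_bcontfun p t, 0),
      (c *\<^sub>R apply_bcontfun \<xi>1 t + \<sigma>\<^sup>2 *\<^sub>R apply_bcontfun \<xi>2 t + a *\<^sub>R apply_bcontfun Z t, c), a)" for \<sigma> a Z t
    unfolding N_def apply_remainder_op[OF R3] ..
  have lin1: "linear (\<lambda>v. ddir F v y)" for y by (rule Ck_ddir_linear[OF F[of "Suc 0"]])
  have lin2: "linear (\<lambda>v. ddir (ddir F u) v y)" for u y by (rule Ck_ddir_linear[OF Ck_ddir[OF F[of "Suc (Suc 0)"]]])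
  have lin3: "linear (\<lambda>v. ddir (ddir F v) u y)" for u y
    using lin2[of u y] by (simp add: ddir_commute[OF F, of _ u])
  have expand: "F (ansatz xh p \<xi>1 \<xi>2 c a \<sigma> Z t, c * a\<^sup>2) = F (apply_bcontfun xh t, 0) + (a * \<sigma>) *\<^sub>R (A t *v apply_bcontfun p t)
        + a\<^sup>2 *\<^sub>R (A t *v (c *\<^sub>R apply_bcontfun \<xi>1 t + \<sigma>\<^sup>2 *\<^sub>R apply_bcontfun \<xi>2 t + a *\<^sub>R apply_bcontfun Z t) + c *\<^sub>R ddir F (0, 1) (apply_bcontfun xh t, 0)
          + (\<sigma>\<^sup>2 / 2) *\<^sub>R ddir (ddir F (apply_bcontfun p t, 0)) (apply_bcontfun p t, 0) (apply_bcontfun xh t, 0)) + a^3 *\<^sub>R apply_bcontfun (N \<sigma> a Z) t" for \<sigma> a Z t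
  proof -
    let ?q = "c *\<^sub>R apply_bcontfun \<xi>1 t + \<sigma>\<^sup>2 *\<^sub>R apply_bcontfun \<xi>2 t + a *\<^sub>R apply_bcontfun Z t"
    let ?y = "(apply_bcontfun xh t, 0::real)" and ?P = "(apply_bcontfun p t, 0::real)"
    have arg: "(ansatz xh p \<xi>1 \<xi>2 c a \<sigma> Z t, c * a\<^sup>2) = ?y + a *\<^sub>R (\<sigma> *\<^sub>R apply_bcontfun p t, 0) + a\<^sup>2 *\<^sub>R (?q, c)"
      by (simp add: ansatz_def mult.commute)
    have w: "(\<sigma> *\<^sub>R apply_bcontfun p t, 0::real) = \<sigma> *\<^sub>R ?P" by simp
    have 1: "ddir F (\<sigma> *\<^sub>R ?P) ?y = \<sigma> *\<^sub>R (A t *v apply_bcontfun p t)"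
      using linear_scale[OF lin1, of \<sigma> ?P] by (simp add: A)
    have 2: "ddir F (?q, c) ?y = A t *v ?q + c *\<^sub>R ddir F (0, 1) ?y"
      using linear_add[OF lin1, of "(?q, 0)" "c *\<^sub>R (0, 1)"] linear_scale[OF lin1, of c "(0, 1)"] by (simp add: A)
    have 3: "ddir (ddir F (\<sigma> *\<^sub>R ?P)) (\<sigma> *\<^sub>R ?P) ?y = \<sigma>\<^sup>2 *\<^sub>R ddir (ddir F ?P) ?P ?y"
      by (simp only: linear_scale[OF lin2] linear_scale[OF lin3]) (simp add: power2_eq_square)
    show ?thesis
      unfolding arg R1 N w 1 2 3 by (simp add: power2_eq_square)
  qed
  \<comment> \<open>The iteration preserves decay if the remainder vanishes at the equilibrium. For
    \<open>a \<noteq> 0\<close> this follows from the Taylor identity at the origin, where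
    \<open>F (0, \<mu>) = 0\<close>, after division by a^3; at \<open>a = 0\<close> it follows from
    the formula for \<open>Rm\<close> by linearity.\<close>
  have z: "\<exists>a1>0. a1 \<le> 1 \<and> (\<forall>a. \<bar>a\<bar> \<le> a1 \<longrightarrow> Rm ((0, 0), (0, 0), (0, c), a) = 0)"
  proof -
    obtain d where d: "d > 0" "\<And>\<mu>. \<bar>\<mu>\<bar> < d \<Longrightarrow> F (0, \<mu>) = 0"
      using F0 unfolding eventually_nhds_metric by (auto simp: dist_real_def)
    have Fmu: "ddir F (0, 1) (0, 0) = 0"
    proof -
      have "((\<lambda>\<nu>. F (0, \<nu>)) has_vector_derivative 0) (at 0)"
        by (rule has_vector_derivative_transform_within_open[of "\<lambda>_. 0" _ _ "ball 0 d"]) (use d in \<open>auto simp: dist_real_def\<close>)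
      then show ?thesis
        using has_vector_derivative_partial_snd[OF F[of "Suc 0"], of 0 0] vector_derivative_unique_at by blast
    qed
    \<comment> \<open>For \<open>\<bar>a\<bar> \<le> 1\<close> one has
      \<open>a\<^sup>2 \<le> \<bar>a\<bar>\<close>, so this bound puts \<open>c * a\<^sup>2\<close>
      inside the interval of known equilibria; the summand 1 in the denominator covers
      \<open>c = 0\<close>.\<close>
    define a1 where "a1 = min 1 (d / (\<bar>c\<bar> + 1))"
    have "Rm ((0, 0), (0, 0), (0, c), a) = 0" if a: "\<bar>a\<bar> \<le> a1" for a
    proof (cases "a = 0")
      case True
      have "ddir (ddir F (0, c)) (0, 0) (0, 0) = 0" "ddir (ddir (ddir F (0, 0)) (0, 0)) (0, 0) (0, 0) = 0"
        using linear_0[OF Ck_ddir_linear[OF Ck_ddir[OF F[of "Suc (Suc 0)"]]]] linear_0[OF Ck_ddir_linear[OF Ck_ddir[OF Ck_ddir[OF F[of "Suc (Suc (Suc 0))"]]]]]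
        by (simp_all add: zero_prod_def)
      then show ?thesis using True by (simp add: R2)
    next
      case False
      have "\<bar>a\<bar> * \<bar>a\<bar> \<le> \<bar>a\<bar> * 1" using a by (intro mult_left_mono) (auto simp: a1_def)
      then have "a\<^sup>2 \<le> \<bar>a\<bar>" by (simp add: power2_eq_square)
      then have "\<bar>c * a\<^sup>2\<bar> \<le> \<bar>c\<bar> * \<bar>a\<bar>" by (simp add: abs_mult mult_left_mono)
      also have "\<dots> \<le> \<bar>c\<bar> * (d / (\<bar>c\<bar> + 1))" using a by (intro mult_left_mono) (auto simp: a1_def)
      also have "\<dots> < d" using d by (simp add: field_simps)
      finally have c0: "F (0, c * a\<^sup>2) = 0" by (rule d)
      have l0: "ddir F (0, 0) (0, 0) = 0" "ddir (ddir F (0, 0)) (0, 0) (0, 0) = 0"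
        using linear_0[OF lin1] linear_0[OF lin2] by (simp_all add: zero_prod_def)
      have lc: "ddir F (0, c) (0, 0) = 0" using linear_scale[OF lin1, of c "(0, 1)" "(0, 0)"] Fmu by simp
      have "F (0, c * a\<^sup>2) = F (0, 0) + a^3 *\<^sub>R Rm ((0, 0), (0, 0), (0, c), a)"
        using R1[of "(0, 0)" a "(0, 0)" "(0, c)"] by (simp add: l0 lc mult.commute)
      then show ?thesis using c0 d(2)[of 0] d(1) False by simp
    qed
    then show ?thesis using d by (intro exI[of _ a1]) (auto simp: a1_def)
  qed
  then obtain a1 where a1: "a1 > 0" "a1 \<le> 1" "\<And>a. \<bar>a\<bar> \<le> a1 \<Longrightarrow> Rm ((0, 0), (0, 0), (0, c), a) = 0" by blast
  define V :: "(real \<Rightarrow>\<^sub>C (real ^ 'n)) set" where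
    "V = {u. (apply_bcontfun u \<longlongrightarrow> 0) at_top} \<inter> {u. (apply_bcontfun u \<longlongrightarrow> 0) at_bot}"
  have V: "closed V" "0 \<in> V" unfolding V_def
    by (auto intro!: closed_Int closed_bcontfun_tendsto_0 simp: zero_bcontfun.rep_eq[abs_def])
  obtain k where k: "k \<ge> 0" "\<And>h. norm (L h) \<le> norm h * k" using bounded_linear.nonneg_bounded[OF L(1)] by blast
  have Ldiff: "L h - L h' = L (h - h')" for h h' using linear_diff[OF bounded_linear.linear[OF L(1)]] by simp
  have lipN: "\<exists>K\<ge>0. \<forall>\<sigma>\<in>{0..2}. \<forall>\<sigma>'\<in>{0..2}. \<forall>a Z Z'. \<bar>a\<bar> \<le> 1 \<longrightarrow> norm Z \<le> M \<longrightarrow> norm Z' \<le> M \<longrightarrow>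
      norm (N \<sigma> a Z - N \<sigma>' a Z') \<le> K * (\<bar>\<sigma> - \<sigma>'\<bar> + \<bar>a\<bar> * norm (Z - Z')) \<and> norm (N \<sigma> a Z - N \<sigma> 0 0) \<le> K * \<bar>a\<bar>" for M
    unfolding N_def by (rule remainder_op_Lipschitz[OF R3])
  have lipT: "\<exists>K\<ge>0. \<forall>\<sigma>\<in>{0..2}. \<forall>\<sigma>'\<in>{0..2}. \<forall>a Z Z'. \<bar>a\<bar> \<le> 1 \<longrightarrow> norm Z \<le> M \<longrightarrow> norm Z' \<le> M \<longrightarrow>
      norm (L (N \<sigma> a Z) - L (N \<sigma>' a Z')) \<le> K * (\<bar>\<sigma> - \<sigma>'\<bar> + \<bar>a\<bar> * norm (Z - Z')) \<and> norm (L (N \<sigma> a Z) - L (N \<sigma> 0 0)) \<le> K * \<bar>a\<bar>" for M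
  proof -
    from lipN[of M] obtain K where K: "K \<ge> 0" "\<forall>\<sigma>\<in>{0..2}. \<forall>\<sigma>'\<in>{0..2}. \<forall>a Z Z'. \<bar>a\<bar> \<le> 1 \<longrightarrow> norm Z \<le> M \<longrightarrow> norm Z' \<le> M \<longrightarrow>
      norm (N \<sigma> a Z - N \<sigma>' a Z') \<le> K * (\<bar>\<sigma> - \<sigma>'\<bar> + \<bar>a\<bar> * norm (Z - Z')) \<and> norm (N \<sigma> a Z - N \<sigma> 0 0) \<le> K * \<bar>a\<bar>" by blast
    have *: "norm (L h - L h') \<le> (K * k) * x" if "norm (h - h') \<le> K * x" for h h' x
      unfolding Ldiff using k(2)[of "h - h'"] mult_right_mono[OF that k(1)] by (simp add: mult_ac)
    show ?thesis
      by (intro exI[of _ "K * k"] conjI ballI allI impI *) (use K k in auto)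
  qed
  have inv: "L (N \<sigma> a Z) \<in> V" if "\<bar>a\<bar> \<le> a1" "Z \<in> V" for \<sigma> a Z
    using that top bot unfolding V_def N_def
    by (auto intro!: L(3,4) tendsto_0_combination[OF R3 a1(3)])
  obtain a0 M where a0: "0 < a0" "a0 \<le> a1" "0 \<le> M" and
    sol: "\<And>a. \<bar>a\<bar> \<le> a0 \<Longrightarrow> \<exists>Z. continuous_on {0..2} Z \<and> (\<forall>\<sigma>\<in>{0..2}. Z \<sigma> \<in> V \<and> norm (Z \<sigma>) \<le> M \<and> L (N \<sigma> a (Z \<sigma>)) = Z \<sigma>)"
    by (rule parametric_contraction[of "\<lambda>\<sigma> a Z. L (N \<sigma> a Z)", OF lipT V _ a1(1,2)], erule (1) inv, rule that)
  from lipN[of M] obtain K where K: "K \<ge> 0" "\<forall>\<sigma>\<in>{0..2}. \<forall>\<sigma>'\<in>{0..2}. \<forall>a Z Z'. \<bar>a\<bar> \<le> 1 \<longrightarrow> norm Z \<le> M \<longrightarrow> norm Z' \<le> M \<longrightarrow>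
      norm (N \<sigma> a Z - N \<sigma>' a Z') \<le> K * (\<bar>\<sigma> - \<sigma>'\<bar> + \<bar>a\<bar> * norm (Z - Z')) \<and> norm (N \<sigma> a Z - N \<sigma> 0 0) \<le> K * \<bar>a\<bar>" by blast
  note Kd = K(2)[rule_format, THEN conjunct1] and Kz = K(2)[rule_format, THEN conjunct2]
  show ?thesis
  proof (rule that[of a0 M K N])
    show "a0 \<le> 1" using a0 a1 by linarith
    fix a assume a: "\<bar>a\<bar> \<le> a0"
    then have a': "\<bar>a\<bar> \<le> 1" using a0 a1 by linarith
    from sol[OF a] obtain Z where Zc: "continuous_on {0..2} Z"
      and Z: "\<And>\<sigma>. \<sigma> \<in> {0..2} \<Longrightarrow> Z \<sigma> \<in> V" "\<And>\<sigma>. \<sigma> \<in> {0..2} \<Longrightarrow> norm (Z \<sigma>) \<le> M" "\<And>\<sigma>. \<sigma> \<in> {0..2} \<Longrightarrow> L (N \<sigma> a (Z \<sigma>)) = Z \<sigma>" by blast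
    have "continuous_on {0..2} (\<lambda>\<sigma>. N \<sigma> a (Z \<sigma>))"
      unfolding continuous_on_def
    proof
      fix \<sigma> :: real assume s: "\<sigma> \<in> {0..2}"
      have "((\<lambda>\<sigma>'. K * (\<bar>\<sigma>' - \<sigma>\<bar> + \<bar>a\<bar> * norm (Z \<sigma>' - Z \<sigma>))) \<longlongrightarrow> K * (\<bar>\<sigma> - \<sigma>\<bar> + \<bar>a\<bar> * norm (Z \<sigma> - Z \<sigma>))) (at \<sigma> within {0..2})"
        using Zc s unfolding continuous_on_def by (intro tendsto_intros) auto
      then have lim: "((\<lambda>\<sigma>'. K * (\<bar>\<sigma>' - \<sigma>\<bar> + \<bar>a\<bar> * norm (Z \<sigma>' - Z \<sigma>))) \<longlongrightarrow> 0) (at \<sigma> within {0..2})" by simp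
      have "\<forall>\<^sub>F \<sigma>' in at \<sigma> within {0..2}. norm (N \<sigma>' a (Z \<sigma>') - N \<sigma> a (Z \<sigma>)) \<le> K * (\<bar>\<sigma>' - \<sigma>\<bar> + \<bar>a\<bar> * norm (Z \<sigma>' - Z \<sigma>))"
        unfolding eventually_at_filter by (intro always_eventually allI impI Kd[OF _ s a'] Z s)
      from Lim_null_comparison[OF this lim] show "((\<lambda>\<sigma>'. N \<sigma>' a (Z \<sigma>')) \<longlongrightarrow> N \<sigma> a (Z \<sigma>)) (at \<sigma> within {0..2})"
        by (simp add: Lim_null[symmetric])
    qed
    moreover have "(ansatz xh p \<xi>1 \<xi>2 c a \<sigma> (Z \<sigma>) \<longlongrightarrow> 0) G" if s: "\<sigma> \<in> {0..2}" and G: "G = at_top \<or> G = at_bot" for \<sigma> G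
    proof -
      have "(ansatz xh p \<xi>1 \<xi>2 c a \<sigma> (Z \<sigma>) \<longlongrightarrow> 0 + (a * \<sigma>) *\<^sub>R 0 + a\<^sup>2 *\<^sub>R (c *\<^sub>R 0 + \<sigma>\<^sup>2 *\<^sub>R 0 + a *\<^sub>R 0)) G"
        unfolding ansatz_def[abs_def] using Z(1)[OF s] G top bot unfolding V_def by (intro tendsto_intros) auto
      then show ?thesis by simp
    qed
    moreover have "(ansatz xh p \<xi>1 \<xi>2 c a \<sigma> (Z \<sigma>) has_vector_derivative F (ansatz xh p \<xi>1 \<xi>2 c a \<sigma> (Z \<sigma>) t, c * a\<^sup>2) - a^3 *\<^sub>R res (N \<sigma> a (Z \<sigma>)) t) (at t)"
      if s: "\<sigma> \<in> {0..2}" for \<sigma> t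
    proof -
      have ZD: "(apply_bcontfun (Z \<sigma>) has_vector_derivative A t *v apply_bcontfun (Z \<sigma>) t + apply_bcontfun (N \<sigma> a (Z \<sigma>)) t - res (N \<sigma> a (Z \<sigma>)) t) (at t)"
        using L(2)[of "N \<sigma> a (Z \<sigma>)" t] unfolding Z(3)[OF s] .
      note sc = bounded_linear.has_vector_derivative[OF bounded_linear_scaleR_right]
      show ?thesis
        unfolding ansatz_def[abs_def]
        by (rule has_vector_derivative_eq_rhs[OF has_vector_derivative_add[OF has_vector_derivative_add[OF xh sc[OF p]]
            sc[OF has_vector_derivative_add[OF has_vector_derivative_add[OF sc[OF \<xi>1] sc[OF \<xi>2]] sc[OF ZD]]]]])
          (unfold expand[unfolded ansatz_def], simp add: matrix_vector_right_distrib matrix_vector_mult_scaleR scaleR_add_right scaleR_diff_right power2_eq_square power3_eq_cube mult_ac)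
    qed
    ultimately show "\<exists>Z. continuous_on {0..2} (\<lambda>\<sigma>. N \<sigma> a (Z \<sigma>)) \<and> (\<forall>\<sigma>\<in>{0..2}. norm (Z \<sigma>) \<le> M \<and> L (N \<sigma> a (Z \<sigma>)) = Z \<sigma> \<and>
        norm (N \<sigma> a (Z \<sigma>) - N \<sigma> 0 0) \<le> K * \<bar>a\<bar> \<and>
        (ansatz xh p \<xi>1 \<xi>2 c a \<sigma> (Z \<sigma>) \<longlongrightarrow> 0) at_top \<and> (ansatz xh p \<xi>1 \<xi>2 c a \<sigma> (Z \<sigma>) \<longlongrightarrow> 0) at_bot \<and>
        (\<forall>t. (ansatz xh p \<xi>1 \<xi>2 c a \<sigma> (Z \<sigma>) has_vector_derivative F (ansatz xh p \<xi>1 \<xi>2 c a \<sigma> (Z \<sigma>) t, c * a\<^sup>2) - a^3 *\<^sub>R res (N \<sigma> a (Z \<sigma>)) t) (at t)))"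
      using Z Kz[OF _ _ a' Z(2) Z(2)] by (intro exI[of _ Z]) auto
  next
    fix \<sigma> t
    show "apply_bcontfun (N \<sigma> 0 0) t =
       ddir (ddir F (c *\<^sub>R apply_bcontfun \<xi>1 t + \<sigma>\<^sup>2 *\<^sub>R apply_bcontfun \<xi>2 t, c)) (\<sigma> *\<^sub>R apply_bcontfun p t, 0) (apply_bcontfun xh t, 0)
       + (1/6) *\<^sub>R ddir (ddir (ddir F (\<sigma> *\<^sub>R apply_bcontfun p t, 0)) (\<sigma> *\<^sub>R apply_bcontfun p t, 0)) (\<sigma> *\<^sub>R apply_bcontfun p t, 0) (apply_bcontfun xh t, 0)"
      unfolding N by (simp add: R2)
  qed (use a0 K expand in auto)
qed

section \<open>Homoclinic branches\<close>

lemma C0_bcontfun: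
  fixes g :: "real \<Rightarrow> 'b::real_normed_vector"
  assumes c: "continuous_on UNIV g" and lim: "(g \<longlongrightarrow> 0) at_top" "(g \<longlongrightarrow> 0) at_bot"
  shows "apply_bcontfun (Bcontfun g) = g"
proof -
  obtain b1 b2 where b: "\<forall>t\<ge>0. norm (g t) \<le> b1" "\<forall>t\<le>0. norm (g t) \<le> b2"
    using continuous_tendsto_0_bounded_half_line(1)[OF c lim(1), of 0] continuous_tendsto_0_bounded_half_line(2)[OF c lim(2), of 0] by blast
  have "norm (g t) \<le> max b1 b2" for t
    using b[rule_format, of t] by (cases "t \<ge> 0") (auto simp: max.coboundedI1 max.coboundedI2)
  then show ?thesis by (rule apply_Bcontfun[OF c])
qed

lemma exp_decaying_tendsto_0:
  assumes "exp_decaying y"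
  shows "(y \<longlongrightarrow> 0) at_top" "(y \<longlongrightarrow> 0) at_bot"
proof -
  obtain C k where k: "k > 0" "\<And>t. norm (y t) \<le> C * exp (- k * \<bar>t\<bar>)" using assms unfolding exp_decaying_def by blast
  have "((\<lambda>t::real. C * exp (- k * \<bar>t\<bar>)) \<longlongrightarrow> 0) at_top" using k(1) by real_asymp
  then show "(y \<longlongrightarrow> 0) at_top" by (rule Lim_null_comparison[rotated]) (use k(2) in auto)
  have "((\<lambda>t::real. C * exp (- k * \<bar>t\<bar>)) \<longlongrightarrow> 0) at_bot" using k(1) by real_asymp
  then show "(y \<longlongrightarrow> 0) at_bot" by (rule Lim_null_comparison[rotated]) (use k(2) in auto)
qed

lemma ddir_scaleR_fun:
  assumes "Ck (Suc n) g"
  shows "ddir (\<lambda>y. r *\<^sub>R g y) v = (\<lambda>y. r *\<^sub>R ddir g v y)"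
  by (rule ext, rule ddir_eq, rule bounded_linear.has_derivative[OF bounded_linear_scaleR_right Ck_Suc_has_derivative[OF assms]])

section \<open>The homoclinic problem with its Hamiltonian and symmetry structure\<close>

locale homoclinic_pitchfork =
  fixes H :: "(real ^ ('m::finite + 'm)) \<times> real \<Rightarrow> real"
    and f :: "real ^ ('m + 'm) \<Rightarrow> real \<Rightarrow> real ^ ('m + 'm)"
    and xh :: "real \<Rightarrow> real ^ ('m + 'm)"
    and \<Phi> \<Psi> :: "real \<Rightarrow> real ^ ('m + 'm) ^ ('m + 'm)"
    and \<phi> \<psi> :: "'m + 'm \<Rightarrow> real \<Rightarrow> real ^ ('m + 'm)"
    and i1 i2 :: 'm
    and S :: "real ^ ('m + 'm) ^ ('m + 'm)"
    and \<xi>\<mu> \<xi>\<alpha> :: "real \<Rightarrow> real ^ ('m + 'm)"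
  assumes H_analytic: "real_analytic H"
    and f_eq: "f = ham_vf H"
    and equilibrium: "\<forall>\<^sub>F \<mu> in nhds 0. f 0 \<mu> = 0"
    and M1: "hyperbolic_saddle (\<lambda>x. f x 0) 0"
    and M2: "homoclinic_orbit_to_0 f 0 xh"
    and Phi: "fundamental_matrix f xh \<Phi>"
    and Psi: "\<And>t. \<Psi> t = matrix_inv (transpose (\<Phi> t))"
    and phi: "\<And>j t. \<phi> j t = column j (\<Phi> t)"
    and psi: "\<And>j t. \<psi> j t = column j (\<Psi> t)"
    and labels: "i1 \<noteq> i2"
    and M3_phi1: "\<And>t. \<phi> (Inl i1) t = vector_derivative xh (at t)"
    and M3: "bounded_solution_basis f xh (\<phi> (Inl i1)) (\<phi> (Inl i2))"
    and Phi_asymptotics: "column_asymptotics (jacobian (\<lambda>x. f x 0) (at 0)) i1 i2 \<phi>"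
    and Psi_normalized: "\<And>i t. i \<in> {i1, i2} \<Longrightarrow> \<psi> (Inr i) t = - (J_mat *v \<phi> (Inl i) t)"
    and M4_involution: "S ** S = mat 1"
    and M4_equivariant: "\<And>x \<mu>. S *v f x \<mu> = f (S *v x) \<mu>"
    and M5_plus: "\<And>t. xh t \<in> X_plus S \<and> \<psi> (Inr i1) t \<in> X_plus S"
    and M5_minus: "\<And>t. \<phi> (Inl i2) t \<in> X_minus S \<and> \<psi> (Inr i2) t \<in> X_minus S"
    and xi_mu: "decaying_solution f xh (G_mu f xh) (\<psi> (Inl i1) 0) (\<psi> (Inl i2) 0) \<xi>\<mu>"
    and xi_alpha: "decaying_solution f xh (G_alpha f xh (\<phi> (Inl i2)))
                     (\<psi> (Inl i1) 0) (\<psi> (Inl i2) 0) \<xi>\<alpha>"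
begin

abbreviation "\<phi>2 \<equiv> \<phi> (Inl i2)"
abbreviation "p1 \<equiv> \<psi> (Inr i1)"
abbreviation "p2 \<equiv> \<psi> (Inr i2)"

definition F :: "(real ^ ('m + 'm)) \<times> real \<Rightarrow> real ^ ('m + 'm)" where "F p = f (fst p) (snd p)"
definition A :: "real \<Rightarrow> real ^ ('m + 'm) ^ ('m + 'm)" where "A t = jacobian (\<lambda>y. f y 0) (at (xh t))"

lemma H_smooth: "Ck n H"
  by (rule monomial_series_imp_Ck[OF real_analytic_imp_monomial_series[OF H_analytic]])

lemma F_smooth: "Ck n F"
proof -
  have "F = (\<lambda>p. ham_vf H (fst p) (snd p))" by (rule ext, unfold F_def, simp only: f_eq)
  then show ?thesis using Ck_ham_vf[OF H_smooth, of n] by simp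
qed

lemma f_F: "f x \<mu> = F (x, \<mu>)" by (simp add: F_def)

lemma f_grad: "f x \<mu> = J_mat *v grad_x H x \<mu>" by (simp add: f_eq ham_vf_def)

lemma F_continuous: "continuous_on UNIV F" by (rule Ck_continuous[OF F_smooth])

lemma ddir_linear: "linear (\<lambda>v. ddir F v y)" by (rule Ck_ddir_linear[OF F_smooth])

lemma jacobian_mult: "jacobian (\<lambda>y. f y 0) (at x) *v v = ddir F (v, 0) (x, 0)"
proof -
  have d: "((\<lambda>y. f y 0) has_derivative (\<lambda>v. ddir F (v, 0) (x, 0))) (at x)"
    using has_derivative_partial_fst[OF F_smooth, of 0 x] by (simp add: f_F)
  then have "((\<lambda>y. f y 0) has_derivative (\<lambda>h. jacobian (\<lambda>y. f y 0) (at x) *v h)) (at x)"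
    by (subst jacobian_works[symmetric]) (rule differentiableI)
  from has_derivative_unique[OF this d] show ?thesis by (rule fun_cong)
qed

lemma A_mult: "A t *v v = ddir F (v, 0) (xh t, 0)" unfolding A_def by (rule jacobian_mult)

lemma Dx_A: "Dx f (xh t) 0 v = A t *v v"
  unfolding A_mult by (rule Dx_eq_ddir[OF F_smooth f_F])

lemma jacobian_continuous: "continuous_on UNIV (\<lambda>x. jacobian (\<lambda>y. f y 0) (at x))"
proof -
  have "jacobian (\<lambda>y. f y 0) (at x) = (\<chi> i j. ddir F (axis j 1, 0) (x, 0) $ i)" for x
  proof -
    have "jacobian (\<lambda>y. f y 0) (at x) $ i $ j = (jacobian (\<lambda>y. f y 0) (at x) *v axis j 1) $ i" for i j
      by (simp add: matrix_vector_mul_component inner_axis)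
    then show ?thesis by (simp add: vec_eq_iff jacobian_mult)
  qed
  moreover have "continuous_on UNIV (\<lambda>x. ddir F (axis j 1, 0) (x, 0))" for j
    by (rule continuous_on_compose2[OF Ck_continuous[OF Ck_ddir[OF F_smooth]]]) (auto intro!: continuous_intros)
  ultimately show ?thesis by (auto intro!: continuous_intros)
qed

lemma xh_derivative: "(xh has_vector_derivative f (xh t) 0) (at t)"
  and xh_top: "(xh \<longlongrightarrow> 0) at_top" and xh_bot: "(xh \<longlongrightarrow> 0) at_bot" and xh_nonzero: "\<exists>t. xh t \<noteq> 0"
  using M2 by (auto simp: homoclinic_orbit_to_0_def)

lemma xh_continuous: "continuous_on T xh" by (rule has_vector_derivative_imp_continuous_on[OF xh_derivative])

lemma A_continuous: "continuous_on UNIV A"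
  unfolding A_def[abs_def] by (rule continuous_on_compose2[OF jacobian_continuous xh_continuous]) auto

lemma A_limit:
  assumes "(xh \<longlongrightarrow> 0) G"
  shows "(A \<longlongrightarrow> jacobian (\<lambda>y. f y 0) (at 0)) G"
proof -
  have "isCont (\<lambda>x. jacobian (\<lambda>y. f y 0) (at x)) 0"
    using jacobian_continuous by (simp add: continuous_on_eq_continuous_at)
  from isCont_tendsto_compose[OF this assms] show ?thesis unfolding A_def[abs_def] .
qed

lemma hyperbolic: "complex_eigenvalue (jacobian (\<lambda>x. f x 0) (at 0)) l \<Longrightarrow> Re l \<noteq> 0"
  using M1 by (auto simp: hyperbolic_saddle_def)

lemma f_0: "f 0 0 = 0" using M1 by (simp add: hyperbolic_saddle_def)

lemma Phi_derivative: "(\<Phi> has_vector_derivative A t ** \<Phi> t) (at t)" and Phi_invertible: "invertible (\<Phi> t)"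
  using Phi by (auto simp: fundamental_matrix_def A_def)

lemma psi_row: "\<psi> k t = matrix_inv (\<Phi> t) $ k"
proof -
  let ?M = "transpose (matrix_inv (\<Phi> t))"
  have M: "transpose (\<Phi> t) ** ?M = mat 1" "?M ** transpose (\<Phi> t) = mat 1"
    by (simp_all add: matrix_transpose_mul[symmetric] matrix_inv_both[OF Phi_invertible])
  then have inv: "invertible (transpose (\<Phi> t))" unfolding invertible_def by blast
  from M(1) have "matrix_inv (transpose (\<Phi> t)) ** (transpose (\<Phi> t) ** ?M) = matrix_inv (transpose (\<Phi> t))" by simp
  then have "\<Psi> t = ?M"
    unfolding Psi by (simp add: matrix_mul_assoc matrix_inv_both[OF inv])
  then show ?thesis by (simp add: psi column_transpose row_def)
qed

lemma psi_phi: "\<psi> k t \<bullet> \<phi> j t = (if k = j then 1 else 0)"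
proof -
  have "\<psi> k t \<bullet> \<phi> j t = (matrix_inv (\<Phi> t) ** \<Phi> t) $ k $ j"
    by (simp add: psi_row phi matrix_matrix_mult_def inner_vec_def column_def)
  then show ?thesis by (simp add: matrix_inv_both[OF Phi_invertible] mat_def)
qed

lemma phi1: "\<phi> (Inl i1) t = f (xh t) 0"
  unfolding M3_phi1 by (rule vector_derivative_at[OF xh_derivative])

lemma phi1_tendsto_0:
  assumes "(xh \<longlongrightarrow> 0) G"
  shows "(\<phi> (Inl i1) \<longlongrightarrow> 0) G"
proof -
  have "isCont (\<lambda>x. F (x, 0)) 0"
    using continuous_on_compose2[OF F_continuous, of UNIV "\<lambda>x. (x, 0)"]
    by (simp add: continuous_on_eq_continuous_at continuous_on_Pair)
  from isCont_tendsto_compose[OF this assms] show ?thesis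
    using f_0 by (simp add: phi1[abs_def] f_F)
qed

lemma phi2_derivative: "(\<phi>2 has_vector_derivative A t *v \<phi>2 t) (at t)"
  using M3 by (simp add: bounded_solution_basis_def variational_solution_def Dx_A)

text \<open>\<open>\<phi>2\<close> is given as a bounded solution; hyperbolicity of the limit system
  at both ends upgrades this to decay.\<close>

lemma phi2_tendsto_0: "(\<phi>2 \<longlongrightarrow> 0) at_top" "(\<phi>2 \<longlongrightarrow> 0) at_bot"
proof -
  have "bounded (range \<phi>2)" using M3 by (simp add: bounded_solution_basis_def)
  then obtain b where b: "\<And>t. norm (\<phi>2 t) \<le> b" by (auto simp: bounded_iff)
  show "(\<phi>2 \<longlongrightarrow> 0) at_top" "(\<phi>2 \<longlongrightarrow> 0) at_bot"
    using bounded_homogeneous_solution_tendsto_0[OF hyperbolic A_continuous A_limit[OF xh_top] A_limit[OF xh_bot] phi2_derivative b] by auto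
qed

lemma phi2_nonzero: "\<phi>2 t \<noteq> 0"
  using psi_phi[of "Inl i2" t "Inl i2"] by auto

lemma p_tendsto_0:
  assumes "G = at_top \<or> G = at_bot" "i \<in> {i1, i2}"
  shows "(\<psi> (Inr i) \<longlongrightarrow> 0) G"
proof -
  have "(\<phi> (Inl i) \<longlongrightarrow> 0) G" using assms phi1_tendsto_0 xh_top xh_bot phi2_tendsto_0 by auto
  then have "((\<lambda>t. - (J_mat *v \<phi> (Inl i) t)) \<longlongrightarrow> - (J_mat *v 0)) G"
    by (intro tendsto_minus bounded_linear.tendsto[OF matrix_vector_mul_bounded_linear])
  moreover have "\<psi> (Inr i) = (\<lambda>t. - (J_mat *v \<phi> (Inl i) t))" by (rule ext) (rule Psi_normalized[OF assms(2)])
  ultimately show ?thesis by simp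
qed

text \<open>This identity ties the first multiplier to the energy: the function that tests it is the
  gradient of \<open>H\<close> along \<open>xh\<close>, because \<open>J_mat\<close> squares to
  minus the identity.\<close>

lemma p1_grad: "p1 t = grad_x H (xh t) 0"
  using Psi_normalized[of i1 t] by (simp add: phi1 f_grad J_mat_J_mat)

lemma Phi_continuous: "continuous_on T \<Phi>" by (rule has_vector_derivative_imp_continuous_on[OF Phi_derivative])

lemma psi_continuous: "continuous_on T (\<psi> k)"
  unfolding psi_row[abs_def] by (intro continuous_intros continuous_on_matrix_inv Phi_continuous Phi_invertible)

text \<open>All columns \<open>Inl i\<close> decay at plus infinity, the two bounded solutions
  included, so they form \<open>P\<close>. The columns \<open>Inr i1\<close> and
  \<open>Inr i2\<close> grow at both ends and cannot be continued to either side; they leave two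
  solvability conditions and form the exceptional set \<open>E\<close>.\<close>

lemma linear_operator:
  obtains L :: "(real \<Rightarrow>\<^sub>C (real ^ ('m + 'm))) \<Rightarrow> (real \<Rightarrow>\<^sub>C (real ^ ('m + 'm)))" and \<Lambda>1 \<Lambda>2 m11 m12 m21 m22 where
    "bounded_linear L" "bounded_linear \<Lambda>1" "bounded_linear \<Lambda>2"
    "\<And>h t. (apply_bcontfun (L h) has_vector_derivative A t *v apply_bcontfun (L h) t + apply_bcontfun h t
       - (\<Lambda>1 h *\<^sub>R (hat t *\<^sub>R (m11 *\<^sub>R p1 t + m12 *\<^sub>R p2 t)) + \<Lambda>2 h *\<^sub>R (hat t *\<^sub>R (m21 *\<^sub>R p1 t + m22 *\<^sub>R p2 t)))) (at t)"
    "\<And>h. (apply_bcontfun h \<longlongrightarrow> 0) at_top \<Longrightarrow> (apply_bcontfun (L h) \<longlongrightarrow> 0) at_top"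
    "\<And>h. (apply_bcontfun h \<longlongrightarrow> 0) at_bot \<Longrightarrow> (apply_bcontfun (L h) \<longlongrightarrow> 0) at_bot"
    "\<And>h. ((\<lambda>S. integral {-S..S} (\<lambda>t. p2 t \<bullet> apply_bcontfun h t)) \<longlongrightarrow> \<Lambda>2 h) at_top"
    "integral {-1..1} (\<lambda>t. p1 t \<bullet> (hat t *\<^sub>R (m11 *\<^sub>R p1 t + m12 *\<^sub>R p2 t))) = 1"
proof -
  have ind: "u = 0 \<and> v = 0" if "u *\<^sub>R p1 0 + v *\<^sub>R p2 0 = 0" for u v
  proof -
    have "(u *\<^sub>R p1 0 + v *\<^sub>R p2 0) \<bullet> \<phi> (Inr i1) 0 = 0" "(u *\<^sub>R p1 0 + v *\<^sub>R p2 0) \<bullet> \<phi> (Inr i2) 0 = 0" using that by simp_all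
    then show ?thesis using labels by (simp add: inner_add_left psi_phi)
  qed
  obtain m11 m12 m21 m22 where m:
    "integral {-1..1} (\<lambda>t. p1 t \<bullet> (hat t *\<^sub>R (m11 *\<^sub>R p1 t + m12 *\<^sub>R p2 t))) = 1"
    "integral {-1..1} (\<lambda>t. p2 t \<bullet> (hat t *\<^sub>R (m11 *\<^sub>R p1 t + m12 *\<^sub>R p2 t))) = 0"
    "integral {-1..1} (\<lambda>t. p1 t \<bullet> (hat t *\<^sub>R (m21 *\<^sub>R p1 t + m22 *\<^sub>R p2 t))) = 0"
    "integral {-1..1} (\<lambda>t. p2 t \<bullet> (hat t *\<^sub>R (m21 *\<^sub>R p1 t + m22 *\<^sub>R p2 t))) = 1"
    by (rule biorthogonal_bumps[of p1 p2], rule psi_continuous, rule psi_continuous, erule ind, rule that)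
  define \<rho> where "\<rho> k t = (if k = Inr i1 then hat t *\<^sub>R (m11 *\<^sub>R p1 t + m12 *\<^sub>R p2 t) else hat t *\<^sub>R (m21 *\<^sub>R p1 t + m22 *\<^sub>R p2 t))"
    for k :: "'m + 'm" and t
  let ?P = "range Inl :: ('m + 'm) set" and ?E = "{Inr i1, Inr i2} :: ('m + 'm) set"
  have ne: "(Inr i1 :: 'm + 'm) \<noteq> Inr i2" using labels by simp
  obtain L :: "(real \<Rightarrow>\<^sub>C (real ^ ('m + 'm))) \<Rightarrow> (real \<Rightarrow>\<^sub>C (real ^ ('m + 'm)))" and \<Lambda> where L: "bounded_linear L" "\<And>k. bounded_linear (\<Lambda> k)"
    "\<And>h t. (apply_bcontfun (L h) has_vector_derivative A t *v apply_bcontfun (L h) t + apply_bcontfun h t - (\<Sum>k\<in>?E. \<Lambda> k h *\<^sub>R \<rho> k t)) (at t)"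
    "\<And>h. (apply_bcontfun h \<longlongrightarrow> 0) at_top \<Longrightarrow> (apply_bcontfun (L h) \<longlongrightarrow> 0) at_top"
    "\<And>h. (apply_bcontfun h \<longlongrightarrow> 0) at_bot \<Longrightarrow> (apply_bcontfun (L h) \<longlongrightarrow> 0) at_bot"
    "\<And>k h. k \<in> ?E \<Longrightarrow> ((\<lambda>S. integral {-S..S} (\<lambda>t. matrix_inv (\<Phi> t) $ k \<bullet> apply_bcontfun h t)) \<longlongrightarrow> \<Lambda> k h) at_top"
  proof (rule bounded_solution_operator[of "jacobian (\<lambda>y. f y 0) (at 0)" A \<Phi> ?P ?E \<rho> 1])
    show "Re l \<noteq> 0" if "complex_eigenvalue (jacobian (\<lambda>y. f y 0) (at 0)) l" for l by (rule hyperbolic[OF that])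
    show "continuous_on UNIV A" "(A \<longlongrightarrow> jacobian (\<lambda>y. f y 0) (at 0)) at_top" "(A \<longlongrightarrow> jacobian (\<lambda>y. f y 0) (at 0)) at_bot"
      by (rule A_continuous A_limit[OF xh_top] A_limit[OF xh_bot])+
    show "(\<Phi> has_vector_derivative A t ** \<Phi> t) (at t)" "invertible (\<Phi> t)" for t by (rule Phi_derivative Phi_invertible)+
    show "((\<lambda>t. column j (\<Phi> t)) \<longlongrightarrow> 0) at_top" if jP: "j \<in> ?P" for j
    proof -
      obtain i where i: "j = Inl i" using jP by blast
      have "(\<phi> (Inl i) \<longlongrightarrow> 0) at_top"
        using phi1_tendsto_0[OF xh_top] phi2_tendsto_0(1) Phi_asymptotics
        by (cases "i = i1 \<or> i = i2") (auto simp: column_asymptotics_def)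
      then show ?thesis unfolding i phi[abs_def] .
    qed
    show "((\<lambda>t. column j (\<Phi> t)) \<longlongrightarrow> 0) at_bot" if j: "j \<notin> ?P" "j \<notin> ?E" for j
    proof -
      obtain i where i: "j = Inr i" using j(1) by (cases j) auto
      have "(\<phi> (Inr i) \<longlongrightarrow> 0) at_bot" using Phi_asymptotics j(2) i by (auto simp: column_asymptotics_def)
      then show ?thesis unfolding i phi[abs_def] .
    qed
    show "?P \<inter> ?E = {}" by auto
    show "((\<lambda>t. matrix_inv (\<Phi> t) $ k) \<longlongrightarrow> 0) at_top" "((\<lambda>t. matrix_inv (\<Phi> t) $ k) \<longlongrightarrow> 0) at_bot" if "k \<in> ?E" for k
      using p_tendsto_0[of at_top] p_tendsto_0[of at_bot] that unfolding psi_row[abs_def] by auto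
    show "continuous_on UNIV (\<rho> k)" for k
      unfolding \<rho>_def by (cases "k = Inr i1") (auto intro!: continuous_intros hat psi_continuous)
    show "\<rho> k t = 0" if "\<bar>t\<bar> \<ge> 1" for k t using hat(3)[OF that] by (simp add: \<rho>_def)
    show "integral {-1..1} (\<lambda>t. matrix_inv (\<Phi> t) $ k \<bullet> \<rho> l t) = (if k = l then 1 else 0)" if "k \<in> ?E" "l \<in> ?E" for k l
      unfolding psi_row[symmetric] \<rho>_def using that m ne by auto
  qed (rule that)
  show ?thesis
  proof (rule that[of L "\<Lambda> (Inr i1)" "\<Lambda> (Inr i2)" m11 m12 m21 m22])
    fix h t
    show "(apply_bcontfun (L h) has_vector_derivative A t *v apply_bcontfun (L h) t + apply_bcontfun h t
       - (\<Lambda> (Inr i1) h *\<^sub>R (hat t *\<^sub>R (m11 *\<^sub>R p1 t + m12 *\<^sub>R p2 t)) + \<Lambda> (Inr i2) h *\<^sub>R (hat t *\<^sub>R (m21 *\<^sub>R p1 t + m22 *\<^sub>R p2 t)))) (at t)"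
      using L(3)[of h t] ne by (simp add: \<rho>_def)
    show "((\<lambda>S. integral {-S..S} (\<lambda>t. p2 t \<bullet> apply_bcontfun h t)) \<longlongrightarrow> \<Lambda> (Inr i2) h) at_top"
      using L(6)[of "Inr i2" h] unfolding psi_row by simp
  qed (use L m(1) in auto)
qed

text \<open>By the energy balance, \<open>\<gamma>\<close> times the integral of
  \<open>grad_x H (x t) \<mu> \<bullet> r t\<close> is 0. For \<open>x\<close> close to
  \<open>xh\<close> and \<open>\<mu>\<close> close to 0 that integral is close to the one with
  \<open>p1 t\<close>, the gradient along \<open>xh\<close>, and hence nonzero.\<close>

lemma multiplier_zero:
  assumes r: "continuous_on UNIV r" "\<And>t. \<bar>t\<bar> \<ge> 1 \<Longrightarrow> r t = 0" and nz: "integral {-1..1} (\<lambda>t. p1 t \<bullet> r t) \<noteq> 0"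
  shows "\<exists>\<delta>>0. \<forall>x \<mu> \<gamma>. (\<forall>t. norm (x t - xh t) \<le> \<delta>) \<longrightarrow> \<bar>\<mu>\<bar> \<le> \<delta> \<longrightarrow>
      (\<forall>t. (x has_vector_derivative f (x t) \<mu> - \<gamma> *\<^sub>R r t) (at t)) \<longrightarrow> (x \<longlongrightarrow> 0) at_top \<longrightarrow> (x \<longlongrightarrow> 0) at_bot \<longrightarrow> \<gamma> = 0"
proof -
  let ?g = "\<lambda>p. grad_x H (fst p) (snd p)"
  define I where "I = \<bar>integral {-1..1} (\<lambda>t. p1 t \<bullet> r t)\<bar>"
  have I: "I > 0" using nz by (simp add: I_def)
  have xh_b: "apply_bcontfun (Bcontfun xh) = xh" by (rule C0_bcontfun[OF xh_continuous xh_top xh_bot])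
  define M where "M = norm (Bcontfun xh) + 2"
  have xhM: "norm (xh t) \<le> norm (Bcontfun xh)" for t using norm_bounded[of "Bcontfun xh" t] xh_b by simp
  obtain L where L: "L \<ge> 0" "\<And>p q. norm p \<le> M \<Longrightarrow> norm q \<le> M \<Longrightarrow> norm (?g p - ?g q) \<le> L * norm (p - q)"
    using Ck_locally_Lipschitz[OF Ck_grad_x[OF H_smooth], of M] by blast
  have "bounded (r ` {-1..1})" by (intro compact_imp_bounded compact_continuous_image continuous_on_subset[OF r(1)]) auto
  then obtain b where b: "\<forall>y\<in>r ` {-1..1}. norm y \<le> b" by (auto simp: bounded_iff)
  \<comment> \<open>Replacing \<open>grad_x H (x t) \<mu>\<close> by \<open>p1 t\<close> changes the
    integral by at most \<open>4 * L * \<bar>b\<bar> * \<delta>\<close>: the interval has length 2,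
    and orbit and parameter together move by at most \<open>2 * \<delta>\<close>. The choice makes
    this at most \<open>I / 2\<close>.\<close>
  define \<delta> where "\<delta> = min 1 (I / (8 * (L + 1) * (\<bar>b\<bar> + 1)))"
  have \<delta>: "\<delta> > 0" "\<delta> \<le> 1" using I L by (auto simp: \<delta>_def)
  show ?thesis
  proof (intro exI[of _ \<delta>] conjI allI impI \<delta>(1))
    fix x \<mu> \<gamma> assume close: "\<forall>t. norm (x t - xh t) \<le> \<delta>" "\<bar>\<mu>\<bar> \<le> \<delta>"
      and x: "\<forall>t. (x has_vector_derivative f (x t) \<mu> - \<gamma> *\<^sub>R r t) (at t)" and lim: "(x \<longlongrightarrow> 0) at_top" "(x \<longlongrightarrow> 0) at_bot"
    have xc: "continuous_on T x" for T by (rule has_vector_derivative_imp_continuous_on) (use x in auto)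
    have gc: "continuous_on UNIV (\<lambda>y. grad_x H y \<nu>)" for \<nu>
    proof -
      have "continuous_on UNIV (\<lambda>y :: real ^ ('m + 'm). (y, \<nu>))" by (intro continuous_intros)
      from continuous_on_compose2[OF Ck_continuous[OF Ck_grad_x[OF H_smooth]] this] show ?thesis by simp
    qed
    have "integral {-1..1} (\<lambda>t. grad_x H (x t) \<mu> \<bullet> (\<gamma> *\<^sub>R r t)) = 0"
      by (rule energy_balance[OF has_derivative_grad_x[OF H_smooth] gc inner_J_mat _ _ _ lim])
        (use x r in \<open>auto simp: f_grad intro!: continuous_intros\<close>)
    then have z: "\<gamma> * integral {-1..1} (\<lambda>t. grad_x H (x t) \<mu> \<bullet> r t) = 0" by simp
    let ?d = "\<lambda>t. (grad_x H (x t) \<mu> - p1 t) \<bullet> r t"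
    have c1: "continuous_on {-1..1} (\<lambda>t. grad_x H (x t) \<mu> \<bullet> r t)"
      by (intro continuous_intros continuous_on_compose2[OF gc xc] continuous_on_subset[OF r(1)]) auto
    have c2: "continuous_on {-1..1} (\<lambda>t. p1 t \<bullet> r t)"
      by (intro continuous_intros psi_continuous continuous_on_subset[OF r(1)]) auto
    have "integral {-1..1} ?d = integral {-1..1} (\<lambda>t. grad_x H (x t) \<mu> \<bullet> r t) - integral {-1..1} (\<lambda>t. p1 t \<bullet> r t)"
      unfolding inner_diff_left by (intro integral_diff integrable_continuous_real c1 c2)
    moreover have "norm (integral {-1..1} ?d) \<le> (L * (2 * \<delta>) * \<bar>b\<bar>) * (1 - (-1))"
    proof (rule integral_bound)
      show "continuous_on {-1..1} ?d" unfolding inner_diff_left by (intro continuous_on_diff c1 c2)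
      fix t :: real assume t: "t \<in> {-1..1}"
      have "norm (r t) \<le> \<bar>b\<bar>" using b t by force
      have "norm (x t) \<le> norm (xh t) + \<delta>" using close(1)[rule_format, of t] norm_triangle_sub[of "x t" "xh t"] by linarith
      then have 1: "norm (x t, \<mu>) \<le> M" using norm_Pair_le[of "x t" \<mu>] xhM[of t] close(2) \<delta> by (simp add: M_def)
      have 2: "norm (xh t, 0::real) \<le> M" using xhM[of t] by (simp add: norm_Pair M_def)
      have "norm (grad_x H (x t) \<mu> - p1 t) \<le> L * norm ((x t, \<mu>) - (xh t, 0))"
        using L(2)[OF 1 2] by (simp add: p1_grad)
      also have "norm ((x t, \<mu>) - (xh t, 0)) \<le> 2 * \<delta>"
        using norm_Pair_le[of "x t - xh t" \<mu>] close(1)[rule_format, of t] close(2) by simp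
      finally have "norm (grad_x H (x t) \<mu> - p1 t) \<le> L * (2 * \<delta>)" using L(1) by (simp add: mult_left_mono)
      then show "norm (?d t) \<le> L * (2 * \<delta>) * \<bar>b\<bar>"
        using Cauchy_Schwarz_ineq2[of "grad_x H (x t) \<mu> - p1 t" "r t"] \<open>norm (r t) \<le> \<bar>b\<bar>\<close> L \<delta>
          mult_mono[of "norm (grad_x H (x t) \<mu> - p1 t)" "L * (2 * \<delta>)" "norm (r t)" "\<bar>b\<bar>"] by simp
    qed simp
    moreover have "(L * (2 * \<delta>) * \<bar>b\<bar>) * (1 - (-1)) < I"
    proof -
      have "(L * (2 * \<delta>) * \<bar>b\<bar>) * (1 - (-1)) = 4 * (L * \<bar>b\<bar>) * \<delta>" by simp
      also have "\<dots> \<le> 4 * ((L + 1) * (\<bar>b\<bar> + 1)) * \<delta>" using L \<delta> by (intro mult_right_mono mult_left_mono mult_mono) auto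
      also have "\<dots> \<le> 4 * ((L + 1) * (\<bar>b\<bar> + 1)) * (I / (8 * (L + 1) * (\<bar>b\<bar> + 1)))"
        using L by (intro mult_left_mono) (auto simp: \<delta>_def)
      also have "\<dots> = I / 2"
      proof -
        have "(L + 1) * (\<bar>b\<bar> + 1) \<noteq> 0" using L by auto
        then show ?thesis by (simp add: field_simps)
      qed
      finally show ?thesis using I by simp
    qed
    ultimately have "integral {-1..1} (\<lambda>t. grad_x H (x t) \<mu> \<bullet> r t) \<noteq> 0" unfolding I_def by auto
    then show "\<gamma> = 0" using z by simp
  qed
qed

lemma xi_mu_facts:
  "(\<xi>\<mu> has_vector_derivative A t *v \<xi>\<mu> t + ddir F (0, 1) (xh t, 0)) (at t)"
  "(\<xi>\<mu> \<longlongrightarrow> 0) at_top" "(\<xi>\<mu> \<longlongrightarrow> 0) at_bot"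
  using xi_mu exp_decaying_tendsto_0[of \<xi>\<mu>]
  by (auto simp: decaying_solution_def variational_solution_def Dx_A G_mu_def Dmu_eq_ddir[OF F_smooth f_F])

lemma xi_alpha_facts:
  "(\<xi>\<alpha> has_vector_derivative A t *v \<xi>\<alpha> t + (1/2) *\<^sub>R ddir (ddir F (\<phi>2 t, 0)) (\<phi>2 t, 0) (xh t, 0)) (at t)"
  "(\<xi>\<alpha> \<longlongrightarrow> 0) at_top" "(\<xi>\<alpha> \<longlongrightarrow> 0) at_bot"
  using xi_alpha exp_decaying_tendsto_0[of \<xi>\<alpha>]
  by (auto simp: decaying_solution_def variational_solution_def Dx_A G_alpha_def Dx2_eq_ddir[OF F_smooth f_F])

lemma F_equilibrium: "\<forall>\<^sub>F \<mu> in nhds 0. F (0, \<mu>) = 0" using equilibrium by (simp add: f_F)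

lemma S_S: "S *v (S *v v) = v" by (simp add: matrix_vector_mul_assoc M4_involution)

lemma S_F: "S *v F (x, \<mu>) = F (S *v x, \<mu>)" using M4_equivariant by (simp add: f_F)

lemma S_xh: "S *v xh t = xh t" using M5_plus by (simp add: X_plus_def)

text \<open>Differentiate the equivariance of \<open>F\<close> at \<open>xh t\<close>, a point fixed
  by \<open>S\<close>.\<close>

lemma S_A: "S *v (A t *v v) = A t *v (S *v v)"
proof -
  have d: "((\<lambda>y. F (y, 0)) has_derivative (\<lambda>v. ddir F (v, 0) (x, 0))) (at x)" for x
    by (rule has_derivative_partial_fst[OF F_smooth])
  have "((\<lambda>y. S *v F (y, 0)) has_derivative (\<lambda>v. S *v ddir F (v, 0) (xh t, 0))) (at (xh t))"
    by (rule bounded_linear.has_derivative[OF matrix_vector_mul_bounded_linear d])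
  moreover have "((\<lambda>y. F (S *v y, 0)) has_derivative (\<lambda>v. ddir F (S *v v, 0) (S *v xh t, 0))) (at (xh t))"
    by (rule has_derivative_compose[OF bounded_linear_imp_has_derivative[OF matrix_vector_mul_bounded_linear] d])
  ultimately have "(\<lambda>v. S *v ddir F (v, 0) (xh t, 0)) = (\<lambda>v. ddir F (S *v v, 0) (S *v xh t, 0))"
    unfolding S_F by (rule has_derivative_unique)
  from fun_cong[OF this, of v] show ?thesis by (simp add: A_mult S_xh)
qed

lemma S_Fmu: "S *v ddir F (0, 1) (xh t, 0) = ddir F (0, 1) (xh t, 0)"
proof -
  have d: "((\<lambda>\<nu>. F (xh t, \<nu>)) has_vector_derivative ddir F (0, 1) (xh t, 0)) (at 0)"
    by (rule has_vector_derivative_partial_snd[OF F_smooth])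
  have "((\<lambda>\<nu>. S *v F (xh t, \<nu>)) has_vector_derivative S *v ddir F (0, 1) (xh t, 0)) (at 0)"
    by (rule bounded_linear.has_vector_derivative[OF matrix_vector_mul_bounded_linear d])
  then have "((\<lambda>\<nu>. F (xh t, \<nu>)) has_vector_derivative S *v ddir F (0, 1) (xh t, 0)) (at 0)" by (simp add: S_F S_xh)
  from vector_derivative_unique_at[OF this d] show ?thesis .
qed

lemma ddir_F_scaleR: "ddir F (r *\<^sub>R v) = (\<lambda>y. r *\<^sub>R ddir F v y)"
  by (rule ext) (rule linear_scale[OF ddir_linear])

lemma bcontfun_xh: "apply_bcontfun (Bcontfun xh) = xh"
  by (rule C0_bcontfun[OF xh_continuous xh_top xh_bot])

lemma bcontfun_phi2: "apply_bcontfun (Bcontfun \<phi>2) = \<phi>2"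
  by (rule C0_bcontfun[OF has_vector_derivative_imp_continuous_on[OF phi2_derivative] phi2_tendsto_0])

lemma bcontfun_xi_mu: "apply_bcontfun (Bcontfun \<xi>\<mu>) = \<xi>\<mu>"
  by (rule C0_bcontfun[OF has_vector_derivative_imp_continuous_on[OF xi_mu_facts(1)] xi_mu_facts(2,3)])

lemma bcontfun_xi_alpha: "apply_bcontfun (Bcontfun \<xi>\<alpha>) = \<xi>\<alpha>"
  by (rule C0_bcontfun[OF has_vector_derivative_imp_continuous_on[OF xi_alpha_facts(1)] xi_alpha_facts(2,3)])

text \<open>
  A nonzero Melnikov-type coefficient forces integrability of its integrand, since the Bochner
  integral of a non-integrable function is 0.
\<close>

lemma functional_eq_LBINT:
  fixes u :: "real \<Rightarrow> real ^ ('m + 'm)"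
  assumes lim: "((\<lambda>T. integral {-T..T} (\<lambda>t. p2 t \<bullet> (c *\<^sub>R u t))) \<longlongrightarrow> l) at_top"
    and v: "v = - (LBINT t. (J_mat *v \<phi>2 t) \<bullet> u t)" "v \<noteq> 0"
  shows "l = c * v"
proof -
  let ?g = "\<lambda>t. (J_mat *v \<phi>2 t) \<bullet> u t"
  have "integrable lborel ?g" using v not_integrable_integral_eq[of lborel ?g] by auto
  from LBINT_symmetric_limit[OF this]
  have "((\<lambda>T. - c * integral {-T..T} ?g) \<longlongrightarrow> - c * (LBINT t. ?g t)) at_top" by (intro tendsto_intros)
  moreover have "integral {-T..T} (\<lambda>t. p2 t \<bullet> (c *\<^sub>R u t)) = - c * integral {-T..T} ?g" for T
    using Psi_normalized[of i2] by (simp add: inner_minus_left)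
  ultimately have "((\<lambda>T. integral {-T..T} (\<lambda>t. p2 t \<bullet> (c *\<^sub>R u t))) \<longlongrightarrow> c * v) at_top" using v(1) by simp
  from tendsto_unique[OF _ lim this] show ?thesis by simp
qed

text \<open>The orbit is asked to follow \<open>a *\<^sub>R \<phi>2\<close> and not
  \<open>(a * \<sigma>) *\<^sub>R \<phi>2\<close>, so the zero \<open>\<sigma>\<close> of the second
  multiplier must not only exist but lie within O(a) of 1.\<close>

lemma pair_branch:
  assumes a2: "a2 = a2_bar f xh \<phi>2 \<xi>\<mu>" "a2 \<noteq> 0" and b2: "b2 = b2_bar f xh \<phi>2 \<xi>\<alpha>" "b2 \<noteq> 0" and c: "c = - b2 / a2"
  shows "\<exists>a0>0. \<exists>C\<ge>0. \<forall>a. a \<noteq> 0 \<longrightarrow> \<bar>a\<bar> < a0 \<longrightarrow> (\<exists>x. (\<forall>t. (x has_vector_derivative f (x t) (c * a\<^sup>2)) (at t)) \<and>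
     (x \<longlongrightarrow> 0) at_top \<and> (x \<longlongrightarrow> 0) at_bot \<and> (\<forall>t. norm (x t - (xh t + a *\<^sub>R \<phi>2 t)) \<le> C * a\<^sup>2))"
proof -
  obtain L :: "(real \<Rightarrow>\<^sub>C (real ^ ('m + 'm))) \<Rightarrow> (real \<Rightarrow>\<^sub>C (real ^ ('m + 'm)))" and \<Lambda>1 \<Lambda>2 m11 m12 m21 m22 where
    L: "bounded_linear L" and \<Lambda>: "bounded_linear \<Lambda>1" "bounded_linear \<Lambda>2" and
    LD: "\<And>h t. (apply_bcontfun (L h) has_vector_derivative A t *v apply_bcontfun (L h) t + apply_bcontfun h t
       - (\<Lambda>1 h *\<^sub>R (hat t *\<^sub>R (m11 *\<^sub>R p1 t + m12 *\<^sub>R p2 t)) + \<Lambda>2 h *\<^sub>R (hat t *\<^sub>R (m21 *\<^sub>R p1 t + m22 *\<^sub>R p2 t)))) (at t)" and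
    L0: "\<And>h. (apply_bcontfun h \<longlongrightarrow> 0) at_top \<Longrightarrow> (apply_bcontfun (L h) \<longlongrightarrow> 0) at_top"
    "\<And>h. (apply_bcontfun h \<longlongrightarrow> 0) at_bot \<Longrightarrow> (apply_bcontfun (L h) \<longlongrightarrow> 0) at_bot" and
    \<Lambda>2: "\<And>h. ((\<lambda>S. integral {-S..S} (\<lambda>t. p2 t \<bullet> apply_bcontfun h t)) \<longlongrightarrow> \<Lambda>2 h) at_top" and
    r1: "integral {-1..1} (\<lambda>t. p1 t \<bullet> (hat t *\<^sub>R (m11 *\<^sub>R p1 t + m12 *\<^sub>R p2 t))) = 1"
    by (rule linear_operator) (rule that)
  define r where "r t = hat t *\<^sub>R (m11 *\<^sub>R p1 t + m12 *\<^sub>R p2 t)" for t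
  define res where "res h t = \<Lambda>1 h *\<^sub>R r t + \<Lambda>2 h *\<^sub>R (hat t *\<^sub>R (m21 *\<^sub>R p1 t + m22 *\<^sub>R p2 t))" for h t
  let ?X = "Bcontfun xh" and ?P = "Bcontfun \<phi>2" and ?M = "Bcontfun \<xi>\<mu>" and ?A = "Bcontfun \<xi>\<alpha>"
  note bc = bcontfun_xh bcontfun_phi2 bcontfun_xi_mu bcontfun_xi_alpha
  let ?x = "\<lambda>a \<sigma> Z. ansatz ?X ?P ?M ?A c a \<sigma> Z"
  obtain a0 M N K where a0: "0 < a0" "a0 \<le> 1" and M: "0 \<le> M" and K: "0 \<le> K" and
    sol: "\<And>a. \<bar>a\<bar> \<le> a0 \<Longrightarrow> \<exists>Z. continuous_on {0..2} (\<lambda>\<sigma>. N \<sigma> a (Z \<sigma>)) \<and> (\<forall>\<sigma>\<in>{0..2}. norm (Z \<sigma>) \<le> M \<and> L (N \<sigma> a (Z \<sigma>)) = Z \<sigma> \<and>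
        norm (N \<sigma> a (Z \<sigma>) - N \<sigma> 0 0) \<le> K * \<bar>a\<bar> \<and>
        (?x a \<sigma> (Z \<sigma>) \<longlongrightarrow> 0) at_top \<and> (?x a \<sigma> (Z \<sigma>) \<longlongrightarrow> 0) at_bot \<and>
        (\<forall>t. (?x a \<sigma> (Z \<sigma>) has_vector_derivative F (?x a \<sigma> (Z \<sigma>) t, c * a\<^sup>2) - a^3 *\<^sub>R res (N \<sigma> a (Z \<sigma>)) t) (at t)))" and
    N: "\<And>\<sigma> t. apply_bcontfun (N \<sigma> 0 0) t =
       ddir (ddir F (c *\<^sub>R apply_bcontfun ?M t + \<sigma>\<^sup>2 *\<^sub>R apply_bcontfun ?A t, c)) (\<sigma> *\<^sub>R apply_bcontfun ?P t, 0) (apply_bcontfun ?X t, 0)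
       + (1/6) *\<^sub>R ddir (ddir (ddir F (\<sigma> *\<^sub>R apply_bcontfun ?P t, 0)) (\<sigma> *\<^sub>R apply_bcontfun ?P t, 0)) (\<sigma> *\<^sub>R apply_bcontfun ?P t, 0) (apply_bcontfun ?X t, 0)"
  proof (rule solution_family[of F A ?X ?P ?M ?A L res c])
    show "(apply_bcontfun (L h) has_vector_derivative A t *v apply_bcontfun (L h) t + apply_bcontfun h t - res h t) (at t)" for h t
      using LD[of h t] by (simp add: res_def r_def)
    show "(apply_bcontfun ?X has_vector_derivative F (apply_bcontfun ?X t, 0)) (at t)" for t
      using xh_derivative[of t] by (simp add: bc f_F)
    show "(apply_bcontfun ?M has_vector_derivative A t *v apply_bcontfun ?M t + ddir F (0, 1) (apply_bcontfun ?X t, 0)) (at t)" for t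
      unfolding bc by (rule xi_mu_facts)
    show "(apply_bcontfun ?A has_vector_derivative A t *v apply_bcontfun ?A t
        + (1/2) *\<^sub>R ddir (ddir F (apply_bcontfun ?P t, 0)) (apply_bcontfun ?P t, 0) (apply_bcontfun ?X t, 0)) (at t)" for t
      unfolding bc by (rule xi_alpha_facts)
    show "A t *v v = ddir F (v, 0) (apply_bcontfun ?X t, 0)" for t v unfolding bc by (rule A_mult)
    show "(apply_bcontfun ?P has_vector_derivative A t *v apply_bcontfun ?P t) (at t)" for t
      unfolding bc by (rule phi2_derivative)
    show "(apply_bcontfun ?X \<longlongrightarrow> 0) at_top" "(apply_bcontfun ?P \<longlongrightarrow> 0) at_top" "(apply_bcontfun ?M \<longlongrightarrow> 0) at_top" "(apply_bcontfun ?A \<longlongrightarrow> 0) at_top"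
      "(apply_bcontfun ?X \<longlongrightarrow> 0) at_bot" "(apply_bcontfun ?P \<longlongrightarrow> 0) at_bot" "(apply_bcontfun ?M \<longlongrightarrow> 0) at_bot" "(apply_bcontfun ?A \<longlongrightarrow> 0) at_bot"
      unfolding bc by (rule xh_top xh_bot phi2_tendsto_0 xi_mu_facts xi_alpha_facts)+
    show "\<forall>\<^sub>F \<mu> in nhds 0. F (0, \<mu>) = 0" "bounded_linear L" by (rule F_equilibrium L)+
  qed (rule F_smooth, erule L0, erule L0, rule that)
  \<comment> \<open>\<open>u\<close> and \<open>w\<close> are the vector parts of the integrands of
    \<open>a2_bar\<close> and \<open>b2_bar\<close>; they turn out to be the coefficients of the
    remainder at \<open>a = 0\<close> as a polynomial in \<open>\<sigma>\<close>, up to the factor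
    \<open>c\<close>.\<close>
  define u where "u t = Dmux f (xh t) 0 (\<phi>2 t) + Dx2 f (xh t) 0 (\<xi>\<mu> t) (\<phi>2 t)" for t
  define w where "w t = (1/6) *\<^sub>R Dx3 f (xh t) 0 (\<phi>2 t) (\<phi>2 t) (\<phi>2 t) + Dx2 f (xh t) 0 (\<xi>\<alpha> t) (\<phi>2 t)" for t
  have N0: "apply_bcontfun (N \<sigma> 0 0) t = \<sigma> *\<^sub>R (c *\<^sub>R u t) + \<sigma>^3 *\<^sub>R w t" for \<sigma> t
  proof -
    let ?y = "(xh t, 0::real)" and ?p = "(\<phi>2 t, 0::real)"
    have lin: "linear (\<lambda>v. ddir (ddir F v) ?p ?y)"
      using Ck_ddir_linear[OF Ck_ddir[OF F_smooth], of ?p ?y] by (simp add: ddir_commute[OF F_smooth, of _ ?p])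
    have q: "(c *\<^sub>R \<xi>\<mu> t + \<sigma>\<^sup>2 *\<^sub>R \<xi>\<alpha> t, c) = c *\<^sub>R (\<xi>\<mu> t, 0) + c *\<^sub>R (0, 1) + \<sigma>\<^sup>2 *\<^sub>R (\<xi>\<alpha> t, 0)" by simp
    have p: "(\<sigma> *\<^sub>R \<phi>2 t, 0::real) = \<sigma> *\<^sub>R ?p" by simp
    have 1: "ddir (ddir F (c *\<^sub>R \<xi>\<mu> t + \<sigma>\<^sup>2 *\<^sub>R \<xi>\<alpha> t, c)) (\<sigma> *\<^sub>R ?p) ?y =
      \<sigma> *\<^sub>R (c *\<^sub>R ddir (ddir F (\<xi>\<mu> t, 0)) ?p ?y + c *\<^sub>R ddir (ddir F (0, 1)) ?p ?y + \<sigma>\<^sup>2 *\<^sub>R ddir (ddir F (\<xi>\<alpha> t, 0)) ?p ?y)"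
      unfolding q linear_scale[OF Ck_ddir_linear[OF Ck_ddir[OF F_smooth]]] by (simp only: linear_add[OF lin] linear_scale[OF lin])
    have 2: "ddir (ddir (ddir F (\<sigma> *\<^sub>R ?p)) (\<sigma> *\<^sub>R ?p)) (\<sigma> *\<^sub>R ?p) ?y = \<sigma>^3 *\<^sub>R ddir (ddir (ddir F ?p) ?p) ?p ?y"
    proof -
      have "ddir F (\<sigma> *\<^sub>R ?p) = (\<lambda>y. \<sigma> *\<^sub>R ddir F ?p y)" by (rule ddir_F_scaleR)
      moreover have "ddir (\<lambda>y. \<sigma> *\<^sub>R ddir F ?p y) (\<sigma> *\<^sub>R ?p) = (\<lambda>y. \<sigma>\<^sup>2 *\<^sub>R ddir (ddir F ?p) ?p y)"
        unfolding ddir_scaleR_fun[OF Ck_ddir[OF F_smooth]]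
        by (simp only: linear_scale[OF Ck_ddir_linear[OF Ck_ddir[OF F_smooth]]] power2_eq_square scaleR_scaleR)
      moreover have "ddir (\<lambda>y. \<sigma>\<^sup>2 *\<^sub>R ddir (ddir F ?p) ?p y) (\<sigma> *\<^sub>R ?p) ?y = \<sigma>^3 *\<^sub>R ddir (ddir (ddir F ?p) ?p) ?p ?y"
        unfolding ddir_scaleR_fun[OF Ck_ddir[OF Ck_ddir[OF F_smooth]]]
        by (simp only: linear_scale[OF Ck_ddir_linear[OF Ck_ddir[OF Ck_ddir[OF F_smooth]]]] power2_eq_square power3_eq_cube scaleR_scaleR mult.assoc)
      ultimately show ?thesis by (simp only:)
    qed
    have 3: "Dmux f (xh t) 0 (\<phi>2 t) = ddir (ddir F (0, 1)) ?p ?y"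
      unfolding Dmux_eq_ddir[OF F_smooth f_F] by (rule ddir_commute[OF F_smooth])
    show ?thesis
      unfolding N bc p 1 2 u_def w_def 3 Dx2_eq_ddir[OF F_smooth f_F] Dx3_eq_ddir[OF F_smooth f_F]
      by (simp add: scaleR_add_right power2_eq_square power3_eq_cube mult_ac)
  qed
  \<comment> \<open>The values at \<open>\<sigma> = 1\<close> and \<open>\<sigma> = 2\<close>
    determine the coefficients of \<open>\<sigma>\<close> and \<open>\<sigma>^3\<close>. Recovering
    \<open>c *\<^sub>R u t\<close> and \<open>w t\<close> in this way yields them as bounded
    continuous functions, so that \<open>\<Lambda>2\<close> applies to each separately.\<close>
  define ha where "ha = (1/6) *\<^sub>R (8 *\<^sub>R N 1 0 0 - N 2 0 0)"
  define hb where "hb = (1/6) *\<^sub>R (N 2 0 0 - 2 *\<^sub>R N 1 0 0)"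
  have ha: "apply_bcontfun ha t = c *\<^sub>R u t" for t
  proof -
    have "6 *\<^sub>R apply_bcontfun ha t = 6 *\<^sub>R (c *\<^sub>R u t)"
      by (simp add: ha_def N0 scaleR_add_right scaleR_diff_right algebra_simps)
        (simp flip: scaleR_left.add scaleR_left.diff add: algebra_simps)
    then show ?thesis by (metis real_vector.scale_left_imp_eq zero_neq_numeral)
  qed
  have hb: "apply_bcontfun hb t = 1 *\<^sub>R w t" for t
  proof -
    have "6 *\<^sub>R apply_bcontfun hb t = 6 *\<^sub>R w t"
      by (simp add: hb_def N0 scaleR_add_right scaleR_diff_right algebra_simps)
        (simp flip: scaleR_left.add scaleR_left.diff add: algebra_simps)
    then show ?thesis by (metis real_vector.scale_left_imp_eq zero_neq_numeral scaleR_one)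
  qed
  have \<Lambda>ha: "\<Lambda>2 ha = c * a2"
    by (rule functional_eq_LBINT[of c u]) (use \<Lambda>2[of ha] a2 in \<open>simp_all add: ha a2_bar_def u_def\<close>)
  have \<Lambda>hb: "\<Lambda>2 hb = 1 * b2"
    by (rule functional_eq_LBINT[of 1 w]) (use \<Lambda>2[of hb] b2 in \<open>simp_all add: hb b2_bar_def w_def\<close>)
  have \<Lambda>N: "\<Lambda>2 (N \<sigma> 0 0) = b2 * (\<sigma>^3 - \<sigma>)" for \<sigma>
  proof -
    have "N \<sigma> 0 0 = \<sigma> *\<^sub>R ha + \<sigma>^3 *\<^sub>R hb" by (rule bcontfun_eqI) (simp add: N0 ha hb)
    then have "\<Lambda>2 (N \<sigma> 0 0) = \<sigma> * \<Lambda>2 ha + \<sigma>^3 * \<Lambda>2 hb"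
      by (simp add: linear_add[OF bounded_linear.linear[OF \<Lambda>(2)]] linear_scale[OF bounded_linear.linear[OF \<Lambda>(2)]])
    then show ?thesis unfolding \<Lambda>ha \<Lambda>hb c using a2(2) by (simp add: algebra_simps)
  qed
  obtain k where k: "k \<ge> 0" "\<And>h. \<bar>\<Lambda>2 h\<bar> \<le> norm h * k" using bounded_linear.nonneg_bounded[OF \<Lambda>(2)] by auto
  define K' where "K' = K * k"
  have K': "K' \<ge> 0" using K k by (simp add: K'_def)
  obtain \<delta> where \<delta>: "\<delta> > 0" and mz: "\<And>x \<mu> \<gamma>. (\<forall>t. norm (x t - xh t) \<le> \<delta>) \<Longrightarrow> \<bar>\<mu>\<bar> \<le> \<delta> \<Longrightarrow>
      (\<forall>t. (x has_vector_derivative f (x t) \<mu> - \<gamma> *\<^sub>R r t) (at t)) \<Longrightarrow> (x \<longlongrightarrow> 0) at_top \<Longrightarrow> (x \<longlongrightarrow> 0) at_bot \<Longrightarrow> \<gamma> = 0"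
  proof -
    have "continuous_on UNIV r" unfolding r_def by (intro continuous_intros hat psi_continuous)
    moreover have "r t = 0" if "\<bar>t\<bar> \<ge> 1" for t using hat(3)[OF that] by (simp add: r_def)
    moreover have "integral {-1..1} (\<lambda>t. p1 t \<bullet> r t) \<noteq> 0" using r1 by (simp add: r_def)
    ultimately show ?thesis using multiplier_zero[of r] that by blast
  qed
  \<comment> \<open>\<open>B\<close> bounds the bracket multiplied by \<open>a\<^sup>2\<close> in
    the ansatz, \<open>\<bar>a\<bar> * D\<close> controls both \<open>x - xh\<close> and the
    parameter, and \<open>C\<close> adds to \<open>B\<close> the contribution of
    \<open>\<sigma> \<noteq> 1\<close>. The threshold \<open>e\<close> also keeps the error of the
    second multiplier at most a quarter of \<open>\<bar>b2\<bar>\<close>.\<close>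
  define B where "B = \<bar>c\<bar> * norm ?M + 4 * norm ?A + M"
  have B: "B \<ge> 0" using M by (simp add: B_def)
  define D where "D = 2 * norm ?P + B + \<bar>c\<bar> + 1"
  have D: "D > 0" using B norm_ge_zero[of ?P] unfolding D_def by linarith
  define C where "C = 4 / 3 * K' / \<bar>b2\<bar> * norm ?P + B"
  define e where "e = min a0 (min (\<bar>b2\<bar> / (4 * (K' + 1))) (\<delta> / D))"
  have C: "C \<ge> 0" using K' B by (simp add: C_def)
  have e: "e > 0" using a0 b2 K' \<delta> D by (simp add: e_def)
  have main: "\<exists>x. (\<forall>t. (x has_vector_derivative f (x t) (c * a\<^sup>2)) (at t)) \<and>
     (x \<longlongrightarrow> 0) at_top \<and> (x \<longlongrightarrow> 0) at_bot \<and> (\<forall>t. norm (x t - (xh t + a *\<^sub>R \<phi>2 t)) \<le> C * a\<^sup>2)"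
    if a: "a \<noteq> 0" "\<bar>a\<bar> < e" for a :: real
  proof -
    have a_a0: "\<bar>a\<bar> \<le> a0" and a1: "\<bar>a\<bar> \<le> 1" using a a0 by (auto simp: e_def)
    have aK: "K' * \<bar>a\<bar> \<le> \<bar>b2\<bar> / 4"
    proof -
      have "\<bar>a\<bar> \<le> \<bar>b2\<bar> / (4 * (K' + 1))" using a by (simp add: e_def)
      then have "(K' + 1) * \<bar>a\<bar> \<le> \<bar>b2\<bar> / 4" using K' by (simp add: field_simps)
      then show ?thesis using abs_ge_zero[of a] by (simp add: algebra_simps)
    qed
    have aD: "\<bar>a\<bar> * D \<le> \<delta>"
    proof -
      have "\<bar>a\<bar> \<le> \<delta> / D" using a by (simp add: e_def)
      then show ?thesis using D by (simp add: field_simps)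
    qed
    from sol[OF a_a0] obtain Z where Zc: "continuous_on {0..2} (\<lambda>\<sigma>. N \<sigma> a (Z \<sigma>))" and Z: "\<And>\<sigma>. \<sigma> \<in> {0..2} \<Longrightarrow> norm (Z \<sigma>) \<le> M"
      "\<And>\<sigma>. \<sigma> \<in> {0..2} \<Longrightarrow> norm (N \<sigma> a (Z \<sigma>) - N \<sigma> 0 0) \<le> K * \<bar>a\<bar>"
      "\<And>\<sigma>. \<sigma> \<in> {0..2} \<Longrightarrow> (?x a \<sigma> (Z \<sigma>) \<longlongrightarrow> 0) at_top" "\<And>\<sigma>. \<sigma> \<in> {0..2} \<Longrightarrow> (?x a \<sigma> (Z \<sigma>) \<longlongrightarrow> 0) at_bot"
      "\<And>\<sigma> t. \<sigma> \<in> {0..2} \<Longrightarrow> (?x a \<sigma> (Z \<sigma>) has_vector_derivative F (?x a \<sigma> (Z \<sigma>) t, c * a\<^sup>2) - a^3 *\<^sub>R res (N \<sigma> a (Z \<sigma>)) t) (at t)"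
      by blast
    define g where "g \<sigma> = \<Lambda>2 (N \<sigma> a (Z \<sigma>))" for \<sigma>
    have gc: "continuous_on {0..2} g" unfolding g_def by (rule bounded_linear.continuous_on[OF \<Lambda>(2) Zc])
    have gb: "\<bar>g \<sigma> - b2 * (\<sigma>^3 - \<sigma>)\<bar> \<le> K' * \<bar>a\<bar>" if "\<sigma> \<in> {0..2}" for \<sigma>
    proof -
      have "g \<sigma> - b2 * (\<sigma>^3 - \<sigma>) = \<Lambda>2 (N \<sigma> a (Z \<sigma>) - N \<sigma> 0 0)"
        unfolding g_def \<Lambda>N[symmetric] by (simp add: linear_diff[OF bounded_linear.linear[OF \<Lambda>(2)]])
      then have "\<bar>g \<sigma> - b2 * (\<sigma>^3 - \<sigma>)\<bar> \<le> norm (N \<sigma> a (Z \<sigma>) - N \<sigma> 0 0) * k" using k(2) by simp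
      also have "\<dots> \<le> (K * \<bar>a\<bar>) * k" by (intro mult_right_mono Z that k)
      finally show ?thesis by (simp add: K'_def mult_ac)
    qed
    \<comment> \<open>At \<open>1/2\<close> and \<open>3/2\<close> the limiting multiplier equals
      \<open>-3/8\<close> and \<open>15/8\<close> times \<open>b2\<close>, so an error of
      \<open>\<bar>b2\<bar> / 4\<close> changes neither sign; multiplication by
      \<open>sgn b2\<close> treats both signs of \<open>b2\<close> together.\<close>
    obtain \<sigma> where \<sigma>: "1/2 \<le> \<sigma>" "\<sigma> \<le> 3/2" "g \<sigma> = 0"
    proof -
      have v: "b2 * ((1/2)^3 - 1/2) = - (3/8) * b2" "b2 * ((3/2)^3 - 3/2) = (15/8) * b2"
        by (simp_all add: power3_eq_cube)
      have g1: "\<bar>g (1/2) + (3/8) * b2\<bar> \<le> \<bar>b2\<bar> / 4" using gb[of "1/2"] aK v(1) by simp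
      have g2: "\<bar>g (3/2) - (15/8) * b2\<bar> \<le> \<bar>b2\<bar> / 4" using gb[of "3/2"] aK v(2) by simp
      have "\<exists>\<sigma>\<ge>1/2. \<sigma> \<le> 3/2 \<and> sgn b2 * g \<sigma> = 0"
      proof (rule IVT')
        show "sgn b2 * g (1/2) \<le> 0" using g1 b2(2) by (auto simp: sgn_if abs_if split: if_splits)
        show "0 \<le> sgn b2 * g (3/2)" using g2 b2(2) by (auto simp: sgn_if abs_if split: if_splits)
        show "continuous_on {1/2..3/2} (\<lambda>\<sigma>. sgn b2 * g \<sigma>)"
          by (intro continuous_intros continuous_on_subset[OF gc]) auto
      qed simp
      then show ?thesis using that b2(2) by (auto simp: sgn_if split: if_splits)
    qed
    have s02: "\<sigma> \<in> {0..2}" using \<sigma> by auto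
    \<comment> \<open>In \<open>\<sigma>^3 - \<sigma> = (\<sigma> * (\<sigma> + 1)) * (\<sigma> -
      1)\<close> the cofactor of \<open>\<sigma> - 1\<close> is at least \<open>3/4\<close> for
      \<open>\<sigma> \<ge> 1/2\<close>, whence the factor \<open>4/3\<close>.\<close>
    have s1: "\<bar>\<sigma> - 1\<bar> \<le> 4 / 3 * K' / \<bar>b2\<bar> * \<bar>a\<bar>"
    proof -
      have "\<bar>b2\<bar> * ((\<sigma> * (\<sigma> + 1)) * \<bar>\<sigma> - 1\<bar>) = \<bar>b2 * (\<sigma>^3 - \<sigma>)\<bar>"
      proof -
        have "\<sigma>^3 - \<sigma> = (\<sigma> * (\<sigma> + 1)) * (\<sigma> - 1)" by (simp add: power3_eq_cube algebra_simps)
        then show ?thesis using \<sigma> by (simp add: abs_mult)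
      qed
      also have "\<dots> \<le> K' * \<bar>a\<bar>" using gb[OF s02] \<sigma>(3) by simp
      finally have 1: "\<bar>b2\<bar> * ((\<sigma> * (\<sigma> + 1)) * \<bar>\<sigma> - 1\<bar>) \<le> K' * \<bar>a\<bar>" .
      have "3/4 \<le> \<sigma> * (\<sigma> + 1)" using mult_mono[of "1/2" \<sigma> "3/2" "\<sigma> + 1"] \<sigma> by simp
      then have "\<bar>b2\<bar> * (3/4 * \<bar>\<sigma> - 1\<bar>) \<le> \<bar>b2\<bar> * ((\<sigma> * (\<sigma> + 1)) * \<bar>\<sigma> - 1\<bar>)" by (intro mult_left_mono mult_right_mono) auto
      with 1 have "\<bar>b2\<bar> * (3/4 * \<bar>\<sigma> - 1\<bar>) \<le> K' * \<bar>a\<bar>" by linarith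
      then show ?thesis using b2(2) by (simp add: field_simps)
    qed
    define x where "x = ?x a \<sigma> (Z \<sigma>)"
    have nb: "norm (xh t) \<le> norm ?X" "norm (\<phi>2 t) \<le> norm ?P" "norm (\<xi>\<mu> t) \<le> norm ?M" "norm (\<xi>\<alpha> t) \<le> norm ?A" for t
      using norm_bounded[of ?X t] norm_bounded[of ?P t] norm_bounded[of ?M t] norm_bounded[of ?A t] by (simp_all add: bc)
    let ?q = "\<lambda>t. c *\<^sub>R \<xi>\<mu> t + \<sigma>\<^sup>2 *\<^sub>R \<xi>\<alpha> t + a *\<^sub>R apply_bcontfun (Z \<sigma>) t"
    have x_eq: "x t = xh t + (a * \<sigma>) *\<^sub>R \<phi>2 t + a\<^sup>2 *\<^sub>R ?q t" for t unfolding x_def ansatz_def bc ..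
    have qB: "norm (?q t) \<le> B" for t
    proof -
      have "\<sigma>\<^sup>2 \<le> 4" using \<sigma> power_mono[of \<sigma> 2 2] by simp
      then have "\<sigma>\<^sup>2 * norm (\<xi>\<alpha> t) \<le> 4 * norm ?A" using nb(4) by (intro mult_mono) auto
      moreover have "\<bar>c\<bar> * norm (\<xi>\<mu> t) \<le> \<bar>c\<bar> * norm ?M" using nb(3) by (intro mult_left_mono) auto
      moreover have "\<bar>a\<bar> * norm (apply_bcontfun (Z \<sigma>) t) \<le> 1 * M"
        using a1 order_trans[OF norm_bounded Z(1)[OF s02]] by (intro mult_mono) auto
      ultimately show ?thesis
        unfolding B_def by (intro norm_triangle_le add_mono) auto
    qed
    have a2a: "a\<^sup>2 \<le> \<bar>a\<bar>" using mult_left_mono[OF a1, of "\<bar>a\<bar>"] by (simp add: power2_eq_square)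
    have near: "norm (x t - xh t) \<le> \<delta>" for t
    proof -
      have "norm (x t - xh t) \<le> norm ((a * \<sigma>) *\<^sub>R \<phi>2 t) + norm (a\<^sup>2 *\<^sub>R ?q t)"
        using norm_triangle_ineq[of "(a * \<sigma>) *\<^sub>R \<phi>2 t" "a\<^sup>2 *\<^sub>R ?q t"] unfolding x_eq by (simp only: add.assoc add_diff_cancel_left')
      also have "norm ((a * \<sigma>) *\<^sub>R \<phi>2 t) \<le> \<bar>a\<bar> * (2 * norm ?P)"
        using \<sigma> nb(2)[of t] by (simp add: abs_mult mult.assoc) (intro mult_left_mono mult_mono, auto)
      also have "norm (a\<^sup>2 *\<^sub>R ?q t) \<le> \<bar>a\<bar> * B"
        unfolding norm_scaleR using a2a qB by (intro mult_mono) auto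
      finally have "norm (x t - xh t) \<le> \<bar>a\<bar> * (2 * norm ?P + B)" by (simp add: algebra_simps)
      also have "\<dots> \<le> \<bar>a\<bar> * D" unfolding D_def by (intro mult_left_mono) auto
      finally show ?thesis using aD by simp
    qed
    have mu: "\<bar>c * a\<^sup>2\<bar> \<le> \<delta>"
    proof -
      have "\<bar>c * a\<^sup>2\<bar> \<le> \<bar>c\<bar> * \<bar>a\<bar>" using a2a by (simp add: abs_mult mult_left_mono)
      also have "\<dots> \<le> \<bar>a\<bar> * D" unfolding D_def using B norm_ge_zero[of ?P]
        by (subst mult.commute, intro mult_left_mono) (linarith, simp)
      finally show ?thesis using aD by simp
    qed
    \<comment> \<open>With the second multiplier equal to 0, the residual is a multiple of the
      single bump \<open>r\<close>, the form that \<open>multiplier_zero\<close> handles.\<close>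
    have xd: "(x has_vector_derivative f (x t) (c * a\<^sup>2) - (a^3 * \<Lambda>1 (N \<sigma> a (Z \<sigma>))) *\<^sub>R r t) (at t)" for t
    proof -
      have "res (N \<sigma> a (Z \<sigma>)) t = \<Lambda>1 (N \<sigma> a (Z \<sigma>)) *\<^sub>R r t" using \<sigma>(3) by (simp add: res_def g_def)
      with Z(5)[OF s02, of t] show ?thesis by (simp only: x_def f_F scaleR_scaleR)
    qed
    have \<gamma>: "a^3 * \<Lambda>1 (N \<sigma> a (Z \<sigma>)) = 0"
      by (rule mz[OF _ mu]) (use near xd Z(3,4)[OF s02] in \<open>auto simp: x_def\<close>)
    have "(x has_vector_derivative f (x t) (c * a\<^sup>2)) (at t)" for t
      using xd[of t] unfolding \<gamma> by simp
    moreover have "norm (x t - (xh t + a *\<^sub>R \<phi>2 t)) \<le> C * a\<^sup>2" for t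
    proof -
      have "x t - (xh t + a *\<^sub>R \<phi>2 t) = (a * (\<sigma> - 1)) *\<^sub>R \<phi>2 t + a\<^sup>2 *\<^sub>R ?q t"
        unfolding x_eq by (simp add: algebra_simps)
      then have "norm (x t - (xh t + a *\<^sub>R \<phi>2 t)) \<le> norm ((a * (\<sigma> - 1)) *\<^sub>R \<phi>2 t) + norm (a\<^sup>2 *\<^sub>R ?q t)"
        using norm_triangle_ineq[of "(a * (\<sigma> - 1)) *\<^sub>R \<phi>2 t" "a\<^sup>2 *\<^sub>R ?q t"] by (simp only:)
      also have "norm ((a * (\<sigma> - 1)) *\<^sub>R \<phi>2 t) \<le> (\<bar>a\<bar> * (4 / 3 * K' / \<bar>b2\<bar> * \<bar>a\<bar>)) * norm ?P"
        unfolding norm_scaleR real_norm_def abs_mult using s1 nb(2) K' by (intro mult_mono mult_nonneg_nonneg) auto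
      also have "norm (a\<^sup>2 *\<^sub>R ?q t) \<le> a\<^sup>2 * B" unfolding norm_scaleR using qB by (simp add: mult_left_mono)
      also have "(\<bar>a\<bar> * (4 / 3 * K' / \<bar>b2\<bar> * \<bar>a\<bar>)) * norm ?P + a\<^sup>2 * B = C * a\<^sup>2"
      proof -
        have "(\<bar>a\<bar> * (4 / 3 * K' / \<bar>b2\<bar> * \<bar>a\<bar>)) * norm ?P = (\<bar>a\<bar> * \<bar>a\<bar>) * (4 / 3 * K' / \<bar>b2\<bar> * norm ?P)" by (simp only: mult_ac)
        also have "\<bar>a\<bar> * \<bar>a\<bar> = a\<^sup>2" by (simp add: power2_eq_square)
        finally show ?thesis unfolding C_def by (simp only: distrib_left distrib_right mult_ac)
      qed
      finally show ?thesis by simp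
    qed
    ultimately show ?thesis
      using Z(3)[OF s02, folded x_def] Z(4)[OF s02, folded x_def] by (intro exI[of _ x]) simp
  qed
  show ?thesis using main e C by blast
qed

section \<open>The branch inside \<open>X_plus S\<close>\<close>

definition sym_part :: "real ^ ('m + 'm) \<Rightarrow> real ^ ('m + 'm)" where "sym_part v = (1/2) *\<^sub>R (v + S *v v)"

lemma sym_part_bounded_linear: "bounded_linear sym_part"
  unfolding sym_part_def[abs_def]
  by (intro bounded_linear_compose[OF bounded_linear_scaleR_right] bounded_linear_add bounded_linear_ident matrix_vector_mul_bounded_linear)

lemma sym_part_X_plus: "sym_part v \<in> X_plus S"
  by (simp add: sym_part_def X_plus_def matrix_vector_mult_scaleR matrix_vector_right_distrib S_S add.commute)

lemma sym_part_fixed: "S *v v = v \<Longrightarrow> sym_part v = v"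
  by (simp add: sym_part_def scaleR_add_right flip: scaleR_left.add)

lemma sym_part_A: "sym_part (A t *v v) = A t *v sym_part v"
  by (simp add: sym_part_def S_A matrix_vector_mult_scaleR matrix_vector_right_distrib)

text \<open>Giving \<open>\<phi>2\<close> the amplitude 0 removes the direction that breaks the
  symmetry, and projecting the right inverse puts the correction in \<open>X_plus S\<close>. The
  bumps lose their \<open>p2\<close> part under the projection, so the energy condition alone
  remains. A positive and a negative \<open>c\<close> together reach both signs of the
  parameter.\<close>

lemma symmetric_branch:
  "\<exists>a0>0. \<exists>C\<ge>0. \<forall>a. a \<noteq> 0 \<longrightarrow> \<bar>a\<bar> < a0 \<longrightarrow> (\<exists>x. (\<forall>t. (x has_vector_derivative f (x t) (c * a\<^sup>2)) (at t)) \<and>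
     (x \<longlongrightarrow> 0) at_top \<and> (x \<longlongrightarrow> 0) at_bot \<and> (\<forall>t. x t \<in> X_plus S) \<and> (\<forall>t. norm (x t - xh t) \<le> C * a\<^sup>2))"
proof -
  obtain L :: "(real \<Rightarrow>\<^sub>C (real ^ ('m + 'm))) \<Rightarrow> (real \<Rightarrow>\<^sub>C (real ^ ('m + 'm)))" and \<Lambda>1 \<Lambda>2 m11 m12 m21 m22 where
    L: "bounded_linear L" and
    LD: "\<And>h t. (apply_bcontfun (L h) has_vector_derivative A t *v apply_bcontfun (L h) t + apply_bcontfun h t
       - (\<Lambda>1 h *\<^sub>R (hat t *\<^sub>R (m11 *\<^sub>R p1 t + m12 *\<^sub>R p2 t)) + \<Lambda>2 h *\<^sub>R (hat t *\<^sub>R (m21 *\<^sub>R p1 t + m22 *\<^sub>R p2 t)))) (at t)" and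
    L0: "\<And>h. (apply_bcontfun h \<longlongrightarrow> 0) at_top \<Longrightarrow> (apply_bcontfun (L h) \<longlongrightarrow> 0) at_top"
    "\<And>h. (apply_bcontfun h \<longlongrightarrow> 0) at_bot \<Longrightarrow> (apply_bcontfun (L h) \<longlongrightarrow> 0) at_bot"
    by (rule linear_operator) (rule that)
  define r where "r t = hat t *\<^sub>R p1 t" for t
  define P where "P u = Bcontfun (\<lambda>t. sym_part (apply_bcontfun u t))" for u :: "real \<Rightarrow>\<^sub>C (real ^ ('m + 'm))"
  obtain k where k: "k \<ge> 0" "\<And>v. norm (sym_part v) \<le> norm v * k" using bounded_linear.nonneg_bounded[OF sym_part_bounded_linear] by blast
  have P: "apply_bcontfun (P u) = (\<lambda>t. sym_part (apply_bcontfun u t))" for u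
    unfolding P_def
  proof (rule apply_Bcontfun)
    show "continuous_on UNIV (\<lambda>t. sym_part (apply_bcontfun u t))" by (rule bounded_linear.continuous_on[OF sym_part_bounded_linear]) simp
    show "norm (sym_part (apply_bcontfun u t)) \<le> norm u * k" for t
      using k(2)[of "apply_bcontfun u t"] mult_right_mono[OF norm_bounded[of u t] k(1)] by simp
  qed
  have P_lin: "bounded_linear P"
  proof (rule bounded_linear_intro[where K=k])
    note lin = bounded_linear.linear[OF sym_part_bounded_linear]
    fix u v :: "real \<Rightarrow>\<^sub>C (real ^ ('m + 'm))" and s :: real
    show "P (u + v) = P u + P v" by (rule bcontfun_eqI) (simp add: P linear_add[OF lin])
    show "P (s *\<^sub>R u) = s *\<^sub>R P u" by (rule bcontfun_eqI) (simp add: P linear_scale[OF lin])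
    show "norm (P u) \<le> norm u * k"
    proof (rule norm_bound)
      fix t show "norm (apply_bcontfun (P u) t) \<le> norm u * k"
        unfolding P using k(2)[of "apply_bcontfun u t"] mult_right_mono[OF norm_bounded[of u t] k(1)] by simp
    qed
  qed
  define \<gamma> where "\<gamma> h = \<Lambda>1 h * m11 + \<Lambda>2 h * m21" for h
  \<comment> \<open>\<open>h - sym_part h\<close> is the part of the forcing that the projected
    inverse ignores. It cancels later because the remainder itself turns out to be
    symmetric.\<close>
  define res where "res h t = apply_bcontfun h t - sym_part (apply_bcontfun h t) + \<gamma> h *\<^sub>R r t" for h t
  have sym_part_p1: "sym_part (p1 t) = p1 t" and sym_part_p2: "sym_part (p2 t) = 0" for t
    using M5_plus[of t] M5_minus[of t] by (auto simp: X_plus_def X_minus_def intro: sym_part_fixed) (simp add: sym_part_def)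
  let ?X = "Bcontfun xh" and ?M = "Bcontfun (\<lambda>t. sym_part (\<xi>\<mu> t))"
  have M_derivative: "((\<lambda>t. sym_part (\<xi>\<mu> t)) has_vector_derivative A t *v sym_part (\<xi>\<mu> t) + ddir F (0, 1) (xh t, 0)) (at t)" for t
    by (rule has_vector_derivative_eq_rhs[OF bounded_linear.has_vector_derivative[OF sym_part_bounded_linear xi_mu_facts(1)]])
      (simp add: linear_add[OF bounded_linear.linear[OF sym_part_bounded_linear]] sym_part_A sym_part_fixed S_Fmu)
  have M_lim: "((\<lambda>t. sym_part (\<xi>\<mu> t)) \<longlongrightarrow> 0) at_top" "((\<lambda>t. sym_part (\<xi>\<mu> t)) \<longlongrightarrow> 0) at_bot"
    using xi_mu_facts(2,3) by (auto intro: bounded_linear.tendsto_zero[OF sym_part_bounded_linear])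
  have bM: "apply_bcontfun ?M = (\<lambda>t. sym_part (\<xi>\<mu> t))"
    by (rule C0_bcontfun[OF has_vector_derivative_imp_continuous_on[OF M_derivative] M_lim])
  have b0: "apply_bcontfun 0 = (\<lambda>t. 0 :: real ^ ('m + 'm))" by (rule zero_bcontfun.rep_eq)
  note bc = bcontfun_xh bM b0
  have dF0: "ddir (ddir F (0, 0)) (0, 0) y = 0" for y
    using linear_0[OF Ck_ddir_linear[OF Ck_ddir[OF F_smooth]]] by (simp add: zero_prod_def)
  let ?x = "\<lambda>a \<sigma> Z. ansatz ?X 0 ?M 0 c a \<sigma> Z"
  obtain a0 M N K where a0: "0 < a0" "a0 \<le> 1" and M: "0 \<le> M" and
    sol: "\<And>a. \<bar>a\<bar> \<le> a0 \<Longrightarrow> \<exists>Z. continuous_on {0..2} (\<lambda>\<sigma>. N \<sigma> a (Z \<sigma>)) \<and> (\<forall>\<sigma>\<in>{0..2}. norm (Z \<sigma>) \<le> M \<and> P (L (N \<sigma> a (Z \<sigma>))) = Z \<sigma> \<and>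
        norm (N \<sigma> a (Z \<sigma>) - N \<sigma> 0 0) \<le> K * \<bar>a\<bar> \<and>
        (?x a \<sigma> (Z \<sigma>) \<longlongrightarrow> 0) at_top \<and> (?x a \<sigma> (Z \<sigma>) \<longlongrightarrow> 0) at_bot \<and>
        (\<forall>t. (?x a \<sigma> (Z \<sigma>) has_vector_derivative F (?x a \<sigma> (Z \<sigma>) t, c * a\<^sup>2) - a^3 *\<^sub>R res (N \<sigma> a (Z \<sigma>)) t) (at t)))" and
    N: "\<And>\<sigma> a Z t. F (?x a \<sigma> Z t, c * a\<^sup>2) = F (apply_bcontfun ?X t, 0) + (a * \<sigma>) *\<^sub>R (A t *v apply_bcontfun 0 t)
        + a\<^sup>2 *\<^sub>R (A t *v (c *\<^sub>R apply_bcontfun ?M t + \<sigma>\<^sup>2 *\<^sub>R apply_bcontfun 0 t + a *\<^sub>R apply_bcontfun Z t) + c *\<^sub>R ddir F (0, 1) (apply_bcontfun ?X t, 0)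
          + (\<sigma>\<^sup>2 / 2) *\<^sub>R ddir (ddir F (apply_bcontfun 0 t, 0)) (apply_bcontfun 0 t, 0) (apply_bcontfun ?X t, 0)) + a^3 *\<^sub>R apply_bcontfun (N \<sigma> a Z) t"
  proof (rule solution_family[of F A ?X 0 ?M 0 "\<lambda>h. P (L h)" res c])
    show "bounded_linear (\<lambda>h. P (L h))" by (rule bounded_linear_compose[OF P_lin L])
    show "(apply_bcontfun (P (L h)) has_vector_derivative A t *v apply_bcontfun (P (L h)) t + apply_bcontfun h t - res h t) (at t)" for h t
      unfolding P
      by (rule has_vector_derivative_eq_rhs[OF bounded_linear.has_vector_derivative[OF sym_part_bounded_linear LD]])
        (simp add: linear_add[OF bounded_linear.linear[OF sym_part_bounded_linear]] linear_diff[OF bounded_linear.linear[OF sym_part_bounded_linear]]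
          linear_scale[OF bounded_linear.linear[OF sym_part_bounded_linear]] sym_part_A sym_part_p1 sym_part_p2 res_def r_def \<gamma>_def algebra_simps)
    show "(apply_bcontfun ?X has_vector_derivative F (apply_bcontfun ?X t, 0)) (at t)" for t
      using xh_derivative[of t] by (simp add: bc f_F)
    show "(apply_bcontfun ?M has_vector_derivative A t *v apply_bcontfun ?M t + ddir F (0, 1) (apply_bcontfun ?X t, 0)) (at t)" for t
      unfolding bc by (rule M_derivative)
    show "(apply_bcontfun 0 has_vector_derivative A t *v apply_bcontfun 0 t
        + (1/2) *\<^sub>R ddir (ddir F (apply_bcontfun 0 t, 0)) (apply_bcontfun 0 t, 0) (apply_bcontfun ?X t, 0)) (at t)" for t
      unfolding bc by (simp add: dF0)
    show "A t *v v = ddir F (v, 0) (apply_bcontfun ?X t, 0)" for t v unfolding bc by (rule A_mult)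
    show "(apply_bcontfun 0 has_vector_derivative A t *v apply_bcontfun 0 t) (at t)" for t
      unfolding bc by simp
    show "(apply_bcontfun ?X \<longlongrightarrow> 0) at_top" "(apply_bcontfun ?M \<longlongrightarrow> 0) at_top" "(apply_bcontfun ?X \<longlongrightarrow> 0) at_bot" "(apply_bcontfun ?M \<longlongrightarrow> 0) at_bot"
      unfolding bc by (rule xh_top xh_bot M_lim)+
    show "(apply_bcontfun (0 :: real \<Rightarrow>\<^sub>C (real ^ ('m + 'm))) \<longlongrightarrow> 0) at_top" "(apply_bcontfun (0 :: real \<Rightarrow>\<^sub>C (real ^ ('m + 'm))) \<longlongrightarrow> 0) at_top"
      "(apply_bcontfun (0 :: real \<Rightarrow>\<^sub>C (real ^ ('m + 'm))) \<longlongrightarrow> 0) at_bot" "(apply_bcontfun (0 :: real \<Rightarrow>\<^sub>C (real ^ ('m + 'm))) \<longlongrightarrow> 0) at_bot"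
      unfolding bc by simp_all
    show "\<forall>\<^sub>F \<mu> in nhds 0. F (0, \<mu>) = 0" by (rule F_equilibrium)
    show "(apply_bcontfun (P (L h)) \<longlongrightarrow> 0) at_top" if "(apply_bcontfun h \<longlongrightarrow> 0) at_top" for h
      unfolding P by (rule bounded_linear.tendsto_zero[OF sym_part_bounded_linear L0(1)[OF that]])
    show "(apply_bcontfun (P (L h)) \<longlongrightarrow> 0) at_bot" if "(apply_bcontfun h \<longlongrightarrow> 0) at_bot" for h
      unfolding P by (rule bounded_linear.tendsto_zero[OF sym_part_bounded_linear L0(2)[OF that]])
  qed (rule F_smooth, rule that)
  obtain \<delta> where \<delta>: "\<delta> > 0" and mz: "\<And>x \<mu> \<gamma>. (\<forall>t. norm (x t - xh t) \<le> \<delta>) \<Longrightarrow> \<bar>\<mu>\<bar> \<le> \<delta> \<Longrightarrow>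
      (\<forall>t. (x has_vector_derivative f (x t) \<mu> - \<gamma> *\<^sub>R r t) (at t)) \<Longrightarrow> (x \<longlongrightarrow> 0) at_top \<Longrightarrow> (x \<longlongrightarrow> 0) at_bot \<Longrightarrow> \<gamma> = 0"
  proof -
    have "continuous_on UNIV r" unfolding r_def by (intro continuous_intros hat psi_continuous)
    moreover have "r t = 0" if "\<bar>t\<bar> \<ge> 1" for t using hat(3)[OF that] by (simp add: r_def)
    moreover have "p1 0 \<noteq> 0" using psi_phi[of "Inr i1" 0 "Inr i1"] by auto
    then have "integral {-1..1} (\<lambda>t. p1 t \<bullet> r t) \<noteq> 0"
      using integral_hat_norm_pos[OF psi_continuous, of "Inr i1"] by (simp add: r_def)
    ultimately show ?thesis using multiplier_zero[of r] that by blast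
  qed
  define C where "C = \<bar>c\<bar> * norm ?M + M"
  have C: "C \<ge> 0" using M by (simp add: C_def)
  define e where "e = min a0 (\<delta> / (C + \<bar>c\<bar> + 1))"
  have e: "e > 0" using a0 \<delta> C by (simp add: e_def)
  have main: "\<exists>x. (\<forall>t. (x has_vector_derivative f (x t) (c * a\<^sup>2)) (at t)) \<and>
     (x \<longlongrightarrow> 0) at_top \<and> (x \<longlongrightarrow> 0) at_bot \<and> (\<forall>t. x t \<in> X_plus S) \<and> (\<forall>t. norm (x t - xh t) \<le> C * a\<^sup>2)"
    if a: "a \<noteq> 0" "\<bar>a\<bar> < e" for a :: real
  proof -
    have a_a0: "\<bar>a\<bar> \<le> a0" and a1: "\<bar>a\<bar> \<le> 1" using a a0 by (auto simp: e_def)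
    have aD: "\<bar>a\<bar> * (C + \<bar>c\<bar> + 1) \<le> \<delta>"
    proof -
      have "\<bar>a\<bar> \<le> \<delta> / (C + \<bar>c\<bar> + 1)" using a by (simp add: e_def)
      then show ?thesis using C by (simp add: pos_le_divide_eq)
    qed
    have zero: "0 \<in> {0..2 :: real}" by simp
    obtain Z where Z: "norm (Z 0) \<le> M" "P (L (N 0 a (Z 0))) = Z 0"
      "(?x a 0 (Z 0) \<longlongrightarrow> 0) at_top" "(?x a 0 (Z 0) \<longlongrightarrow> 0) at_bot"
      "\<And>t. (?x a 0 (Z 0) has_vector_derivative F (?x a 0 (Z 0) t, c * a\<^sup>2) - a^3 *\<^sub>R res (N 0 a (Z 0)) t) (at t)"
    proof -
      from sol[OF a_a0] obtain Z where "norm (Z 0) \<le> M \<and> P (L (N 0 a (Z 0))) = Z 0 \<and>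
        norm (N 0 a (Z 0) - N 0 0 0) \<le> K * \<bar>a\<bar> \<and>
        (?x a 0 (Z 0) \<longlongrightarrow> 0) at_top \<and> (?x a 0 (Z 0) \<longlongrightarrow> 0) at_bot \<and>
        (\<forall>t. (?x a 0 (Z 0) has_vector_derivative F (?x a 0 (Z 0) t, c * a\<^sup>2) - a^3 *\<^sub>R res (N 0 a (Z 0)) t) (at t))"
        by (elim exE conjE) (drule bspec[OF _ zero], rule that, assumption)
      then show thesis by (elim conjE) (rule that, assumption+, erule spec)
    qed
    define z where "z t = apply_bcontfun (Z 0) t" for t
    define x where "x = ?x a 0 (Z 0)"
    have x_eq: "x t = xh t + a\<^sup>2 *\<^sub>R (c *\<^sub>R sym_part (\<xi>\<mu> t) + a *\<^sub>R z t)" for t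
      unfolding x_def ansatz_def bc z_def by simp
    have z_fix: "S *v z t = z t" for t
    proof -
      have "z t = sym_part (apply_bcontfun (L (N 0 a (Z 0))) t)" unfolding z_def using Z(2) P by metis
      then show ?thesis using sym_part_X_plus by (simp add: X_plus_def)
    qed
    have sym_part_S: "S *v sym_part v = sym_part v" for v using sym_part_X_plus[of v] by (simp add: X_plus_def)
    have x_fix: "S *v x t = x t" for t
      unfolding x_eq by (simp add: matrix_vector_right_distrib matrix_vector_mult_scaleR S_xh z_fix sym_part_S)
    let ?n = "\<lambda>t. apply_bcontfun (N 0 a (Z 0)) t"
    \<comment> \<open>The expansion of \<open>F\<close> expresses \<open>a^3\<close> times the
      remainder through terms that are each fixed by \<open>S\<close>, and
      \<open>a \<noteq> 0\<close>.\<close>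
    have n_fix: "sym_part (?n t) = ?n t" for t
    proof (rule sym_part_fixed)
      have eq: "a^3 *\<^sub>R ?n t = F (x t, c * a\<^sup>2) - F (xh t, 0) - a\<^sup>2 *\<^sub>R (A t *v (c *\<^sub>R sym_part (\<xi>\<mu> t) + a *\<^sub>R z t) + c *\<^sub>R ddir F (0, 1) (xh t, 0))"
        using N[of a 0 "Z 0" t] by (simp add: x_def bc z_def)
      have "a^3 *\<^sub>R (S *v ?n t) = S *v (a^3 *\<^sub>R ?n t)" by (simp add: matrix_vector_mult_scaleR)
      also have "\<dots> = a^3 *\<^sub>R ?n t"
        unfolding eq
        by (simp add: matrix_vector_mult_diff_distrib matrix_vector_right_distrib matrix_vector_mult_scaleR S_F S_A S_Fmu x_fix S_xh z_fix sym_part_S)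
      finally show "S *v ?n t = ?n t" using a(1) by simp
    qed
    have xd: "(x has_vector_derivative f (x t) (c * a\<^sup>2) - (a^3 * \<gamma> (N 0 a (Z 0))) *\<^sub>R r t) (at t)" for t
    proof -
      have "res (N 0 a (Z 0)) t = \<gamma> (N 0 a (Z 0)) *\<^sub>R r t" by (simp add: res_def n_fix)
      with Z(5)[of t] show ?thesis by (simp only: x_def f_F scaleR_scaleR)
    qed
    have zM: "norm (z t) \<le> M" for t unfolding z_def using norm_bounded Z(1) by (rule order_trans)
    have bound: "norm (x t - xh t) \<le> C * a\<^sup>2" for t
    proof -
      have "norm (sym_part (\<xi>\<mu> t)) \<le> norm ?M" using norm_bounded[of ?M t] by (simp add: bM)
      then have "\<bar>c\<bar> * norm (sym_part (\<xi>\<mu> t)) \<le> \<bar>c\<bar> * norm ?M" by (intro mult_left_mono) auto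
      moreover have "\<bar>a\<bar> * norm (z t) \<le> 1 * M" using a1 zM by (intro mult_mono) auto
      ultimately have "norm (c *\<^sub>R sym_part (\<xi>\<mu> t) + a *\<^sub>R z t) \<le> C"
        unfolding C_def by (intro norm_triangle_le add_mono) auto
      then have "a\<^sup>2 * norm (c *\<^sub>R sym_part (\<xi>\<mu> t) + a *\<^sub>R z t) \<le> a\<^sup>2 * C" by (intro mult_left_mono) auto
      then show ?thesis unfolding x_eq by (simp add: mult.commute)
    qed
    have a2a: "a\<^sup>2 \<le> \<bar>a\<bar>" using mult_left_mono[OF a1, of "\<bar>a\<bar>"] by (simp add: power2_eq_square)
    have small: "y * a\<^sup>2 \<le> \<delta>" if "0 \<le> y" "y \<le> C + \<bar>c\<bar> + 1" for y
    proof -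
      have "y * a\<^sup>2 \<le> (C + \<bar>c\<bar> + 1) * \<bar>a\<bar>" using that a2a C by (intro mult_mono) auto
      then show ?thesis using aD by (simp add: mult.commute)
    qed
    have near: "norm (x t - xh t) \<le> \<delta>" for t
      using bound[of t] small[of C] C by linarith
    have mu: "\<bar>c * a\<^sup>2\<bar> \<le> \<delta>" using small[of "\<bar>c\<bar>"] C by (simp add: abs_mult)
    have \<gamma>0: "a^3 * \<gamma> (N 0 a (Z 0)) = 0"
      by (rule mz[OF _ mu]) (use near xd Z(3,4) in \<open>auto simp: x_def\<close>)
    have "(x has_vector_derivative f (x t) (c * a\<^sup>2)) (at t)" for t using xd[of t] unfolding \<gamma>0 by simp
    then show ?thesis
      using Z(3)[folded x_def] Z(4)[folded x_def] bound x_fix by (intro exI[of _ x]) (simp add: X_plus_def)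
  qed
  show ?thesis using main e C by blast
qed

section \<open>Distinctness of the pair, and assembly of the bifurcation\<close>

lemma orbits_distinct:
  assumes x: "\<And>t. (x has_vector_derivative f (x t) \<mu>) (at t)" and lim: "(x \<longlongrightarrow> 0) at_top" "(x \<longlongrightarrow> 0) at_bot"
    and nz: "x t1 \<noteq> 0" and ne: "S *v x t0 \<noteq> x t0"
  shows "range x \<noteq> range (\<lambda>t. S *v x t)"
proof
  assume eq: "range x = range (\<lambda>t. S *v x t)"
  then have "S *v x 0 \<in> range x" by blast
  then obtain \<tau> where \<tau>: "S *v x 0 = x \<tau>" by blast
  have xc: "continuous_on T x" for T by (rule has_vector_derivative_imp_continuous_on[OF x])
  have Sx: "((\<lambda>t. S *v x t) has_vector_derivative f (S *v x t) \<mu>) (at t)" for t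
    using bounded_linear.has_vector_derivative[OF matrix_vector_mul_bounded_linear x, of S t] by (simp add: M4_equivariant)
  have shift: "((\<lambda>t. x (t + s)) has_vector_derivative f (x (t + s)) \<mu>) (at t)" for s t
  proof -
    have "((\<lambda>t. t + s) has_vector_derivative 1) (at t)" by (auto intro!: derivative_eq_intros)
    from vector_diff_chain_at[OF this x] show ?thesis by (simp add: o_def)
  qed
  define B where "B = norm (Bcontfun x)"
  have xB: "norm (x t) \<le> B" for t
    using norm_bounded[of "Bcontfun x" t] C0_bcontfun[OF xc lim] by (simp add: B_def)
  obtain k where k: "k \<ge> 0" "\<And>v. norm (S *v v) \<le> norm v * k"
    using bounded_linear.nonneg_bounded[OF matrix_vector_mul_bounded_linear] by blast
  \<comment> \<open>The radius contains both \<open>x\<close> and its image under \<open>S\<close>,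
    together with the parameter, so that one Lipschitz constant of \<open>F\<close> serves the
    uniqueness lemma.\<close>
  define R where "R = B * (k + 1) + \<bar>\<mu>\<bar>"
  have B0: "B \<ge> 0" by (simp add: B_def)
  have R1: "norm (x t, \<mu>) \<le> R" for t
  proof -
    have "norm (x t, \<mu>) \<le> norm (x t) + \<bar>\<mu>\<bar>" using norm_Pair_le[of "x t" \<mu>] by simp
    moreover have "B * 1 \<le> B * (k + 1)" using k(1) B0 by (intro mult_left_mono) auto
    ultimately show ?thesis using xB[of t] by (simp add: R_def)
  qed
  have R2: "norm (S *v x t, \<mu>) \<le> R" for t
  proof -
    have "norm (S *v x t, \<mu>) \<le> norm (S *v x t) + \<bar>\<mu>\<bar>" using norm_Pair_le[of "S *v x t" \<mu>] by simp
    also have "norm (S *v x t) \<le> B * k" using k(2)[of "x t"] mult_right_mono[OF xB[of t] k(1)] by linarith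
    finally show ?thesis using B0 by (simp add: R_def algebra_simps)
  qed
  obtain K where K: "K \<ge> 0" "\<And>p q. norm p \<le> R \<Longrightarrow> norm q \<le> R \<Longrightarrow> norm (F p - F q) \<le> K * norm (p - q)"
    using Ck_locally_Lipschitz[OF F_smooth, of R] by blast
  \<comment> \<open>Equality of the ranges gives a common point at one time only; uniqueness of
    solutions extends it to a time shift of the whole orbit.\<close>
  have "S *v x t = x (t + \<tau>)" for t
  proof (rule autonomous_ode_unique[OF Sx shift K(1)])
    show "norm (f (S *v x t) \<mu> - f (x (t + \<tau>)) \<mu>) \<le> K * norm (S *v x t - x (t + \<tau>))" for t
      using K(2)[OF R2[of t] R1[of "t + \<tau>"]] by (simp add: f_F norm_Pair)
    show "S *v x 0 = x (0 + \<tau>)" using \<tau> by simp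
  qed
  note flow = this
  have per1: "x (t + 2 * \<tau>) = x t" for t
  proof -
    have "x t = S *v (S *v x t)" by (simp add: S_S)
    also have "\<dots> = S *v x (t + \<tau>)" by (simp only: flow)
    also have "\<dots> = x (t + \<tau> + \<tau>)" by (rule flow)
    finally show ?thesis by (simp add: add.assoc)
  qed
  have per: "x (t + real n * (2 * \<tau>)) = x t" for t n
  proof (induction n)
    case (Suc n)
    have "x (t + real (Suc n) * (2 * \<tau>)) = x ((t + real n * (2 * \<tau>)) + 2 * \<tau>)" by (simp add: algebra_simps)
    then show ?case using Suc per1 by simp
  qed simp
  consider "\<tau> = 0" | "\<tau> > 0" | "\<tau> < 0" by linarith
  then show False
  proof cases
    case 1 then show False using flow[of t0] ne by simp
  next
    case 2
    then have "filterlim (\<lambda>n. t1 + real n * (2 * \<tau>)) at_top sequentially" by real_asymp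
    from filterlim_compose[OF lim(1) this] have "(\<lambda>n. x t1) \<longlonglongrightarrow> 0" by (simp add: per)
    then show False using nz by (simp add: LIMSEQ_const_iff)
  next
    case 3
    then have "filterlim (\<lambda>n. t1 + real n * (2 * \<tau>)) at_bot sequentially" by real_asymp
    from filterlim_compose[OF lim(2) this] have "(\<lambda>n. x t1) \<longlonglongrightarrow> 0" by (simp add: per)
    then show False using nz by (simp add: LIMSEQ_const_iff)
  qed
qed

lemma pitchfork:
  assumes a2: "a2 = a2_bar f xh \<phi>2 \<xi>\<mu>" "a2 \<noteq> 0" and b2: "b2 = b2_bar f xh \<phi>2 \<xi>\<alpha>" "b2 \<noteq> 0"
  shows "\<exists>I \<theta>. pitchfork_bifurcation f S xh \<phi>2 I \<theta> \<and>
           (a2 * b2 < 0 \<longrightarrow> supercritical \<theta>) \<and> (a2 * b2 > 0 \<longrightarrow> subcritical \<theta>)"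
proof -
  define c where "c = - b2 / a2"
  have c0: "c \<noteq> 0" using a2 b2 by (simp add: c_def)
  define \<theta> where "\<theta> \<alpha> = c * \<alpha>\<^sup>2" for \<alpha> :: real
  obtain e1 C1 where e1: "e1 > 0" "C1 \<ge> 0" and pair: "\<And>a. a \<noteq> 0 \<Longrightarrow> \<bar>a\<bar> < e1 \<Longrightarrow> \<exists>x. (\<forall>t. (x has_vector_derivative f (x t) (c * a\<^sup>2)) (at t)) \<and>
     (x \<longlongrightarrow> 0) at_top \<and> (x \<longlongrightarrow> 0) at_bot \<and> (\<forall>t. norm (x t - (xh t + a *\<^sub>R \<phi>2 t)) \<le> C1 * a\<^sup>2)"
    using pair_branch[OF a2 b2 c_def] by blast
  obtain e2 C2 where e2: "e2 > 0" "C2 \<ge> 0" and plus: "\<And>a. a \<noteq> 0 \<Longrightarrow> \<bar>a\<bar> < e2 \<Longrightarrow> \<exists>x. (\<forall>t. (x has_vector_derivative f (x t) (1 * a\<^sup>2)) (at t)) \<and>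
     (x \<longlongrightarrow> 0) at_top \<and> (x \<longlongrightarrow> 0) at_bot \<and> (\<forall>t. x t \<in> X_plus S) \<and> (\<forall>t. norm (x t - xh t) \<le> C2 * a\<^sup>2)"
    using symmetric_branch[of 1] by blast
  obtain e3 C3 where e3: "e3 > 0" "C3 \<ge> 0" and minus: "\<And>a. a \<noteq> 0 \<Longrightarrow> \<bar>a\<bar> < e3 \<Longrightarrow> \<exists>x. (\<forall>t. (x has_vector_derivative f (x t) (- 1 * a\<^sup>2)) (at t)) \<and>
     (x \<longlongrightarrow> 0) at_top \<and> (x \<longlongrightarrow> 0) at_bot \<and> (\<forall>t. x t \<in> X_plus S) \<and> (\<forall>t. norm (x t - xh t) \<le> C3 * a\<^sup>2)"
    using symmetric_branch[of "- 1"] by blast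
  obtain t1 where t1: "xh t1 \<noteq> 0" using xh_nonzero by blast
  obtain k where k: "k \<ge> 0" "\<And>v. norm (S *v v) \<le> norm v * k"
    using bounded_linear.nonneg_bounded[OF matrix_vector_mul_bounded_linear] by blast
  define D where "D = C1 + norm (\<phi>2 t1) + C2 + C3 + 1"
  have D: "D > 0" using e1 e2 e3 norm_ge_zero[of "\<phi>2 t1"] unfolding D_def by linarith
  \<comment> \<open>The squares of \<open>e2\<close> and \<open>e3\<close> appear because the
    symmetric branch is parametrized by \<open>sqrt \<bar>\<mu>\<bar>\<close>. The next two bounds
    keep \<open>x t1\<close> nonzero and separate \<open>S *v x 0\<close> from \<open>x 0\<close>;
    the last one gives \<open>\<alpha>\<^sup>2 \<le> \<bar>\<alpha>\<bar>\<close>.\<close>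
  define \<epsilon> where "\<epsilon> = Min {e1, e2\<^sup>2, e3\<^sup>2, norm (xh t1) / D, 2 * norm (\<phi>2 0) / ((k + 1) * C1 + 1), 1}"
  have kC: "(k + 1) * C1 + 1 > 0" using k(1) e1(2) by (simp add: add_nonneg_pos)
  have \<epsilon>: "\<epsilon> > 0" using e1(1) e2(1) e3(1) t1 D kC phi2_nonzero[of 0] by (simp add: \<epsilon>_def)
  have \<epsilon>_le: "\<epsilon> \<le> e1" "\<epsilon> \<le> e2\<^sup>2" "\<epsilon> \<le> e3\<^sup>2" "\<epsilon> \<le> norm (xh t1) / D" "\<epsilon> \<le> 2 * norm (\<phi>2 0) / ((k + 1) * C1 + 1)" "\<epsilon> \<le> 1"
    unfolding \<epsilon>_def by (rule Min_le; simp)+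
  have nonzero: "x t1 \<noteq> 0" if "norm (x t1 - xh t1) \<le> D' * s" "0 \<le> s" "s < \<epsilon>" "D' \<le> D" for x :: "real \<Rightarrow> real ^ ('m + 'm)" and D' s
  proof
    assume "x t1 = 0"
    then have "norm (xh t1) \<le> D' * s" using that(1) by simp
    also have "\<dots> \<le> D * s" using that by (intro mult_right_mono) auto
    also have "\<dots> < D * (norm (xh t1) / D)" using that(3) \<epsilon>_le(4) D by (intro mult_strict_left_mono) auto
    finally show False using D by simp
  qed
  define I where "I = {- \<epsilon> <..< \<epsilon>}"
  have sym_ex: "\<exists>x. homoclinic_orbit_to_0 f \<mu> x \<and> (\<forall>t. x t \<in> X_plus S) \<and> (\<forall>t. norm (x t - xh t) \<le> (C2 + C3) * \<bar>\<mu>\<bar>)"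
    if \<mu>: "\<mu> \<noteq> 0" "\<bar>\<mu>\<bar> < \<epsilon>" for \<mu>
  proof -
    define a where "a = sqrt \<bar>\<mu>\<bar>"
    have a: "a \<noteq> 0" "a\<^sup>2 = \<bar>\<mu>\<bar>" "\<bar>a\<bar> = a" using \<mu> by (auto simp: a_def)
    have "a < e2" "a < e3"
      unfolding a_def using \<mu>(2) \<epsilon>_le(2,3) e2(1) e3(1) real_sqrt_less_mono[of "\<bar>\<mu>\<bar>" "e2\<^sup>2"] real_sqrt_less_mono[of "\<bar>\<mu>\<bar>" "e3\<^sup>2"] by simp_all
    then obtain x C where x: "\<forall>t. (x has_vector_derivative f (x t) \<mu>) (at t)" "(x \<longlongrightarrow> 0) at_top" "(x \<longlongrightarrow> 0) at_bot"
      "\<forall>t. x t \<in> X_plus S" "\<forall>t. norm (x t - xh t) \<le> C * \<bar>\<mu>\<bar>" "C = C2 \<or> C = C3"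
      using plus[of a] minus[of a] a \<mu>(1) by (cases "\<mu> > 0") auto
    have C: "C \<le> C2 + C3" using x(6) e2(2) e3(2) by auto
    have "x t1 \<noteq> 0"
    proof (rule nonzero)
      show "norm (x t1 - xh t1) \<le> C * \<bar>\<mu>\<bar>" using x(5) by blast
      show "C \<le> D" using C e1(2) norm_ge_zero[of "\<phi>2 t1"] unfolding D_def by linarith
    qed (use \<mu> in auto)
    then have "homoclinic_orbit_to_0 f \<mu> x" unfolding homoclinic_orbit_to_0_def using x by blast
    moreover have "norm (x t - xh t) \<le> (C2 + C3) * \<bar>\<mu>\<bar>" for t
      using x(5)[rule_format, of t] mult_right_mono[OF C abs_ge_zero[of \<mu>]] by linarith
    ultimately show ?thesis using x(4) by blast
  qed
  define y where "y \<mu> = (if \<mu> = 0 then xh else SOME x. homoclinic_orbit_to_0 f \<mu> x \<and> (\<forall>t. x t \<in> X_plus S) \<and> (\<forall>t. norm (x t - xh t) \<le> (C2 + C3) * \<bar>\<mu>\<bar>))" for \<mu>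
  have y0: "y 0 = xh" by (simp add: y_def)
  have y: "homoclinic_orbit_to_0 f \<mu> (y \<mu>) \<and> (\<forall>t. y \<mu> t \<in> X_plus S) \<and> (\<forall>t. norm (y \<mu> t - xh t) \<le> (C2 + C3) * \<bar>\<mu>\<bar>)" if "\<mu> \<in> I" for \<mu>
  proof (cases "\<mu> = 0")
    case True then show ?thesis using M2 M5_plus by (simp add: y_def)
  next
    case False
    have "\<bar>\<mu>\<bar> < \<epsilon>" using that by (auto simp: I_def)
    from someI_ex[OF sym_ex[OF False this]] False show ?thesis by (simp add: y_def)
  qed
  have y_lim: "uniform_limit UNIV y xh (at 0)"
  proof (rule uniform_limitI)
    fix e :: real assume e: "e > 0"
    define d where "d = min \<epsilon> (e / (C2 + C3 + 1))"
    have d: "d > 0" using \<epsilon> e e2(2) e3(2) by (simp add: d_def)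
    have "dist (y \<mu> t) (xh t) < e" if "\<bar>\<mu>\<bar> < d" for \<mu> t
    proof -
      have "\<mu> \<in> I" using that by (auto simp: I_def d_def)
      then have "dist (y \<mu> t) (xh t) \<le> (C2 + C3) * \<bar>\<mu>\<bar>" using y unfolding dist_norm by blast
      also have "\<dots> \<le> (C2 + C3) * (e / (C2 + C3 + 1))" using that e2(2) e3(2) by (intro mult_left_mono) (auto simp: d_def)
      also have "\<dots> < e" using e e2(2) e3(2) by (simp add: field_simps)
      finally show ?thesis .
    qed
    then show "\<forall>\<^sub>F \<mu> in at 0. \<forall>t\<in>UNIV. dist (y \<mu> t) (xh t) < e"
      unfolding eventually_at using d by (intro exI[of _ d]) (auto simp: dist_real_def)
  qed
  have pair_ex: "\<exists>x. homoclinic_orbit_to_0 f (\<theta> \<alpha>) x \<and> homoclinic_orbit_to_0 f (\<theta> \<alpha>) (\<lambda>t. S *v x t) \<and>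
      range x \<noteq> range (\<lambda>t. S *v x t) \<and> (\<forall>t. norm (x t - (xh t + \<alpha> *\<^sub>R \<phi>2 t)) \<le> C1 * sqrt (\<alpha> ^ 4 + \<bar>\<theta> \<alpha>\<bar>\<^sup>2))"
    if \<alpha>: "\<alpha> \<in> I - {0}" for \<alpha>
  proof -
    have a: "\<alpha> \<noteq> 0" "\<bar>\<alpha>\<bar> < \<epsilon>" using \<alpha> by (auto simp: I_def)
    then have "\<bar>\<alpha>\<bar> < e1" using \<epsilon>_le(1) by simp
    from pair[OF a(1) this] obtain x where x: "\<And>t. (x has_vector_derivative f (x t) (\<theta> \<alpha>)) (at t)" "(x \<longlongrightarrow> 0) at_top" "(x \<longlongrightarrow> 0) at_bot"
      "\<And>t. norm (x t - (xh t + \<alpha> *\<^sub>R \<phi>2 t)) \<le> C1 * \<alpha>\<^sup>2" by (auto simp: \<theta>_def)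
    have sq: "\<alpha>\<^sup>2 \<le> \<bar>\<alpha>\<bar>"
      using mult_left_mono[of "\<bar>\<alpha>\<bar>" 1 "\<bar>\<alpha>\<bar>"] a(2) \<epsilon>_le(6) by (simp add: power2_eq_square)
    have xt1: "x t1 \<noteq> 0"
    proof (rule nonzero)
      have "norm (x t1 - xh t1) \<le> norm (x t1 - (xh t1 + \<alpha> *\<^sub>R \<phi>2 t1)) + norm (\<alpha> *\<^sub>R \<phi>2 t1)"
        using norm_triangle_ineq[of "x t1 - (xh t1 + \<alpha> *\<^sub>R \<phi>2 t1)" "\<alpha> *\<^sub>R \<phi>2 t1"] by (simp add: algebra_simps)
      also have "\<dots> \<le> C1 * \<bar>\<alpha>\<bar> + \<bar>\<alpha>\<bar> * norm (\<phi>2 t1)"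
        using x(4)[of t1] mult_left_mono[OF sq e1(2)] by simp
      finally show "norm (x t1 - xh t1) \<le> (C1 + norm (\<phi>2 t1)) * \<bar>\<alpha>\<bar>" by (simp add: algebra_simps)
      show "C1 + norm (\<phi>2 t1) \<le> D" using e2(2) e3(2) by (simp add: D_def)
    qed (use a in auto)
    define d where "d = x 0 - (xh 0 + \<alpha> *\<^sub>R \<phi>2 0)"
    \<comment> \<open>\<open>S\<close> fixes \<open>xh\<close> and reverses \<open>\<phi>2\<close>,
      so \<open>x\<close> and its image under \<open>S\<close> differ by
      \<open>(2 * \<alpha>) *\<^sub>R \<phi>2\<close> up to an error of order
      \<open>\<alpha>\<^sup>2\<close>. At time 0 the leading term wins because
      \<open>\<phi>2 0 \<noteq> 0\<close>.\<close>
    have Sx0: "S *v x 0 \<noteq> x 0"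
    proof
      assume eq: "S *v x 0 = x 0"
      have x0: "x 0 = xh 0 + \<alpha> *\<^sub>R \<phi>2 0 + d" by (simp add: d_def)
      have "S *v \<phi>2 0 = - \<phi>2 0" using M5_minus[of 0] by (simp add: X_minus_def)
      then have "xh 0 - \<alpha> *\<^sub>R \<phi>2 0 + S *v d = xh 0 + \<alpha> *\<^sub>R \<phi>2 0 + d"
        using eq unfolding x0 by (simp add: matrix_vector_right_distrib matrix_vector_mult_scaleR S_xh)
      then have eq2: "(2 * \<alpha>) *\<^sub>R \<phi>2 0 = S *v d - d" by (simp add: algebra_simps scaleR_2[symmetric])
      have \<alpha>_sq: "\<alpha>\<^sup>2 = \<bar>\<alpha>\<bar> * \<bar>\<alpha>\<bar>" by (simp add: power2_eq_square)
      have "2 * \<bar>\<alpha>\<bar> * norm (\<phi>2 0) = norm (S *v d - d)"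
        unfolding eq2[symmetric] by (simp add: abs_mult)
      also have "\<dots> \<le> norm d * k + norm d" using norm_triangle_ineq4[of "S *v d" d] k(2)[of d] by linarith
      also have "\<dots> = (k + 1) * norm d" by (simp add: algebra_simps)
      also have "\<dots> \<le> (k + 1) * (C1 * \<alpha>\<^sup>2)" using x(4)[of 0] k(1) by (intro mult_left_mono) (auto simp: d_def)
      also have "\<dots> < ((k + 1) * C1 + 1) * \<alpha>\<^sup>2" using a(1) by (simp add: algebra_simps)
      finally have "2 * \<bar>\<alpha>\<bar> * norm (\<phi>2 0) < ((k + 1) * C1 + 1) * \<alpha>\<^sup>2" .
      then have "\<bar>\<alpha>\<bar> * (2 * norm (\<phi>2 0)) < \<bar>\<alpha>\<bar> * (((k + 1) * C1 + 1) * \<bar>\<alpha>\<bar>)"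
        by (simp only: \<alpha>_sq mult_ac)
      then have "2 * norm (\<phi>2 0) < ((k + 1) * C1 + 1) * \<bar>\<alpha>\<bar>" using a(1) by (simp add: mult_less_cancel_left)
      moreover have "((k + 1) * C1 + 1) * \<bar>\<alpha>\<bar> \<le> 2 * norm (\<phi>2 0)"
      proof -
        have "\<bar>\<alpha>\<bar> \<le> 2 * norm (\<phi>2 0) / ((k + 1) * C1 + 1)" using a(2) \<epsilon>_le(5) by linarith
        then show ?thesis using kC by (simp add: pos_le_divide_eq mult.commute)
      qed
      ultimately show False by simp
    qed
    have Sd: "((\<lambda>t. S *v x t) has_vector_derivative f (S *v x t) (\<theta> \<alpha>)) (at t)" for t
      using bounded_linear.has_vector_derivative[OF matrix_vector_mul_bounded_linear x(1), of S t] by (simp add: M4_equivariant)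
    have Sl: "((\<lambda>t. S *v x t) \<longlongrightarrow> 0) G" if "(x \<longlongrightarrow> 0) G" for G
      by (rule bounded_linear.tendsto_zero[OF matrix_vector_mul_bounded_linear that])
    have "S *v x t1 \<noteq> 0" using S_S[of "x t1"] xt1 by auto
    then have "homoclinic_orbit_to_0 f (\<theta> \<alpha>) (\<lambda>t. S *v x t)"
      unfolding homoclinic_orbit_to_0_def using Sd Sl x(2,3) by blast
    moreover have "homoclinic_orbit_to_0 f (\<theta> \<alpha>) x"
      unfolding homoclinic_orbit_to_0_def using x xt1 by blast
    moreover have "range x \<noteq> range (\<lambda>t. S *v x t)" by (rule orbits_distinct[OF x(1-3) xt1 Sx0])
    moreover have "norm (x t - (xh t + \<alpha> *\<^sub>R \<phi>2 t)) \<le> C1 * sqrt (\<alpha> ^ 4 + \<bar>\<theta> \<alpha>\<bar>\<^sup>2)" for t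
    proof -
      \<comment> \<open>\<open>\<alpha> ^ 4\<close> is the square of
        \<open>\<alpha>\<^sup>2\<close>, so the square root dominates it whatever the value of
        \<open>\<theta> \<alpha>\<close>.\<close>
      have "\<alpha>\<^sup>2 \<le> sqrt (\<alpha> ^ 4 + \<bar>\<theta> \<alpha>\<bar>\<^sup>2)" by (rule real_le_rsqrt) (simp flip: power_mult)
      from mult_left_mono[OF this e1(2)] x(4)[of t] show ?thesis by linarith
    qed
    ultimately show ?thesis by blast
  qed
  then have "\<exists>xb. \<forall>\<alpha>\<in>I - {0}. homoclinic_orbit_to_0 f (\<theta> \<alpha>) (xb \<alpha>) \<and> homoclinic_orbit_to_0 f (\<theta> \<alpha>) (\<lambda>t. S *v xb \<alpha> t) \<and>
      range (xb \<alpha>) \<noteq> range (\<lambda>t. S *v xb \<alpha> t) \<and> (\<forall>t. norm (xb \<alpha> t - (xh t + \<alpha> *\<^sub>R \<phi>2 t)) \<le> C1 * sqrt (\<alpha> ^ 4 + \<bar>\<theta> \<alpha>\<bar>\<^sup>2))"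
    by (intro bchoice ballI)
  then obtain xb where xb: "\<forall>\<alpha>\<in>I - {0}. homoclinic_orbit_to_0 f (\<theta> \<alpha>) (xb \<alpha>) \<and> homoclinic_orbit_to_0 f (\<theta> \<alpha>) (\<lambda>t. S *v xb \<alpha> t) \<and>
      range (xb \<alpha>) \<noteq> range (\<lambda>t. S *v xb \<alpha> t) \<and> (\<forall>t. norm (xb \<alpha> t - (xh t + \<alpha> *\<^sub>R \<phi>2 t)) \<le> C1 * sqrt (\<alpha> ^ 4 + \<bar>\<theta> \<alpha>\<bar>\<^sup>2))" ..
  have d1: "(\<theta> has_real_derivative 2 * c * \<alpha>) (at \<alpha>)" for \<alpha>
    unfolding \<theta>_def[abs_def] by (auto intro!: derivative_eq_intros)
  have d2: "deriv \<theta> = (\<lambda>\<alpha>. 2 * c * \<alpha>)" by (rule ext) (rule DERIV_imp_deriv[OF d1])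
  have d3: "((\<lambda>\<alpha>. 2 * c * \<alpha>) has_real_derivative 2 * c) (at 0)" by (auto intro!: derivative_eq_intros)
  have dd: "deriv (deriv \<theta>) 0 = 2 * c" unfolding d2 by (rule DERIV_imp_deriv[OF d3])
  have "pitchfork_bifurcation f S xh \<phi>2 I \<theta>"
    unfolding pitchfork_bifurcation_def
  proof (intro conjI)
    show "open I" "is_interval I" "0 \<in> I" using \<epsilon> by (auto simp: I_def is_interval_oo)
    show "\<exists>y. (\<forall>\<mu>\<in>I. homoclinic_orbit_to_0 f \<mu> (y \<mu>) \<and> (\<forall>t. y \<mu> t \<in> X_plus S)) \<and> y 0 = xh \<and> uniform_limit UNIV y xh (at 0)"
      using y y0 y_lim by (intro exI[of _ y]) blast
    show "\<theta> differentiable_on I"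
      unfolding differentiable_on_def real_differentiable_def using has_field_derivative_at_within[OF d1] by blast
    show "deriv \<theta> differentiable (at 0)" unfolding d2 real_differentiable_def using d3 by blast
    show "\<theta> 0 = 0" by (simp add: \<theta>_def)
    show "\<forall>\<alpha>\<in>I. - \<alpha> \<in> I \<and> \<theta> (- \<alpha>) = \<theta> \<alpha>" by (auto simp: I_def \<theta>_def)
    show "deriv (deriv \<theta>) 0 \<noteq> 0" using dd c0 by simp
    show "\<exists>xb C. \<forall>\<alpha>\<in>I - {0}. homoclinic_orbit_to_0 f (\<theta> \<alpha>) (xb \<alpha>) \<and> homoclinic_orbit_to_0 f (\<theta> \<alpha>) (\<lambda>t. S *v xb \<alpha> t) \<and>
      range (xb \<alpha>) \<noteq> range (\<lambda>t. S *v xb \<alpha> t) \<and> (\<forall>t. norm (xb \<alpha> t - (xh t + \<alpha> *\<^sub>R \<phi>2 t)) \<le> C * sqrt (\<alpha> ^ 4 + \<bar>\<theta> \<alpha>\<bar>\<^sup>2))"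
      using xb by (intro exI[of _ xb] exI[of _ C1])
  qed
  \<comment> \<open>The sign of \<open>c = - b2 / a2\<close> is opposite to that of
    \<open>a2 * b2\<close>, and the second derivative of \<open>\<theta>\<close> at 0 is
    \<open>2 * c\<close>.\<close>
  moreover have "a2 * b2 < 0 \<Longrightarrow> c > 0" "a2 * b2 > 0 \<Longrightarrow> c < 0"
    by (auto simp: c_def zero_less_mult_iff mult_less_0_iff divide_less_0_iff zero_less_divide_iff)
  ultimately show ?thesis
    unfolding supercritical_def subcritical_def using dd by (intro exI[of _ I] exI[of _ \<theta>]) simp
qed

end

theorem theorem2p15:
  fixes H :: "(real ^ ('m::finite + 'm)) \<times> real \<Rightarrow> real"
    and f :: "real ^ ('m + 'm) \<Rightarrow> real \<Rightarrow> real ^ ('m + 'm)"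
    and xh :: "real \<Rightarrow> real ^ ('m + 'm)"
    and \<Phi> \<Psi> :: "real \<Rightarrow> real ^ ('m + 'm) ^ ('m + 'm)"
    and \<phi> \<psi> :: "'m + 'm \<Rightarrow> real \<Rightarrow> real ^ ('m + 'm)"
    and i1 i2 :: 'm
    and S :: "real ^ ('m + 'm) ^ ('m + 'm)"
    and \<xi>\<mu> \<xi>\<alpha> :: "real \<Rightarrow> real ^ ('m + 'm)"
    and a2 b2 :: real
  assumes H_analytic: "real_analytic H"
    and f_eq: "f = ham_vf H"
    and equilibrium: "\<forall>\<^sub>F \<mu> in nhds 0. f 0 \<mu> = 0"
    and M1: "hyperbolic_saddle (\<lambda>x. f x 0) 0"
    and M2: "homoclinic_orbit_to_0 f 0 xh"
    and Phi: "fundamental_matrix f xh \<Phi>"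
    and Psi: "\<And>t. \<Psi> t = matrix_inv (transpose (\<Phi> t))"
    and phi: "\<And>j t. \<phi> j t = column j (\<Phi> t)"
    and psi: "\<And>j t. \<psi> j t = column j (\<Psi> t)"
    and labels: "i1 \<noteq> i2"
    and M3_phi1: "\<And>t. \<phi> (Inl i1) t = vector_derivative xh (at t)"
    and M3: "bounded_solution_basis f xh (\<phi> (Inl i1)) (\<phi> (Inl i2))"
    and Phi_asymptotics: "column_asymptotics (jacobian (\<lambda>x. f x 0) (at 0)) i1 i2 \<phi>"
    and Psi_normalized: "\<And>i t. i \<in> {i1, i2} \<Longrightarrow> \<psi> (Inr i) t = - (J_mat *v \<phi> (Inl i) t)"
    and M4_involution: "S ** S = mat 1"
    and M4_equivariant: "\<And>x \<mu>. S *v f x \<mu> = f (S *v x) \<mu>"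
    and M5_plus: "\<And>t. xh t \<in> X_plus S \<and> \<psi> (Inr i1) t \<in> X_plus S"
    and M5_minus: "\<And>t. \<phi> (Inl i2) t \<in> X_minus S \<and> \<psi> (Inr i2) t \<in> X_minus S"
    and xi_mu: "decaying_solution f xh (G_mu f xh) (\<psi> (Inl i1) 0) (\<psi> (Inl i2) 0) \<xi>\<mu>"
    and xi_alpha: "decaying_solution f xh (G_alpha f xh (\<phi> (Inl i2)))
                     (\<psi> (Inl i1) 0) (\<psi> (Inl i2) 0) \<xi>\<alpha>"
    and a2: "a2 = a2_bar f xh (\<phi> (Inl i2)) \<xi>\<mu>" "a2 \<noteq> 0"
    and b2: "b2 = b2_bar f xh (\<phi> (Inl i2)) \<xi>\<alpha>" "b2 \<noteq> 0"
  shows "\<exists>I \<theta>. pitchfork_bifurcation f S xh (\<phi> (Inl i2)) I \<theta> \<and>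
           (a2 * b2 < 0 \<longrightarrow> supercritical \<theta>) \<and> (a2 * b2 > 0 \<longrightarrow> subcritical \<theta>)"
proof -
  interpret homoclinic_pitchfork H f xh \<Phi> \<Psi> \<phi> \<psi> i1 i2 S \<xi>\<mu> \<xi>\<alpha>
    by unfold_locales (fact H_analytic f_eq equilibrium M1 M2 Phi Psi phi psi labels M3_phi1 M3 Phi_asymptotics
      Psi_normalized M4_involution M4_equivariant M5_plus M5_minus xi_mu xi_alpha)+
  show ?thesis by (rule pitchfork[OF a2 b2])
qed

end
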